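(* Let $p\ge3$ be a prime and $K$ a number field with $[K:\mathbb{Q}]\le2$. Then every $P\in Y_{\mathrm{sp.C.}}(p)(\mathcal{O}_K)$ satisfies $\mathrm{h}(P)\le 24p\log(3p)$.
   Context: $X_{\mathrm{sp.C.}}(p)$ is the modular curve $X_G$ for $G$ the diagonal (split Cartan) subgroup of $\mathrm{GL}_2(\mathbb{F}_p)$; it parametrizes elliptic curves with an ordered pair of independent $p$-isogenies and is defined over $\mathbb{Q}$. $Y_{\mathrm{sp.C.}}(p)$ is $X_{\mathrm{sp.C.}}(p)$ minus its cusps, and $Y_{\mathrm{sp.C.}}(p)(\mathcal{O}_K)$ is the set of $P\in Y_{\mathrm{sp.C.}}(p)(K)$ with $j(P)\in\mathcal{O}_K$ ($j$ the modular invariant, $\mathcal{O}_K$ the ring of integers). $\mathrm{h}(P)=\mathrm{h}(j(P))$ with $\mathrm{h}$ the absolute logarithmic Weil height. *)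

theory Defs
  imports
    "HOL-Complex_Analysis.Complex_Analysis"
    "HOL-Number_Theory.Cong"
    "HOL-Algebra.Algebraic_Closure_Type"
    "HOL-Algebra.Embedded_Algebras"
    "HOL-Algebra.Generated_Fields"
    "HOL-Algebra.Ideal_Product"
    "HOL-Algebra.QuotRing"
begin

hide_const (open) Divisibility.prime

section \<open>Number fields and the absolute logarithmic Weil height\<close>

text \<open>Number fields are taken inside the complex numbers.\<close>

abbreviation complex_field :: "complex ring"  (\<open>\<C>\<close>)
  where "\<C> \<equiv> ring_of_type_algebra"

definition number_field :: "complex set \<Rightarrow> bool"
  where "number_field K \<longleftrightarrow> subfield K \<C> \<and> ring.finite_dimension \<C> \<rat> K"

definition field_degree :: "complex set \<Rightarrow> nat"
  where "field_degree K = ring.dim \<C> \<rat> K"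

definition ring_of_integers :: "complex set \<Rightarrow> complex set"
  where "ring_of_integers K = {x \<in> K. algebraic_int x}"

abbreviation integer_ring :: "complex set \<Rightarrow> complex ring"  (\<open>\<O>\<close>)
  where "\<O> K \<equiv> \<C>\<lparr>carrier := ring_of_integers K\<rparr>"

definition embeddings :: "complex set \<Rightarrow> (complex \<Rightarrow> complex) set"
  where "embeddings K = ring_hom (\<C>\<lparr>carrier := K\<rparr>) \<C> \<inter> extensional K"

definition finite_places :: "complex set \<Rightarrow> complex set set"
  where "finite_places K = {\<pp>. primeideal \<pp> (\<O> K) \<and> \<pp> \<noteq> {0}}"

definition integral_valuation :: "complex set \<Rightarrow> complex set \<Rightarrow> complex \<Rightarrow> nat"
  where "integral_valuation K \<pp> a = (GREATEST n::nat. a \<in> \<pp> [^]\<^bsub>ideals_set (\<O> K)\<^esub> n)"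

definition valuation :: "complex set \<Rightarrow> complex set \<Rightarrow> complex \<Rightarrow> int"
  where "valuation K \<pp> x =
    (THE k. \<exists>a\<in>ring_of_integers K - {0}. \<exists>b\<in>ring_of_integers K - {0}.
       x = a / b \<and> k = int (integral_valuation K \<pp> a) - int (integral_valuation K \<pp> b))"

text \<open>
  For a finite place \<open>v\<close> with prime ideal \<open>\<pp>\<close>, the absolute value extending the standard
  \<open>p\<close>-adic one satisfies \<open>\<bar>x\<bar>\<^sub>v\<close> to the power \<open>[K\<^sub>v : \<rat>\<^sub>p]\<close> equal to
  \<open>N(\<pp>)\<close> to the power \<open>-v(x)\<close>. This is the quantity below, so the local degree is included.
\<close>

definition finite_place_norm :: "complex set \<Rightarrow> complex set \<Rightarrow> complex \<Rightarrow> real"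
  where "finite_place_norm K \<pp> x =
    (if x = 0 then 0 else real (card (carrier (\<O> K Quot \<pp>))) powi (- valuation K \<pp> x))"

text \<open>
  The height of \<open>x \<in> K\<close> is the average of \<open>[K\<^sub>v : \<rat>\<^sub>v] log max(1, \<bar>x\<bar>\<^sub>v)\<close> over
  the places \<open>v\<close> of \<open>K\<close>, with total weight \<open>[K : \<rat>]\<close>. A complex place has local degree 2 and
  corresponds to two conjugate embeddings, hence the sum over embeddings; only
  finitely many of the terms of the sum over finite places are nonzero.
\<close>

definition weil_height :: "complex set \<Rightarrow> complex \<Rightarrow> real"
  where "weil_height K x =
    ((\<Sum>\<sigma>\<in>embeddings K. ln (max 1 (cmod (\<sigma> x)))) +
     (\<Sum>\<^sub>\<infinity>\<pp>\<in>finite_places K. ln (max 1 (finite_place_norm K \<pp> x)))) / real (field_degree K)"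


section \<open>The modular invariant\<close>

definition upper_half_plane :: "complex set"  (\<open>\<H>\<close>)
  where "\<H> = {z. Im z > 0}"

definition eisenstein_sum :: "nat \<Rightarrow> complex \<Rightarrow> complex"
  where "eisenstein_sum k \<tau> =
    (\<Sum>\<^sub>\<infinity>(m, n)\<in>UNIV - {(0, 0)}. 1 / (of_int m * \<tau> + of_int n) ^ k)"

definition klein_j :: "complex \<Rightarrow> complex"
  where "klein_j \<tau> =
    (let g2 = 60 * eisenstein_sum 4 \<tau>; g3 = 140 * eisenstein_sum 6 \<tau>
     in 1728 * g2 ^ 3 / (g2 ^ 3 - 27 * g3 ^ 2))"


section \<open>Modular functions of level \<open>N\<close>\<close>

definition SL2Z :: "(int^2^2) set"
  where "SL2Z = {A. det A = 1}"

definition moebius_act :: "int^2^2 \<Rightarrow> complex \<Rightarrow> complex"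
  where "moebius_act A z =
    (of_int (A$1$1) * z + of_int (A$1$2)) / (of_int (A$2$1) * z + of_int (A$2$2))"

definition mat_cong :: "nat \<Rightarrow> int^2^2 \<Rightarrow> int^2^2 \<Rightarrow> bool"
  where "mat_cong N A B \<longleftrightarrow> (\<forall>i j. [A$i$j = B$i$j] (mod int N))"

definition diag2 :: "int \<Rightarrow> int \<Rightarrow> int^2^2"
  where "diag2 a d = vector [vector [a, 0], vector [0, d]]"

text \<open>
  \<open>f(z)\<close> equals the Laurent series \<open>F\<close> in \<open>q = exp(2 \<pi> i z / N)\<close> near the cusp \<open>i\<infinity>\<close>; there
  are only finitely many negative exponents, so \<open>f\<close> is meromorphic at that cusp.
\<close>

definition has_q_expansion :: "nat \<Rightarrow> (complex \<Rightarrow> complex) \<Rightarrow> complex fls \<Rightarrow> bool"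
  where "has_q_expansion N f F \<longleftrightarrow> fls_conv_radius F > 0 \<and>
    (\<exists>Y. \<forall>z. Im z > Y \<longrightarrow> f z = eval_fls F (exp (2 * of_real pi * \<i> * z / of_nat N)))"

text \<open>
  Functions are normalised to be continuous at removable singularities and to vanish at poles,
  so that the invariance under \<open>\<Gamma>(N)\<close> can be required at every point.
\<close>

definition modular_functions :: "nat \<Rightarrow> (complex \<Rightarrow> complex) set"
  where "modular_functions N = {f. f nicely_meromorphic_on \<H> \<and>
    (\<forall>A\<in>SL2Z. mat_cong N A (mat 1) \<longrightarrow> (\<forall>z\<in>\<H>. f (moebius_act A z) = f z)) \<and>
    (\<forall>A\<in>SL2Z. \<exists>F. has_q_expansion N (f \<circ> moebius_act A) F)}"

definition root_unity :: "nat \<Rightarrow> complex"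
  where "root_unity N = exp (2 * of_real pi * \<i> / of_nat N)"

definition cyclotomic_field :: "nat \<Rightarrow> complex set"
  where "cyclotomic_field N = generate_field \<C> {root_unity N}"

text \<open>The function field \<open>\<rat>(X(N))\<close> of the full modular curve of level \<open>N\<close>.\<close>

definition level_field :: "nat \<Rightarrow> (complex \<Rightarrow> complex) set"
  where "level_field N = {f \<in> modular_functions N.
    \<exists>F. has_q_expansion N f F \<and> (\<forall>n. fls_nth F n \<in> cyclotomic_field N)}"

definition cyclotomic_aut :: "nat \<Rightarrow> int \<Rightarrow> (complex \<Rightarrow> complex) \<Rightarrow> bool"
  where "cyclotomic_aut N d \<sigma> \<longleftrightarrow>
    \<sigma> \<in> ring_iso (\<C>\<lparr>carrier := cyclotomic_field N\<rparr>) (\<C>\<lparr>carrier := cyclotomic_field N\<rparr>) \<and>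
    \<sigma> (root_unity N) = root_unity N powi d"

text \<open>
  The right action of \<open>GL\<^sub>2(\<int>/N\<int>)\<close> on \<open>\<rat>(X(N))\<close>: a matrix of determinant 1 lifts to
  \<open>SL\<^sub>2(\<int>)\<close> and acts by composition, and \<open>diag(1, d)\<close> acts on the coefficients of the
  \<open>q\<close>-expansion through the automorphism \<open>\<zeta> \<mapsto> \<zeta>\<^sup>d\<close> of \<open>\<rat>(\<zeta>\<^sub>N)\<close>. A general \<open>M\<close> is
  decomposed as \<open>diag(1, det M) A\<close>, and \<open>gl2_acts N M f g\<close> says that \<open>M\<close> maps \<open>f\<close> to \<open>g\<close>.
  Elements of \<open>GL\<^sub>2(\<int>/N\<int>)\<close> are represented by integer matrices.
\<close>

definition gl2_acts :: "nat \<Rightarrow> int^2^2 \<Rightarrow> (complex \<Rightarrow> complex) \<Rightarrow> (complex \<Rightarrow> complex) \<Rightarrow> bool"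
  where "gl2_acts N M f g \<longleftrightarrow> f \<in> level_field N \<and> g \<in> level_field N \<and>
    (\<exists>A\<in>SL2Z. \<exists>h\<in>level_field N. \<exists>\<sigma> F F'.
       mat_cong N M (diag2 1 (det M) ** A) \<and> cyclotomic_aut N (det M) \<sigma> \<and>
       has_q_expansion N f F \<and> has_q_expansion N h F' \<and>
       (\<forall>n. fls_nth F' n = \<sigma> (fls_nth F n)) \<and>
       (\<forall>z\<in>\<H>. g z = h (moebius_act A z)))"


section \<open>The modular curve \<open>X\<^sub>G\<close> without its cusps\<close>

text \<open>
  A subgroup of \<open>GL\<^sub>2(\<int>/N\<int>)\<close> is given by its preimage \<open>G\<close> in the integer matrices, and \<open>X\<^sub>G\<close> is
  the curve with function field \<open>\<rat>(X(N))\<^sup>G\<close>. When the determinant is surjective on the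
  subgroup, the constant field is \<open>\<rat>\<close>, that is, \<open>X\<^sub>G\<close> is defined over \<open>\<rat>\<close>.
\<close>

definition curve_function_field :: "nat \<Rightarrow> (int^2^2) set \<Rightarrow> (complex \<Rightarrow> complex) set"
  where "curve_function_field N G = {f \<in> level_field N. \<forall>M\<in>G. gl2_acts N M f f}"

text \<open>The complex noncuspidal points are the orbits of \<open>\<Gamma>\<^sub>G = G \<inter> SL\<^sub>2(\<int>)\<close> on \<open>\<H>\<close>.\<close>

definition open_curve :: "(int^2^2) set \<Rightarrow> complex set set"
  where "open_curve G = (\<lambda>\<tau>. (\<lambda>A. moebius_act A \<tau>) ` (SL2Z \<inter> G)) ` \<H>"

text \<open>
  A complex point is \<open>K\<close>-rational iff its residue field, i.e. the set of values at the point of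
  the functions in \<open>\<rat>(X\<^sub>G)\<close> that are regular there, is contained in \<open>K\<close>.
\<close>

definition rational_points :: "nat \<Rightarrow> (int^2^2) set \<Rightarrow> complex set \<Rightarrow> complex set set"
  where "rational_points N G K = {P \<in> open_curve G.
    \<forall>f\<in>curve_function_field N G. \<forall>\<tau>\<in>P. \<not> is_pole f \<tau> \<longrightarrow> f \<tau> \<in> K}"

definition point_j :: "complex set \<Rightarrow> complex"
  where "point_j P = the_elem (klein_j ` P)"

definition integral_points :: "nat \<Rightarrow> (int^2^2) set \<Rightarrow> complex set \<Rightarrow> complex set set"
  where "integral_points N G K = {P \<in> rational_points N G K. point_j P \<in> ring_of_integers K}"

definition split_cartan :: "nat \<Rightarrow> (int^2^2) set"
  where "split_cartan p = {M. coprime (det M) (int p) \<and>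
    [M$1$2 = 0] (mod int p) \<and> [M$2$1 = 0] (mod int p)}"

end

(*
Let Delta be the discriminant and let phi_k, for k in the projective line over F_p, be the quotients of
Delta((tau + k)/p), respectively p^12 Delta(p tau) for k = infinity, by Delta(tau). They are permuted by
SL_2(Z); phi_0 and phi_infinity are invariant under the split Cartan subgroup and have rational
q-expansions, so they lie in the function field of the curve. All phi_k and p^12/phi_k are integral over Z[j].

Galois conjugation of the coefficients of the q-expansions (zeta -> zeta^d) also permutes the phi_k, so by
the q-expansion principle the polynomial with roots phi_a + t phi_b, a <> b, has coefficients in Z[j].
Varying the integer t, one finds that every conjugate of the pair (phi_0, phi_infinity) at a point is a pair
(phi_a(tau'), phi_b(tau')) with a <> b, where j(tau') is the conjugate of j; tau' may be taken in the
fundamental domain. With x = 2 pi Im(tau'), log|phi_k(tau')| is (1 - 1/p) x for k <> infinity and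
12 log p - (p - 1) x for k = infinity, up to O(p), and log|j(tau')| <= x + O(1).

Since there are at most two conjugates, one of the algebraic integers p^12/phi_0, p^12/phi_infinity and
phi_0 phi_infinity is small at both of them. Its norm is at least 1 in absolute value, which bounds the
average of x, hence the height of j; finite places do not contribute because j is integral.
*)
theory Submission
  imports Defs
begin

hide_const (open) Module.smult up_ring.coeff up_ring.monom Polynomials.degree Polynomials.lead_coeff Divisibility.irreducible Coset.order

section \<open>Lattice sums\<close>

text \<open>The crux is that the two indices are distinct at each conjugate. At most one of the two
  values then has index infinity there, so with two conjugates either one of the functions never has
  it, or each has it exactly once, at different conjugates; this is the source of the three
  candidates for a small integer. Separate polynomials for \<open>phi p 0\<close> and
  \<open>phi p p\<close> could not exclude equal indices, hence the linear combinations. Conjugation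
  is applied only to values of functions in \<open>K\<close>, never to points of the curve. The
  finite places hide real work: \<open>valuation\<close> is a definite description over all ways to
  write a number as a quotient, so even for an integer its value is known only once the powers of a
  prime ideal are shown to define an additive order function. Constants: the two values of x sum to
  at most 36 log p + 48 (p + 1). Halving and adding 40, the loss in comparing log|j| with x, gives
  18 log p + 24 (p + 1) + 40, which is below the claimed bound from p = 3 on, with little room at p
  = 3.\<close>

text \<open>The imaginary part controls x, and the triangle inequality then controls y. The constant
  \<open>c\<close> is behind every absolute convergence statement for lattice sums.\<close>

lemma lattice_norm_lower_bound:
  fixes \<tau> :: complex
  assumes "Im \<tau> > 0"
  obtains c where "c > 0" "\<And>x y :: real. c * (\<bar>x\<bar> + \<bar>y\<bar>) \<le> cmod (of_real x * \<tau> + of_real y)"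
proof -
  define C where "C = 1 / Im \<tau> + 1 + cmod \<tau> / Im \<tau>"
  have "1 / Im \<tau> > 0" "cmod \<tau> / Im \<tau> \<ge> 0" using assms by auto
  hence C: "C > 0" unfolding C_def by linarith
  have "1 / C * (\<bar>x\<bar> + \<bar>y\<bar>) \<le> cmod (of_real x * \<tau> + of_real y)" for x y :: real
  proof -
    let ?w = "of_real x * \<tau> + of_real y"
    have "\<bar>x\<bar> * Im \<tau> = \<bar>Im ?w\<bar>" using assms by (simp add: abs_mult)
    also have "\<dots> \<le> cmod ?w" by (rule abs_Im_le_cmod)
    finally have 1: "\<bar>x\<bar> \<le> cmod ?w / Im \<tau>" using assms by (simp add: field_simps)
    have "cmod (of_real y) \<le> cmod ?w + cmod (of_real x * \<tau>)"
      by (metis add_diff_cancel_left' norm_triangle_ineq4 add.commute)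
    also have "cmod (of_real x * \<tau>) = \<bar>x\<bar> * cmod \<tau>" by (simp add: norm_mult)
    finally have "\<bar>y\<bar> \<le> cmod ?w + \<bar>x\<bar> * cmod \<tau>" by simp
    also have "\<dots> \<le> cmod ?w + cmod ?w / Im \<tau> * cmod \<tau>"
      using 1 by (intro add_left_mono mult_right_mono) auto
    finally have "\<bar>x\<bar> + \<bar>y\<bar> \<le> C * cmod ?w" using 1 by (simp add: C_def algebra_simps)
    thus ?thesis using C by (simp add: field_simps)
  qed
  thus thesis using C by (intro that[of "1 / C"]) auto
qed

lemma summable_on_int_iff_nat:
  fixes f :: "int \<Rightarrow> 'a :: {real_normed_vector, banach}"
  assumes "(\<lambda>n::nat. f (int n)) summable_on UNIV" "(\<lambda>n::nat. f (- int (Suc n))) summable_on UNIV"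
  shows "f summable_on UNIV"
proof -
  have "f summable_on range int"
    by (subst summable_on_reindex) (use assms(1) in \<open>auto simp: o_def\<close>)
  moreover have "f summable_on range (\<lambda>n. - int (Suc n))"
    by (subst summable_on_reindex) (use assms(2) in \<open>auto simp: o_def inj_on_def\<close>)
  ultimately have "f summable_on (range int \<union> range (\<lambda>n. - int (Suc n)))"
    by (intro summable_on_Un_disjoint) auto
  also have "range int \<union> range (\<lambda>n. - int (Suc n)) = UNIV"
  proof -
    have "x \<in> range int \<union> range (\<lambda>n. - int (Suc n))" for x :: int
      by (cases x rule: int_cases) blast+
    thus ?thesis by blast
  qed
  finally show ?thesis .
qed

lemma has_sum_int_nat:
  fixes f :: "int \<Rightarrow> 'a :: {real_normed_vector, banach}"
  assumes "((\<lambda>n::nat. f (int n)) has_sum A) UNIV" "((\<lambda>n::nat. f (- int (Suc n))) has_sum B) UNIV"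
  shows "(f has_sum (A + B)) UNIV"
proof -
  have "(f has_sum A) (range int)"
    by (subst has_sum_reindex) (use assms(1) in \<open>auto simp: o_def\<close>)
  moreover have "(f has_sum B) (range (\<lambda>n. - int (Suc n)))"
    by (subst has_sum_reindex) (use assms(2) in \<open>auto simp: o_def inj_on_def\<close>)
  ultimately have "(f has_sum (A + B)) (range int \<union> range (\<lambda>n. - int (Suc n)))"
    by (intro has_sum_Un_disjoint) auto
  also have "range int \<union> range (\<lambda>n. - int (Suc n)) = UNIV"
  proof -
    have "x \<in> range int \<union> range (\<lambda>n. - int (Suc n))" for x :: int
      by (cases x rule: int_cases) blast+
    thus ?thesis by blast
  qed
  finally show ?thesis .
qed

text \<open>The exponent 3/2 is chosen so that the weight is summable over the integers while a
  product of two weights still dominates an inverse cube, the slowest decay that occurs in the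
  double sums below.\<close>

definition int_weight :: "int \<Rightarrow> real"
  where "int_weight n = (1 + \<bar>real_of_int n\<bar>) powr (-(3/2))"

lemma int_weight_nonneg [simp]: "int_weight n \<ge> 0"
  by (simp add: int_weight_def)

lemma int_weight_eq: "int_weight n = 1 / (1 + \<bar>real_of_int n\<bar>) powr (3/2)"
  by (simp only: int_weight_def powr_minus divide_inverse mult_1_left)

lemma summable_int_weight: "int_weight summable_on UNIV"
proof -
  have "summable (\<lambda>n. real n powr (-(3/2)))" by (subst summable_real_powr_iff) auto
  hence s: "summable (\<lambda>n. real (Suc n) powr (-(3/2)))" by (subst summable_Suc_iff)
  hence s2: "summable (\<lambda>n. real (Suc (Suc n)) powr (-(3/2)))" by (subst summable_Suc_iff)
  show ?thesis
  proof (rule summable_on_int_iff_nat)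
    show "(\<lambda>n. int_weight (int n)) summable_on UNIV"
      by (rule norm_summable_imp_summable_on) (use s in \<open>simp add: int_weight_def add.commute\<close>)
    show "(\<lambda>n. int_weight (- int (Suc n))) summable_on UNIV"
      by (rule norm_summable_imp_summable_on) (use s2 in \<open>simp add: int_weight_def add.commute\<close>)
  qed
qed

lemma summable_int_weight_pair: "(\<lambda>(m, n). int_weight m * int_weight n) summable_on UNIV"
proof -
  have "(\<lambda>(m, n). int_weight m * int_weight n) summable_on UNIV \<times> UNIV"
  proof (rule summable_on_SigmaI[where g = "\<lambda>m. int_weight m * infsum int_weight UNIV"])
    show "((\<lambda>n. case (m, n) of (m, n) \<Rightarrow> int_weight m * int_weight n) has_sum
            int_weight m * infsum int_weight UNIV) UNIV" for m
      using has_sum_cmult_right[OF has_sum_infsum[OF summable_int_weight], of "int_weight m"] by simp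
  qed (auto intro!: summable_on_cmult_left summable_int_weight)
  thus ?thesis by simp
qed

text \<open>Since |m| + |n| >= 1, the product (1 + |m|)(1 + |n|) is at most (2(|m| + |n|))^2;
  raising this to the power 3/2 gives the cube and the factor 8.\<close>

lemma int_weight_bound:
  fixes m n :: int
  assumes "(m, n) \<noteq> (0, 0)"
  shows "1 / (\<bar>real_of_int m\<bar> + \<bar>real_of_int n\<bar>) ^ 3 \<le> 8 * (int_weight m * int_weight n)"
proof -
  define a b where "a = \<bar>real_of_int m\<bar>" and "b = \<bar>real_of_int n\<bar>"
  have ab: "a \<ge> 0" "b \<ge> 0" "a + b \<ge> 1"
  proof -
    show "a \<ge> 0" "b \<ge> 0" by (auto simp: a_def b_def)
    have "\<bar>m\<bar> + \<bar>n\<bar> \<ge> 1" using assms by auto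
    thus "a + b \<ge> 1" unfolding a_def b_def by linarith
  qed
  have "(1 + a) * (1 + b) \<le> (2 * (a + b)) * (2 * (a + b))"
    using ab by (intro mult_mono) auto
  hence "((1 + a) * (1 + b)) powr (3/2) \<le> ((2 * (a + b)) ^ 2) powr (3/2)"
    using ab by (intro powr_mono2) (auto simp: power2_eq_square)
  also have "\<dots> = (2 * (a + b)) powr 3"
    using ab by (subst powr_numeral [symmetric]) (auto simp: powr_powr simp del: powr_numeral)
  also have "\<dots> = 8 * (a + b) ^ 3"
    using ab by (subst powr_numeral) (auto simp: power_mult_distrib simp del: distrib_left_numeral)
  finally have *: "((1 + a) * (1 + b)) powr (3/2) \<le> 8 * (a + b) ^ 3" .
  have "int_weight m * int_weight n = 1 / ((1 + a) * (1 + b)) powr (3/2)"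
  proof -
    have "int_weight m * int_weight n = inverse ((1 + a) powr (3/2)) * inverse ((1 + b) powr (3/2))"
      by (simp only: int_weight_eq a_def b_def divide_inverse mult_1_left)
    also have "\<dots> = 1 / ((1 + a) * (1 + b)) powr (3/2)"
      using ab by (simp only: powr_mult inverse_mult_distrib divide_inverse mult_1_left)
    finally show ?thesis .
  qed
  moreover have "1 / (8 * (a + b) ^ 3) \<le> 1 / ((1 + a) * (1 + b)) powr (3/2)"
    using * ab by (intro divide_left_mono) auto
  ultimately show ?thesis unfolding a_def [symmetric] b_def [symmetric] by simp
qed

text \<open>Comparison with the inverse cube of |m| + |n|, which is at least 1 off the origin, so
  larger exponents only help.\<close>

lemma abs_summable_lattice:
  fixes \<tau> :: complex
  assumes "Im \<tau> > 0" "k \<ge> 3"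
  shows "(\<lambda>x. norm (case x of (m, n) \<Rightarrow> 1 / (of_int m * \<tau> + of_int n) ^ k)) summable_on UNIV - {(0, 0)}"
proof -
  obtain c where c: "c > 0" "\<And>x y :: real. c * (\<bar>x\<bar> + \<bar>y\<bar>) \<le> cmod (of_real x * \<tau> + of_real y)"
    using lattice_norm_lower_bound[OF assms(1)] by blast
  show ?thesis
  proof (rule Infinite_Sum.abs_summable_on_comparison_test'
      [where g = "\<lambda>(m, n). 8 / c ^ k * (int_weight m * int_weight n)"])
    have "(\<lambda>x. 8 / c ^ k * (case x of (m, n) \<Rightarrow> int_weight m * int_weight n)) summable_on UNIV - {(0, 0)}"
      by (intro summable_on_cmult_right summable_on_subset[OF summable_int_weight_pair]) auto
    thus "(\<lambda>(m, n). 8 / c ^ k * (int_weight m * int_weight n)) summable_on UNIV - {(0, 0)}"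
      by (simp add: case_prod_unfold)
  next
    fix x :: "int \<times> int" assume x: "x \<in> UNIV - {(0, 0)}"
    obtain m n where mn: "x = (m, n)" by force
    have ne: "(m, n) \<noteq> (0, 0)" using x mn by auto
    define s where "s = \<bar>real_of_int m\<bar> + \<bar>real_of_int n\<bar>"
    have "\<bar>m\<bar> + \<bar>n\<bar> \<ge> 1" using ne by auto
    hence s: "s \<ge> 1" unfolding s_def by linarith
    have le: "c * s \<le> cmod (of_int m * \<tau> + of_int n)"
      using c(2)[of m n] by (simp add: s_def)
    have pos: "c * s > 0" using c s by simp
    have "1 / cmod (of_int m * \<tau> + of_int n) ^ k \<le> 1 / (c * s) ^ k"
      using le pos by (intro divide_left_mono power_mono mult_pos_pos[OF zero_less_power zero_less_power]) linarith+
    also have "\<dots> = 1 / c ^ k * (1 / s ^ k)" by (simp add: power_mult_distrib)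
    also have "\<dots> \<le> 1 / c ^ k * (1 / s ^ 3)"
      using s c assms(2) by (intro mult_left_mono divide_left_mono power_increasing) auto
    also have "\<dots> \<le> 1 / c ^ k * (8 * (int_weight m * int_weight n))"
      using int_weight_bound[OF ne] c by (intro mult_left_mono) (auto simp: s_def)
    finally show "norm (case x of (m, n) \<Rightarrow> 1 / (of_int m * \<tau> + of_int n) ^ k)
       \<le> (case x of (m, n) \<Rightarrow> 8 / c ^ k * (int_weight m * int_weight n))"
      by (simp add: mn norm_divide norm_power)
  qed
qed

section \<open>Power sum series and the Lipschitz formula\<close>

text \<open>This is the usual q of modular forms, not the classical nome exp(pi i z).\<close>

definition nome :: "complex \<Rightarrow> complex"
  where "nome z = exp (2 * of_real pi * \<i> * z)"

lemma norm_nome: "cmod (nome z) = exp (- 2 * pi * Im z)"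
  by (simp add: nome_def norm_exp_eq_Re)

lemma norm_nome_less_1: "Im z > 0 \<Longrightarrow> cmod (nome z) < 1"
  by (simp add: norm_nome)

lemma nome_nonzero [simp]: "nome z \<noteq> 0"
  by (simp add: nome_def)

lemma nome_add: "nome (a + b) = nome a * nome b"
  by (simp add: nome_def ring_distribs exp_add)

lemma nome_of_nat_mult: "nome (of_nat n * z) = nome z ^ n"
  by (simp add: nome_def exp_of_nat_mult [symmetric] mult_ac)

lemma nome_of_int [simp]: "nome (of_int n) = 1"
  by (simp add: nome_def exp_eq_1 mult_ac)

lemma nome_has_field_derivative [derivative_intros]:
  "(f has_field_derivative f') (at z within A) \<Longrightarrow>
   ((\<lambda>z. nome (f z)) has_field_derivative (2 * of_real pi * \<i> * nome (f z) * f')) (at z within A)"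
  unfolding nome_def by (auto intro!: derivative_eq_intros)

lemma holomorphic_on_nome [holomorphic_intros]:
  "f holomorphic_on A \<Longrightarrow> (\<lambda>z. nome (f z)) holomorphic_on A"
  unfolding nome_def by (intro holomorphic_intros)

lemma summable_power_sum:
  fixes w :: complex
  assumes "norm w < 1"
  shows "summable (\<lambda>n. of_nat n ^ k * w ^ n)"
  using assms
proof (induction k arbitrary: w)
  case 0
  thus ?case by (simp add: summable_geometric)
next
  case (Suc k)
  have "summable (\<lambda>n. diffs (\<lambda>n. of_nat n ^ k) n * w ^ n)"
    by (rule termdiff_converges[OF Suc.prems]) (use Suc.IH in auto)
  hence "summable (\<lambda>n. w * (of_nat (Suc n) ^ Suc k * w ^ n))"
    by (intro summable_mult) (simp add: diffs_def)
  hence "summable (\<lambda>n. of_nat (Suc n) ^ Suc k * w ^ Suc n)"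
    by (simp add: mult_ac)
  thus ?case by (subst (asm) summable_Suc_iff)
qed

text \<open>The polylogarithm of order -k. For k = 0 the term n = 0 counts as 1, because 0^0 = 1;
  for k >= 1 it vanishes.\<close>

definition power_sum :: "nat \<Rightarrow> complex \<Rightarrow> complex"
  where "power_sum k w = (\<Sum>n. of_nat n ^ k * w ^ n)"

lemma power_sum_0: "norm w < 1 \<Longrightarrow> power_sum 0 w = 1 / (1 - w)"
  by (simp add: power_sum_def suminf_geometric)

text \<open>The operator w d/dw raises the exponent k by one. Stating the result for w * D avoids a
  division by w.\<close>

lemma power_sum_has_field_derivative:
  assumes "norm w < 1"
  shows "\<exists>D. (power_sum k has_field_derivative D) (at w) \<and> w * D = power_sum (Suc k) w"
proof (intro exI conjI)
  show "(power_sum k has_field_derivative (\<Sum>n. diffs (\<lambda>n. of_nat n ^ k) n * w ^ n)) (at w)"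
    unfolding power_sum_def [abs_def] using assms summable_power_sum
    by (intro termdiffs_strong'[where K = 1]) auto
  have "summable (\<lambda>n. diffs (\<lambda>n. of_nat n ^ k) n * w ^ n)"
    by (rule termdiff_converges[OF assms]) (use summable_power_sum in auto)
  hence "w * (\<Sum>n. diffs (\<lambda>n. of_nat n ^ k) n * w ^ n) = (\<Sum>n. of_nat (Suc n) ^ Suc k * w ^ Suc n)"
    by (subst suminf_mult [symmetric]) (simp_all add: diffs_def mult_ac)
  also have "\<dots> = power_sum (Suc k) w"
    unfolding power_sum_def using summable_power_sum[OF assms, of "Suc k"]
    by (subst suminf_split_head) auto
  finally show "w * (\<Sum>n. diffs (\<lambda>n. of_nat n ^ k) n * w ^ n) = power_sum (Suc k) w" .
qed

lemma power_sum_nome_has_field_derivative: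
  assumes "Im z > 0"
  shows "((\<lambda>z. power_sum k (nome z)) has_field_derivative
           2 * of_real pi * \<i> * power_sum (Suc k) (nome z)) (at z)"
proof -
  obtain D where D: "(power_sum k has_field_derivative D) (at (nome z))"
    "nome z * D = power_sum (Suc k) (nome z)"
    using power_sum_has_field_derivative[OF norm_nome_less_1[OF assms]] by blast
  have "((\<lambda>z. power_sum k (nome z)) has_field_derivative D * (2 * of_real pi * \<i> * nome z * 1)) (at z)"
    by (rule DERIV_chain2[where f = "power_sum k" and g = nome, OF D(1)]) (auto intro!: derivative_eq_intros)
  moreover have "D * (2 * of_real pi * \<i> * nome z * 1) = 2 * of_real pi * \<i> * power_sum (Suc k) (nome z)"
    unfolding D(2) [symmetric] by (simp add: mult_ac)
  ultimately show ?thesis by (simp only:)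
qed

section \<open>Reflection formulas for polygamma functions and the Lipschitz formula\<close>

text \<open>Both sides of the reflection formula for the entire function 1/Gamma are differentiated;
  dividing by the sine then gives the cotangent.\<close>

lemma Digamma_reflection:
  fixes z :: complex
  assumes "z \<notin> \<int>"
  shows "Digamma (1 - z) - Digamma z = of_real pi * cot (of_real pi * z)"
proof -
  have z: "z \<notin> \<int>\<^sub>\<le>\<^sub>0" using assms by (auto dest: nonpos_Ints_Int)
  have z': "1 - z \<notin> \<int>\<^sub>\<le>\<^sub>0"
    using assms by (metis Ints_1 Ints_diff diff_diff_eq2 add_diff_cancel_left' nonpos_Ints_Int)
  have "((\<lambda>z. rGamma z * rGamma (1 - z)) has_field_derivative
          (- rGamma z * Digamma z) * rGamma (1 - z) + rGamma z * (rGamma (1 - z) * Digamma (1 - z))) (at z)"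
    using z z' by (auto intro!: derivative_eq_intros)
  moreover have "((\<lambda>z. rGamma z * rGamma (1 - z)) has_field_derivative cos (of_real pi * z)) (at z)"
    unfolding rGamma_reflection_complex by (auto intro!: derivative_eq_intros)
  ultimately have "(- rGamma z * Digamma z) * rGamma (1 - z) + rGamma z * (rGamma (1 - z) * Digamma (1 - z))
      = cos (of_real pi * z)" by (rule DERIV_unique)
  hence "(rGamma z * rGamma (1 - z)) * (Digamma (1 - z) - Digamma z) = cos (of_real pi * z)"
    by (simp add: algebra_simps)
  moreover have "sin (of_real pi * z) \<noteq> 0"
  proof
    assume "sin (of_real pi * z) = 0"
    then obtain n :: int where "of_real pi * z = complex_of_real (of_int n * pi)"
      by (auto simp: sin_eq_0)
    hence "z = of_int n" by simp
    thus False using assms by simp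
  qed
  ultimately have "Digamma (1 - z) - Digamma z = cos (of_real pi * z) / (sin (of_real pi * z) / of_real pi)"
    unfolding rGamma_reflection_complex by (subst eq_divide_eq) (auto simp: mult.commute)
  thus ?thesis by (simp add: cot_def)
qed

text \<open>With e = exp(i pi z) the cotangent is i (e^2 + 1)/(e^2 - 1), a fractional linear
  function of q = e^2.\<close>

lemma cot_nome:
  assumes "Im z > 0"
  shows "of_real pi * cot (of_real pi * z) = of_real pi * \<i> - 2 * of_real pi * \<i> * power_sum 0 (nome z)"
proof -
  define e where "e = exp (\<i> * (of_real pi * z))"
  have e0: "e \<noteq> 0" by (simp add: e_def)
  have w: "nome z = e ^ 2" by (simp add: nome_def e_def exp_double [symmetric] power2_eq_square exp_add [symmetric])
      (simp add: algebra_simps)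
  have n1: "e ^ 2 \<noteq> 1" using norm_nome_less_1[OF assms] w by (metis norm_one less_irrefl)
  have c: "cos (of_real pi * z) = (e + 1 / e) / 2"
    unfolding e_def by (simp only: cos_exp_eq exp_minus divide_inverse mult_1_left)
  have s: "sin (of_real pi * z) = (e - 1 / e) / (2 * \<i>)"
    unfolding e_def by (simp only: sin_exp_eq exp_minus divide_inverse mult_1_left)
  have "cot (of_real pi * z) = \<i> * (e ^ 2 + 1) / (e ^ 2 - 1)"
  proof -
    have "cot (of_real pi * z) = \<i> * ((e * (e + 1 / e)) / (e * (e - 1 / e)))"
      unfolding cot_def c s using e0 by (simp add: mult.commute)
    moreover have "e * (e + 1 / e) = e ^ 2 + 1" "e * (e - 1 / e) = e ^ 2 - 1"
      using e0 by (simp_all add: algebra_simps power2_eq_square)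
    ultimately show ?thesis by simp
  qed
  moreover have "power_sum 0 (nome z) = 1 / (1 - e ^ 2)"
    using power_sum_0[OF norm_nome_less_1[OF assms]] w by simp
  moreover have "(e ^ 2 + 1) / (e ^ 2 - 1) = 1 - 2 * (1 / (1 - e ^ 2))"
  proof -
    define x where "x = e ^ 2 - 1"
    have "x \<noteq> 0" "e ^ 2 + 1 = x + 2" "1 - e ^ 2 = - x" using n1 by (auto simp: x_def)
    thus ?thesis by (simp add: x_def [symmetric] add_divide_distrib)
  qed
  ultimately have "cot (of_real pi * z) = \<i> * (1 - 2 * power_sum 0 (nome z))"
    by (simp only: times_divide_eq_right [symmetric])
  thus ?thesis by (simp only:) (simp add: algebra_simps)
qed

lemma Im_pos_notin_Ints: "Im z > 0 \<Longrightarrow> z \<notin> \<int>"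
  by (auto elim!: Ints_cases)

lemma one_minus_notin_nonpos_Ints:
  fixes z :: complex
  assumes "z \<notin> \<int>"
  shows "z \<notin> \<int>\<^sub>\<le>\<^sub>0" "1 - z \<notin> \<int>\<^sub>\<le>\<^sub>0"
proof -
  show "z \<notin> \<int>\<^sub>\<le>\<^sub>0" using assms by (auto dest: nonpos_Ints_Int)
  show "1 - z \<notin> \<int>\<^sub>\<le>\<^sub>0"
    using assms by (metis Ints_1 Ints_diff diff_diff_eq2 add_diff_cancel_left' nonpos_Ints_Int)
qed

text \<open>Repeated differentiation of the case k = 0: every step contributes a factor 2 pi i and
  raises the order of the power sum, and the constant pi i disappears after the first step.\<close>

lemma Polygamma_reflection_nome:
  assumes "Im z > 0"
  shows "(-1) ^ k * Polygamma k (1 - z) - Polygamma k z =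
     (if k = 0 then of_real pi * \<i> else 0) - (2 * of_real pi * \<i>) ^ Suc k * power_sum k (nome z)"
  using assms
proof (induction k arbitrary: z)
  case 0
  thus ?case using Digamma_reflection[OF Im_pos_notin_Ints[OF 0]] cot_nome[OF 0] by simp
next
  case (Suc k)
  have z: "z \<notin> \<int>\<^sub>\<le>\<^sub>0" "1 - z \<notin> \<int>\<^sub>\<le>\<^sub>0"
    using one_minus_notin_nonpos_Ints[OF Im_pos_notin_Ints[OF Suc.prems]] by auto
  let ?f = "\<lambda>z. (-1) ^ k * Polygamma k (1 - z) - Polygamma k z"
  have D1: "(?f has_field_derivative ((-1) ^ Suc k * Polygamma (Suc k) (1 - z) - Polygamma (Suc k) z)) (at z)"
    using z by (auto intro!: derivative_eq_intros)
  have D2: "((\<lambda>z. (if k = 0 then complex_of_real pi * \<i> else 0) - (2 * of_real pi * \<i>) ^ Suc k * power_sum k (nome z))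
      has_field_derivative (- ((2 * of_real pi * \<i>) ^ Suc (Suc k) * power_sum (Suc k) (nome z)))) (at z)"
    using Suc.prems
    by (auto intro!: derivative_eq_intros power_sum_nome_has_field_derivative simp: mult_ac)
  have ev: "\<forall>\<^sub>F x in nhds z. ?f x = (if k = 0 then of_real pi * \<i> else 0) - (2 * of_real pi * \<i>) ^ Suc k * power_sum k (nome x)"
  proof (rule eventually_mono)
    show "\<forall>\<^sub>F x in nhds z. x \<in> {x. Im x > 0}"
      using Suc.prems by (intro eventually_nhds_in_open open_halfspace_Im_gt) auto
  qed (use Suc.IH in blast)
  have "(?f has_field_derivative (- ((2 * of_real pi * \<i>) ^ Suc (Suc k) * power_sum (Suc k) (nome z)))) (at z)"
    using D2 by (subst DERIV_cong_ev[OF refl ev refl])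
  from DERIV_unique[OF D1 this] show ?case by simp
qed

lemma abs_summable_int_shift:
  assumes "Im z > 0" "k \<ge> 2"
  shows "(\<lambda>n::int. norm (1 / (z + of_int n) ^ k)) summable_on UNIV"
proof -
  obtain c where c: "c > 0" "\<And>x y :: real. c * (\<bar>x\<bar> + \<bar>y\<bar>) \<le> cmod (of_real x * z + of_real y)"
    using lattice_norm_lower_bound[OF assms(1)] by blast
  show ?thesis
  proof (rule Infinite_Sum.abs_summable_on_comparison_test'[where g = "\<lambda>n. 1 / c ^ k * int_weight n"])
    show "(\<lambda>n. 1 / c ^ k * int_weight n) summable_on UNIV"
      by (intro summable_on_cmult_right summable_int_weight)
  next
    fix n :: int
    have le: "c * (1 + \<bar>real_of_int n\<bar>) \<le> cmod (z + of_int n)" using c(2)[of 1 "of_int n"] by simp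
    have pos: "c * (1 + \<bar>real_of_int n\<bar>) > 0" using c by (intro mult_pos_pos add_pos_nonneg) auto
    have "1 / cmod (z + of_int n) ^ k \<le> 1 / (c * (1 + \<bar>real_of_int n\<bar>)) ^ k"
      using le pos by (intro divide_left_mono power_mono mult_pos_pos[OF zero_less_power zero_less_power]) linarith+
    also have "\<dots> = 1 / c ^ k * (1 / (1 + \<bar>real_of_int n\<bar>) powr real k)"
      by (subst powr_realpow) (auto simp: power_mult_distrib add_pos_nonneg)
    also have "\<dots> \<le> 1 / c ^ k * (1 / (1 + \<bar>real_of_int n\<bar>) powr (3/2))"
      using c assms(2) by (intro mult_left_mono divide_left_mono powr_mono) auto
    finally show "norm (1 / (z + of_int n) ^ k) \<le> 1 / c ^ k * int_weight n"
      by (simp add: int_weight_eq norm_divide norm_power)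
  qed
qed

text \<open>The terms with n >= 0 and with n < 0 sum to polygamma values at z and at 1 - z. For odd
  k the reflection formula has exactly the signs needed to add them.\<close>

lemma Lipschitz_formula:
  assumes "Im z > 0" "odd k"
  shows "((\<lambda>n::int. 1 / (z + of_int n) ^ Suc k) has_sum
           ((2 * of_real pi * \<i>) ^ Suc k / fact k * power_sum k (nome z))) UNIV"
proof -
  have k: "k \<ge> 1" using assms(2) by (cases k) auto
  let ?f = "\<lambda>n::int. 1 / (z + of_int n) ^ Suc k"
  have as: "(\<lambda>n. norm (?f n)) summable_on UNIV" using abs_summable_int_shift[OF assms(1), of "Suc k"] k by auto
  have s1: "(\<lambda>n::nat. ?f (int n)) summable_on UNIV"
    using abs_summable_summable[OF as]
    by (intro summable_on_reindex[where h = int, THEN iffD1, unfolded o_def]) (auto intro: summable_on_subset)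
  have s2: "(\<lambda>n::nat. ?f (- int (Suc n))) summable_on UNIV"
    using abs_summable_summable[OF as]
    by (intro summable_on_reindex[where h = "\<lambda>n::nat. - int (Suc n)", THEN iffD1, unfolded o_def])
       (auto intro: summable_on_subset simp: inj_on_def)
  have e1: "((\<lambda>n::nat. ?f (int n)) has_sum (Polygamma k z / fact k)) UNIV"
  proof -
    have "(\<lambda>n::nat. ?f (int n)) sums (infsum (\<lambda>n::nat. ?f (int n)) UNIV)"
      using s1 by (intro has_sum_imp_sums has_sum_infsum)
    hence "infsum (\<lambda>n::nat. ?f (int n)) UNIV = (\<Sum>n. inverse ((z + of_nat n) ^ Suc k))"
      by (simp add: sums_iff divide_inverse)
    also have "\<dots> = Polygamma k z / fact k" using k assms(2) by (simp add: Polygamma_def)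
    finally show ?thesis using has_sum_infsum[OF s1] by simp
  qed
  have e2: "((\<lambda>n::nat. ?f (- int (Suc n))) has_sum (Polygamma k (1 - z) / fact k)) UNIV"
  proof -
    have "(\<lambda>n::nat. ?f (- int (Suc n))) sums (infsum (\<lambda>n::nat. ?f (- int (Suc n))) UNIV)"
      using s2 by (intro has_sum_imp_sums has_sum_infsum)
    moreover have "?f (- int (Suc n)) = inverse ((1 - z + of_nat n) ^ Suc k)" for n
    proof -
      have "(z + of_int (- int (Suc n))) ^ Suc k = (- (1 - z + of_nat n)) ^ Suc k" by (simp add: algebra_simps)
      also have "\<dots> = (1 - z + of_nat n) ^ Suc k"
        by (rule power_minus_even) (use assms(2) in auto)
      finally show ?thesis by (simp add: divide_inverse)
    qed
    ultimately have "infsum (\<lambda>n::nat. ?f (- int (Suc n))) UNIV = (\<Sum>n. inverse ((1 - z + of_nat n) ^ Suc k))"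
      by (simp add: sums_iff)
    also have "\<dots> = Polygamma k (1 - z) / fact k" using k assms(2) by (simp add: Polygamma_def)
    finally show ?thesis using has_sum_infsum[OF s2] by simp
  qed
  have "Polygamma k (1 - z) + Polygamma k z = (2 * of_real pi * \<i>) ^ Suc k * power_sum k (nome z)"
    using Polygamma_reflection_nome[OF assms(1), of k] k assms(2) by (simp add: algebra_simps)
  hence "Polygamma k z / fact k + Polygamma k (1 - z) / fact k =
      (2 * of_real pi * \<i>) ^ Suc k / fact k * power_sum k (nome z)" by (simp add: field_simps)
  thus ?thesis using has_sum_int_nat[OF e1 e2] by simp
qed

lemma has_sum_even_int:
  fixes f :: "int \<Rightarrow> complex"
  assumes "\<And>n. f (- n) = f n" "((\<lambda>n::nat. f (int n)) has_sum A) {1..}"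
  shows "(f has_sum 2 * A) (UNIV - {0})"
proof -
  have "(f has_sum A) (int ` {1..})"
    by (subst has_sum_reindex) (use assms(2) in \<open>auto simp: o_def\<close>)
  moreover have "(f has_sum A) ((\<lambda>n. - int n) ` {1..})"
    by (subst has_sum_reindex) (use assms in \<open>auto simp: o_def inj_on_def\<close>)
  ultimately have "(f has_sum (A + A)) (int ` {1..} \<union> (\<lambda>n. - int n) ` {1..})"
    by (intro has_sum_Un_disjoint) auto
  also have "int ` {1..} \<union> (\<lambda>n. - int n) ` {1..} = UNIV - {0}"
  proof -
    have "x \<in> int ` {1..} \<union> (\<lambda>n. - int n) ` {1..}" if "x \<noteq> 0" for x :: int
      using that by (cases x rule: int_cases3) (auto intro!: image_eqI)
    thus ?thesis by auto
  qed
  finally show ?thesis by simp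
qed

subsection \<open>Zeta values\<close>

text \<open>The even n contribute the same sum scaled by 2^-(k+1), and the odd n contribute a
  polygamma value at 1/2; the resulting linear equation is solved for the sum.\<close>

lemma zeta_Polygamma:
  assumes "odd k"
  shows "((\<lambda>n::nat. 1 / of_nat n ^ Suc k :: complex) has_sum
            (Polygamma k (1 / 2) / (fact k * (2 ^ Suc k - 1)))) {1..}"
proof -
  have k: "k \<ge> 1" using assms by (cases k) auto
  let ?f = "\<lambda>n::nat. 1 / of_nat n ^ Suc k :: complex"
  have "summable (\<lambda>n. norm (?f n))"
    using inverse_power_summable[of "Suc k", where ?'a = real] k
    by (simp add: norm_divide norm_power norm_mult norm_inverse divide_inverse)
  hence "?f summable_on UNIV" by (rule norm_summable_imp_summable_on)
  hence summ: "?f summable_on A" for A by (rule summable_on_subset) auto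
  define S where "S = infsum ?f {1..}"
  have S: "(?f has_sum S) {1..}" unfolding S_def by (rule has_sum_infsum[OF summ])
  have "?f (2 * n) = 1 / 2 ^ Suc k * ?f n" for n
    by (simp add: power_mult_distrib)
  hence "((?f \<circ> (\<lambda>n. 2 * n)) has_sum (1 / 2 ^ Suc k * S)) {1..}"
    using has_sum_cmult_right[OF S, of "1 / 2 ^ Suc k"] by (simp add: o_def mult_ac)
  hence e: "(?f has_sum (1 / 2 ^ Suc k * S)) ((\<lambda>n. 2 * n) ` {1..})"
    by (subst has_sum_reindex) (auto simp: inj_on_def)
  have o: "(?f has_sum (1 / 2 ^ Suc k * (Polygamma k (1 / 2) / fact k))) ((\<lambda>n. 2 * n + 1) ` UNIV)"
  proof -
    have s: "(?f \<circ> (\<lambda>n. 2 * n + 1)) summable_on UNIV"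
      using summ[of "range (\<lambda>n. 2 * n + 1)"] by (subst (asm) summable_on_reindex) (auto simp: inj_on_def)
    have eq: "(?f \<circ> (\<lambda>n. 2 * n + 1)) = (\<lambda>n. 1 / 2 ^ Suc k * inverse ((1 / 2 + of_nat n) ^ Suc k))"
    proof
      fix n :: nat
      have e: "(of_nat (2 * n + 1) :: complex) = 2 * (1 / 2 + of_nat n)" by simp
      show "(?f \<circ> (\<lambda>n. 2 * n + 1)) n = 1 / 2 ^ Suc k * inverse ((1 / 2 + of_nat n) ^ Suc k)"
        unfolding o_def e power_mult_distrib by (simp only: divide_inverse mult_1_left inverse_mult_distrib)
    qed
    have "(\<Sum>n. inverse ((1 / 2 + of_nat n :: complex) ^ Suc k)) = Polygamma k (1 / 2) / fact k"
      using k assms by (simp add: Polygamma_def)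
    moreover have "summable (\<lambda>n. inverse ((1 / 2 + of_nat n :: complex) ^ Suc k))"
      using k by (intro Polygamma_converges') auto
    ultimately have "(\<lambda>n. inverse ((1 / 2 + of_nat n :: complex) ^ Suc k)) sums (Polygamma k (1 / 2) / fact k)"
      by (simp add: sums_iff)
    hence "(?f \<circ> (\<lambda>n. 2 * n + 1)) sums (1 / 2 ^ Suc k * (Polygamma k (1 / 2) / fact k))"
      unfolding eq by (rule sums_mult)
    moreover have "(?f \<circ> (\<lambda>n. 2 * n + 1)) sums infsum (?f \<circ> (\<lambda>n. 2 * n + 1)) UNIV"
      by (intro has_sum_imp_sums has_sum_infsum s)
    ultimately have "((?f \<circ> (\<lambda>n. 2 * n + 1)) has_sum (1 / 2 ^ Suc k * (Polygamma k (1 / 2) / fact k))) UNIV"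
      using has_sum_infsum[OF s] sums_unique2 by metis
    thus ?thesis by (subst has_sum_reindex) (auto simp: inj_on_def)
  qed
  have "(?f has_sum (1 / 2 ^ Suc k * S + 1 / 2 ^ Suc k * (Polygamma k (1 / 2) / fact k)))
      ((\<lambda>n. 2 * n) ` {1..} \<union> (\<lambda>n. 2 * n + 1) ` UNIV)"
    by (intro has_sum_Un_disjoint e o) (auto, presburger)
  also have "(\<lambda>n. 2 * n) ` {1..} \<union> (\<lambda>n. 2 * n + 1) ` UNIV = {1::nat..}"
  proof -
    have "x \<in> (\<lambda>n. 2 * n) ` {1..} \<union> (\<lambda>n. 2 * n + 1) ` UNIV" if "x \<ge> 1" for x :: nat
    proof (cases "even x")
      case True
      then obtain y where "x = 2 * y" by blast
      thus ?thesis using that by auto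
    next
      case False
      then obtain y where "x = 2 * y + 1" using oddE by blast
      thus ?thesis by auto
    qed
    thus ?thesis by auto
  qed
  finally have "S = 1 / 2 ^ Suc k * S + 1 / 2 ^ Suc k * (Polygamma k (1 / 2) / fact k)"
    using S has_sum_unique by blast
  note * = this
  have "t * S = S + Q" if "S = 1 / t * S + 1 / t * Q" "t \<noteq> 0" for t Q :: complex
  proof -
    have "t * S = t * (1 / t * S + 1 / t * Q)" using that(1) by (rule arg_cong)
    thus ?thesis using that(2) by (simp add: distrib_left)
  qed
  from this[OF *] have "2 ^ Suc k * S = S + Polygamma k (1 / 2) / fact k"
    by simp
  hence "S * (2 ^ Suc k - 1) = Polygamma k (1 / 2) / fact k" by (simp add: algebra_simps)
  moreover have "(2 ^ Suc k - 1 :: complex) \<noteq> 0"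
  proof
    assume "(2 ^ Suc k - 1 :: complex) = 0"
    hence "of_nat (2 ^ Suc k) = (of_nat 1 :: complex)" by simp
    hence "(2::nat) ^ Suc k = 1" using of_nat_eq_iff by blast
    thus False by simp
  qed
  ultimately have "S = Polygamma k (1 / 2) / fact k / (2 ^ Suc k - 1)" by (metis nonzero_eq_divide_eq)
  thus ?thesis using S by (simp add: divide_divide_eq_left)
qed

text \<open>Because \<open>c\<close> satisfies c' = -(a + c^2), all derivatives of the reflection
  formula are polynomials in \<open>c\<close>. At z = 1/2 the cotangent is zero and these
  polynomials yield the zeta values.\<close>

lemma Polygamma_reflection_cot:
  fixes z :: complex
  assumes "z \<notin> \<int>"
  defines "c \<equiv> of_real pi * cot (of_real pi * z)" and "a \<equiv> (of_real pi)\<^sup>2"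
  shows "- Polygamma 1 (1 - z) - Polygamma 1 z = - (a + c ^ 2)"
    and "- Polygamma 3 (1 - z) - Polygamma 3 z = - (2 * a + 6 * c ^ 2) * (a + c ^ 2)"
    and "- Polygamma 5 (1 - z) - Polygamma 5 z = - (16 * a ^ 2 + 120 * a * c ^ 2 + 120 * c ^ 4) * (a + c ^ 2)"
proof -
  let ?c = "\<lambda>z::complex. of_real pi * cot (of_real pi * z)"
  have open_U: "open (- \<int> :: complex set)" by (simp add: closed_Ints open_Compl)
  have Dc: "(?c has_field_derivative - (a + ?c z ^ 2)) (at z)" if "z \<notin> \<int>" for z
  proof -
    have s: "sin (of_real pi * z) \<noteq> 0"
    proof
      assume "sin (of_real pi * z) = 0"
      then obtain n :: int where "of_real pi * z = complex_of_real (of_int n * pi)" by (auto simp: sin_eq_0)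
      hence "z = of_int n" by simp
      thus False using that by simp
    qed
    have "(?c has_field_derivative of_real pi * (- inverse ((sin (of_real pi * z))\<^sup>2) * (of_real pi * 1))) (at z)"
      using s by (auto intro!: derivative_eq_intros DERIV_chain2[OF DERIV_cot])
    moreover have "inverse ((sin (of_real pi * z))\<^sup>2) = 1 + cot (of_real pi * z) ^ 2"
    proof -
      have "1 + cot (of_real pi * z) ^ 2 =
          sin (of_real pi * z) ^ 2 / sin (of_real pi * z) ^ 2 + cos (of_real pi * z) ^ 2 / sin (of_real pi * z) ^ 2"
        using s by (simp add: cot_def power_divide)
      also have "\<dots> = 1 / sin (of_real pi * z) ^ 2"
        by (simp only: add_divide_distrib [symmetric] sin_cos_squared_add)
      finally show ?thesis by (simp add: divide_inverse)
    qed
    ultimately show ?thesis by (simp add: a_def power_mult_distrib algebra_simps power2_eq_square)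
  qed
  have step: "(-1) ^ Suc k * Polygamma (Suc k) (1 - z) - Polygamma (Suc k) z = G' z"
    if "\<And>z. z \<notin> \<int> \<Longrightarrow> (-1) ^ k * Polygamma k (1 - z) - Polygamma k z = G z"
       "\<And>z. z \<notin> \<int> \<Longrightarrow> (G has_field_derivative G' z) (at z)" "z \<notin> \<int>" for k G G' and z :: complex
  proof -
    let ?f = "\<lambda>z::complex. (-1) ^ k * Polygamma k (1 - z) - Polygamma k z"
    have "(?f has_field_derivative ((-1) ^ Suc k * Polygamma (Suc k) (1 - z) - Polygamma (Suc k) z)) (at z)"
      using one_minus_notin_nonpos_Ints[OF that(3)] by (auto intro!: derivative_eq_intros)
    moreover have "(?f has_field_derivative G' z) (at z)"
    proof (rule has_field_derivative_transform_within_open[OF that(2)[OF that(3)] open_U])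
      show "z \<in> - \<int>" using that by simp
      show "\<And>x. x \<in> - \<int> \<Longrightarrow> G x = ?f x" using that(1) by simp
    qed
    ultimately show ?thesis by (rule DERIV_unique)
  qed
  have P0: "(-1) ^ 0 * Polygamma 0 (1 - z) - Polygamma 0 z = ?c z" if "z \<notin> \<int>" for z
    using Digamma_reflection[OF that] by simp
  have P1: "(-1) ^ Suc 0 * Polygamma (Suc 0) (1 - z) - Polygamma (Suc 0) z = - (a + ?c z ^ 2)" if "z \<notin> \<int>" for z
    using step[where k = 0 and G = ?c and G' = "\<lambda>z. - (a + ?c z ^ 2)", OF P0 Dc that] .
  have P2: "(-1) ^ Suc (Suc 0) * Polygamma (Suc (Suc 0)) (1 - z) - Polygamma (Suc (Suc 0)) z
      = 2 * ?c z * (a + ?c z ^ 2)" if "z \<notin> \<int>" for z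
  proof -
    have D: "((\<lambda>z. - (a + ?c z ^ 2)) has_field_derivative 2 * ?c z * (a + ?c z ^ 2)) (at z)" if "z \<notin> \<int>" for z
      using DERIV_minus[OF DERIV_add[OF DERIV_const[of a] DERIV_power[OF Dc[OF that], of 2]]]
      by (rule DERIV_cong) (simp add: algebra_simps)
    show ?thesis
      using step[where k = "Suc 0" and G = "\<lambda>z. - (a + ?c z ^ 2)" and
        G' = "\<lambda>z. 2 * ?c z * (a + ?c z ^ 2)", OF P1 D that] .
  qed
  have P3: "(-1) ^ Suc (Suc (Suc 0)) * Polygamma (Suc (Suc (Suc 0))) (1 - z) - Polygamma (Suc (Suc (Suc 0))) z
      = - (2 * a + 6 * ?c z ^ 2) * (a + ?c z ^ 2)" if "z \<notin> \<int>" for z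
  proof -
    have D: "((\<lambda>z. 2 * ?c z * (a + ?c z ^ 2)) has_field_derivative - (2 * a + 6 * ?c z ^ 2) * (a + ?c z ^ 2)) (at z)" if "z \<notin> \<int>" for z
      using DERIV_mult[OF DERIV_cmult[OF Dc[OF that], of 2] DERIV_add[OF DERIV_const[of a] DERIV_power[OF Dc[OF that], of 2]]]
      by (rule DERIV_cong) (simp add: algebra_simps power2_eq_square)
    show ?thesis
      using step[where k = "Suc (Suc 0)" and G = "\<lambda>z. 2 * ?c z * (a + ?c z ^ 2)" and
        G' = "\<lambda>z. - (2 * a + 6 * ?c z ^ 2) * (a + ?c z ^ 2)", OF P2 D that] .
  qed
  have P4: "(-1) ^ Suc (Suc (Suc (Suc 0))) * Polygamma (Suc (Suc (Suc (Suc 0)))) (1 - z) - Polygamma (Suc (Suc (Suc (Suc 0)))) z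
      = (16 * a * ?c z + 24 * ?c z ^ 3) * (a + ?c z ^ 2)" if "z \<notin> \<int>" for z
  proof -
    have D: "((\<lambda>z. - (2 * a + 6 * ?c z ^ 2) * (a + ?c z ^ 2)) has_field_derivative (16 * a * ?c z + 24 * ?c z ^ 3) * (a + ?c z ^ 2)) (at z)" if "z \<notin> \<int>" for z
      using DERIV_mult[OF DERIV_minus[OF DERIV_add[OF DERIV_const[of "2 * a"] DERIV_cmult[OF DERIV_power[OF Dc[OF that], of 2], of 6]]]
         DERIV_add[OF DERIV_const[of a] DERIV_power[OF Dc[OF that], of 2]]]
      by (rule DERIV_cong) (simp add: algebra_simps power2_eq_square power3_eq_cube)
    show ?thesis
      using step[where k = "Suc (Suc (Suc 0))" and G = "\<lambda>z. - (2 * a + 6 * ?c z ^ 2) * (a + ?c z ^ 2)" and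
        G' = "\<lambda>z. (16 * a * ?c z + 24 * ?c z ^ 3) * (a + ?c z ^ 2)", OF P3 D that] .
  qed
  have P5: "(-1) ^ Suc (Suc (Suc (Suc (Suc 0)))) * Polygamma (Suc (Suc (Suc (Suc (Suc 0))))) (1 - z) - Polygamma (Suc (Suc (Suc (Suc (Suc 0))))) z
      = - (16 * a ^ 2 + 120 * a * ?c z ^ 2 + 120 * ?c z ^ 4) * (a + ?c z ^ 2)" if "z \<notin> \<int>" for z
  proof -
    have D: "((\<lambda>z. (16 * a * ?c z + 24 * ?c z ^ 3) * (a + ?c z ^ 2)) has_field_derivative
         - (16 * a ^ 2 + 120 * a * ?c z ^ 2 + 120 * ?c z ^ 4) * (a + ?c z ^ 2)) (at z)" if "z \<notin> \<int>" for z
      using DERIV_mult[OF DERIV_add[OF DERIV_cmult[OF Dc[OF that], of "16 * a"] DERIV_cmult[OF DERIV_power[OF Dc[OF that], of 3], of 24]]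
         DERIV_add[OF DERIV_const[of a] DERIV_power[OF Dc[OF that], of 2]]]
      by (rule DERIV_cong) (simp add: algebra_simps power2_eq_square power3_eq_cube power4_eq_xxxx)
    show ?thesis
      using step[where k = "Suc (Suc (Suc (Suc 0)))" and G = "\<lambda>z. (16 * a * ?c z + 24 * ?c z ^ 3) * (a + ?c z ^ 2)" and
        G' = "\<lambda>z. - (16 * a ^ 2 + 120 * a * ?c z ^ 2 + 120 * ?c z ^ 4) * (a + ?c z ^ 2)", OF P4 D that] .
  qed
  show "- Polygamma 1 (1 - z) - Polygamma 1 z = - (a + c ^ 2)"
    using P1[OF assms(1)] by (simp add: c_def)
  show "- Polygamma 3 (1 - z) - Polygamma 3 z = - (2 * a + 6 * c ^ 2) * (a + c ^ 2)"
    using P3[OF assms(1)] by (simp add: c_def eval_nat_numeral(3) numeral_2_eq_2)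
  show "- Polygamma 5 (1 - z) - Polygamma 5 z = - (16 * a ^ 2 + 120 * a * c ^ 2 + 120 * c ^ 4) * (a + c ^ 2)"
    using P5[OF assms(1)] unfolding c_def by (simp add: numeral_eq_Suc)
qed

lemma zeta_values:
  "((\<lambda>n::nat. 1 / of_nat n ^ 2 :: complex) has_sum (of_real pi ^ 2 / 6)) {1..}"
  "((\<lambda>n::nat. 1 / of_nat n ^ 4 :: complex) has_sum (of_real pi ^ 4 / 90)) {1..}"
  "((\<lambda>n::nat. 1 / of_nat n ^ 6 :: complex) has_sum (of_real pi ^ 6 / 945)) {1..}"
proof -
  have h: "(1 / 2 :: complex) \<notin> \<int>"
    using fraction_not_in_Ints[where 'a = complex, of 2 1] by simp
  have half: "(1 :: complex) - 1 / 2 = 1 / 2" by simp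
  have "cot (complex_of_real pi * (1 / 2)) = of_real (cot (pi / 2))"
    by (metis cot_of_real mult.right_neutral of_real_1 of_real_divide of_real_mult of_real_numeral times_divide_eq_right)
  also have "cot (pi / 2) = 0" by (simp add: cot_def)
  finally have c: "cot (complex_of_real pi * (1 / 2)) = 0" by simp
  note P = Polygamma_reflection_cot[OF h, unfolded half c]
  have "2 * Polygamma 1 (1 / 2 :: complex) = of_real pi ^ 2" using P(1) by simp
  hence P1: "Polygamma 1 (1 / 2 :: complex) = of_real pi ^ 2 / 2"
    by (metis nonzero_mult_div_cancel_left zero_neq_numeral)
  have P3: "Polygamma 3 (1 / 2 :: complex) = of_real pi ^ 4" using P(2) by (simp add: algebra_simps flip: power_add)
  have P5: "Polygamma 5 (1 / 2 :: complex) = 8 * of_real pi ^ 6"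
    using P(3) by (simp add: algebra_simps flip: power_add power_mult)
  show "((\<lambda>n::nat. 1 / of_nat n ^ 2 :: complex) has_sum (of_real pi ^ 2 / 6)) {1..}"
    using zeta_Polygamma[of 1, unfolded P1] by (simp add: eval_nat_numeral)
  show "((\<lambda>n::nat. 1 / of_nat n ^ 4 :: complex) has_sum (of_real pi ^ 4 / 90)) {1..}"
    using zeta_Polygamma[of 3] P3 by (simp add: fact_numeral)
  show "((\<lambda>n::nat. 1 / of_nat n ^ 6 :: complex) has_sum (of_real pi ^ 6 / 945)) {1..}"
    using zeta_Polygamma[of 5] P5 by (simp add: fact_numeral)
qed

subsection \<open>Lambert series\<close>

text \<open>At N = 0 the set of divisors is infinite, so the sum takes its default value 0; hence
  the series \<open>lamb k\<close> has no constant term.\<close>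

definition sig :: "nat \<Rightarrow> nat \<Rightarrow> nat"
  where "sig k N = (\<Sum>d | d dvd N. d ^ k)"

definition lamb :: "nat \<Rightarrow> complex fps"
  where "lamb k = Abs_fps (\<lambda>N. of_nat (sig k N))"

lemma sig_0 [simp]: "sig k 0 = 0"
  by (simp add: sig_def)

lemma sig_1 [simp]: "sig k (Suc 0) = 1"
  by (simp add: sig_def)

text \<open>For m, n >= 1 the product m n is at least (m - 1) + n, which bounds the double series by
  a product of two convergent series.\<close>

lemma summable_on_pairs:
  assumes "norm (w::complex) < 1"
  shows "(\<lambda>(m::nat, n::nat). of_nat n ^ k * w ^ (m * n)) summable_on {1..} \<times> {1..}"
proof -
  define r where "r = norm w"
  have r: "0 \<le> r" "r < 1" using assms by (auto simp: r_def)
  have s1: "(\<lambda>n. r ^ (n - 1)) summable_on {1..}"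
  proof -
    have "(\<lambda>n::nat. r ^ n) summable_on UNIV"
      using r by (intro norm_summable_imp_summable_on) (simp add: summable_geometric)
    hence "((\<lambda>n. r ^ (n - 1)) \<circ> Suc) summable_on UNIV" by (simp add: o_def)
    hence "(\<lambda>n. r ^ (n - 1)) summable_on range Suc" by (subst summable_on_reindex) auto
    moreover have "range Suc = {1..}"
      by (auto simp: image_iff Suc_le_eq gr0_conv_Suc)
    ultimately show ?thesis by simp
  qed
  have s2: "(\<lambda>n. real n ^ k * r ^ n) summable_on {1..}"
  proof -
    have "summable (\<lambda>n. norm (of_nat n ^ k * (of_real r :: complex) ^ n))"
    proof (rule abs_summable_in_conv_radius)
      have cr: "conv_radius (\<lambda>n. of_nat n ^ k :: complex) \<ge> 1"
        by (rule conv_radius_geI_ex') (use summable_power_sum in auto)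
      show "ereal (norm (complex_of_real r)) < conv_radius (\<lambda>n. of_nat n ^ k :: complex)"
        using r by (intro less_le_trans[OF _ cr]) (simp add: one_ereal_def)
    qed
    hence "summable (\<lambda>n. norm (real n ^ k * r ^ n))" using r by (simp add: norm_mult norm_power)
    hence "(\<lambda>n. real n ^ k * r ^ n) summable_on UNIV" by (rule norm_summable_imp_summable_on)
    thus ?thesis by (rule summable_on_subset) auto
  qed
  have "(\<lambda>(m, n). r ^ (m - 1) * (real n ^ k * r ^ n)) summable_on {1..} \<times> {1..}"
  proof (rule summable_on_SigmaI[where g = "\<lambda>m. r ^ (m - 1) * infsum (\<lambda>n. real n ^ k * r ^ n) {1..}"])
    show "((\<lambda>n. case (m, n) of (m, n) \<Rightarrow> r ^ (m - 1) * (real n ^ k * r ^ n)) has_sum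
            r ^ (m - 1) * infsum (\<lambda>n. real n ^ k * r ^ n) {1..}) {1..}" for m
      using has_sum_cmult_right[OF has_sum_infsum[OF s2], of "r ^ (m - 1)"] by simp
  qed (use r s1 in \<open>auto intro!: summable_on_cmult_left\<close>)
  hence "(\<lambda>x. norm (case x of (m, n) \<Rightarrow> of_nat n ^ k * w ^ (m * n))) summable_on {1..} \<times> {1..}"
  proof (rule Infinite_Sum.abs_summable_on_comparison_test')
    fix x :: "nat \<times> nat" assume "x \<in> {1..} \<times> {1..}"
    then obtain m n where x: "x = (m, n)" "m \<ge> 1" "n \<ge> 1" by auto
    have "(m - 1) * n \<ge> (m - 1) * 1" using x by (intro mult_left_mono) auto
    hence "m * n \<ge> m - 1 + n" using x by (cases m) auto
    hence "r ^ (m * n) \<le> r ^ (m - 1 + n)" using r by (intro power_decreasing) auto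
    hence "real n ^ k * r ^ (m * n) \<le> real n ^ k * r ^ (m - 1 + n)" by (intro mult_left_mono) auto
    thus "norm (case x of (m, n) \<Rightarrow> of_nat n ^ k * w ^ (m * n)) \<le>
        (case x of (m, n) \<Rightarrow> r ^ (m - 1) * (real n ^ k * r ^ n))"
      by (simp add: x norm_mult norm_power r_def power_add mult_ac)
  qed
  thus ?thesis by (rule abs_summable_summable)
qed

text \<open>The double series of n^k w^(m n) is summed in two orders: by m it gives the power sums,
  by N = m n it gives the divisor sums.\<close>

lemma Lambert_has_sum:
  assumes "norm (w::complex) < 1" "k \<ge> 1"
  shows "((\<lambda>m. power_sum k (w ^ m)) has_sum infsum (\<lambda>N. of_nat (sig k N) * w ^ N) {1..}) {1..}"
    and "(\<lambda>N. of_nat (sig k N) * w ^ N) summable_on {1..}"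
proof -
  let ?f = "\<lambda>(m::nat, n::nat). of_nat n ^ k * w ^ (m * n)"
  define S where "S = infsum ?f ({1..} \<times> {1..})"
  have S: "(?f has_sum S) ({1..} \<times> {1..})"
    unfolding S_def by (intro has_sum_infsum summable_on_pairs assms)
  have "((\<lambda>(N, d). of_nat d ^ k * w ^ N) has_sum S) (Sigma {1..} (\<lambda>N. {d. d dvd N}))"
  proof (subst has_sum_reindex_bij_witness[where i = "\<lambda>(m, n). (m * n, n)" and
       j = "\<lambda>(N, d). (N div d, d)" and T = "{1..} \<times> {1..}" and h = ?f and s' = S])
    show "(?f has_sum S) ({1..} \<times> {1..})" by (rule S)
  qed (auto simp: Suc_le_eq dvd_div_mult_self mult.commute elim!: dvdE)
  hence A: "((\<lambda>N. of_nat (sig k N) * w ^ N) has_sum S) {1..}"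
  proof (rule has_sum_SigmaD)
    fix N :: nat assume "N \<in> {1..}"
    hence "finite {d. d dvd N}" by auto
    thus "((\<lambda>d. case (N, d) of (N, d) \<Rightarrow> of_nat d ^ k * w ^ N) has_sum of_nat (sig k N) * w ^ N) {d. d dvd N}"
      by (intro has_sum_finiteI) (auto simp: sig_def sum_distrib_right)
  qed
  have B: "((\<lambda>m. power_sum k (w ^ m)) has_sum S) {1..}"
    using S
  proof (rule has_sum_SigmaD)
    fix m :: nat assume m: "m \<in> {1..}"
    have "norm (w ^ m) \<le> norm w" using m assms(1)
      unfolding norm_power by (intro power_le_one_iff[THEN iffD2] power_decreasing[of 1 m "norm w", simplified]) auto
    hence wm: "norm (w ^ m) < 1" using assms(1) by linarith
    have cr: "conv_radius (\<lambda>n. of_nat n ^ k :: complex) \<ge> 1"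
      by (rule conv_radius_geI_ex') (use summable_power_sum in auto)
    hence "summable (\<lambda>n. norm (of_nat n ^ k * (w ^ m) ^ n))"
      using wm by (intro abs_summable_in_conv_radius less_le_trans[OF _ cr]) (simp add: one_ereal_def)
    hence su: "(\<lambda>n. of_nat n ^ k * (w ^ m) ^ n) summable_on UNIV" by (rule norm_summable_imp_summable_on)
    hence "((\<lambda>n. of_nat n ^ k * (w ^ m) ^ n) has_sum power_sum k (w ^ m)) UNIV"
      unfolding power_sum_def using has_sum_infsum[OF su] has_sum_imp_sums[OF has_sum_infsum[OF su]] sums_unique
      by metis
    thus "((\<lambda>n. case (m, n) of (m, n) \<Rightarrow> of_nat n ^ k * w ^ (m * n)) has_sum power_sum k (w ^ m)) {1..}"
      by (subst (asm) has_sum_cong_neutral[where S = UNIV and T = "{1..}" and g = "\<lambda>n. of_nat n ^ k * w ^ (m * n)"])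
         (use assms(2) in \<open>auto simp: power_mult not_less_eq_eq\<close>)
  qed
  show "((\<lambda>m. power_sum k (w ^ m)) has_sum infsum (\<lambda>N. of_nat (sig k N) * w ^ N) {1..}) {1..}"
    using B infsumI[OF A] by simp
  show "(\<lambda>N. of_nat (sig k N) * w ^ N) summable_on {1..}"
    using A by (rule has_sum_imp_summable)
qed

lemma summable_sig:
  assumes "norm (w::complex) < 1" "k \<ge> 1"
  shows "summable (\<lambda>N. of_nat (sig k N) * w ^ N)"
    and "(\<Sum>N. of_nat (sig k N) * w ^ N) = infsum (\<lambda>N. of_nat (sig k N) * w ^ N) {1..}"
proof -
  have "((\<lambda>N. of_nat (sig k N) * w ^ N) has_sum infsum (\<lambda>N. of_nat (sig k N) * w ^ N) {1..}) UNIV"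
    by (subst has_sum_cong_neutral[where T = "{1..}" and g = "\<lambda>N. of_nat (sig k N) * w ^ N"])
       (use Lambert_has_sum(2)[OF assms] in \<open>auto simp: not_less_eq_eq intro!: has_sum_infsum\<close>)
  hence "(\<lambda>N. of_nat (sig k N) * w ^ N) sums infsum (\<lambda>N. of_nat (sig k N) * w ^ N) {1..}"
    by (rule has_sum_imp_sums)
  thus "summable (\<lambda>N. of_nat (sig k N) * w ^ N)"
    "(\<Sum>N. of_nat (sig k N) * w ^ N) = infsum (\<lambda>N. of_nat (sig k N) * w ^ N) {1..}"
    by (auto simp: sums_iff)
qed

lemma lamb_conv_radius: "k \<ge> 1 \<Longrightarrow> fps_conv_radius (lamb k) \<ge> 1"
  unfolding fps_conv_radius_def
  by (rule conv_radius_geI_ex') (use summable_sig(1) in \<open>auto simp: lamb_def\<close>)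

lemma Lambert_series:
  assumes "norm (w::complex) < 1" "k \<ge> 1"
  shows "((\<lambda>m. power_sum k (w ^ m)) has_sum eval_fps (lamb k) w) {1..}"
proof -
  have "eval_fps (lamb k) w = infsum (\<lambda>N. of_nat (sig k N) * w ^ N) {1..}"
    unfolding eval_fps_def lamb_def using summable_sig(2)[OF assms] by simp
  thus ?thesis using Lambert_has_sum(1)[OF assms] by simp
qed

subsection \<open>Eisenstein series\<close>

text \<open>Rows with negative m reduce to positive ones through n -> -n, since the exponent is
  even.\<close>

lemma eisenstein_rows:
  assumes "Im \<tau> > 0" "odd k" "m \<noteq> 0"
  shows "((\<lambda>n::int. 1 / (of_int m * \<tau> + of_int n) ^ Suc k) has_sum
     ((2 * of_real pi * \<i>) ^ Suc k / fact k * power_sum k (nome \<tau> ^ nat \<bar>m\<bar>))) UNIV"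
proof -
  let ?C = "(2 * of_real pi * \<i>) ^ Suc k / fact k :: complex"
  have *: "((\<lambda>n::int. 1 / (of_int \<bar>m\<bar> * \<tau> + of_int n) ^ Suc k) has_sum
     (?C * power_sum k (nome \<tau> ^ nat \<bar>m\<bar>))) UNIV"
  proof -
    have "nome (of_int \<bar>m\<bar> * \<tau>) = nome \<tau> ^ nat \<bar>m\<bar>"
      using nome_of_nat_mult[of "nat \<bar>m\<bar>" \<tau>] by (simp add: of_nat_nat)
    moreover have "Im (of_int \<bar>m\<bar> * \<tau>) > 0" using assms by simp
    ultimately show ?thesis using Lipschitz_formula[of "of_int \<bar>m\<bar> * \<tau>" k] assms(2) by simp
  qed
  show ?thesis
  proof (cases "m > 0")
    case True
    thus ?thesis using * by simp
  next
    case False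
    have "((\<lambda>n::int. 1 / (of_int m * \<tau> + of_int n) ^ Suc k) has_sum (?C * power_sum k (nome \<tau> ^ nat \<bar>m\<bar>))) UNIV \<longleftrightarrow>
       ((\<lambda>n::int. 1 / (of_int \<bar>m\<bar> * \<tau> + of_int n) ^ Suc k) has_sum (?C * power_sum k (nome \<tau> ^ nat \<bar>m\<bar>))) UNIV"
    proof (rule has_sum_reindex_bij_witness[where i = uminus and j = uminus])
      fix n :: int
      have "of_int \<bar>m\<bar> * \<tau> + of_int (- n) = - (of_int m * \<tau> + of_int n)" using False by simp
      thus "1 / (of_int \<bar>m\<bar> * \<tau> + of_int (- n)) ^ Suc k = 1 / (of_int m * \<tau> + of_int n) ^ Suc k"
        using assms(2) by (metis even_Suc power_minus_even)
    qed auto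
    thus ?thesis using * by blast
  qed
qed

text \<open>The row m = 0 gives twice the zeta value \<open>Z\<close>; the Lipschitz formula turns
  every other row into a power sum, and these assemble to a Lambert series.\<close>

lemma eisenstein_q_expansion:
  assumes "Im \<tau> > 0" "odd k" "k \<ge> 2" and Z: "((\<lambda>n::nat. 1 / of_nat n ^ Suc k :: complex) has_sum Z) {1..}"
  shows "eisenstein_sum (Suc k) \<tau> = 2 * Z + 2 * (2 * of_real pi * \<i>) ^ Suc k / fact k * eval_fps (lamb k) (nome \<tau>)"
proof -
  let ?C = "(2 * of_real pi * \<i>) ^ Suc k / fact k :: complex"
  let ?f = "\<lambda>(m::int, n::int). 1 / (of_int m * \<tau> + of_int n) ^ Suc k"
  define S where "S = eisenstein_sum (Suc k) \<tau>"
  have "?f summable_on UNIV - {(0, 0)}"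
    by (rule abs_summable_summable, rule abs_summable_lattice) (use assms in simp_all)
  hence "(?f has_sum S) (UNIV - {(0, 0)})" unfolding S_def eisenstein_sum_def by (rule has_sum_infsum)
  also have "UNIV - {(0, 0)} = Sigma UNIV (\<lambda>m::int. if m = 0 then UNIV - {0::int} else UNIV)" by (auto split: if_splits)
  finally have S: "(?f has_sum S) (Sigma UNIV (\<lambda>m::int. if m = 0 then UNIV - {0::int} else UNIV))" .
  define g where "g = (\<lambda>m::int. if m = 0 then 2 * Z else ?C * power_sum k (nome \<tau> ^ nat \<bar>m\<bar>))"
  have g: "(g has_sum S) UNIV"
    using S
  proof (rule has_sum_SigmaD)
    fix m :: int
    have ev: "((\<lambda>n::int. 1 / of_int n ^ Suc k :: complex) has_sum 2 * Z) (UNIV - {0})"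
      by (rule has_sum_even_int) (use Z assms(2) in auto)
    show "((\<lambda>n. case (m, n) of (m, n) \<Rightarrow> 1 / (of_int m * \<tau> + of_int n) ^ Suc k) has_sum g m)
       (if m = 0 then UNIV - {0} else UNIV)"
      using ev eisenstein_rows[OF assms(1,2), of m] by (auto simp: g_def)
  qed
  have "((\<lambda>m::nat. g (int m)) has_sum (?C * eval_fps (lamb k) (nome \<tau>))) {1..}"
  proof -
    have "((\<lambda>m::nat. ?C * power_sum k (nome \<tau> ^ m)) has_sum (?C * eval_fps (lamb k) (nome \<tau>))) {1..}"
      using assms by (intro has_sum_cmult_right Lambert_series norm_nome_less_1) auto
    thus ?thesis by (subst has_sum_cong[where g = "\<lambda>m::nat. ?C * power_sum k (nome \<tau> ^ m)"]) (auto simp: g_def)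
  qed
  hence "(g has_sum 2 * (?C * eval_fps (lamb k) (nome \<tau>))) (UNIV - {0})"
    by (intro has_sum_even_int) (auto simp: g_def)
  hence "(g has_sum (g 0 + 2 * (?C * eval_fps (lamb k) (nome \<tau>)))) (insert 0 (UNIV - {0}))"
    by (intro has_sum_insert) auto
  hence "(g has_sum (g 0 + 2 * (?C * eval_fps (lamb k) (nome \<tau>)))) UNIV" by (simp add: insert_UNIV)
  hence "S = g 0 + 2 * (?C * eval_fps (lamb k) (nome \<tau>))" using g has_sum_unique by blast
  thus ?thesis by (simp add: S_def g_def)
qed

text \<open>The Eisenstein series of weights 4 and 6 as functions of q, scaled to constant term 1;
  240 and 504 are what remains after dividing by 2 zeta(4) and 2 zeta(6).\<close>

definition E4q :: "complex \<Rightarrow> complex" where "E4q w = 1 + 240 * eval_fps (lamb 3) w"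
definition E6q :: "complex \<Rightarrow> complex" where "E6q w = 1 - 504 * eval_fps (lamb 5) w"

lemma eisenstein_sum_4:
  assumes "Im \<tau> > 0"
  shows "eisenstein_sum 4 \<tau> = of_real pi ^ 4 / 45 * E4q (nome \<tau>)"
proof -
  have "(2 * of_real pi * \<i>) ^ Suc 3 = (16 * of_real pi ^ 4 :: complex)"
    by (simp add: power_mult_distrib)
  moreover have "((\<lambda>n::nat. 1 / of_nat n ^ Suc 3 :: complex) has_sum (of_real pi ^ 4 / 90)) {1..}"
    using zeta_values(2) by simp
  ultimately show ?thesis
    using eisenstein_q_expansion[OF assms, of 3 "of_real pi ^ 4 / 90"]
    by (simp add: E4q_def fact_numeral algebra_simps)
qed

lemma eisenstein_sum_6:
  assumes "Im \<tau> > 0"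
  shows "eisenstein_sum 6 \<tau> = 2 * of_real pi ^ 6 / 945 * E6q (nome \<tau>)"
proof -
  have "\<i> ^ 6 = -1" by (simp add: eval_nat_numeral)
  hence "(2 * of_real pi * \<i>) ^ Suc 5 = (- 64 * of_real pi ^ 6 :: complex)"
    by (simp add: power_mult_distrib)
  moreover have "((\<lambda>n::nat. 1 / of_nat n ^ Suc 5 :: complex) has_sum (of_real pi ^ 6 / 945)) {1..}"
    using zeta_values(3) by simp
  ultimately show ?thesis
    using eisenstein_q_expansion[OF assms, of 5 "of_real pi ^ 6 / 945"]
    by (simp add: E6q_def fact_numeral algebra_simps)
qed

subsection \<open>The quasi-modular series of weight 2\<close>

text \<open>The two digamma series at 1 - z and z + 1 are subtracted termwise. The formula evaluates
  the telescoped columns in the transformation law of weight 2.\<close>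

lemma cot_partial_fractions:
  fixes z :: complex
  assumes "z \<notin> \<int>"
  shows "(\<lambda>k. 1 / (z + of_nat (Suc k)) + 1 / (z - of_nat (Suc k))) sums (of_real pi * cot (of_real pi * z) - 1 / z)"
proof -
  have z0: "z \<noteq> 0" and z1: "1 - z \<noteq> 0" and z2: "z + 1 \<noteq> 0"
  proof -
    show "z \<noteq> 0" using assms by auto
    show "1 - z \<noteq> 0" using assms by auto
    show "z + 1 \<noteq> 0" using assms by (metis Ints_1 Ints_minus add_eq_0_iff2)
  qed
  have s: "(\<lambda>k. inverse (of_nat (Suc k)) - inverse (w + of_nat k)) sums (Digamma w + euler_mascheroni)"
    if "w \<noteq> 0" for w :: complex
    using summable_Digamma[OF that] by (simp add: Digamma_def sums_iff)
  have "(\<lambda>k. (inverse (of_nat (Suc k)) - inverse ((1 - z) + of_nat k)) - (inverse (of_nat (Suc k)) - inverse ((z + 1) + of_nat k)))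
      sums ((Digamma (1 - z) + euler_mascheroni) - (Digamma (z + 1) + euler_mascheroni))"
    by (intro sums_diff s z1 z2)
  moreover have "(inverse (of_nat (Suc k)) - inverse ((1 - z) + of_nat k)) - (inverse (of_nat (Suc k)) - inverse ((z + 1) + of_nat k))
      = 1 / (z + of_nat (Suc k)) + 1 / (z - of_nat (Suc k))" for k
  proof -
    have "(1 - z) + of_nat k = - (z - of_nat (Suc k))" by simp
    hence "inverse ((1 - z) + of_nat k) = - inverse (z - of_nat (Suc k))" by (simp only: inverse_minus_eq)
    moreover have "(z + 1) + of_nat k = z + of_nat (Suc k)" by simp
    ultimately show ?thesis by (simp only: divide_inverse mult_1_left) simp
  qed
  moreover have "(Digamma (1 - z) + euler_mascheroni) - (Digamma (z + 1) + euler_mascheroni) =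
      of_real pi * cot (of_real pi * z) - 1 / z"
    using Digamma_reflection[OF assms] Digamma_plus1[OF z0] by (simp add: algebra_simps)
  ultimately show ?thesis by simp
qed

lemma has_sum_diff:
  fixes f g :: "'a \<Rightarrow> complex"
  assumes "(f has_sum a) A" "(g has_sum b) A"
  shows "((\<lambda>x. f x - g x) has_sum (a - b)) A"
  using has_sum_add[OF assms(1) has_sum_uminusI[OF assms(2)]] by simp

lemma summable_on_diff:
  fixes f g :: "'a \<Rightarrow> complex"
  assumes "f summable_on A" "g summable_on A"
  shows "(\<lambda>x. f x - g x) summable_on A"
  using has_sum_diff[OF has_sum_infsum has_sum_infsum, OF assms] by (rule has_sum_imp_summable)

lemma has_sum_sum:
  fixes f :: "'b \<Rightarrow> 'a \<Rightarrow> complex"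
  assumes "finite I" "\<And>i. i \<in> I \<Longrightarrow> (f i has_sum s i) A"
  shows "((\<lambda>x. \<Sum>i\<in>I. f i x) has_sum (\<Sum>i\<in>I. s i)) A"
  using assms by (induction I rule: finite_induct) (auto intro!: has_sum_add)

text \<open>The half-open intervals exhaust the integers. They are half-open so that a telescoping
  sum over one of them leaves h(-N) - h(N).\<close>

lemma has_sum_int_partial_sums:
  fixes f :: "int \<Rightarrow> complex"
  assumes "(f has_sum S) UNIV"
  shows "(\<lambda>N. \<Sum>n\<in>{- int N..<int N}. f n) \<longlonglongrightarrow> S"
proof -
  have "filterlim (\<lambda>N. {- int N..<int N}) (finite_subsets_at_top UNIV) sequentially"
    unfolding filterlim_finite_subsets_at_top
  proof (intro allI impI)
    fix Y :: "int set" assume "finite Y \<and> Y \<subseteq> UNIV"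
    hence Y: "finite Y" by blast
    define M where "M = (if Y = {} then 0 else Max ((\<lambda>x. nat \<bar>x\<bar>) ` Y))"
    have M: "nat \<bar>x\<bar> \<le> M" if "x \<in> Y" for x using that Y by (auto simp: M_def)
    have "Y \<subseteq> {- int N..<int N}" if "N \<ge> Suc M" for N
    proof
      fix x assume "x \<in> Y"
      hence "nat \<bar>x\<bar> < N" using M[of x] that by simp
      thus "x \<in> {- int N..<int N}" by auto
    qed
    thus "\<forall>\<^sub>F N in sequentially. finite {- int N..<int N} \<and> Y \<subseteq> {- int N..<int N} \<and> {- int N..<int N} \<subseteq> UNIV"
      by (intro eventually_sequentiallyI[of "Suc M"]) auto
  qed
  from filterlim_compose[OF assms[unfolded has_sum_def] this] show ?thesis by simp
qed

lemma telescoping_int_sum: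
  fixes h :: "int \<Rightarrow> complex"
  shows "(\<Sum>n\<in>{- int N..<int N}. h n - h (n + 1)) = h (- int N) - h (int N)"
proof (induction N)
  case (Suc N)
  have "{- int (Suc N)..<int (Suc N)} = insert (- int (Suc N)) (insert (int N) {- int N..<int N})" by auto
  hence "(\<Sum>n\<in>{- int (Suc N)..<int (Suc N)}. h n - h (n + 1)) =
     (h (- int (Suc N)) - h (- int (Suc N) + 1)) + ((h (int N) - h (int N + 1)) + (\<Sum>n\<in>{- int N..<int N}. h n - h (n + 1)))"
    by (simp del: of_nat_Suc)
  also have "- int (Suc N) + 1 = - int N" by simp
  also have "int N + 1 = int (Suc N)" by simp
  finally show ?case unfolding Suc.IH by simp
qed auto

lemma tendsto_inverse_shift: "(\<lambda>N::nat. 1 / (of_nat N + w :: complex)) \<longlonglongrightarrow> 0"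
proof -
  have "filterlim (\<lambda>N::nat. of_nat N + w) at_infinity sequentially"
    by (rule tendsto_add_filterlim_at_infinity'[OF tendsto_of_nat tendsto_const])
  from tendsto_divide_0[OF tendsto_const this] show ?thesis .
qed

lemma int_translate_nonzero:
  assumes "Im \<tau> > 0" "m \<noteq> 0"
  shows "of_int m * \<tau> + of_int n \<noteq> 0"
proof
  assume "of_int m * \<tau> + of_int n = 0"
  hence "Im (of_int m * \<tau> + of_int n) = 0" by simp
  thus False using assms by simp
qed

text \<open>The double series of weight 2 is not absolutely convergent. Subtracting the telescoping
  difference 1/u - 1/v with v = u + 1 leaves 1/(u^2 v), which decays like an inverse cube.\<close>

lemma weight2_summand:
  assumes "Im \<tau> > 0"
  shows "(\<lambda>(m::int, n::int). 1 / (of_int m * \<tau> + of_int n) ^ 2 -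
            (1 / (of_int m * \<tau> + of_int n) - 1 / (of_int m * \<tau> + of_int (n + 1)))) summable_on (UNIV - {0}) \<times> UNIV"
    (is "?f summable_on _")
proof -
  obtain c where c: "c > 0" "\<And>x y :: real. c * (\<bar>x\<bar> + \<bar>y\<bar>) \<le> cmod (of_real x * \<tau> + of_real y)"
    using lattice_norm_lower_bound[OF assms] by blast
  have "(\<lambda>x. norm (?f x)) summable_on (UNIV - {0}) \<times> UNIV"
  proof (rule Infinite_Sum.abs_summable_on_comparison_test'
      [where g = "\<lambda>x. 16 / c ^ 3 * (case x of (m, n) \<Rightarrow> int_weight m * int_weight n)"])
    show "(\<lambda>x. 16 / c ^ 3 * (case x of (m, n) \<Rightarrow> int_weight m * int_weight n)) summable_on (UNIV - {0}) \<times> UNIV"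
      by (intro summable_on_cmult_right summable_on_subset[OF summable_int_weight_pair]) auto
  next
    fix x :: "int \<times> int" assume "x \<in> (UNIV - {0}) \<times> UNIV"
    then obtain m n where x: "x = (m, n)" "m \<noteq> 0" by auto
    define u v where "u = of_int m * \<tau> + of_int n" and "v = of_int m * \<tau> + of_int (n + 1)"
    have nz: "u \<noteq> 0" "v \<noteq> 0" using int_translate_nonzero[OF assms x(2)] by (simp_all only: u_def v_def not_False_eq_True)
    define s where "s = \<bar>real_of_int m\<bar> + \<bar>real_of_int n\<bar>"
    have m1: "\<bar>real_of_int m\<bar> \<ge> 1" using x(2) by linarith
    have s1: "s \<ge> 1" using m1 by (simp add: s_def)
    have n1: "\<bar>real_of_int n\<bar> \<le> \<bar>real_of_int n + 1\<bar> + 1" by (auto simp: abs_if)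
    have u: "c * s \<le> cmod u" using c(2)[of m n] by (simp add: s_def u_def)
    \<comment> \<open>Moving from n to n + 1 costs at most a factor 2, since |m| >= 1.\<close>
    have "c * (s / 2) \<le> c * (\<bar>real_of_int m\<bar> + \<bar>real_of_int n + 1\<bar>)"
    proof (rule mult_left_mono)
      have *: "(x + y) / 2 \<le> x + z" if "1 \<le> x" "y \<le> z + 1" "0 \<le> z" for x y z :: real
        using that by (simp add: field_simps)
      show "s / 2 \<le> \<bar>real_of_int m\<bar> + \<bar>real_of_int n + 1\<bar>"
        unfolding s_def by (rule *[OF m1 n1 abs_ge_zero])
    qed (use c in simp)
    also have "\<dots> \<le> cmod v" using c(2)[of m "n + 1"] by (simp add: v_def)
    finally have v: "c * (s / 2) \<le> cmod v" .
    have vu: "v = u + 1" by (simp add: u_def v_def)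
    have "1 / u ^ 2 - (1 / u - 1 / v) = 1 / (u ^ 2 * v)"
    proof -
      have "1 / u - 1 / v = (v - u) / (u * v)" using nz by (simp add: diff_divide_distrib)
      moreover have "1 / u ^ 2 - (v - u) / (u * v) = (v - u * (v - u)) / (u ^ 2 * v)"
        using nz by (simp add: diff_divide_distrib power2_eq_square)
      ultimately show ?thesis by (simp add: vu)
    qed
    hence "norm (?f x) = 1 / (cmod u ^ 2 * cmod v)"
      by (simp add: x u_def v_def norm_divide norm_mult norm_power)
    also have "\<dots> \<le> 1 / ((c * s) ^ 2 * (c * (s / 2)))"
      using u v c(1) s1 nz
      by (intro divide_left_mono mult_mono power_mono mult_pos_pos[OF zero_less_power] mult_pos_pos zero_less_power) auto
    also have "\<dots> = 2 / c ^ 3 * (1 / s ^ 3)"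
      by (simp add: power2_eq_square power3_eq_cube)
    also have "\<dots> \<le> 2 / c ^ 3 * (8 * (int_weight m * int_weight n))"
      using c(1) int_weight_bound[of m n] x by (intro mult_left_mono) (auto simp: s_def)
    finally show "norm (?f x) \<le> 16 / c ^ 3 * (case x of (m, n) \<Rightarrow> int_weight m * int_weight n)"
      by (simp add: x)
  qed
  thus ?thesis by (rule abs_summable_summable)
qed

text \<open>An absolutely convergent double series is summed by rows and by columns. The subtracted
  telescoping part vanishes along rows, but its column sums add up to a cotangent limit, and this is
  the source of the term 2 pi i / \<tau> that spoils modularity in weight 2.\<close>

lemma weight2_transformation:
  assumes "Im \<tau> > 0"
  defines "C \<equiv> (2 * of_real pi * \<i>) ^ 2 :: complex" and "L \<equiv> \<lambda>\<tau>. eval_fps (lamb 1) (nome \<tau>)"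
  shows "2 * C * L \<tau> = (of_real pi ^ 2 / 3 + 2 * C * L (- 1 / \<tau>)) / \<tau> ^ 2 - of_real pi ^ 2 / 3 + 2 * of_real pi * \<i> / \<tau>"
proof -
  define f where "f = (\<lambda>m n::int. 1 / (of_int m * \<tau> + of_int n) ^ 2)"
  define h where "h = (\<lambda>m n::int. 1 / (of_int m * \<tau> + of_int n))"
  \<comment> \<open>Only \<open>a\<close> may be summed in either order; \<open>f\<close> and
    \<open>h\<close> are recovered separately along each row and each column.\<close>
  define a where "a = (\<lambda>(m, n). f m n - (h m n - h m (n + 1)))"
  have tau0: "\<tau> \<noteq> 0" using assms(1) by auto
  define \<tau>' where "\<tau>' = - 1 / \<tau>"
  have tt: "\<tau>' * \<tau> = - 1" using tau0 by (simp add: \<tau>'_def)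
  have "Im \<tau>' = Im \<tau> / (cmod \<tau>)\<^sup>2" by (simp add: \<tau>'_def Im_divide cmod_power2)
  hence tau': "Im \<tau>' > 0" using assms(1) tau0 by simp
  have "a summable_on (UNIV - {0}) \<times> UNIV"
    using weight2_summand[OF assms(1)] by (simp add: a_def f_def h_def)
  then obtain S where S: "(a has_sum S) ((UNIV - {0}) \<times> UNIV)" by (auto simp: summable_on_def)

  define g where "g = (\<lambda>m::int. C * power_sum 1 (nome \<tau> ^ nat \<bar>m\<bar>))"
  have rows: "(f m has_sum g m) UNIV" if "m \<noteq> 0" for m
    using eisenstein_rows[OF assms(1), of 1 m] that by (simp add: f_def g_def C_def numeral_2_eq_2)
  have "(g has_sum S) (UNIV - {0})"
    using S
  proof (rule has_sum_SigmaD)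
    fix m :: int assume "m \<in> UNIV - {0}"
    hence m: "m \<noteq> 0" by simp
    have "(\<lambda>n. a (m, n)) summable_on UNIV"
      using summable_on_SigmaD1[where f = "\<lambda>m n. a (m, n)" and A = "UNIV - {0}" and B = "\<lambda>_. UNIV" and x = m]
        has_sum_imp_summable[OF S] m by (simp add: case_prod_unfold)
    hence "(\<lambda>n. f m n - a (m, n)) summable_on UNIV"
      using has_sum_imp_summable[OF rows[OF m]] by (intro summable_on_diff) auto
    hence "(\<lambda>n. h m n - h m (n + 1)) summable_on UNIV" by (simp add: a_def)
    then obtain T where T: "((\<lambda>n. h m n - h m (n + 1)) has_sum T) UNIV" by (auto simp: summable_on_def)
    have "(\<lambda>N. h m (- int N) - h m (int N)) \<longlonglongrightarrow> T"
      using has_sum_int_partial_sums[OF T] unfolding telescoping_int_sum .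
    moreover have "(\<lambda>N. h m (- int N) - h m (int N)) \<longlonglongrightarrow> - 0 - 0"
    proof (intro tendsto_diff)
      have "h m (- int N) = - (1 / (of_nat N + (- (of_int m * \<tau>))))" for N
      proof -
        have "of_int m * \<tau> + of_int (- int N) = - (of_nat N + (- (of_int m * \<tau>)))" by simp
        thus ?thesis unfolding h_def by (simp only: divide_minus_right)
      qed
      thus "(\<lambda>N. h m (- int N)) \<longlonglongrightarrow> - 0" by (simp only:) (rule tendsto_minus[OF tendsto_inverse_shift])
      have "h m (int N) = 1 / (of_nat N + of_int m * \<tau>)" for N by (simp add: h_def add.commute)
      thus "(\<lambda>N. h m (int N)) \<longlonglongrightarrow> 0" by (simp only:) (rule tendsto_inverse_shift)
    qed
    ultimately have "T = 0" using LIMSEQ_unique by fastforce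
    hence "((\<lambda>n. f m n - (h m n - h m (n + 1))) has_sum (g m - 0)) UNIV"
      using T by (intro has_sum_diff rows m) auto
    thus "((\<lambda>n. a (m, n)) has_sum g m) UNIV" by (simp add: a_def)
  qed
  moreover have "(g has_sum 2 * (C * L \<tau>)) (UNIV - {0})"
  proof (rule has_sum_even_int)
    have "((\<lambda>m::nat. C * power_sum 1 (nome \<tau> ^ m)) has_sum (C * L \<tau>)) {1..}"
      unfolding L_def using assms by (intro has_sum_cmult_right Lambert_series norm_nome_less_1) auto
    thus "((\<lambda>m::nat. g (int m)) has_sum (C * L \<tau>)) {1..}" by (simp add: g_def)
  qed (simp add: g_def)
  ultimately have S_eq: "S = 2 * C * L \<tau>" using has_sum_unique by (metis mult.assoc)

  \<comment> \<open>Column sums of \<open>f\<close> over m different from 0. Column n is row -n of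
    the lattice of \<tau>' = -1/\<tau>, divided by \<tau>^2; for n different from 0 the entry m = 0
    must be taken out.\<close>
  define b where "b = (\<lambda>n::int. if n = 0 then (of_real pi ^ 2 / 3) / \<tau> ^ 2 else
      C * power_sum 1 (nome \<tau>' ^ nat \<bar>n\<bar>) / \<tau> ^ 2 - 1 / of_int n ^ 2)"
  have zeta2: "((\<lambda>n::int. 1 / of_int n ^ 2 :: complex) has_sum of_real pi ^ 2 / 3) (UNIV - {0})"
    using has_sum_even_int[of "\<lambda>n. 1 / of_int n ^ 2" "of_real pi ^ 2 / 6"] zeta_values(1) by simp
  have cols: "((\<lambda>m. f m n) has_sum b n) (UNIV - {0})" for n
  proof (cases "n = 0")
    case True
    have "((\<lambda>m::int. (1 / of_int m ^ 2) * (1 / \<tau> ^ 2)) has_sum (of_real pi ^ 2 / 3) * (1 / \<tau> ^ 2)) (UNIV - {0})"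
      by (rule has_sum_cmult_left[OF zeta2])
    thus ?thesis by (simp add: f_def b_def True power_mult_distrib)
  next
    case False
    have "((\<lambda>m::int. 1 / (of_int (- n) * \<tau>' + of_int m) ^ Suc 1) has_sum C * power_sum 1 (nome \<tau>' ^ nat \<bar>n\<bar>)) UNIV"
      using eisenstein_rows[OF tau', of 1 "- n"] False by (simp add: C_def numeral_2_eq_2)
    hence "((\<lambda>m::int. 1 / (of_int (- n) * \<tau>' + of_int m) ^ Suc 1 * (1 / \<tau> ^ 2)) has_sum
        C * power_sum 1 (nome \<tau>' ^ nat \<bar>n\<bar>) * (1 / \<tau> ^ 2)) UNIV"
      by (rule has_sum_cmult_left)
    moreover have "1 / (of_int (- n) * \<tau>' + of_int m) ^ Suc 1 * (1 / \<tau> ^ 2) = f m n" for m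
    proof -
      have e: "of_int m * \<tau> + of_int n = (of_int (- n) * \<tau>' + of_int m) * \<tau>"
        by (simp add: distrib_right left_diff_distrib mult.assoc tt)
      have "1 / y ^ Suc 1 * (1 / \<tau> ^ 2) = 1 / (y * \<tau>) ^ 2" for y
        by (simp add: power2_eq_square mult_ac)
      thus ?thesis unfolding f_def e .
    qed
    ultimately have "((\<lambda>m. f m n) has_sum C * power_sum 1 (nome \<tau>' ^ nat \<bar>n\<bar>) / \<tau> ^ 2) UNIV" by simp
    moreover have "((\<lambda>m. f m n) has_sum f 0 n) {0}" by (rule has_sum_finiteI) auto
    ultimately have "((\<lambda>m. f m n) has_sum (C * power_sum 1 (nome \<tau>' ^ nat \<bar>n\<bar>) / \<tau> ^ 2 - f 0 n)) (UNIV - {0})"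
      by (intro has_sum_Diff) auto
    thus ?thesis using False by (simp add: b_def f_def)
  qed
  have b_sum: "(b has_sum ((of_real pi ^ 2 / 3 + 2 * C * L \<tau>') / \<tau> ^ 2 - of_real pi ^ 2 / 3)) UNIV"
  proof -
    have "((\<lambda>n::int. C * power_sum 1 (nome \<tau>' ^ nat \<bar>n\<bar>)) has_sum 2 * (C * L \<tau>')) (UNIV - {0})"
    proof (rule has_sum_even_int)
      have "((\<lambda>m::nat. C * power_sum 1 (nome \<tau>' ^ m)) has_sum (C * L \<tau>')) {1..}"
        unfolding L_def using tau' by (intro has_sum_cmult_right Lambert_series norm_nome_less_1) auto
      thus "((\<lambda>n::nat. C * power_sum 1 (nome \<tau>' ^ nat \<bar>int n\<bar>)) has_sum (C * L \<tau>')) {1..}" by simp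
    qed simp
    hence "((\<lambda>n::int. C * power_sum 1 (nome \<tau>' ^ nat \<bar>n\<bar>) * (1 / \<tau> ^ 2) - 1 / of_int n ^ 2) has_sum
        (2 * (C * L \<tau>') * (1 / \<tau> ^ 2) - of_real pi ^ 2 / 3)) (UNIV - {0})"
      by (intro has_sum_diff zeta2 has_sum_cmult_left)
    hence "(b has_sum (2 * (C * L \<tau>') * (1 / \<tau> ^ 2) - of_real pi ^ 2 / 3)) (UNIV - {0})"
      by (subst has_sum_cong[where g = "\<lambda>n::int. C * power_sum 1 (nome \<tau>' ^ nat \<bar>n\<bar>) * (1 / \<tau> ^ 2) - 1 / of_int n ^ 2"])
         (auto simp: b_def)
    hence "(b has_sum (b 0 + (2 * (C * L \<tau>') * (1 / \<tau> ^ 2) - of_real pi ^ 2 / 3))) (insert 0 (UNIV - {0}))"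
      by (intro has_sum_insert) auto
    moreover have "b 0 + (2 * (C * L \<tau>') * (1 / \<tau> ^ 2) - of_real pi ^ 2 / 3) =
        (of_real pi ^ 2 / 3 + 2 * C * L \<tau>') / \<tau> ^ 2 - of_real pi ^ 2 / 3"
      by (simp add: b_def add_divide_distrib)
    ultimately show ?thesis by (simp only: insert_Diff_single insert_UNIV)
  qed
  have swapped: "((\<lambda>(n, m). a (m, n)) has_sum S) (UNIV \<times> (UNIV - {0}))"
    using S by (subst (asm) has_sum_swap)
  define d where "d = (\<lambda>n. infsum (\<lambda>m. h m n - h m (n + 1)) (UNIV - {0}))"
  have d: "((\<lambda>m. h m n - h m (n + 1)) has_sum d n) (UNIV - {0})"
    and col_a: "((\<lambda>m. a (m, n)) has_sum (b n - d n)) (UNIV - {0})" for n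
  proof -
    have "(\<lambda>m. a (m, n)) summable_on UNIV - {0}"
      by (rule summable_on_SigmaD1[where f = "\<lambda>n m. a (m, n)" and B = "\<lambda>_. UNIV - {0}" and A = UNIV,
            OF has_sum_imp_summable[OF swapped] UNIV_I])
    hence "(\<lambda>m. f m n - a (m, n)) summable_on UNIV - {0}"
      using has_sum_imp_summable[OF cols] by (intro summable_on_diff) auto
    hence "(\<lambda>m. h m n - h m (n + 1)) summable_on UNIV - {0}" by (simp add: a_def)
    thus d: "((\<lambda>m. h m n - h m (n + 1)) has_sum d n) (UNIV - {0})" unfolding d_def by (rule has_sum_infsum)
    have "((\<lambda>m. f m n - (h m n - h m (n + 1))) has_sum (b n - d n)) (UNIV - {0})"
      by (intro has_sum_diff cols d)
    thus "((\<lambda>m. a (m, n)) has_sum (b n - d n)) (UNIV - {0})" by (simp add: a_def)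
  qed
  have "((\<lambda>n. b n - d n) has_sum S) UNIV"
    using swapped by (rule has_sum_SigmaD) (use col_a in simp)
  from has_sum_diff[OF b_sum this]
  have d_sum: "(d has_sum ((of_real pi ^ 2 / 3 + 2 * C * L \<tau>') / \<tau> ^ 2 - of_real pi ^ 2 / 3 - S)) UNIV"
    by simp
  have "(\<lambda>N. \<Sum>n\<in>{- int N..<int N}. d n) \<longlonglongrightarrow> (of_real pi ^ 2 / 3 + 2 * C * L \<tau>') / \<tau> ^ 2 - of_real pi ^ 2 / 3 - S"
    by (rule has_sum_int_partial_sums[OF d_sum])
  moreover have "(\<lambda>N. \<Sum>n\<in>{- int N..<int N}. d n) \<longlonglongrightarrow> - (2 / \<tau>) * (of_real pi * \<i> - 0)"
  proof -
    \<comment> \<open>The finite sum over n is taken inside the sum over m, where it telescopes to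
      partial fractions of the cotangent at z = N/\<tau>. Evaluation is at -z = N \<tau>', which
      lies in the upper half plane.\<close>
    have val: "(\<Sum>n\<in>{- int N..<int N}. d n) = - (2 / \<tau>) * (- (of_real pi * \<i> - 2 * of_real pi * \<i> * (1 / (1 - nome \<tau>' ^ N))) - \<tau> * (1 / (of_nat N + 0)))"
      if N: "N \<ge> 1" for N
    proof -
      define z where "z = of_nat N / \<tau>"
      have z': "- z = of_nat N * \<tau>'" by (simp add: z_def \<tau>'_def)
      have Im_z: "Im (- z) > 0" using tau' N unfolding z' by simp
      have zI: "z \<notin> \<int>"
        using Im_pos_notin_Ints[OF Im_z] by (metis Ints_minus minus_minus)
      have part: "((\<lambda>m. \<Sum>n\<in>{- int N..<int N}. h m n - h m (n + 1)) has_sum (\<Sum>n\<in>{- int N..<int N}. d n)) (UNIV - {0})"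
        by (intro has_sum_sum) (use d in auto)
      have eq: "(\<Sum>n\<in>{- int N..<int N}. h m n - h m (n + 1)) = - (1 / \<tau>) * (1 / (z + of_int m) + 1 / (z - of_int m))" for m
      proof -
        have tz: "\<tau> * z = of_nat N" using tau0 by (simp add: z_def)
        have 1: "of_int m * \<tau> + of_int (- int N) = - \<tau> * (z - of_int m)"
          by (simp add: right_diff_distrib tz mult.commute[of \<tau> "of_int m"])
        have 2: "of_int m * \<tau> + of_int (int N) = \<tau> * (z + of_int m)"
          by (simp add: distrib_left tz mult.commute[of \<tau> "of_int m"])
        have "h m (- int N) = - (1 / \<tau>) * (1 / (z - of_int m))" unfolding h_def 1 by simp
        moreover have "h m (int N) = (1 / \<tau>) * (1 / (z + of_int m))" unfolding h_def 2 by simp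
        ultimately show ?thesis unfolding telescoping_int_sum
          by (simp only: minus_mult_left [symmetric] distrib_left) simp
      qed
      let ?g = "\<lambda>m::int. 1 / (z + of_int m) + 1 / (z - of_int m)"
      have "(\<lambda>m. - \<tau> * (- (1 / \<tau>) * ?g m)) summable_on UNIV - {0}"
        using has_sum_imp_summable[OF part] unfolding eq by (rule summable_on_cmult_right)
      hence gs: "?g summable_on UNIV - {0}" using tau0 by (simp add: add.commute)
      hence "?g summable_on range (\<lambda>k::nat. int (Suc k))" by (rule summable_on_subset) auto
      hence "(\<lambda>k::nat. ?g (int (Suc k))) summable_on UNIV"
        by (subst (asm) summable_on_reindex) (auto simp: o_def inj_on_def)
      then obtain G where G: "((\<lambda>k::nat. ?g (int (Suc k))) has_sum G) UNIV" by (auto simp: summable_on_def)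
      have "(\<lambda>k. ?g (int (Suc k))) sums (of_real pi * cot (of_real pi * z) - 1 / z)"
        using cot_partial_fractions[OF zI] by simp
      hence G_eq: "G = of_real pi * cot (of_real pi * z) - 1 / z"
        using has_sum_imp_sums[OF G] sums_unique2 by blast
      have "((\<lambda>k::nat. ?g (int k)) has_sum G) (range Suc)"
        using G by (subst has_sum_reindex) (auto simp: o_def)
      moreover have "range Suc = {1..}" by (auto simp: image_iff Suc_le_eq gr0_conv_Suc)
      ultimately have "(?g has_sum 2 * G) (UNIV - {0})"
        by (intro has_sum_even_int) auto
      from has_sum_cmult_right[OF this, of "- (1 / \<tau>)"]
      have "(\<Sum>n\<in>{- int N..<int N}. d n) = - (1 / \<tau>) * (2 * G)"
        using part unfolding eq using has_sum_unique by blast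
      also have "of_real pi * cot (of_real pi * z) = - (of_real pi * cot (of_real pi * (- z)))"
        by (simp add: cot_minus)
      hence "G = - (of_real pi * \<i> - 2 * of_real pi * \<i> * (1 / (1 - nome \<tau>' ^ N))) - 1 / z"
        unfolding G_eq cot_nome[OF Im_z] power_sum_0[OF norm_nome_less_1[OF Im_z]] unfolding z' nome_of_nat_mult by simp
      finally show ?thesis using N by (simp add: z_def)
    qed
    \<comment> \<open>As N grows, N \<tau>' tends to the cusp and the cotangent to a nonzero
      constant. The summand \<open>1 / (of_nat N + 0)\<close> is written so as to match
      \<open>tendsto_inverse_shift\<close>.\<close>
    have lim: "(\<lambda>N. - (2 / \<tau>) * (- (of_real pi * \<i> - 2 * of_real pi * \<i> * (1 / (1 - nome \<tau>' ^ N))) - \<tau> * (1 / (of_nat N + 0))))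
        \<longlonglongrightarrow> - (2 / \<tau>) * (- (of_real pi * \<i> - 2 * of_real pi * \<i> * (1 / (1 - 0))) - \<tau> * 0)"
      by (intro tendsto_intros tendsto_inverse_shift LIMSEQ_power_zero norm_nome_less_1 tau') auto
    have "- (of_real pi * \<i> - 2 * of_real pi * \<i> * (1 / (1 - 0))) - \<tau> * 0 = of_real pi * \<i> - 0" by simp
    note lim' = lim[unfolded this]
    show ?thesis
      by (rule Lim_transform_eventually[OF lim' eventually_sequentiallyI[of 1]]) (rule val [symmetric])
  qed
  ultimately have "(of_real pi ^ 2 / 3 + 2 * C * L \<tau>') / \<tau> ^ 2 - of_real pi ^ 2 / 3 - S = - (2 / \<tau>) * (of_real pi * \<i> - 0)"
    by (rule LIMSEQ_unique)
  note * = this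
  have "s = a + 2 * p * \<i> / t" if "a - s = - (2 / t) * (p * \<i> - 0)" for a s p t :: complex
  proof -
    have "s = a - (a - s)" by simp
    also have "\<dots> = a - (- (2 / t) * (p * \<i> - 0))" by (simp only: that)
    finally show ?thesis by (simp add: mult.assoc)
  qed
  from this[OF *] show ?thesis unfolding S_eq \<tau>'_def .
qed

section \<open>The discriminant\<close>

text \<open>The sum of -log(1 - w^n) over n >= 1: the terms w^(n e)/e with n e = N collect to the
  sum of the divisors of N, divided by N.\<close>

definition log_euler :: "complex fps"
  where "log_euler = Abs_fps (\<lambda>N. of_nat (sig 1 N) / of_nat N)"

text \<open>\<open>euler w\<close> is the Euler product of all \<open>1 - w ^ n\<close> with \<open>n \<ge> 1\<close>, given through its logarithm.\<close>

definition euler :: "complex \<Rightarrow> complex"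
  where "euler w = exp (- eval_fps log_euler w)"

text \<open>The discriminant as a function of q, without the factor (2 pi)^12. Being w times a power
  of an exponential, it visibly vanishes only at 0.\<close>

definition Dq :: "complex \<Rightarrow> complex"
  where "Dq w = w * euler w ^ 24"

definition Delta :: "complex \<Rightarrow> complex"
  where "Delta \<tau> = Dq (nome \<tau>)"

lemma norm_less_conv_radius:
  assumes "norm (w :: complex) < 1" "fps_conv_radius F \<ge> 1"
  shows "ereal (norm w) < fps_conv_radius F"
  using assms(1) by (intro less_le_trans[OF _ assms(2)]) (simp add: one_ereal_def)

lemma log_euler_conv_radius: "fps_conv_radius log_euler \<ge> 1"
proof -
  have "summable (\<lambda>n. fps_nth log_euler n * of_real r ^ n)" if r: "0 < r" "ereal r < 1" for r
  proof (rule summable_comparison_test)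
    have "norm (complex_of_real r) < 1" using r by (simp add: one_ereal_def)
    thus "summable (\<lambda>n. norm (fps_nth (lamb 1) n * complex_of_real r ^ n))"
      by (intro abs_summable_in_conv_radius norm_less_conv_radius[unfolded fps_conv_radius_def]
          lamb_conv_radius[unfolded fps_conv_radius_def]) simp_all
    show "\<exists>N. \<forall>n\<ge>N. norm (fps_nth log_euler n * of_real r ^ n) \<le> norm (fps_nth (lamb 1) n * complex_of_real r ^ n)"
    proof (intro exI allI impI)
      fix n :: nat
      have "norm (fps_nth log_euler n) \<le> norm (fps_nth (lamb 1) n)"
      proof (cases "n = 0")
        case False
        hence "real (sig 1 n) / real n \<le> real (sig 1 n) / 1" by (intro divide_left_mono) auto
        thus ?thesis by (simp add: lamb_def log_euler_def norm_divide)
      qed (simp add: lamb_def log_euler_def)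
      thus "norm (fps_nth log_euler n * of_real r ^ n) \<le> norm (fps_nth (lamb 1) n * complex_of_real r ^ n)"
        unfolding norm_mult by (rule mult_right_mono) simp
    qed
  qed
  thus ?thesis unfolding fps_conv_radius_def by (rule conv_radius_geI_ex')
qed

lemma holomorphic_on_eval_fps_disc:
  assumes "fps_conv_radius F \<ge> 1"
  shows "eval_fps F holomorphic_on ball (0 :: complex) 1"
  by (intro holomorphic_on_eval_fps) (use norm_less_conv_radius[OF _ assms] in \<open>auto simp: in_eball_iff\<close>)

lemma log_euler_deriv: "w * eval_fps (fps_deriv log_euler) w = eval_fps (lamb 1) w" if "norm w < 1"
proof -
  have "fps_X * fps_deriv log_euler = lamb 1"
  proof (rule fps_ext)
    fix n show "fps_nth (fps_X * fps_deriv log_euler) n = fps_nth (lamb 1) n"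
      by (cases n) (auto simp: log_euler_def lamb_def simp del: of_nat_Suc)
  qed
  moreover have "fps_conv_radius (fps_deriv log_euler) \<ge> 1"
    using fps_conv_radius_deriv[of log_euler] log_euler_conv_radius by (rule order_trans[rotated])
  hence "eval_fps (fps_X * fps_deriv log_euler) w = w * eval_fps (fps_deriv log_euler) w"
    using norm_less_conv_radius[OF that] by (subst eval_fps_mult) auto
  ultimately show ?thesis by simp
qed

lemma euler_has_field_derivative:
  assumes "norm w < 1"
  shows "(euler has_field_derivative - eval_fps (fps_deriv log_euler) w * euler w) (at w)"
proof -
  have "ereal (norm w) < fps_conv_radius log_euler"
    by (rule norm_less_conv_radius[OF assms log_euler_conv_radius])
  thus ?thesis unfolding euler_def [abs_def] by (auto intro!: derivative_eq_intros)
qed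

lemma euler_nonzero [simp]: "euler w \<noteq> 0"
  by (simp add: euler_def)

lemma holomorphic_on_euler: "euler holomorphic_on ball 0 1"
  unfolding euler_def [abs_def] by (intro holomorphic_intros holomorphic_on_eval_fps_disc log_euler_conv_radius)

lemma holomorphic_on_Dq: "Dq holomorphic_on ball 0 1"
  unfolding Dq_def [abs_def] by (intro holomorphic_intros holomorphic_on_euler)

lemma Delta_nonzero [simp]: "Delta \<tau> \<noteq> 0"
  by (simp add: Delta_def Dq_def)

text \<open>The logarithmic derivative of the discriminant is the Eisenstein series of weight 2,
  here \<open>1 - 24 * eval_fps (lamb 1) w\<close>.\<close>

lemma Dq_has_field_derivative:
  assumes "norm w < 1"
  shows "\<exists>D. (Dq has_field_derivative D) (at w) \<and> w * D = (1 - 24 * eval_fps (lamb 1) w) * Dq w"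
proof (intro exI conjI)
  let ?e = "eval_fps (fps_deriv log_euler) w"
  show "(Dq has_field_derivative (euler w ^ 24 + w * (24 * (- ?e * euler w) * euler w ^ 23))) (at w)"
    unfolding Dq_def [abs_def]
    by (rule derivative_eq_intros euler_has_field_derivative assms refl)+ (simp add: mult_ac)
  have "w * (euler w ^ 24 + w * (24 * (- ?e * euler w) * euler w ^ 23)) =
      (1 - 24 * (w * ?e)) * (w * euler w ^ 24)"
    by (simp add: algebra_simps flip: power_Suc)
  also have "w * ?e = eval_fps (lamb 1) w" by (rule log_euler_deriv[OF assms])
  finally show "w * (euler w ^ 24 + w * (24 * (- ?e * euler w) * euler w ^ 23)) = (1 - 24 * eval_fps (lamb 1) w) * Dq w"
    by (simp add: Dq_def)
qed

lemma Delta_has_field_derivative: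
  assumes "Im \<tau> > 0"
  shows "(Delta has_field_derivative
     (2 * of_real pi * \<i> * (1 - 24 * eval_fps (lamb 1) (nome \<tau>)) * Delta \<tau>)) (at \<tau>)"
proof -
  obtain D where D: "(Dq has_field_derivative D) (at (nome \<tau>))"
    "nome \<tau> * D = (1 - 24 * eval_fps (lamb 1) (nome \<tau>)) * Dq (nome \<tau>)"
    using Dq_has_field_derivative[OF norm_nome_less_1[OF assms]] by blast
  have "((\<lambda>\<tau>. Dq (nome \<tau>)) has_field_derivative D * (2 * of_real pi * \<i> * nome \<tau> * 1)) (at \<tau>)"
    by (rule DERIV_chain2[where f = Dq and g = nome, OF D(1)]) (auto intro!: derivative_eq_intros)
  moreover have "D * (2 * of_real pi * \<i> * nome \<tau> * 1) = 2 * of_real pi * \<i> * (nome \<tau> * D)" by simp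
  ultimately show ?thesis by (simp only: D(2) Delta_def [abs_def] mult.assoc)
qed

lemma Im_minus_inverse:
  assumes "Im \<tau> > 0"
  shows "Im (- 1 / \<tau>) > 0"
proof -
  have "Im (- 1 / \<tau>) = Im \<tau> / (cmod \<tau>)\<^sup>2" by (simp add: Im_divide cmod_power2)
  moreover have "\<tau> \<noteq> 0" using assms by auto
  ultimately show ?thesis using assms by simp
qed

lemma Delta_plus_1: "Delta (\<tau> + of_int n) = Delta \<tau>"
  by (simp add: Delta_def nome_add)

text \<open>By the transformation law of weight 2 the quotient of the two sides has derivative 0 on
  the half plane; the fixed point i, where i^12 = 1, identifies the constant as 1.\<close>

lemma Delta_minus_inverse:
  assumes "Im \<tau> > 0"
  shows "Delta (- 1 / \<tau>) = \<tau> ^ 12 * Delta \<tau>"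
proof -
  define H where "H = {z. Im z > 0}"
  define g where "g = (\<lambda>\<tau>. Delta (- 1 / \<tau>) / (\<tau> ^ 12 * Delta \<tau>))"
  have "\<exists>c. \<forall>x\<in>H. g x = c"
  proof (rule has_field_derivative_zero_constant)
    show "convex H" unfolding H_def by (rule convex_halfspace_Im_gt)
  next
    fix x assume "x \<in> H"
    hence x: "Im x > 0" by (simp add: H_def)
    hence x0: "x \<noteq> 0" by auto
    define L1 L2 where "L1 = eval_fps (lamb 1) (nome (- 1 / x))" and "L2 = eval_fps (lamb 1) (nome x)"
    define e1 e2 where "e1 = 2 * of_real pi * \<i> * (1 - 24 * L1)" and "e2 = 2 * of_real pi * \<i> * (1 - 24 * L2)"
    have "((\<lambda>x. - 1 / x) has_field_derivative 1 / x ^ 2) (at x)"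
      using x0 by (auto intro!: derivative_eq_intros simp: power2_eq_square)
    from DERIV_chain2[where f = Delta and g = "\<lambda>x. - 1 / x", OF Delta_has_field_derivative[OF Im_minus_inverse[OF x]] this]
    have d1: "((\<lambda>x. Delta (- 1 / x)) has_field_derivative e1 * Delta (- 1 / x) * (1 / x ^ 2)) (at x)"
      by (simp add: e1_def L1_def)
    have d2: "(Delta has_field_derivative e2 * Delta x) (at x)"
      using Delta_has_field_derivative[OF x] by (simp add: e2_def L2_def)
    have d3: "((\<lambda>x. x ^ 12 * Delta x) has_field_derivative (of_nat 12 * x ^ 11 * Delta x + e2 * Delta x * x ^ 12)) (at x)"
      by (rule DERIV_cong[OF DERIV_mult[OF DERIV_power[OF DERIV_ident, of 12] d2]]) simp
    have nz: "x ^ 12 * Delta x \<noteq> 0" using x0 by simp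
    have key: "e1 * (1 / x ^ 2) = 12 / x + e2"
    proof -
      define c :: complex where "c = of_real pi"
      have c0: "c \<noteq> 0" by (simp add: c_def)
      have "2 * (2 * c * \<i>) ^ 2 * L2 = (c ^ 2 / 3 + 2 * (2 * c * \<i>) ^ 2 * L1) / x ^ 2 - c ^ 2 / 3 + 2 * c * \<i> / x"
        using weight2_transformation[OF x] by (simp add: L1_def L2_def c_def)
      hence "- 8 * c ^ 2 * L2 = (c ^ 2 / 3 - 8 * c ^ 2 * L1) * (1 / x ^ 2) - c ^ 2 / 3 + 2 * c * \<i> * (1 / x)"
        by (simp add: power_mult_distrib)
      \<comment> \<open>The factor 6 i turns the coefficients of \<open>L1\<close> and
        \<open>L2\<close> into those of \<open>c * e1\<close> and \<open>c * e2\<close>.\<close>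
      hence "(6 * \<i>) * (- 8 * c ^ 2 * L2) = (6 * \<i>) * ((c ^ 2 / 3 - 8 * c ^ 2 * L1) * (1 / x ^ 2) - c ^ 2 / 3 + 2 * c * \<i> * (1 / x))"
        by (rule arg_cong)
      hence "c * (2 * c * \<i> * (1 - 24 * L1) * (1 / x ^ 2)) = c * (12 * (1 / x) + 2 * c * \<i> * (1 - 24 * L2))"
        by (simp add: algebra_simps power2_eq_square)
      hence "2 * c * \<i> * (1 - 24 * L1) * (1 / x ^ 2) = 12 * (1 / x) + 2 * c * \<i> * (1 - 24 * L2)"
        by (simp only: mult_left_cancel[OF c0])
      thus ?thesis by (simp add: e1_def e2_def c_def)
    qed
    have "(g has_field_derivative ((e1 * Delta (- 1 / x) * (1 / x ^ 2)) * (x ^ 12 * Delta x) -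
        Delta (- 1 / x) * (of_nat 12 * x ^ 11 * Delta x + e2 * Delta x * x ^ 12)) / ((x ^ 12 * Delta x) * (x ^ 12 * Delta x))) (at x)"
      unfolding g_def by (rule DERIV_divide[OF d1 d3 nz])
    moreover have "(e1 * Delta (- 1 / x) * (1 / x ^ 2)) * (x ^ 12 * Delta x) -
        Delta (- 1 / x) * (of_nat 12 * x ^ 11 * Delta x + e2 * Delta x * x ^ 12) = 0"
    proof -
      have "(e1 * Delta (- 1 / x) * (1 / x ^ 2)) * (x ^ 12 * Delta x) -
        Delta (- 1 / x) * (of_nat 12 * x ^ 11 * Delta x + e2 * Delta x * x ^ 12) =
        Delta (- 1 / x) * Delta x * (x ^ 12 * (e1 * (1 / x ^ 2)) - (12 * x ^ 11 + e2 * x ^ 12))"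
        by (simp add: algebra_simps)
      also have "x ^ 12 * (e1 * (1 / x ^ 2)) = 12 * (x ^ 12 / x) + e2 * x ^ 12"
        unfolding key by (simp add: algebra_simps)
      also have "x ^ 12 / x = x ^ 11" using x0 by (simp add: eval_nat_numeral)
      finally show ?thesis by simp
    qed
    ultimately have "(g has_field_derivative 0) (at x)" by simp
    thus "(g has_field_derivative 0) (at x within H)" by (rule has_field_derivative_at_within)
  qed
  then obtain c where c: "\<And>x. x \<in> H \<Longrightarrow> g x = c" by blast
  have "\<i> ^ 12 = 1" by (simp add: eval_nat_numeral)
  moreover have "- 1 / \<i> = \<i>" by (simp add: complex_eq_iff Im_divide Re_divide)
  ultimately have "g \<i> = 1" unfolding g_def by simp
  moreover have "\<i> \<in> H" by (simp add: H_def)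
  ultimately have "g \<tau> = 1" using c assms by (metis H_def mem_Collect_eq)
  moreover have "\<tau> ^ 12 * Delta \<tau> \<noteq> 0" using assms by auto
  ultimately show ?thesis by (simp add: g_def)
qed

section \<open>The modular group\<close>

lemma moebius_denominator_nonzero:
  fixes a b c d :: int
  assumes "a * d - b * c = 1" "Im z > 0"
  shows "of_int c * z + of_int d \<noteq> 0"
proof (cases "c = 0")
  case True
  with assms(1) have "d \<noteq> 0" by auto
  thus ?thesis using True by simp
next
  case False
  thus ?thesis using int_translate_nonzero[OF assms(2)] by blast
qed

lemma Im_moebius:
  fixes a b c d :: int
  assumes "a * d - b * c = 1" "Im z > 0"
  shows "Im ((of_int a * z + of_int b) / (of_int c * z + of_int d)) = Im z / (cmod (of_int c * z + of_int d))\<^sup>2"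
proof -
  have "Im ((of_int a * z + of_int b) / (of_int c * z + of_int d)) =
     (of_int (a * d - b * c) * Im z) / (cmod (of_int c * z + of_int d))\<^sup>2"
    by (simp add: Im_divide cmod_power2) (simp add: algebra_simps)
  thus ?thesis using assms(1) by simp
qed

lemma Im_moebius_pos:
  fixes a b c d :: int
  assumes "a * d - b * c = 1" "Im z > 0"
  shows "Im ((of_int a * z + of_int b) / (of_int c * z + of_int d)) > 0"
  unfolding Im_moebius[OF assms] using assms moebius_denominator_nonzero[OF assms] by simp

text \<open>Euclidean algorithm on the lower row (c, d): a translation replaces d by d mod c and the
  inversion exchanges the two entries, so |c| decreases. At c = 0 the matrix is plus or minus a
  translation, where even k absorbs the sign.\<close>

lemma modular_generators:
  fixes F :: "complex \<Rightarrow> complex" and a b c d :: int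
  assumes T: "\<And>z n. Im z > 0 \<Longrightarrow> F (z + of_int n) = F z"
    and S: "\<And>z. Im z > 0 \<Longrightarrow> F (- 1 / z) = z ^ k * F z" and k: "even k"
    and det: "a * d - b * c = 1" and z: "Im z > 0"
  shows "F ((of_int a * z + of_int b) / (of_int c * z + of_int d)) = (of_int c * z + of_int d) ^ k * F z"
  using det z
proof (induction "nat \<bar>c\<bar>" arbitrary: a b c d z rule: less_induct)
  case less
  show ?case
  proof (cases "c = 0")
    case True
    hence "a * d = 1" using less.prems by simp
    hence ad: "(a = 1 \<and> d = 1) \<or> (a = -1 \<and> d = -1)" by (simp add: zmult_eq_1_iff)
    hence "(of_int a * z + of_int b) / (of_int c * z + of_int d) = z + of_int (b * d)"
      using True by auto
    moreover have "(of_int c * z + of_int d) ^ k = 1" using True ad k by auto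
    ultimately show ?thesis using T[OF less.prems(2), of "b * d"] by (simp only: mult_1_left)
  next
    case False
    define q where "q = d div c"
    define d' b' where "d' = d - c * q" and "b' = b - a * q"
    define w where "w = z + of_int q"
    have w: "Im w > 0" using less.prems by (simp add: w_def)
    hence w0: "w \<noteq> 0" by auto
    have d'_eq: "d' = d mod c" by (simp add: d'_def q_def minus_mult_div_eq_mod)
    have "\<bar>d'\<bar> < \<bar>c\<bar>" unfolding d'_eq using False by (rule abs_mod_less)
    hence lt: "nat \<bar>d'\<bar> < nat \<bar>c\<bar>" using False by simp
    \<comment> \<open>The matrix with rows (b', -a) and (d', -c), evaluated at -1/w, gives the same
      value as the original one at z; its lower left entry is the smaller d'.\<close>
    have det': "b' * (- c) - (- a) * d' = 1" using less.prems(1) by (simp add: b'_def d'_def algebra_simps)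
    have num: "of_int a * z + of_int b = of_int a * w + of_int b'" by (simp add: w_def b'_def algebra_simps)
    have den: "of_int c * z + of_int d = of_int c * w + of_int d'" by (simp add: w_def d'_def algebra_simps)
    have e1: "of_int b' * (- 1 / w) + of_int (- a) = - (of_int a * w + of_int b') * (1 / w)"
      using w0 by (simp add: diff_divide_distrib algebra_simps)
    have e2: "of_int d' * (- 1 / w) + of_int (- c) = - (of_int c * w + of_int d') * (1 / w)"
      using w0 by (simp add: diff_divide_distrib algebra_simps)
    have "F ((of_int a * w + of_int b') / (of_int c * w + of_int d')) =
        F ((of_int b' * (- 1 / w) + of_int (- a)) / (of_int d' * (- 1 / w) + of_int (- c)))"
    proof -
      have "(- x * (1 / w)) / (- y * (1 / w)) = x / y" for x y using w0 by simp
      thus ?thesis unfolding e1 e2 by (simp only:)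
    qed
    also have "\<dots> = (of_int d' * (- 1 / w) + of_int (- c)) ^ k * F (- 1 / w)"
      by (rule less.hyps[OF lt det' Im_minus_inverse[OF w]])
    also have "\<dots> = (- (of_int c * w + of_int d') * (1 / w)) ^ k * (w ^ k * F w)"
      unfolding e2 S[OF w] ..
    also have "\<dots> = (- (of_int c * w + of_int d')) ^ k * (1 / w * w) ^ k * F w"
      by (simp only: power_mult_distrib mult_ac)
    also have "\<dots> = (of_int c * w + of_int d') ^ k * F w"
      using w0 k by (simp only: power_minus_even) simp
    also have "F w = F z" unfolding w_def by (rule T[OF less.prems(2)])
    finally show ?thesis unfolding num den .
  qed
qed

section \<open>Fundamental domain and maximum principle\<close>

text \<open>Minimising |c z + d| over coprime pairs maximises the imaginary part in the orbit.
  Translation then makes the real part small, and minimality forces |w| >= 1. The bound 1/2 is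
  weaker than the optimal one and suffices.\<close>

lemma fundamental_domain:
  assumes z: "Im z > 0"
  obtains a b c d :: int and w where "a * d - b * c = 1"
    "w = (of_int a * z + of_int b) / (of_int c * z + of_int d)" "\<bar>Re w\<bar> \<le> 1 / 2" "cmod w \<ge> 1" "Im w > 1 / 2"
proof -
  obtain c0 where c0: "c0 > 0" "\<And>x y :: real. c0 * (\<bar>x\<bar> + \<bar>y\<bar>) \<le> cmod (of_real x * z + of_real y)"
    using lattice_norm_lower_bound[OF z] by blast
  define M where "M = \<lceil>1 / c0\<rceil>"
  have M0: "M \<ge> 0" "real_of_int M \<ge> 1 / c0"
  proof -
    have "1 / c0 > 0" using c0 by simp
    thus "M \<ge> 0" "real_of_int M \<ge> 1 / c0" unfolding M_def by linarith+
  qed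
  define N where "N = (\<lambda>(c::int, d::int). cmod (of_int c * z + of_int d))"
  define B where "B = {x \<in> {- M - 1..M + 1} \<times> {- M - 1..M + 1}. coprime (fst x) (snd x)}"
  have finB: "finite B" by (simp add: B_def)
  have inB: "(0, 1) \<in> B" using M0 by (simp add: B_def)
  obtain x where x: "x \<in> B" "\<And>y. y \<in> B \<Longrightarrow> N x \<le> N y"
    using ex_min_if_finite[of "N ` B"] finB inB
    by (metis (no_types, lifting) arg_min_if_finite(1) arg_min_least empty_iff)
  obtain c d where cd: "x = (c, d)" by force
  \<comment> \<open>Outside the finite box \<open>B\<close> the norm is at least 1, the value at the
    pair (0, 1) inside it, so a minimum over \<open>B\<close> is a global one.\<close>
  have min: "N (c, d) \<le> N (c', d')" if "coprime c' d'" for c' d'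
  proof (cases "(c', d') \<in> B")
    case True
    thus ?thesis using x cd by blast
  next
    case False
    hence "M + 1 \<le> \<bar>c'\<bar> + \<bar>d'\<bar>" using that M0 by (auto simp: B_def)
    hence "real_of_int (M + 1) \<le> real_of_int (\<bar>c'\<bar> + \<bar>d'\<bar>)" by (simp only: of_int_le_iff)
    hence "1 / c0 \<le> \<bar>real_of_int c'\<bar> + \<bar>real_of_int d'\<bar>" using M0 by simp
    hence "1 \<le> c0 * (\<bar>real_of_int c'\<bar> + \<bar>real_of_int d'\<bar>)" using c0(1) by (simp add: divide_le_eq mult.commute)
    also have "\<dots> \<le> N (c', d')" using c0(2)[of c' d'] by (simp add: N_def)
    finally have "1 \<le> N (c', d')" .
    moreover have "N (c, d) \<le> N (0, 1)" using x inB cd by blast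
    hence "N (c, d) \<le> 1" by (simp add: N_def)
    ultimately show ?thesis by linarith
  qed
  have "coprime d c" using x(1) cd by (auto simp: B_def coprime_commute)
  then obtain a0 b0 where "a0 * d + b0 * c = 1"
    using bezout_int[of d c] by (auto simp: coprime_iff_gcd_eq_1)
  hence ab0: "a0 * d - (- b0) * c = 1" by simp
  define w0 where "w0 = (of_int a0 * z + of_int (- b0)) / (of_int c * z + of_int d)"
  define n where "n = round (Re w0)"
  define a b where "a = a0 - n * c" and "b = - b0 - n * d"
  have det: "a * d - b * c = 1" using ab0 by (simp add: a_def b_def algebra_simps)
  have den: "of_int c * z + of_int d \<noteq> 0" by (rule moebius_denominator_nonzero[OF det z])
  define w where "w = (of_int a * z + of_int b) / (of_int c * z + of_int d)"
  have "w = w0 - of_int n"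
  proof -
    have "of_int a * z + of_int b = (of_int a0 * z + of_int (- b0)) - of_int n * (of_int c * z + of_int d)"
      by (simp add: a_def b_def algebra_simps)
    thus ?thesis using den by (simp add: w_def w0_def diff_divide_distrib)
  qed
  hence re: "\<bar>Re w\<bar> \<le> 1 / 2" using of_int_round_abs_le[of "Re w0"] by (simp add: n_def abs_minus_commute)
  have "coprime a b"
  proof (rule coprimeI)
    fix e assume "e dvd a" "e dvd b"
    hence "e dvd a * d - b * c" by (intro dvd_diff dvd_mult2)
    thus "is_unit e" unfolding det .
  qed
  \<comment> \<open>The upper row is itself a coprime pair and hence a competitor for the
    minimum.\<close>
  from min[OF this] have "cmod (of_int c * z + of_int d) \<le> cmod (of_int a * z + of_int b)" by (simp add: N_def)
  hence norm_w: "cmod w \<ge> 1" using den by (simp add: w_def norm_divide)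
  have Im_w: "Im w > 0" unfolding w_def by (rule Im_moebius_pos[OF det z])
  have "1 \<le> (cmod w)\<^sup>2" using norm_w by (simp add: power2_eq_square) (metis mult_mono' norm_ge_zero mult_1 zero_le_one)
  also have "\<dots> = \<bar>Re w\<bar>\<^sup>2 + (Im w)\<^sup>2" by (simp add: cmod_power2)
  also have "\<dots> \<le> (1 / 2)\<^sup>2 + (Im w)\<^sup>2" using re by (intro add_right_mono power_mono) auto
  finally have im2: "(Im w)\<^sup>2 > (1 / 2)\<^sup>2" by (simp add: power2_eq_square)
  have im: "Im w > 1 / 2" using im2 Im_w by (meson less_imp_le power_less_imp_less_base)
  show thesis using that[OF det w_def re norm_w im] .
qed

lemma tendsto_at_cusp:
  assumes "(u \<longlongrightarrow> L) (at 0)" "e > 0"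
  shows "\<exists>Y. \<forall>z. Im z > Y \<longrightarrow> norm (u (nome z) - L) < e"
proof -
  from assms obtain \<delta> where \<delta>: "\<delta> > 0" "\<And>w. w \<noteq> 0 \<Longrightarrow> norm w < \<delta> \<Longrightarrow> norm (u w - L) < e"
    unfolding LIM_eq by force
  show ?thesis
  proof (intro exI allI impI)
    fix z assume z: "Im z > - ln \<delta> / (2 * pi)"
    hence "- ln \<delta> < Im z * (2 * pi)" by (subst (asm) pos_divide_less_eq) auto
    hence "- 2 * pi * Im z < ln \<delta>" by (simp add: mult.commute)
    hence "exp (- 2 * pi * Im z) < \<delta>" using \<delta>(1) by (metis exp_less_cancel_iff exp_ln)
    hence "norm (nome z) < \<delta>" by (simp add: norm_nome)
    thus "norm (u (nome z) - L) < e" using \<delta>(2) by simp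
  qed
qed

lemma open_connected_upper_half_plane: "open {z. Im z > 0}" "connected {z. Im z > 0}"
  by (auto intro: open_halfspace_Im_gt convex_connected convex_halfspace_Im_gt)

lemma compact_box: "compact {z. \<bar>Re z\<bar> \<le> 1 / 2 \<and> 1 / 2 \<le> Im z \<and> Im z \<le> Y}"
proof -
  have "{z. \<bar>Re z\<bar> \<le> 1 / 2 \<and> 1 / 2 \<le> Im z \<and> Im z \<le> Y} = cbox (Complex (-1/2) (1/2)) (Complex (1/2) Y)"
    by (auto simp: in_cbox_complex_iff abs_le_iff)
  thus ?thesis by simp
qed

text \<open>If h differs from its value L at the cusp somewhere, then |h - L| attains its supremum
  in the compact part of the fundamental domain. It would then be constant, contradicting its decay
  at the cusp.\<close>

lemma modular_maximum_principle:
  fixes h :: "complex \<Rightarrow> complex"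
  assumes hol: "h holomorphic_on {z. Im z > 0}"
    and T: "\<And>z n. Im z > 0 \<Longrightarrow> h (z + of_int n) = h z"
    and S: "\<And>z. Im z > 0 \<Longrightarrow> h (- 1 / z) = h z"
    and lim: "\<And>e. e > 0 \<Longrightarrow> \<exists>Y. \<forall>z. Im z > Y \<longrightarrow> norm (h z - L) < e"
    and z: "Im z > 0"
  shows "h z = L"
proof (rule ccontr)
  assume neq: "h z \<noteq> L"
  define k where "k = (\<lambda>z. h z - L)"
  have hol_k: "k holomorphic_on {z. Im z > 0}" unfolding k_def by (intro holomorphic_intros hol)
  define e where "e = norm (k z)"
  have e: "e > 0" using neq by (simp add: e_def k_def)
  obtain Y where Y: "\<And>z. Im z > Y \<Longrightarrow> norm (k z) < e" using lim[OF e] by (auto simp: k_def)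
  define C where "C = {z. \<bar>Re z\<bar> \<le> 1 / 2 \<and> 1 / 2 \<le> Im z \<and> Im z \<le> Y}"
  have C: "compact C" "C \<subseteq> {z. Im z > 0}" unfolding C_def by (rule compact_box) auto
  have rep: "\<exists>w. Im w > 1 / 2 \<and> \<bar>Re w\<bar> \<le> 1 / 2 \<and> k w = k z" if Im_z: "Im z > 0" for z
  proof -
    obtain a b c d :: int and w where *: "a * d - b * c = 1"
      "w = (of_int a * z + of_int b) / (of_int c * z + of_int d)" "\<bar>Re w\<bar> \<le> 1 / 2" "cmod w \<ge> 1" "Im w > 1 / 2"
      by (rule fundamental_domain[OF Im_z])
    have "h w = (of_int c * z + of_int d) ^ 0 * h z"
      unfolding *(2) by (rule modular_generators[OF T _ _ *(1) Im_z]) (use S in auto)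
    thus ?thesis using * by (auto simp: k_def)
  qed
  obtain w0 where w0: "Im w0 > 1 / 2" "\<bar>Re w0\<bar> \<le> 1 / 2" "k w0 = k z" using rep[OF z] by blast
  have "\<not> Im w0 > Y" using w0 Y[of w0] by (auto simp: e_def)
  hence "w0 \<in> C" using w0 by (simp add: C_def)
  have "continuous_on C (\<lambda>z. norm (k z))"
    using holomorphic_on_imp_continuous_on[OF hol_k] C(2) by (intro continuous_intros) (rule continuous_on_subset)
  with \<open>w0 \<in> C\<close> obtain z1 where z1: "z1 \<in> C" "\<And>y. y \<in> C \<Longrightarrow> norm (k y) \<le> norm (k z1)"
    using continuous_attains_sup[OF C(1), of "\<lambda>z. norm (k z)"] by blast
  have e_le: "e \<le> norm (k z1)" using z1(2)[OF \<open>w0 \<in> C\<close>] w0 by (simp add: e_def)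
  have max: "norm (k y) \<le> norm (k z1)" if "Im y > 0" for y
  proof -
    obtain w where w: "Im w > 1 / 2" "\<bar>Re w\<bar> \<le> 1 / 2" "k w = k y" using rep[OF \<open>Im y > 0\<close>] by blast
    show ?thesis
    proof (cases "Im w > Y")
      case True
      thus ?thesis using Y[OF True] w e_le by simp
    next
      case False
      hence "w \<in> C" using w by (simp add: C_def)
      thus ?thesis using z1(2) w by metis
    qed
  qed
  have z1H: "Im z1 > 0" using z1 C by auto
  have "k constant_on {z. Im z > 0}"
    by (rule maximum_modulus_principle[OF hol_k open_connected_upper_half_plane open_connected_upper_half_plane(1), of z1])
       (use z1H max in auto)
  then obtain c where c: "\<And>x. Im x > 0 \<Longrightarrow> k x = c" unfolding constant_on_def by auto
  define y where "y = Complex 0 (max Y 0 + 1)"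
  have "Im y > Y" "Im y > 0" by (auto simp: y_def)
  hence "norm c < e" using Y[of y] c[of y] by simp
  moreover have "norm c \<ge> e" using e_le c[OF z1H] by simp
  ultimately show False by simp
qed

section \<open>Level one: Eisenstein series, discriminant and the modular invariant\<close>

lemma eisenstein_sum_minus_inverse:
  assumes "Im \<tau> > 0" "even k"
  shows "eisenstein_sum k (- 1 / \<tau>) = \<tau> ^ k * eisenstein_sum k \<tau>"
proof -
  have t0: "\<tau> \<noteq> 0" using assms by auto
  have "eisenstein_sum k (- 1 / \<tau>) =
      (\<Sum>\<^sub>\<infinity>(m, n)\<in>UNIV - {(0, 0)}. \<tau> ^ k * (1 / (of_int m * \<tau> + of_int n) ^ k))"
    unfolding eisenstein_sum_def
  proof (rule infsum_reindex_bij_witness[where j = "\<lambda>(m, n). (n, - m)" and i = "\<lambda>(m, n). (- n, m)"])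
    fix x :: "int \<times> int"
    obtain m n where x: "x = (m, n)" by force
    have e: "of_int m * (- 1 / \<tau>) + of_int n = (of_int n * \<tau> + of_int (- m)) * (1 / \<tau>)"
      using t0 by (simp add: diff_divide_distrib)
    show "(case case x of (m, n) \<Rightarrow> (n, - m) of (m, n) \<Rightarrow> \<tau> ^ k * (1 / (of_int m * \<tau> + of_int n) ^ k)) =
          (case x of (m, n) \<Rightarrow> 1 / (of_int m * (- 1 / \<tau>) + of_int n) ^ k)"
      unfolding x prod.case e power_mult_distrib using t0 by (simp add: power_divide)
  qed auto
  also have "\<dots> = \<tau> ^ k * eisenstein_sum k \<tau>"
    unfolding eisenstein_sum_def infsum_cmult_right' [symmetric] by (simp add: case_prod_unfold)
  finally show ?thesis .
qed

lemma E4_minus_inverse: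
  assumes "Im \<tau> > 0"
  shows "E4q (nome (- 1 / \<tau>)) = \<tau> ^ 4 * E4q (nome \<tau>)"
proof -
  define c :: complex where "c = of_real pi ^ 4 / 45"
  have c: "c \<noteq> 0" by (simp add: c_def)
  have "c * E4q (nome (- 1 / \<tau>)) = c * (\<tau> ^ 4 * E4q (nome \<tau>))"
    using eisenstein_sum_minus_inverse[OF assms, of 4]
    unfolding eisenstein_sum_4[OF assms] eisenstein_sum_4[OF Im_minus_inverse[OF assms]]
    by (simp add: c_def mult_ac)
  thus ?thesis using c by simp
qed

lemma E6_minus_inverse:
  assumes "Im \<tau> > 0"
  shows "E6q (nome (- 1 / \<tau>)) = \<tau> ^ 6 * E6q (nome \<tau>)"
proof -
  define c :: complex where "c = 2 * of_real pi ^ 6 / 945"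
  have c: "c \<noteq> 0" by (simp add: c_def)
  have "c * E6q (nome (- 1 / \<tau>)) = c * (\<tau> ^ 6 * E6q (nome \<tau>))"
    using eisenstein_sum_minus_inverse[OF assms, of 6]
    unfolding eisenstein_sum_6[OF assms] eisenstein_sum_6[OF Im_minus_inverse[OF assms]]
    by (simp add: c_def mult_ac)
  thus ?thesis using c by simp
qed

lemma nome_plus_int [simp]: "nome (z + of_int n) = nome z"
  by (simp add: nome_add)

lemma holomorphic_E4q: "E4q holomorphic_on ball 0 1"
  unfolding E4q_def [abs_def] by (intro holomorphic_intros holomorphic_on_eval_fps_disc lamb_conv_radius) auto

lemma holomorphic_E6q: "E6q holomorphic_on ball 0 1"
  unfolding E6q_def [abs_def] by (intro holomorphic_intros holomorphic_on_eval_fps_disc lamb_conv_radius) auto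

lemma holomorphic_compose_nome:
  assumes "f holomorphic_on ball 0 1"
  shows "(\<lambda>z. f (nome z)) holomorphic_on {z. Im z > 0}"
proof -
  have "(f \<circ> nome) holomorphic_on {z. Im z > 0}"
    by (rule holomorphic_on_compose_gen[OF _ assms]) (auto intro!: holomorphic_intros norm_nome_less_1)
  thus ?thesis by (simp add: o_def)
qed

lemma holomorphic_Delta: "Delta holomorphic_on {z. Im z > 0}"
  unfolding Delta_def [abs_def] by (rule holomorphic_compose_nome[OF holomorphic_on_Dq])

lemma eval_lamb_at_0 [simp]: "eval_fps (lamb k) 0 = 0"
  by (simp add: eval_fps_at_0 lamb_def)

lemma E4q_0 [simp]: "E4q 0 = 1" and E6q_0 [simp]: "E6q 0 = 1"
  by (simp_all add: E4q_def E6q_def)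

lemma euler_0 [simp]: "euler 0 = 1"
  by (simp add: euler_def eval_fps_at_0 log_euler_def)

lemma lamb_has_derivative_0:
  assumes "k \<ge> 1"
  shows "(eval_fps (lamb k) has_field_derivative 1) (at 0)"
proof -
  have "(eval_fps (lamb k) has_field_derivative eval_fps (fps_deriv (lamb k)) 0) (at 0)"
    by (rule has_field_derivative_eval_fps) (rule norm_less_conv_radius, use lamb_conv_radius[OF assms] in auto)
  thus ?thesis by (simp add: eval_fps_at_0 lamb_def)
qed

text \<open>Both sides transform with weight 12 and \<open>Delta\<close> has no zeros, so their
  quotient is a holomorphic modular function that is finite at the cusp, hence constant.\<close>

lemma discriminant_eq:
  assumes "Im \<tau> > 0"
  shows "E4q (nome \<tau>) ^ 3 - E6q (nome \<tau>) ^ 2 = 1728 * Delta \<tau>"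
proof -
  define N where "N = (\<lambda>w. E4q w ^ 3 - E6q w ^ 2)"
  define h where "h = (\<lambda>\<tau>. N (nome \<tau>) / Delta \<tau>)"
  have hol_N: "N holomorphic_on ball 0 1"
    unfolding N_def by (intro holomorphic_intros holomorphic_E4q holomorphic_E6q)
  have "h \<tau> = 1728"
  proof (rule modular_maximum_principle[OF _ _ _ _ assms])
    show "h holomorphic_on {z. Im z > 0}"
      unfolding h_def by (intro holomorphic_intros holomorphic_compose_nome hol_N holomorphic_Delta) auto
    show "h (z + of_int n) = h z" for z n by (simp add: h_def Delta_plus_1)
    show "h (- 1 / z) = h z" if "Im z > 0" for z
    proof -
      have "N (nome (- 1 / z)) = z ^ 12 * N (nome z)"
        unfolding N_def E4_minus_inverse[OF that] E6_minus_inverse[OF that]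
        by (simp add: power_mult_distrib right_diff_distrib flip: power_mult)
      hence "h (- 1 / z) = z ^ 12 * N (nome z) / (z ^ 12 * Delta z)"
        unfolding h_def Delta_minus_inverse[OF that] by (simp only:)
      moreover have "z ^ 12 \<noteq> 0" using that by auto
      ultimately show ?thesis by (simp add: h_def)
    qed
    fix e :: real assume e: "e > 0"
    have d4: "(E4q has_field_derivative 240) (at 0)"
      unfolding E4q_def [abs_def]
      using DERIV_add[OF DERIV_const[of 1] DERIV_cmult[OF lamb_has_derivative_0[of 3], of 240]] by simp
    have d6: "(E6q has_field_derivative - 504) (at 0)"
      unfolding E6q_def [abs_def]
      using DERIV_diff[OF DERIV_const[of 1] DERIV_cmult[OF lamb_has_derivative_0[of 5], of 504]] by simp
    \<comment> \<open>3 * 240 + 2 * 504 = 1728.\<close>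
    have "(N has_field_derivative 1728) (at 0)"
      unfolding N_def using DERIV_diff[OF DERIV_power[OF d4, of 3] DERIV_power[OF d6, of 2]] by simp
    hence 1: "((\<lambda>w. N w / w) \<longlongrightarrow> 1728) (at 0)"
      unfolding has_field_derivative_iff by (simp add: N_def)
    have "isCont euler 0"
      using holomorphic_on_imp_continuous_on[OF holomorphic_on_euler] by (simp add: continuous_on_eq_continuous_at)
    hence 2: "(euler \<longlongrightarrow> 1) (at 0)" by (simp add: isCont_def)
    have "((\<lambda>w. (N w / w) / euler w ^ 24) \<longlongrightarrow> 1728 / 1 ^ 24) (at 0)"
      by (intro tendsto_intros 1 2) auto
    hence "((\<lambda>w. N w / Dq w) \<longlongrightarrow> 1728) (at 0)" by (simp add: Dq_def)
    from tendsto_at_cusp[OF this e] show "\<exists>Y. \<forall>z. Y < Im z \<longrightarrow> norm (h z - 1728) < e"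
      by (simp add: h_def Delta_def)
  qed
  thus ?thesis by (simp add: h_def N_def divide_eq_eq)
qed

lemma klein_j_eq:
  assumes "Im \<tau> > 0"
  shows "klein_j \<tau> = E4q (nome \<tau>) ^ 3 / Delta \<tau>"
proof -
  \<comment> \<open>The common value of (4 pi^4 / 3)^3 and 27 (8 pi^6 / 27)^2, the scalings of g2^3
    and 27 g3^2.\<close>
  define C :: complex where "C = 64 * of_real pi ^ 12 / 27"
  have C: "C \<noteq> 0" by (simp add: C_def)
  define E4 E6 where "E4 = E4q (nome \<tau>)" and "E6 = E6q (nome \<tau>)"
  have g2: "(60 * eisenstein_sum 4 \<tau>) ^ 3 = C * E4 ^ 3"
  proof -
    have "60 * eisenstein_sum 4 \<tau> = 4 / 3 * (of_real pi ^ 4 * E4)"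
      unfolding eisenstein_sum_4[OF assms] E4_def by simp
    thus ?thesis by (simp only: power_mult_distrib) (simp add: C_def power_divide flip: power_mult)
  qed
  have g3: "27 * (140 * eisenstein_sum 6 \<tau>) ^ 2 = C * E6 ^ 2"
  proof -
    have "140 * eisenstein_sum 6 \<tau> = 8 / 27 * (of_real pi ^ 6 * E6)"
      unfolding eisenstein_sum_6[OF assms] E6_def by simp
    thus ?thesis by (simp only: power_mult_distrib) (simp add: C_def power_divide flip: power_mult)
  qed
  have D: "E4 ^ 3 - E6 ^ 2 = 1728 * Delta \<tau>" using discriminant_eq[OF assms] by (simp add: E4_def E6_def)
  have "klein_j \<tau> = 1728 * (C * E4 ^ 3) / (C * E4 ^ 3 - C * E6 ^ 2)"
    unfolding klein_j_def Let_def g2 [symmetric] g3 [symmetric] ..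
  also have "C * E4 ^ 3 - C * E6 ^ 2 = C * (1728 * Delta \<tau>)" unfolding D [symmetric] by (simp add: right_diff_distrib)
  also have "1728 * (C * E4 ^ 3) / (C * (1728 * Delta \<tau>)) = E4 ^ 3 / Delta \<tau>" using C by simp
  finally show ?thesis by (simp add: E4_def)
qed

lemma holomorphic_klein_j: "klein_j holomorphic_on {z. Im z > 0}"
proof -
  have "(\<lambda>\<tau>. E4q (nome \<tau>) ^ 3 / Delta \<tau>) holomorphic_on {z. Im z > 0}"
    by (intro holomorphic_intros holomorphic_compose_nome holomorphic_E4q holomorphic_Delta) auto
  thus ?thesis by (rule holomorphic_transform) (simp add: klein_j_eq)
qed

lemma klein_j_plus_int: "Im \<tau> > 0 \<Longrightarrow> klein_j (\<tau> + of_int n) = klein_j \<tau>"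
  by (simp add: klein_j_eq Delta_plus_1)

lemma klein_j_minus_inverse:
  assumes "Im \<tau> > 0"
  shows "klein_j (- 1 / \<tau>) = klein_j \<tau>"
proof -
  have "\<tau> ^ 12 \<noteq> 0" using assms by auto
  thus ?thesis
    unfolding klein_j_eq[OF assms] klein_j_eq[OF Im_minus_inverse[OF assms]] E4_minus_inverse[OF assms]
      Delta_minus_inverse[OF assms] by (simp add: power_mult_distrib flip: power_mult)
qed

lemma klein_j_moebius:
  fixes a b c d :: int
  assumes "a * d - b * c = 1" "Im z > 0"
  shows "klein_j ((of_int a * z + of_int b) / (of_int c * z + of_int d)) = klein_j z"
  using modular_generators[of klein_j 0, OF klein_j_plus_int _ _ assms] klein_j_minus_inverse by simp

text \<open>Near the cusp 1/j = q \<open>euler\<close>(q)^24 / \<open>E4q\<close>(q)^3 tends to 0;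
  keeping \<open>E4q\<close> within 1 of the value 1 makes this quotient meaningful.\<close>

lemma klein_j_large: "\<exists>Y. \<forall>z. Im z > Y \<and> Im z > 0 \<longrightarrow> cmod (klein_j z) > B"
proof -
  have "isCont E4q 0" "isCont euler 0"
    using holomorphic_on_imp_continuous_on[OF holomorphic_on_euler] holomorphic_on_imp_continuous_on[OF holomorphic_E4q]
    by (simp_all add: continuous_on_eq_continuous_at)
  hence lim: "(E4q \<longlongrightarrow> 1) (at 0)" "(euler \<longlongrightarrow> 1) (at 0)" by (simp_all add: isCont_def)
  have "((\<lambda>w. w * euler w ^ 24 / E4q w ^ 3) \<longlongrightarrow> 0 * 1 ^ 24 / 1 ^ 3) (at 0)"
    by (intro tendsto_intros lim) auto
  hence l0: "((\<lambda>w. w * euler w ^ 24 / E4q w ^ 3) \<longlongrightarrow> 0) (at 0)" by simp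
  define b where "b = \<bar>B\<bar> + 1"
  have b: "b > 0" "b > B" by (auto simp: b_def)
  obtain Y1 where Y1: "\<And>z. Im z > Y1 \<Longrightarrow> norm (nome z * euler (nome z) ^ 24 / E4q (nome z) ^ 3 - 0) < 1 / b"
    using tendsto_at_cusp[OF l0, of "1 / b"] b by auto
  obtain Y2 where Y2: "\<And>z. Im z > Y2 \<Longrightarrow> norm (E4q (nome z) - 1) < 1"
    using tendsto_at_cusp[OF lim(1), of 1] by auto
  have "cmod (klein_j z) > B" if z: "Im z > max Y1 Y2" "Im z > 0" for z
  proof -
    have E: "E4q (nome z) \<noteq> 0" using Y2[of z] z by auto
    define x where "x = klein_j z"
    have x: "x \<noteq> 0" "nome z * euler (nome z) ^ 24 / E4q (nome z) ^ 3 = 1 / x"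
      using E by (simp_all add: x_def klein_j_eq[OF z(2)] Delta_def Dq_def)
    have "norm (1 / x) < 1 / b" using Y1[of z] z x by simp
    hence "1 / norm x < 1 / b" by (simp add: norm_divide)
    hence "b < norm x" using x(1) b(1) by (simp add: divide_less_eq less_divide_eq)
    thus ?thesis using b by (simp add: x_def)
  qed
  thus ?thesis by (intro exI[of _ "max Y1 Y2"]) auto
qed

text \<open>The image is open by the open mapping theorem. It is closed because bounded values are
  taken at bounded height in the fundamental domain, hence on a compact box. The plane being
  connected, it is everything.\<close>

lemma klein_j_surj: "\<exists>\<tau>. Im \<tau> > 0 \<and> klein_j \<tau> = x"
proof -
  define J where "J = klein_j ` {z. Im z > 0}"
  have rep: "\<exists>w. Im w > 1 / 2 \<and> \<bar>Re w\<bar> \<le> 1 / 2 \<and> klein_j w = klein_j z" if Im_z: "Im z > 0" for z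
  proof -
    obtain a b c d :: int and w where *: "a * d - b * c = 1"
      "w = (of_int a * z + of_int b) / (of_int c * z + of_int d)" "\<bar>Re w\<bar> \<le> 1 / 2" "cmod w \<ge> 1" "Im w > 1 / 2"
      by (rule fundamental_domain[OF Im_z])
    thus ?thesis using klein_j_moebius[OF *(1) Im_z] by blast
  qed
  have i: "Im \<i> > 0" by simp
  have "open J"
    unfolding J_def
  proof (rule open_mapping_thm[OF holomorphic_klein_j open_connected_upper_half_plane open_connected_upper_half_plane(1)])
    show "\<not> klein_j constant_on {z. Im z > 0}"
    proof
      assume "klein_j constant_on {z. Im z > 0}"
      then obtain c where c: "\<And>x. Im x > 0 \<Longrightarrow> klein_j x = c" unfolding constant_on_def by auto
      obtain Y where Y: "\<And>z. Im z > Y \<Longrightarrow> Im z > 0 \<Longrightarrow> cmod (klein_j z) > cmod c"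
        using klein_j_large[of "cmod c"] by blast
      have "max Y 0 + 1 > Y" "max Y 0 + 1 > 0" by linarith+
      thus False using Y[of "Complex 0 (max Y 0 + 1)"] c[of "Complex 0 (max Y 0 + 1)"] by simp
    qed
  qed simp
  moreover have "closed J"
  proof -
    have "l \<in> J" if l: "l \<in> closure J" for l
    proof -
      obtain Y where Y: "\<And>z. Im z > Y \<Longrightarrow> Im z > 0 \<Longrightarrow> cmod (klein_j z) > cmod l + 1"
        using klein_j_large[of "cmod l + 1"] by blast
      define C where "C = {z. \<bar>Re z\<bar> \<le> 1 / 2 \<and> 1 / 2 \<le> Im z \<and> Im z \<le> Y}"
      have C: "compact C" "C \<subseteq> {z. Im z > 0}" unfolding C_def by (rule compact_box) auto
      have "compact (klein_j ` C)"
        by (intro compact_continuous_image C continuous_on_subset[OF holomorphic_on_imp_continuous_on[OF holomorphic_klein_j] C(2)])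
      hence "closed (klein_j ` C)" by (rule compact_imp_closed)
      moreover have "l \<in> closure (klein_j ` C)"
        unfolding closure_approachable
      proof (intro allI impI)
        fix e :: real assume "e > 0"
        then obtain y where y: "y \<in> J" "dist y l < min e 1" using l unfolding closure_approachable by (meson min_less_iff_conj zero_less_one)
        then obtain z where z: "Im z > 0" "klein_j z = y" by (auto simp: J_def)
        obtain w where w: "Im w > 1 / 2" "\<bar>Re w\<bar> \<le> 1 / 2" "klein_j w = y" using rep[OF z(1)] z by auto
        have "cmod y \<le> cmod l + dist y l" by (metis dist_norm norm_triangle_sub)
        hence "cmod (klein_j w) \<le> cmod l + 1" using y w by simp
        hence "Im w \<le> Y" using Y[of w] w by (meson less_trans not_less zero_less_divide_1_iff zero_less_numeral)
        hence "w \<in> C" using w by (simp add: C_def)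
        thus "\<exists>y\<in>klein_j ` C. dist y l < e" using w y by auto
      qed
      ultimately show ?thesis using C by (auto simp: J_def closure_closed)
    qed
    thus ?thesis using closure_subset_eq by blast
  qed
  moreover have "J \<noteq> {}" using i unfolding J_def by blast
  ultimately have "J = UNIV" using clopen[of J] by blast
  hence "x \<in> J" by simp
  thus ?thesis unfolding J_def by blast
qed

section \<open>Automorphisms of the cyclotomic field\<close>

lemma complex_ring_simps [simp]:
  "carrier \<C> = UNIV" "x \<otimes>\<^bsub>\<C>\<^esub> y = x * y" "x \<oplus>\<^bsub>\<C>\<^esub> y = x + y" "\<one>\<^bsub>\<C>\<^esub> = 1" "\<zero>\<^bsub>\<C>\<^esub> = 0"
  by (simp_all add: ring_of_type_algebra_def)

lemma complex_ring_field: "field \<C>" by (rule field_from_type_algebra)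

lemma complex_m_inv: "x \<noteq> 0 \<Longrightarrow> inv\<^bsub>\<C>\<^esub> x = inverse x"
proof -
  assume x: "x \<noteq> 0"
  interpret C: field \<C> by (rule complex_ring_field)
  show ?thesis by (rule C.inv_char) (use x in auto)
qed

lemma complex_a_inv: "\<ominus>\<^bsub>\<C>\<^esub> x = - x"
proof -
  interpret C: field \<C> by (rule complex_ring_field)
  show ?thesis by (rule C.minus_equality) auto
qed

lemma subring_complexI:
  assumes "1 \<in> A" "\<And>x. x \<in> A \<Longrightarrow> - x \<in> A" "\<And>x y. x \<in> A \<Longrightarrow> y \<in> A \<Longrightarrow> x + y \<in> A" "\<And>x y. x \<in> A \<Longrightarrow> y \<in> A \<Longrightarrow> x * y \<in> A"
  shows "subring A \<C>"
proof -
  interpret C: field \<C> by (rule complex_ring_field)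
  show ?thesis by (rule C.subringI) (use assms complex_a_inv in auto)
qed

lemma subfield_complexI:
  assumes "1 \<in> A" "\<And>x. x \<in> A \<Longrightarrow> - x \<in> A" "\<And>x y. x \<in> A \<Longrightarrow> y \<in> A \<Longrightarrow> x + y \<in> A" "\<And>x y. x \<in> A \<Longrightarrow> y \<in> A \<Longrightarrow> x * y \<in> A"
    "\<And>x. x \<in> A \<Longrightarrow> x \<noteq> 0 \<Longrightarrow> inverse x \<in> A"
  shows "subfield A \<C>"
proof -
  interpret C: field \<C> by (rule complex_ring_field)
  show ?thesis
    by (rule C.subfieldI'[OF subring_complexI[OF assms(1-4)]]) (use assms(5) complex_m_inv in auto)
qed

lemma subfield_Rats: "subfield \<rat> \<C>"
  by (rule subfield_complexI) auto

lemma line_extension_complex: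
  "ring.line_extension \<C> \<rat> v E = {q * v + e | q e. q \<in> \<rat> \<and> e \<in> E}"
proof -
  interpret C: field \<C> by (rule complex_ring_field)
  show ?thesis unfolding C.line_extension_def r_coset_def set_add_def' by auto
qed

definition rat_eval :: "rat poly \<Rightarrow> complex \<Rightarrow> complex"
  where "rat_eval r z = poly (map_poly of_rat r) z"

lemma rat_eval_add: "rat_eval (r + s) z = rat_eval r z + rat_eval s z"
proof -
  have "map_poly of_rat (r + s) = (map_poly of_rat r + map_poly of_rat s :: complex poly)"
    by (intro poly_eqI) (simp add: coeff_map_poly of_rat_add)
  thus ?thesis by (simp add: rat_eval_def)
qed

lemma rat_eval_mult: "rat_eval (r * s) z = rat_eval r z * rat_eval s z"
proof -
  have "map_poly of_rat (r * s) = (map_poly of_rat r * map_poly of_rat s :: complex poly)"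
    by (intro poly_eqI) (simp add: coeff_map_poly coeff_mult of_rat_sum of_rat_mult)
  thus ?thesis by (simp add: rat_eval_def)
qed

lemma rat_eval_pCons: "rat_eval (pCons c r) z = of_rat c + z * rat_eval r z"
  by (simp add: rat_eval_def map_poly_pCons)

lemma rat_eval_0 [simp]: "rat_eval 0 z = 0" and rat_eval_1 [simp]: "rat_eval 1 z = 1"
  by (simp_all add: rat_eval_def one_pCons map_poly_pCons)

lemma rat_eval_smult: "rat_eval (smult c r) z = of_rat c * rat_eval r z"
  using rat_eval_mult[of "[:c:]" r z] by (simp add: rat_eval_pCons)

lemma rat_eval_pcompose: "rat_eval (pcompose r s) z = rat_eval r (rat_eval s z)"
  by (induction r) (simp_all add: pcompose_pCons rat_eval_add rat_eval_mult rat_eval_pCons)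

lemma pcompose_X_power: "pcompose ([:0, 1:] ^ n) q = (q :: 'a :: comm_ring_1 poly) ^ n"
  by (induction n) (simp_all add: pcompose_mult pcompose_pCons pcompose_1)

lemma rat_eval_minus: "rat_eval (- r) z = - rat_eval r z"
  using rat_eval_smult[of "-1" r z] by simp

lemma rat_eval_diff: "rat_eval (r - s) z = rat_eval r z - rat_eval s z"
  using rat_eval_add[of r "- s" z] by (simp add: rat_eval_minus)

lemma rat_eval_X_power: "rat_eval ([:0, 1:] ^ k) z = z ^ k"
  by (induction k) (simp_all add: rat_eval_mult rat_eval_pCons)

section \<open>The cyclotomic field of prime level\<close>

locale cyclotomic =
  fixes p :: nat
  assumes prime_p: "prime p"
begin

abbreviation "\<zeta> \<equiv> root_unity p"

lemma p_pos: "p > 0" and p_gt_1: "p > 1"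
  using prime_ge_2_nat[OF prime_p] by auto

lemma zeta_power_eq: "\<zeta> ^ k = exp (2 * of_real pi * \<i> * of_nat k / of_nat p)"
  unfolding root_unity_def exp_of_nat_mult [symmetric] by (simp add: mult_ac)

lemma zeta_power_p: "\<zeta> ^ p = 1"
  unfolding zeta_power_eq using p_pos by simp

lemma zeta_nonzero: "\<zeta> \<noteq> 0"
  by (simp add: root_unity_def)

lemma zeta_power_eq_1_iff: "\<zeta> ^ k = 1 \<longleftrightarrow> p dvd k"
proof
  assume "\<zeta> ^ k = 1"
  then obtain n :: int where n: "2 * pi * real k / real p = real_of_int (2 * n) * pi"
    unfolding zeta_power_eq exp_eq_1 by auto
  hence "(2 * pi) * (real k / real p) = (2 * pi) * real_of_int n" by (simp add: mult_ac)
  hence "real k / real p = real_of_int n" by (subst (asm) mult_left_cancel) auto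
  hence "real k = real_of_int n * real p" using p_pos by (simp add: divide_eq_eq)
  hence "real_of_int (int k) = real_of_int (n * int p)" by simp
  hence "int k = n * int p" by (simp only: of_int_eq_iff)
  hence "int p dvd int k" by simp
  thus "p dvd k" by simp
next
  assume "p dvd k"
  then obtain j where "k = p * j" by blast
  thus "\<zeta> ^ k = 1" by (simp add: power_mult zeta_power_p)
qed

definition Phi :: "int poly"
  where "Phi = (\<Sum>i<p. [:0, 1:] ^ i)"

lemma Phi_mult: "[:-1, 1:] * Phi = [:0, 1:] ^ p - 1"
proof -
  have "[:0, 1:] ^ p - 1 = ([:0, 1:] - 1) * (\<Sum>i<p. ([:0, 1:] :: int poly) ^ i)"
    by (rule power_diff_1_eq)
  moreover have "[:0, 1:] - 1 = [:-1, 1 :: int:]" by (simp add: one_pCons)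
  ultimately show ?thesis by (simp add: Phi_def)
qed

lemma coeff_X_power: "coeff ([:0, 1 :: 'a :: comm_ring_1:] ^ i) j = (if i = j then 1 else 0)"
  by (simp add: coeff_monom flip: monom_altdef[of "1 :: 'a", simplified])

lemma coeff_Phi: "coeff Phi j = (if j < p then 1 else 0)"
  by (simp add: Phi_def coeff_sum coeff_X_power)

lemma degree_Phi: "degree Phi = p - 1" and lead_coeff_Phi: "lead_coeff Phi = 1"
proof -
  show d: "degree Phi = p - 1"
  proof (rule antisym)
    show "degree Phi \<le> p - 1" by (rule degree_le) (use p_pos in \<open>auto simp: coeff_Phi\<close>)
    show "p - 1 \<le> degree Phi" by (rule le_degree) (use p_pos in \<open>simp add: coeff_Phi\<close>)
  qed
  show "lead_coeff Phi = 1" unfolding d using p_pos by (simp add: coeff_Phi)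
qed

text \<open>The shift by 1 brings the cyclotomic polynomial into Eisenstein form: its coefficients
  are binomial coefficients, divisible by p below the leading one.\<close>

definition Phi1 :: "int poly"
  where "Phi1 = pcompose Phi [:1, 1:]"

lemma coeff_Phi1: "coeff Phi1 i = int (p choose Suc i)"
proof -
  have "pcompose ([:-1, 1:] * Phi) [:1, 1:] = pcompose ([:0, 1:] ^ p - 1) [:1, 1 :: int:]"
    by (simp only: Phi_mult)
  hence "[:0, 1:] * Phi1 = [:1, 1:] ^ p - 1"
    by (simp add: pcompose_mult pcompose_diff pcompose_pCons pcompose_X_power pcompose_1 Phi1_def)
  hence "coeff ([:0, 1:] * Phi1) (Suc i) = coeff ([:1, 1 :: int:] ^ p - 1) (Suc i)" by simp
  thus ?thesis
  proof (cases "Suc i \<le> p")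
    case True
    thus ?thesis using \<open>coeff ([:0, 1:] * Phi1) (Suc i) = _\<close> by (simp add: coeff_linear_poly_power)
  next
    case False
    have "degree ([:1, 1 :: int:] ^ p) \<le> p" using degree_power_le[of "[:1, 1 :: int:]" p] by simp
    hence "coeff ([:1, 1 :: int:] ^ p) (Suc i) = 0" using False by (intro coeff_eq_0) simp
    thus ?thesis using False \<open>coeff ([:0, 1:] * Phi1) (Suc i) = _\<close> by (simp add: binomial_eq_0)
  qed
qed

text \<open>Eisenstein's argument. If the constant term of the shifted first factor is prime to p,
  then p divides successively all coefficients of the shifted second factor below degree p - 1; a
  smaller degree would include its leading coefficient, which is a unit.\<close>

lemma Phi_factor_degree:
  assumes AB: "Phi = A * B" and A: "\<not> int p dvd poly A 1"
  shows "degree B \<ge> p - 1"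
proof (rule ccontr)
  assume "\<not> degree B \<ge> p - 1"
  hence deg: "degree B < p - 1" by simp
  define A1 B1 where "A1 = pcompose A [:1, 1:]" and "B1 = pcompose B [:1, 1:]"
  have A1B1: "Phi1 = A1 * B1" by (simp add: Phi1_def AB A1_def B1_def pcompose_mult)
  have A10: "coeff A1 0 = poly A 1" by (simp add: A1_def flip: poly_0_coeff_0) (simp add: poly_pcompose)
  have dvd: "int p dvd coeff B1 i" if "i < p - 1" for i
    using that
  proof (induction i rule: less_induct)
    case (less i)
    have "prime (int p)" using prime_p by simp
    have "int p dvd coeff Phi1 i"
      unfolding coeff_Phi1 using less.prems prime_p p_pos by (auto intro!: dvd_choose_prime)
    also have "coeff Phi1 i = (\<Sum>j\<le>i. coeff B1 j * coeff A1 (i - j))"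
      unfolding A1B1 mult.commute[of A1] coeff_mult ..
    also have "\<dots> = coeff B1 i * coeff A1 0 + (\<Sum>j<i. coeff B1 j * coeff A1 (i - j))"
      by (simp add: lessThan_Suc_atMost [symmetric])
    finally have "int p dvd coeff B1 i * coeff A1 0 + (\<Sum>j<i. coeff B1 j * coeff A1 (i - j))" .
    moreover have "int p dvd (\<Sum>j<i. coeff B1 j * coeff A1 (i - j))"
      by (intro dvd_sum dvd_mult2 less.IH) (use less.prems in auto)
    ultimately have "int p dvd coeff B1 i * coeff A1 0" by (simp add: dvd_add_left_iff)
    thus ?case using A A10 \<open>prime (int p)\<close> by (simp add: prime_dvd_mult_iff)
  qed
  have degB1: "degree B1 = degree B" by (simp add: B1_def degree_pcompose)
  have "lead_coeff A * lead_coeff B = 1" using lead_coeff_Phi unfolding AB by (simp add: lead_coeff_mult)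
  hence "lead_coeff B dvd 1" by (metis dvd_triv_right)
  moreover have "lead_coeff B1 = lead_coeff B" by (simp add: B1_def lead_coeff_comp)
  moreover have "int p dvd lead_coeff B1" using dvd[of "degree B1"] deg degB1 by simp
  ultimately have "int p dvd 1" by (metis dvd_trans)
  thus False using p_gt_1 by simp
qed

definition QPhi :: "rat poly"
  where "QPhi = map_poly of_int Phi"

lemma degree_QPhi: "degree QPhi = p - 1"
  unfolding QPhi_def by (subst degree_map_poly) (auto simp: degree_Phi)

lemma QPhi_root:
  assumes "z ^ p = 1" "z \<noteq> 1"
  shows "rat_eval QPhi z = 0"
proof -
  have "map_poly of_rat QPhi = (\<Sum>i<p. [:0, 1 :: complex:] ^ i)"
    by (intro poly_eqI) (simp add: QPhi_def coeff_map_poly coeff_Phi coeff_sum coeff_X_power)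
  hence "rat_eval QPhi z = (\<Sum>i<p. z ^ i)" by (simp add: rat_eval_def poly_sum)
  moreover have "z ^ p - 1 = (z - 1) * (\<Sum>i<p. z ^ i)" by (rule power_diff_1_eq)
  ultimately show ?thesis using assms by simp
qed

text \<open>A rational polynomial of least degree with root \<zeta> divides the cyclotomic
  polynomial, and by Gauss's lemma the factorisation can be made integral. The values of the factors
  at 1 multiply to p, so one of them is prime to p and the other factor has full degree.\<close>

lemma zeta_root_degree:
  assumes "rat_eval r \<zeta> = 0" "r \<noteq> 0"
  shows "degree r \<ge> p - 1"
proof -
  define P where "P = (\<lambda>n. \<exists>r. r \<noteq> 0 \<and> rat_eval r \<zeta> = 0 \<and> degree r = n)"
  have ex: "P (degree r)" using assms by (auto simp: P_def)
  define n where "n = (LEAST n. P n)"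
  have "P n" unfolding n_def by (rule LeastI[of P, OF ex])
  then obtain m where m: "m \<noteq> 0" "rat_eval m \<zeta> = 0" "degree m = n" by (auto simp: P_def)
  have least: "degree s \<ge> n" if "s \<noteq> 0" "rat_eval s \<zeta> = 0" for s
    unfolding n_def by (rule Least_le) (use that in \<open>auto simp: P_def\<close>)
  have n0: "n > 0"
  proof (rule ccontr)
    assume "\<not> n > 0"
    hence "degree m = 0" using m by simp
    then obtain c where "m = [:c:]" by (rule degree_eq_zeroE)
    thus False using m by (simp add: rat_eval_pCons)
  qed
  have z1: "\<zeta> \<noteq> 1" using zeta_power_eq_1_iff[of 1] p_gt_1 by auto
  have dvd: "m dvd QPhi"
  proof -
    have "rat_eval (QPhi div m * m + QPhi mod m) \<zeta> = 0"
      using QPhi_root[OF zeta_power_p z1] by simp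
    hence "rat_eval (QPhi mod m) \<zeta> = 0" using m by (simp only: rat_eval_add rat_eval_mult) simp
    hence "QPhi mod m = 0" using least[of "QPhi mod m"] degree_mod_less'[OF m(1), of QPhi] m(3) by (meson not_less)
    thus ?thesis by (simp add: dvd_eq_mod_eq_0)
  qed
  then obtain q where q: "QPhi = m * q" by blast
  \<comment> \<open>Common denominators, found one coefficient at a time.\<close>
  have clear: "\<exists>c m'. c \<noteq> (0::int) \<and> map_poly rat_of_int m' = smult (of_int c) m" for m :: "rat poly"
  proof (induction m)
    case 0
    show ?case by (intro exI[of _ 1] exI[of _ 0]) auto
  next
    case (pCons a m)
    then obtain c m' where c: "c \<noteq> 0" "map_poly rat_of_int m' = smult (of_int c) m" by blast
    obtain u v :: int where uv: "a = of_int u / of_int v" "v > 0" using quotient_of_div surjective_pairing quotient_of_denom_pos by metis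
    have "map_poly rat_of_int (pCons (u * c) (smult v m')) = smult (of_int (c * v)) (pCons a m)"
    proof -
      have "map_poly rat_of_int (smult v m') = smult (of_int v) (map_poly rat_of_int m')"
        by (intro poly_eqI) (simp add: coeff_map_poly)
      thus ?thesis using c uv by (simp add: map_poly_pCons mult_ac)
    qed
    thus ?case using c(1) uv(2) by (intro exI[of _ "c * v"] exI[of _ "pCons (u * c) (smult v m')"]) auto
  qed
  obtain c1 m1 c2 q1 where c: "c1 \<noteq> 0" "map_poly rat_of_int m1 = smult (of_int c1) m"
    "c2 \<noteq> 0" "map_poly rat_of_int q1 = smult (of_int c2) q" using clear by metis
  have deg_m1: "degree m1 = n"
  proof -
    have "degree (map_poly rat_of_int m1) = degree m1" by (rule degree_map_poly) simp
    thus ?thesis using c m by simp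
  qed
  have "map_poly rat_of_int (smult (c1 * c2) Phi) = smult (of_int (c1 * c2)) (m * q)"
    unfolding q [symmetric] QPhi_def by (intro poly_eqI) (simp add: coeff_map_poly)
  also have "\<dots> = map_poly rat_of_int m1 * map_poly rat_of_int q1" unfolding c by (simp add: mult_ac)
  also have "\<dots> = map_poly rat_of_int (m1 * q1)" by (intro poly_eqI) (simp add: coeff_map_poly coeff_mult)
  finally have "map_poly rat_of_int (smult (c1 * c2) Phi) = map_poly rat_of_int (m1 * q1)" .
  hence "coeff (map_poly rat_of_int (smult (c1 * c2) Phi)) i = coeff (map_poly rat_of_int (m1 * q1)) i" for i by simp
  hence eq: "smult (c1 * c2) Phi = m1 * q1" by (intro poly_eqI) (simp add: coeff_map_poly flip: of_int_mult)
  have m1: "m1 \<noteq> 0" using deg_m1 n0 by auto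
  define a where "a = primitive_part m1"
  have ca: "content a = 1" using m1 by (simp add: a_def)
  have dega: "degree a = n" by (simp add: a_def deg_m1)
  define b where "b = smult (content m1) q1"
  have "m1 = smult (content m1) a" by (simp add: a_def)
  hence eq': "smult (c1 * c2) Phi = a * b" unfolding eq b_def by (metis mult_smult_left mult_smult_right)
  have e0: "c1 * c2 \<noteq> 0" using c by simp
  have "content Phi dvd lead_coeff Phi" by (rule content_dvd_coeff)
  hence cPhi: "content Phi = 1" using lead_coeff_Phi by (metis is_unit_normalize normalize_content)
  have "content (smult (c1 * c2) Phi) = content (a * b)" using eq' by simp
  hence cb: "content b = \<bar>c1 * c2\<bar>" using ca cPhi by (simp add: content_mult)
  \<comment> \<open>Contents are nonnegative, so the sign of c1 * c2 is moved into the second factor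
    through s = 1 or -1.\<close>
  obtain s where s: "c1 * c2 * s = \<bar>c1 * c2\<bar>" "s * s = 1" 
    by (cases "c1 * c2 > 0") (auto intro: that[of 1] that[of "-1"])
  define b' where "b' = smult s (primitive_part b)"
  have "b = smult \<bar>c1 * c2\<bar> (primitive_part b)" unfolding cb [symmetric] by simp
  hence "b = smult (c1 * c2) b'" unfolding s(1) [symmetric] b'_def by (simp add: mult.assoc)
  hence eq'': "smult (c1 * c2) Phi = smult (c1 * c2) (a * b')" using eq' by simp
  have fac: "Phi = a * b'"
  proof (rule poly_eqI)
    fix i
    have "c1 * c2 * coeff Phi i = c1 * c2 * coeff (a * b') i"
      using arg_cong[OF eq'', of "\<lambda>r. coeff r i"] by (simp only: coeff_smult)
    thus "coeff Phi i = coeff (a * b') i" using e0 by simp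
  qed
  have nz: "a \<noteq> 0" "b' \<noteq> 0" using fac lead_coeff_Phi by auto
  have "degree a + degree b' = p - 1" using degree_Phi fac nz by (simp add: degree_mult_eq)
  moreover have "poly a 1 * poly b' 1 = int p"
  proof -
    have "poly Phi 1 = int p" by (simp add: Phi_def poly_sum)
    thus ?thesis unfolding fac by simp
  qed
  hence "\<not> int p dvd poly a 1 \<or> \<not> int p dvd poly b' 1"
  proof -
    assume ab: "poly a 1 * poly b' 1 = int p"
    have "\<not> int p * int p dvd int p" using p_gt_1 by (metis dvd_mult_cancel_left dvd_refl mult_1_right not_prime_unit of_nat_0_less_iff p_pos prime_p int_dvd_int_iff of_nat_mult nat_dvd_1_iff_1 less_irrefl dvd_times_right_cancel_iff mult.commute of_nat_1 less_numeral_extra(3))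
    thus ?thesis using ab mult_dvd_mono by metis
  qed
  ultimately have "n \<ge> p - 1"
    using Phi_factor_degree[OF fac] Phi_factor_degree[of b' a] fac n0 dega by (auto simp: mult.commute)
  thus ?thesis using least[OF assms(2,1)] by linarith
qed

lemma QPhi_dvd:
  assumes "rat_eval r \<zeta> = 0"
  shows "QPhi dvd r"
proof -
  have z1: "\<zeta> \<noteq> 1" using zeta_power_eq_1_iff[of 1] p_gt_1 by auto
  have Q0: "QPhi \<noteq> 0" using degree_QPhi p_gt_1 by auto
  have "rat_eval (r div QPhi * QPhi + r mod QPhi) \<zeta> = 0" using assms by simp
  hence "rat_eval (r mod QPhi) \<zeta> = 0"
    using QPhi_root[OF zeta_power_p z1] by (simp only: rat_eval_add rat_eval_mult) simp
  hence "r mod QPhi = 0"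
    using zeta_root_degree[of "r mod QPhi"] degree_mod_less'[OF Q0, of r] unfolding degree_QPhi by (meson not_less)
  thus ?thesis by (simp add: dvd_eq_mod_eq_0)
qed

text \<open>The cyclotomic polynomial divides r, and \<zeta>^k is another of its roots. This makes
  the substitution of \<zeta>^k for \<zeta> well defined on the field.\<close>

lemma rat_eval_conj:
  assumes "rat_eval r \<zeta> = 0" "\<not> p dvd k"
  shows "rat_eval r (\<zeta> ^ k) = 0"
proof -
  obtain s where "r = QPhi * s" using QPhi_dvd[OF assms(1)] by blast
  moreover have "(\<zeta> ^ k) ^ p = 1" by (metis mult.commute power_mult power_one zeta_power_p)
  hence "rat_eval QPhi (\<zeta> ^ k) = 0" using zeta_power_eq_1_iff[of k] assms(2) by (intro QPhi_root) auto
  ultimately show ?thesis by (simp add: rat_eval_mult)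
qed

definition QZ :: "complex set" where "QZ = range (\<lambda>r. rat_eval r \<zeta>)"

text \<open>Euclidean descent: the remainder of the cyclotomic polynomial modulo a representative s
  is, at \<zeta>, a multiple of the value of s, and it has smaller degree, so its inverse is
  available by induction.\<close>

lemma QZ_inverse: "rat_eval r \<zeta> \<noteq> 0 \<Longrightarrow> inverse (rat_eval r \<zeta>) \<in> QZ"
proof (induction "degree (r mod QPhi)" arbitrary: r rule: less_induct)
  case less
  have z1: "\<zeta> \<noteq> 1" using zeta_power_eq_1_iff[of 1] p_gt_1 by auto
  have root: "rat_eval QPhi \<zeta> = 0" by (rule QPhi_root[OF zeta_power_p z1])
  have Q0: "QPhi \<noteq> 0" using degree_QPhi p_gt_1 by auto
  define s where "s = r mod QPhi"
  have "rat_eval r \<zeta> = rat_eval (r div QPhi * QPhi + s) \<zeta>" by (simp add: s_def)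
  hence rs: "rat_eval r \<zeta> = rat_eval s \<zeta>" using root by (simp only: rat_eval_add rat_eval_mult) simp
  have s0: "s \<noteq> 0" using less.prems rs by auto
  have degs: "degree s < p - 1" using degree_mod_less'[OF Q0, of r] s0 degree_QPhi by (simp add: s_def)
  show ?case
  proof (cases "degree s = 0")
    case True
    then obtain c where c: "s = [:c:]" by (rule degree_eq_zeroE)
    have "inverse (rat_eval r \<zeta>) = rat_eval [:inverse c:] \<zeta>" unfolding rs c by (simp add: rat_eval_pCons of_rat_inverse)
    thus ?thesis by (auto simp: QZ_def)
  next
    case False
    define t where "t = QPhi mod s"
    have "rat_eval (QPhi div s * s + t) \<zeta> = 0" using root by (simp add: t_def)
    hence t_eq: "rat_eval t \<zeta> = - (rat_eval (QPhi div s) \<zeta> * rat_eval s \<zeta>)"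
      by (simp add: rat_eval_add rat_eval_mult add_eq_0_iff)
    have t0: "rat_eval t \<zeta> \<noteq> 0"
    proof
      assume t: "rat_eval t \<zeta> = 0"
      have "t = 0"
      proof (rule ccontr)
        assume "t \<noteq> 0"
        hence "degree t < degree s" using degree_mod_less'[OF s0, of QPhi] by (simp add: t_def)
        thus False using zeta_root_degree[OF t \<open>t \<noteq> 0\<close>] degs by simp
      qed
      hence "QPhi = QPhi div s * s" unfolding t_def by (metis add.right_neutral div_mult_mod_eq)
      moreover have "rat_eval (QPhi div s) \<zeta> = 0" using t t_eq less.prems rs by simp
      moreover have "QPhi div s \<noteq> 0" using \<open>QPhi = QPhi div s * s\<close> Q0 by (metis mult_zero_left)
      ultimately have "degree (QPhi div s) \<ge> p - 1" "degree QPhi = degree (QPhi div s) + degree s"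
        using zeta_root_degree s0 by (auto simp: degree_mult_eq dest: arg_cong[of _ _ degree])
      thus False using degree_QPhi False by simp
    qed
    have "t \<noteq> 0" using t0 by auto
    hence lt: "degree t < degree s" using degree_mod_less'[OF s0, of QPhi] by (simp add: t_def)
    have "t mod QPhi = t" by (rule mod_poly_less) (use lt degs degree_QPhi in simp)
    hence "degree (t mod QPhi) < degree (r mod QPhi)" using lt by (simp add: s_def)
    from less.hyps[OF this t0] obtain u where u: "inverse (rat_eval t \<zeta>) = rat_eval u \<zeta>" by (auto simp: QZ_def)
    have "rat_eval (QPhi div s) \<zeta> \<noteq> 0" using t0 t_eq by auto
    hence "inverse (rat_eval r \<zeta>) = - rat_eval (QPhi div s) \<zeta> * inverse (rat_eval t \<zeta>)"
      unfolding t_eq rs by simp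
    also have "\<dots> = rat_eval (smult (- 1) (QPhi div s) * u) \<zeta>" unfolding u by (simp add: rat_eval_mult rat_eval_smult rat_eval_minus)
    finally show ?thesis by (auto simp: QZ_def)
  qed
qed

lemma cyclotomic_field_eq: "cyclotomic_field p = QZ"
proof (intro equalityI)
  interpret C: field \<C> by (rule complex_ring_field)
  have "subfield QZ \<C>"
  proof (rule subfield_complexI)
    show "1 \<in> QZ" unfolding QZ_def by (rule range_eqI[of _ _ 1]) simp
    show "- x \<in> QZ" if x: "x \<in> QZ" for x
    proof -
      obtain r where "x = rat_eval r \<zeta>" using x by (auto simp: QZ_def)
      hence "- x = rat_eval (smult (-1) r) \<zeta>" by (simp add: rat_eval_smult rat_eval_minus)
      thus ?thesis by (auto simp: QZ_def)
    qed
    fix x assume "x \<in> QZ"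
    then obtain r where r: "x = rat_eval r \<zeta>" by (auto simp: QZ_def)
    show "inverse x \<in> QZ" if "x \<noteq> 0" using QZ_inverse r that by simp
    fix y assume "y \<in> QZ"
    then obtain s where s: "y = rat_eval s \<zeta>" by (auto simp: QZ_def)
    have "x + y = rat_eval (r + s) \<zeta>" "x * y = rat_eval (r * s) \<zeta>" by (simp_all add: r s rat_eval_add rat_eval_mult)
    thus "x + y \<in> QZ" "x * y \<in> QZ" unfolding QZ_def by blast+
  qed
  moreover have "\<zeta> \<in> QZ" unfolding QZ_def by (rule range_eqI[of _ _ "[:0, 1:]"]) (simp add: rat_eval_pCons)
  ultimately show "cyclotomic_field p \<subseteq> QZ"
    unfolding cyclotomic_field_def by (intro C.generate_field_min_subfield1) auto
  let ?G = "generate_field \<C> {\<zeta>}"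
  have one: "1 \<in> ?G" using generate_field.one[of \<C> "{\<zeta>}"] by simp
  have add: "x + y \<in> ?G" if "x \<in> ?G" "y \<in> ?G" for x y using generate_field.eng_add[OF that] by simp
  have mult: "x * y \<in> ?G" if "x \<in> ?G" "y \<in> ?G" for x y using generate_field.eng_mult[OF that] by simp
  have neg: "- x \<in> ?G" if "x \<in> ?G" for x using generate_field.a_inv[OF that] by (simp add: complex_a_inv)
  have zero: "0 \<in> ?G" using add[OF one neg[OF one]] by simp
  have nat: "of_nat n \<in> ?G" for n by (induction n) (use zero one add in auto)
  have int: "of_int n \<in> ?G" for n by (cases n rule: int_cases2) (use nat neg in auto)
  have rat: "of_rat q \<in> ?G" for q
  proof -
    obtain u v :: int where uv: "q = of_int u / of_int v" "v > 0" using quotient_of_div surjective_pairing quotient_of_denom_pos by metis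
    have "inv\<^bsub>\<C>\<^esub> (of_int v) \<in> ?G" by (rule generate_field.m_inv[OF int]) (use uv in auto)
    hence "inverse (of_int v) \<in> ?G" using uv by (simp add: complex_m_inv)
    from mult[OF int[of u] this] show ?thesis using uv by (simp add: of_rat_mult of_rat_inverse divide_inverse)
  qed
  have "\<zeta> \<in> ?G" by (rule generate_field.incl) auto
  hence "rat_eval r \<zeta> \<in> ?G" for r
    by (induction r) (auto simp: rat_eval_pCons intro!: zero add mult rat)
  thus "QZ \<subseteq> cyclotomic_field p" by (auto simp: QZ_def cyclotomic_field_def)
qed

lemma Rats_sub_cyclotomic: "\<rat> \<subseteq> cyclotomic_field p"
proof
  fix x :: complex assume "x \<in> \<rat>"
  then obtain q where "x = of_rat q" by (auto elim: Rats_cases)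
  hence "x = rat_eval [:q:] \<zeta>" by (simp add: rat_eval_pCons)
  thus "x \<in> cyclotomic_field p" unfolding cyclotomic_field_eq QZ_def by blast
qed

text \<open>Sends r(\<zeta>) to r(\<zeta>^k) with k = d mod p, through an arbitrary choice of
  representing polynomial. The action of matrices on modular functions asks for such an
  automorphism; it fixes the rational coefficients that matter later.\<close>

lemma exists_cyclotomic_aut:
  assumes "coprime d (int p)"
  obtains \<sigma> where "cyclotomic_aut p d \<sigma>" "\<And>x. x \<in> \<rat> \<Longrightarrow> \<sigma> x = x"
proof -
  define k where "k = nat (d mod int p)"
  have k: "int k = d mod int p" using p_pos by (simp add: k_def)
  have ndvd: "\<not> p dvd k"
  proof
    assume "p dvd k"
    hence "int p dvd d" using k by (metis dvd_mod_imp_dvd dvd_refl int_dvd_int_iff)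
    hence "is_unit (int p)" using assms by (metis coprime_common_divisor dvd_refl)
    thus False using p_gt_1 by simp
  qed
  have zd: "\<zeta> powi d = \<zeta> ^ k"
  proof -
    have "\<zeta> powi d = \<zeta> powi (int p * (d div int p) + int k)" unfolding k by simp
    also have "\<dots> = (\<zeta> powi int p) powi (d div int p) * \<zeta> powi int k"
      using zeta_nonzero by (simp add: power_int_add power_int_mult)
    finally show ?thesis using zeta_power_p by simp
  qed
  define w where "w = \<zeta> ^ k"
  \<comment> \<open>The inverse e of k modulo p recovers \<zeta> from \<zeta>^k, which gives
    surjectivity.\<close>
  obtain e where e: "w ^ e = \<zeta>"
  proof -
    have "coprime k p" using ndvd prime_p by (metis coprime_commute prime_imp_coprime_nat)
    then obtain e where "[k * e = Suc 0] (mod p)" using cong_solve_coprime_nat by blast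
    hence "(k * e) mod p = 1" using p_gt_1 by (simp add: cong_def)
    hence "k * e = p * (k * e div p) + 1" by (metis mult_div_mod_eq)
    hence "\<zeta> ^ (k * e) = (\<zeta> ^ p) ^ (k * e div p) * \<zeta>" by (metis power_add power_mult power_one_right)
    thus ?thesis using that[of e] by (simp add: w_def power_mult zeta_power_p)
  qed
  have diff: "rat_eval r w = rat_eval s w" if "rat_eval r \<zeta> = rat_eval s \<zeta>" for r s
  proof -
    have "rat_eval (r + smult (- 1) s) \<zeta> = 0" using that by (simp add: rat_eval_diff)
    from rat_eval_conj[OF this ndvd] show ?thesis by (simp add: rat_eval_diff w_def)
  qed
  define \<sigma> where "\<sigma> = (\<lambda>x. rat_eval (SOME r. rat_eval r \<zeta> = x) w)"
  have \<sigma>: "\<sigma> (rat_eval r \<zeta>) = rat_eval r w" for r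
    unfolding \<sigma>_def by (rule diff) (rule someI, rule refl)
  have in_QZ: "rat_eval r w \<in> QZ" for r
  proof -
    have "rat_eval r w = rat_eval (pcompose r ([:0, 1:] ^ k)) \<zeta>" by (simp add: rat_eval_pcompose rat_eval_X_power w_def)
    thus ?thesis by (auto simp: QZ_def)
  qed
  have "cyclotomic_aut p d \<sigma>"
    unfolding cyclotomic_aut_def ring_iso_def cyclotomic_field_eq
  proof safe
    show "\<sigma> \<in> ring_hom (\<C>\<lparr>carrier := QZ\<rparr>) (\<C>\<lparr>carrier := QZ\<rparr>)"
    proof (rule ring_hom_memI)
      fix x assume "x \<in> carrier (\<C>\<lparr>carrier := QZ\<rparr>)"
      then obtain r where r: "x = rat_eval r \<zeta>" by (auto simp: QZ_def)
      show "\<sigma> x \<in> carrier (\<C>\<lparr>carrier := QZ\<rparr>)" using in_QZ by (simp add: r \<sigma>)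
      fix y assume "y \<in> carrier (\<C>\<lparr>carrier := QZ\<rparr>)"
      then obtain s where s: "y = rat_eval s \<zeta>" by (auto simp: QZ_def)
      show "\<sigma> (x \<otimes>\<^bsub>\<C>\<lparr>carrier := QZ\<rparr>\<^esub> y) = \<sigma> x \<otimes>\<^bsub>\<C>\<lparr>carrier := QZ\<rparr>\<^esub> \<sigma> y"
        using \<sigma>[of "r * s"] by (simp add: r s \<sigma> rat_eval_mult)
      show "\<sigma> (x \<oplus>\<^bsub>\<C>\<lparr>carrier := QZ\<rparr>\<^esub> y) = \<sigma> x \<oplus>\<^bsub>\<C>\<lparr>carrier := QZ\<rparr>\<^esub> \<sigma> y"
        using \<sigma>[of "r + s"] by (simp add: r s \<sigma> rat_eval_add)
    next
      show "\<sigma> \<one>\<^bsub>\<C>\<lparr>carrier := QZ\<rparr>\<^esub> = \<one>\<^bsub>\<C>\<lparr>carrier := QZ\<rparr>\<^esub>" using \<sigma>[of 1] by simp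
    qed
    show "bij_betw \<sigma> (carrier (\<C>\<lparr>carrier := QZ\<rparr>)) (carrier (\<C>\<lparr>carrier := QZ\<rparr>))"
      unfolding bij_betw_def
    proof
      show "inj_on \<sigma> (carrier (\<C>\<lparr>carrier := QZ\<rparr>))"
      proof (rule inj_onI)
        fix x y assume "x \<in> carrier (\<C>\<lparr>carrier := QZ\<rparr>)" "y \<in> carrier (\<C>\<lparr>carrier := QZ\<rparr>)" and eq: "\<sigma> x = \<sigma> y"
        then obtain r s where rs: "x = rat_eval r \<zeta>" "y = rat_eval s \<zeta>" by (auto simp: QZ_def)
        let ?t = "r + smult (- 1) s"
        show "x = y"
        proof (rule ccontr)
          assume "x \<noteq> y"
          hence "rat_eval ?t \<zeta> \<noteq> 0" using rs by (simp add: rat_eval_diff)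
          from QZ_inverse[OF this] obtain u where u: "inverse (rat_eval ?t \<zeta>) = rat_eval u \<zeta>" by (auto simp: QZ_def)
          have "rat_eval (?t * u) \<zeta> = rat_eval 1 \<zeta>"
            using \<open>rat_eval ?t \<zeta> \<noteq> 0\<close> by (simp only: rat_eval_mult u [symmetric]) simp
          from diff[OF this] have "rat_eval ?t w * rat_eval u w = 1" by (simp add: rat_eval_mult)
          moreover have "rat_eval ?t w = 0" using eq by (simp add: rs \<sigma> rat_eval_diff)
          ultimately show False by simp
        qed
      qed
      show "\<sigma> ` carrier (\<C>\<lparr>carrier := QZ\<rparr>) = carrier (\<C>\<lparr>carrier := QZ\<rparr>)"
      proof safe
        fix x assume "x \<in> carrier (\<C>\<lparr>carrier := QZ\<rparr>)"
        then obtain r where r: "x = rat_eval r \<zeta>" by (auto simp: QZ_def)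
        show "\<sigma> x \<in> carrier (\<C>\<lparr>carrier := QZ\<rparr>)" using in_QZ by (simp add: r \<sigma>)
        have "x = rat_eval (pcompose r ([:0, 1:] ^ e)) w" by (simp add: r rat_eval_pcompose rat_eval_X_power e)
        also have "\<dots> = \<sigma> (rat_eval (pcompose r ([:0, 1:] ^ e)) \<zeta>)" by (simp add: \<sigma>)
        finally show "x \<in> \<sigma> ` carrier (\<C>\<lparr>carrier := QZ\<rparr>)" by (auto simp: QZ_def)
      qed
    qed
    have "\<sigma> (rat_eval [:0, 1:] \<zeta>) = w" unfolding \<sigma> by (simp add: rat_eval_pCons)
    thus "\<sigma> \<zeta> = \<zeta> powi d" unfolding zd w_def by (simp add: rat_eval_pCons)
  qed
  moreover have "\<sigma> x = x" if "x \<in> \<rat>" for x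
  proof -
    obtain q where q: "x = of_rat q" using \<open>x \<in> \<rat>\<close> by (auto elim: Rats_cases)
    thus ?thesis using \<sigma>[of "[:q:]"] by (simp add: rat_eval_pCons)
  qed
  ultimately show thesis using that by blast
qed

end

section \<open>Number fields of degree at most two\<close>

text \<open>A basis has at most two elements, and since 1 lies in K one of them can be exchanged for
  1.\<close>

lemma degree_le_two_generator:
  assumes "number_field K" "field_degree K \<le> 2"
  obtains \<theta> where "K = {a + b * \<theta> | a b. a \<in> \<rat> \<and> b \<in> \<rat>}" "field_degree K = 2 \<or> K = \<rat>"
    "\<And>x y. x \<in> K \<Longrightarrow> y \<in> K \<Longrightarrow> x * y \<in> K"
proof -
  interpret C: field \<C> by (rule complex_ring_field)
  have sf: "subfield K \<C>" and fd: "C.finite_dimension \<rat> K" using assms(1) by (auto simp: number_field_def)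
  have sr: "subring K \<C>" using subfieldE(1)[OF sf] by blast
  have one: "1 \<in> K" using subringE(3)[OF sr] by simp
  have mult: "x * y \<in> K" if "x \<in> K" "y \<in> K" for x y using subringE(6)[OF sr that] by simp
  obtain n where n: "C.dimension n \<rat> K" using fd by (auto simp: C.finite_dimension_def)
  have "field_degree K = n" unfolding field_degree_def using C.dimI[OF subfield_Rats n] by (simp add: over_def)
  hence n2: "n \<le> 2" "field_degree K = n" using assms(2) by auto
  show thesis
    using n
  proof (cases rule: C.dimension.cases)
    case zero_dim
    thus ?thesis using one by simp
  next
    case (Suc_dim v E m)
    have K: "K = {q * v + e | q e. q \<in> \<rat> \<and> e \<in> E}" using Suc_dim(2) by (simp add: line_extension_complex)
    from Suc_dim(5) show ?thesis
    proof (cases rule: C.dimension.cases)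
      case zero_dim
      have K: "K = {q * v | q. q \<in> \<rat>}" using K zero_dim by auto
      obtain q where q: "q \<in> \<rat>" "q * v = 1" using one unfolding K by force
      have "v \<in> \<rat>"
      proof -
        have "v = inverse q" using q by (metis inverse_unique)
        thus ?thesis using q by simp
      qed
      have "K = \<rat>"
      proof (intro equalityI subsetI)
        fix x :: complex assume "x \<in> \<rat>"
        hence "x * q \<in> \<rat>" "x = (x * q) * v" using q by (auto simp: mult.assoc)
        thus "x \<in> K" unfolding K by blast
      qed (use \<open>v \<in> \<rat>\<close> K in auto)
      moreover have "(\<rat> :: complex set) = {a + b * 0 | a b. a \<in> \<rat> \<and> b \<in> \<rat>}" by auto
      ultimately show ?thesis using that[of 0] mult by simp
    next
      case (Suc_dim w E' m')
      have m': "m' = 0" using n2 \<open>n = Suc m\<close> \<open>m = Suc m'\<close> by simp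
      hence "E' = {0}" using Suc_dim(5) by (auto elim: C.dimension.cases)
      hence E: "E = {q * w | q. q \<in> \<rat>}" using Suc_dim(2) by (auto simp: line_extension_complex)
      have K: "K = {q * v + r * w | q r. q \<in> \<rat> \<and> r \<in> \<rat>}" unfolding K E by blast
      have deg: "field_degree K = 2" using n2 \<open>n = Suc m\<close> \<open>m = Suc m'\<close> m' by simp
      have main: "K = {a + b * w | a b. a \<in> \<rat> \<and> b \<in> \<rat>}"
        if K: "K = {q * v + r * w | q r. q \<in> \<rat> \<and> r \<in> \<rat>}" and q: "q \<in> \<rat>" "r \<in> \<rat>" "q * v + r * w = 1" "q \<noteq> 0" for v w q r
      proof (intro equalityI subsetI)
        fix x assume "x \<in> K"
        then obtain a b where ab: "a \<in> \<rat>" "b \<in> \<rat>" "x = a * v + b * w" unfolding K by blast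
        have "q * v = 1 - r * w" using q(3) by (simp add: eq_diff_eq)
        moreover have "a * v = a / q * (q * v)" using q(4) by simp
        ultimately have "x = a / q * (1 - r * w) + b * w" unfolding ab(3) by (simp only:)
        hence "x = a / q + (b - a * r / q) * w" by (simp add: algebra_simps)
        moreover have "a / q \<in> \<rat>" "b - a * r / q \<in> \<rat>" using ab q by auto
        ultimately show "x \<in> {a + b * w | a b. a \<in> \<rat> \<and> b \<in> \<rat>}" by blast
      next
        fix x assume "x \<in> {a + b * w | a b. a \<in> \<rat> \<and> b \<in> \<rat>}"
        then obtain a b where ab: "a \<in> \<rat>" "b \<in> \<rat>" "x = a + b * w" by blast
        have "x = a * (q * v + r * w) + b * w" unfolding q(3) ab(3) by simp
        also have "\<dots> = (a * q) * v + (a * r + b) * w" by (simp add: algebra_simps)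
        finally have "x = (a * q) * v + (a * r + b) * w" .
        moreover have "a * q \<in> \<rat>" "a * r + b \<in> \<rat>" using ab q by auto
        ultimately show "x \<in> K" unfolding K by blast
      qed
      obtain q r where q: "q \<in> \<rat>" "r \<in> \<rat>" "q * v + r * w = 1" using one unfolding K by force
      show ?thesis
      proof (cases "q = 0")
        case False
        thus ?thesis using that[OF main[OF K q False]] deg mult by blast
      next
        case True
        hence "r \<noteq> 0" using q by auto
        moreover have "K = {q * w + r * v | q r. q \<in> \<rat> \<and> r \<in> \<rat>}" unfolding K by (metis (no_types, lifting) add.commute)
        moreover have "r * w + q * v = 1" using q by (simp add: add.commute)
        ultimately show ?thesis using that[OF main[of w v r q]] q deg mult by blast
      qed
    qed
  qed
qed

section \<open>Conjugation and embeddings\<close>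

text \<open>Treats the rationals, with \<open>cj\<close> the identity, and quadratic fields
  uniformly; rational traces and norms replace any reference to a generator.\<close>

locale quadratic_conj =
  fixes K :: "complex set" and cj :: "complex \<Rightarrow> complex"
  assumes Rats_sub: "\<rat> \<subseteq> K"
    and K_add: "x \<in> K \<Longrightarrow> y \<in> K \<Longrightarrow> x + y \<in> K"
    and K_mult: "x \<in> K \<Longrightarrow> y \<in> K \<Longrightarrow> x * y \<in> K"
    and cj_in: "x \<in> K \<Longrightarrow> cj x \<in> K"
    and cj_add: "x \<in> K \<Longrightarrow> y \<in> K \<Longrightarrow> cj (x + y) = cj x + cj y"
    and cj_mult: "x \<in> K \<Longrightarrow> y \<in> K \<Longrightarrow> cj (x * y) = cj x * cj y"
    and cj_cj: "x \<in> K \<Longrightarrow> cj (cj x) = x"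
    and cj_Rats: "x \<in> \<rat> \<Longrightarrow> cj x = x"
    and tr_Rats: "x \<in> K \<Longrightarrow> x + cj x \<in> \<rat>"
    and nm_Rats: "x \<in> K \<Longrightarrow> x * cj x \<in> \<rat>"

lemma embedding_of_Rats:
  assumes "\<sigma> \<in> ring_hom (\<C>\<lparr>carrier := K\<rparr>) \<C>" "\<rat> \<subseteq> K" "x \<in> \<rat>"
  shows "\<sigma> x = x"
proof -
  have add: "\<sigma> (x + y) = \<sigma> x + \<sigma> y" if "x \<in> K" "y \<in> K" for x y
    using ring_hom_add[OF assms(1), of x y] that by simp
  have mult: "\<sigma> (x * y) = \<sigma> x * \<sigma> y" if "x \<in> K" "y \<in> K" for x y
    using ring_hom_mult[OF assms(1), of x y] that by simp
  have one: "\<sigma> 1 = 1" using ring_hom_one[OF assms(1)] by simp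
  have R: "of_nat n \<in> K" "of_int m \<in> K" "0 \<in> K" "1 \<in> K" for n m using assms(2) by auto
  have zero: "\<sigma> 0 = 0" using add[of 0 0] R by simp
  have nat: "\<sigma> (of_nat n) = of_nat n" for n
    by (induction n) (use add[OF R(4) R(1)] one zero in auto)
  have int: "\<sigma> (of_int m) = of_int m" for m
  proof (cases m rule: int_cases2)
    case (nonneg n)
    thus ?thesis using nat by simp
  next
    case (nonpos n)
    have "\<sigma> (of_int m + of_nat n) = \<sigma> (of_int m) + of_nat n" using add[OF R(2) R(1)] nat by simp
    moreover have "of_int m + of_nat n = (0 :: complex)" using nonpos by simp
    ultimately show ?thesis using zero nonpos by (simp add: add_eq_0_iff2)
  qed
  obtain a b :: int where ab: "b > 0" "x = of_int a / of_int b"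
    using assms(3) by (elim Rats_cases') auto
  have "\<sigma> (x * of_int b) = \<sigma> x * of_int b" using mult[of x "of_int b"] R int assms by auto
  moreover have "x * of_int b = of_int a" using ab by simp
  ultimately have "\<sigma> x * of_int b = x * of_int b" using int by (simp only:)
  thus ?thesis using ab(1) by simp
qed

text \<open>An inequality for nonnegative f needs only that every embedding is the identity or the
  conjugation; it is not necessary to count the embeddings exactly.\<close>

lemma exists_quadratic_conj:
  assumes "number_field K" "field_degree K \<le> 2"
  obtains cj where "quadratic_conj K cj"
    "\<And>(f :: complex \<Rightarrow> real) x. (\<And>y. f y \<ge> 0) \<Longrightarrow> x \<in> K \<Longrightarrow>
       (\<Sum>\<sigma>\<in>embeddings K. f (\<sigma> x)) / real (field_degree K) \<le> (f x + f (cj x)) / 2"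
proof -
  obtain \<theta> where K: "K = {a + b * \<theta> | a b. a \<in> \<rat> \<and> b \<in> \<rat>}" and deg: "field_degree K = 2 \<or> K = \<rat>"
    and mult: "\<And>x y. x \<in> K \<Longrightarrow> y \<in> K \<Longrightarrow> x * y \<in> K"
    using degree_le_two_generator[OF assms] by blast
  have KI: "a + b * \<theta> \<in> K" if "a \<in> \<rat>" "b \<in> \<rat>" for a b using that unfolding K by blast
  have RK: "\<rat> \<subseteq> K" using KI[of _ 0] by auto
  have ext: "\<sigma> \<in> ring_hom (\<C>\<lparr>carrier := K\<rparr>) \<C>" "\<sigma> \<in> extensional K" if "\<sigma> \<in> embeddings K" for \<sigma>
    using that by (auto simp: embeddings_def)
  show thesis
  proof (cases "\<theta> \<in> \<rat>")
    case True
    have KR: "K = \<rat>"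
    proof (intro equalityI subsetI)
      fix x assume "x \<in> K"
      then obtain a b where "a \<in> \<rat>" "b \<in> \<rat>" "x = a + b * \<theta>" unfolding K by blast
      thus "x \<in> \<rat>" using True by simp
    qed (use RK in blast)
    have "quadratic_conj K (\<lambda>x. x)" unfolding KR by unfold_locales auto
    moreover have "(\<Sum>\<sigma>\<in>embeddings K. f (\<sigma> x)) / real (field_degree K) \<le> (f x + f x) / 2"
      if f: "\<And>y. f y \<ge> 0" and x: "x \<in> K" for f :: "complex \<Rightarrow> real" and x
    proof -
      have sub: "embeddings K \<subseteq> {restrict id K}"
      proof
        fix \<sigma> assume s: "\<sigma> \<in> embeddings K"
        have "\<sigma> y = restrict id K y" for y
          using embedding_of_Rats[OF ext(1)[OF s] RK, of y] extensional_arb[OF ext(2)[OF s], of y] KR by (cases "y \<in> K") auto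
        thus "\<sigma> \<in> {restrict id K}" by auto
      qed
      have "(\<Sum>\<sigma>\<in>embeddings K. f (\<sigma> x)) \<le> (\<Sum>\<sigma>\<in>{restrict id K}. f (\<sigma> x))"
        by (rule sum_mono2) (use sub f in auto)
      also have "\<dots> = f x" using x by simp
      finally have le: "(\<Sum>\<sigma>\<in>embeddings K. f (\<sigma> x)) \<le> f x" .
      \<comment> \<open>Should the degree be 0, division by zero makes the left side 0.\<close>
      show ?thesis
      proof (cases "field_degree K = 0")
        case False
        have "(\<Sum>\<sigma>\<in>embeddings K. f (\<sigma> x)) / real (field_degree K) \<le> f x / real (field_degree K)"
          using le by (intro divide_right_mono) auto
        also have "\<dots> \<le> f x / 1" using False f[of x] by (intro divide_left_mono) auto
        finally show ?thesis by simp
      qed (use f[of x] in simp)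
    qed
    ultimately show ?thesis using that by blast
  next
    case False
    have neq: "K \<noteq> \<rat>" using KI[of 0 1] False by auto
    hence deg2: "field_degree K = 2" using deg by blast
    have uniq: "a = a' \<and> b = b'" if "a \<in> \<rat>" "b \<in> \<rat>" "a' \<in> \<rat>" "b' \<in> \<rat>" "a + b * \<theta> = a' + b' * \<theta>" for a b a' b'
    proof -
      have "(b - b') * \<theta> - (a' - a) = (a + b * \<theta>) - (a' + b' * \<theta>)" by (simp add: algebra_simps)
      hence e: "(b - b') * \<theta> = a' - a" unfolding that(5) by simp
      have "b = b'"
      proof (rule ccontr)
        assume "b \<noteq> b'"
        hence "\<theta> = (a' - a) / (b - b')" using e by (simp add: eq_divide_eq mult.commute)
        thus False using False that by simp
      qed
      thus ?thesis using that(5) by simp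
    qed
    have "\<theta> * \<theta> \<in> K" using mult[of \<theta> \<theta>] KI[of 0 1] by simp
    then obtain s0 r where rs: "s0 \<in> \<rat>" "r \<in> \<rat>" "\<theta> * \<theta> = s0 + r * \<theta>" unfolding K by blast
    \<comment> \<open>The second root of t^2 = s0 + r t, with the sum of the roots equal to
      r.\<close>
    define \<theta>' where "\<theta>' = r - \<theta>"
    have th': "\<theta>' * \<theta>' = s0 + r * \<theta>'"
    proof -
      have "\<theta>' * \<theta>' = r * r - 2 * (r * \<theta>) + \<theta> * \<theta>" by (simp add: \<theta>'_def algebra_simps)
      thus ?thesis unfolding rs(3) by (simp add: \<theta>'_def algebra_simps)
    qed
    have "\<forall>x\<in>K. \<exists>ab. fst ab \<in> \<rat> \<and> snd ab \<in> \<rat> \<and> x = fst ab + snd ab * \<theta>" unfolding K by auto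
    then obtain AB where AB: "\<And>x. x \<in> K \<Longrightarrow> fst (AB x) \<in> \<rat> \<and> snd (AB x) \<in> \<rat> \<and> x = fst (AB x) + snd (AB x) * \<theta>"
      by metis
    define cj where "cj = (\<lambda>x. fst (AB x) + snd (AB x) * \<theta>')"
    have cj: "cj (a + b * \<theta>) = a + b * \<theta>'" if "a \<in> \<rat>" "b \<in> \<rat>" for a b
    proof -
      have "fst (AB (a + b * \<theta>)) = a \<and> snd (AB (a + b * \<theta>)) = b"
        by (rule uniq) (use AB[OF KI[OF that]] that in auto)
      thus ?thesis by (simp add: cj_def)
    qed
    have cases: "\<exists>a\<in>\<rat>. \<exists>b\<in>\<rat>. x = a + b * \<theta>" if "x \<in> K" for x using that unfolding K by blast
    have prod: "(a + b * t) * (a' + b' * t) = (a * a' + b * b' * s0) + (a * b' + a' * b + b * b' * r) * t"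
      if "t * t = s0 + r * t" for a b a' b' t
    proof -
      have "(a + b * t) * (a' + b' * t) = a * a' + (a * b' + a' * b) * t + b * b' * (t * t)" by (simp add: algebra_simps)
      thus ?thesis unfolding that by (simp add: algebra_simps)
    qed
    have conj: "quadratic_conj K cj"
    proof
      show "\<rat> \<subseteq> K" by (rule RK)
    next
      fix x y assume "x \<in> K" "y \<in> K"
      then obtain a b a' b' where ab: "a \<in> \<rat>" "b \<in> \<rat>" "x = a + b * \<theta>" "a' \<in> \<rat>" "b' \<in> \<rat>" "y = a' + b' * \<theta>"
        using cases by meson
      have s: "x + y = (a + a') + (b + b') * \<theta>" unfolding ab(3,6) by (simp add: algebra_simps)
      show "x + y \<in> K" unfolding s using ab by (intro KI) auto
      show "x * y \<in> K" by (rule mult) fact+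
      have "cj (x + y) = (a + a') + (b + b') * \<theta>'" unfolding s using ab by (intro cj) auto
      thus "cj (x + y) = cj x + cj y" unfolding ab(3,6) cj[OF ab(1,2)] cj[OF ab(4,5)] by (simp add: algebra_simps)
      have "cj (x * y) = (a * a' + b * b' * s0) + (a * b' + a' * b + b * b' * r) * \<theta>'"
        unfolding ab(3,6) prod[OF rs(3)] using ab rs by (intro cj) auto
      also have "\<dots> = cj x * cj y" unfolding ab(3,6) cj[OF ab(1,2)] cj[OF ab(4,5)] prod[OF th'] ..
      finally show "cj (x * y) = cj x * cj y" .
    next
      fix x assume "x \<in> K"
      then obtain a b where ab: "a \<in> \<rat>" "b \<in> \<rat>" "x = a + b * \<theta>" using cases by meson
      have c: "cj x = a + b * \<theta>'" unfolding ab(3) by (rule cj[OF ab(1,2)])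
      have c': "cj x = (a + b * r) + (- b) * \<theta>" unfolding c \<theta>'_def by (simp add: algebra_simps)
      show "cj x \<in> K" unfolding c' using ab rs by (intro KI) auto
      have "cj (cj x) = (a + b * r) + (- b) * \<theta>'" unfolding c' using ab rs by (intro cj) auto
      thus "cj (cj x) = x" unfolding ab(3) \<theta>'_def by (simp add: algebra_simps)
      have 1: "x + cj x = a + a + b * r" unfolding c unfolding ab(3) \<theta>'_def by (simp add: algebra_simps)
      have "a + a + b * r \<in> \<rat>" using ab rs by auto
      thus "x + cj x \<in> \<rat>" by (simp only: 1)
      have 2: "x * cj x = a * a + a * b * r + b * b * (r * \<theta> - \<theta> * \<theta>)"
        unfolding c unfolding ab(3) \<theta>'_def by (simp add: algebra_simps)
      have "r * \<theta> - \<theta> * \<theta> = - s0" using rs(3) by simp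
      hence "a * a + a * b * r + b * b * (r * \<theta> - \<theta> * \<theta>) \<in> \<rat>" using ab rs by simp
      thus "x * cj x \<in> \<rat>" by (simp only: 2)
    next
      fix x :: complex assume "x \<in> \<rat>"
      thus "cj x = x" using cj[of x 0] by simp
    qed
    moreover have "(\<Sum>\<sigma>\<in>embeddings K. f (\<sigma> x)) / real (field_degree K) \<le> (f x + f (cj x)) / 2"
      if f: "\<And>y. f y \<ge> 0" and x: "x \<in> K" for f :: "complex \<Rightarrow> real" and x
    proof -
      have sub: "embeddings K \<subseteq> {restrict id K, restrict cj K}"
      proof
        fix \<sigma> assume s: "\<sigma> \<in> embeddings K"
        have add: "\<sigma> (x + y) = \<sigma> x + \<sigma> y" if "x \<in> K" "y \<in> K" for x y
          using ring_hom_add[OF ext(1)[OF s], of x y] that by simp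
        have mul: "\<sigma> (x * y) = \<sigma> x * \<sigma> y" if "x \<in> K" "y \<in> K" for x y
          using ring_hom_mult[OF ext(1)[OF s], of x y] that by simp
        have fix_Rats: "\<sigma> q = q" if "q \<in> \<rat>" for q by (rule embedding_of_Rats[OF ext(1)[OF s] RK that])
        have thK: "\<theta> \<in> K" using KI[of 0 1] by simp
        have lin: "\<sigma> (a + b * \<theta>) = a + b * \<sigma> \<theta>" if "a \<in> \<rat>" "b \<in> \<rat>" for a b
        proof -
          have K': "a \<in> K" "b \<in> K" using that RK by auto
          show ?thesis using add[OF K'(1) mult[OF K'(2) thK]] mul[OF K'(2) thK] fix_Rats that by simp
        qed
        have "\<sigma> \<theta> * \<sigma> \<theta> = s0 + r * \<sigma> \<theta>" using mul[OF thK thK] lin[OF rs(1,2)] rs(3) by simp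
        hence "(\<sigma> \<theta> - \<theta>) * (\<sigma> \<theta> - \<theta>') = 0"
        proof -
          assume e: "\<sigma> \<theta> * \<sigma> \<theta> = s0 + r * \<sigma> \<theta>"
          have "(\<sigma> \<theta> - \<theta>) * (\<sigma> \<theta> - \<theta>') = \<sigma> \<theta> * \<sigma> \<theta> - r * \<sigma> \<theta> + (r * \<theta> - \<theta> * \<theta>)"
            by (simp add: \<theta>'_def algebra_simps)
          thus ?thesis unfolding e rs(3) by simp
        qed
        hence "\<sigma> \<theta> = \<theta> \<or> \<sigma> \<theta> = \<theta>'" by auto
        thus "\<sigma> \<in> {restrict id K, restrict cj K}"
        proof
          assume t: "\<sigma> \<theta> = \<theta>"
          have "\<sigma> y = restrict id K y" for y
          proof (cases "y \<in> K")
            case True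
            then obtain a b where "a \<in> \<rat>" "b \<in> \<rat>" "y = a + b * \<theta>" using cases by meson
            thus ?thesis using lin t True by simp
          qed (use extensional_arb[OF ext(2)[OF s]] in simp)
          thus ?thesis by auto
        next
          assume t: "\<sigma> \<theta> = \<theta>'"
          have "\<sigma> y = restrict cj K y" for y
          proof (cases "y \<in> K")
            case True
            then obtain a b where "a \<in> \<rat>" "b \<in> \<rat>" "y = a + b * \<theta>" using cases by meson
            thus ?thesis using lin cj t True by simp
          qed (use extensional_arb[OF ext(2)[OF s]] in simp)
          thus ?thesis by auto
        qed
      qed
      have "(\<Sum>\<sigma>\<in>embeddings K. f (\<sigma> x)) \<le> (\<Sum>\<sigma>\<in>{restrict id K, restrict cj K}. f (\<sigma> x))"
        by (rule sum_mono2) (use sub f in auto)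
      also have "\<dots> \<le> f x + f (cj x)"
        using x f[of "cj x"] f[of x] by (cases "restrict id K = restrict cj K") auto
      finally have "(\<Sum>\<sigma>\<in>embeddings K. f (\<sigma> x)) \<le> f x + f (cj x)" .
      thus ?thesis unfolding deg2 by simp
    qed
    ultimately show ?thesis using that by blast
  qed
qed

subsection \<open>Integers of a quadratic field\<close>

lemma Rats_quadratic_int_coeffs:
  assumes "T \<in> \<rat>" "N \<in> \<rat>"
  obtains a b c :: int where "a > 0" "T * of_int a = of_int b" "N * of_int a = of_int c"
proof -
  obtain b1 d1 :: int where 1: "d1 > 0" "T = of_int b1 / of_int d1" using assms(1) by (elim Rats_cases') auto
  obtain b2 d2 :: int where 2: "d2 > 0" "N = of_int b2 / of_int d2" using assms(2) by (elim Rats_cases') auto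
  show thesis by (rule that[of "d1 * d2" "b1 * d2" "b2 * d1"]) (use 1 2 in auto)
qed

text \<open>Gauss's lemma: the content of q must be |e|, so after cancelling it the leading
  coefficient of m divides 1.\<close>

lemma primitive_dvd_monic_leading_coeff:
  fixes m p q :: "int poly"
  assumes "content m = 1" "smult e p = m * q" "e \<noteq> 0" "lead_coeff p = 1"
  shows "\<bar>lead_coeff m\<bar> = 1"
proof -
  have "content p dvd lead_coeff p" by (rule content_dvd_coeff)
  hence cp: "content p = 1" using assms(4) by (metis is_unit_normalize normalize_content)
  have "content (smult e p) = content (m * q)" using assms(2) by simp
  hence "\<bar>e\<bar> = content q" using assms(1) cp by (simp add: content_mult)
  hence "q = smult \<bar>e\<bar> (primitive_part q)" by (metis content_times_primitive_part)
  hence "smult e p = smult \<bar>e\<bar> (m * primitive_part q)" using assms(2) by (metis mult_smult_right)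
  hence "lead_coeff (smult e p) = lead_coeff (smult \<bar>e\<bar> (m * primitive_part q))" by simp
  hence "e = \<bar>e\<bar> * (lead_coeff m * lead_coeff (primitive_part q))" using assms(3,4) by (simp add: lead_coeff_mult)
  hence "\<bar>e\<bar> = \<bar>\<bar>e\<bar> * (lead_coeff m * lead_coeff (primitive_part q))\<bar>" by (rule arg_cong)
  hence "\<bar>e\<bar> * 1 = \<bar>e\<bar> * \<bar>lead_coeff m * lead_coeff (primitive_part q)\<bar>" by (simp add: abs_mult)
  hence "\<bar>lead_coeff m * lead_coeff (primitive_part q)\<bar> = 1" using assms(3) by (metis abs_eq_0 mult_cancel_left)
  thus ?thesis by (metis abs_mult abs_zmult_eq_1 abs_abs)
qed

text \<open>The rational quadratic is scaled to a primitive integer polynomial m. Pseudo-division of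
  a monic integer polynomial with root x by m leaves a remainder of degree below 2, which vanishes
  because x is irrational; hence m has leading coefficient 1 or -1.\<close>

lemma quadratic_integer_coeffs:
  fixes x :: complex
  assumes "algebraic_int x" "x \<notin> \<rat>" "T \<in> \<rat>" "N \<in> \<rat>" "x * x - T * x + N = 0"
  shows "T \<in> \<int>" "N \<in> \<int>"
proof -
  let ?P = "\<lambda>p. poly (map_poly of_int p) x"
  obtain p :: "int poly" where p: "?P p = 0" "lead_coeff p = 1"
    using assms(1) unfolding algebraic_int_altdef_ipoly by blast
  obtain a b c :: int where abc: "a > 0" "T * of_int a = of_int b" "N * of_int a = of_int c"
    using Rats_quadratic_int_coeffs[OF assms(3,4)] by blast
  define m0 where "m0 = [:c, - b, a:]"
  have m0: "m0 \<noteq> 0" "degree m0 = 2" "lead_coeff m0 = a" using abc by (auto simp: m0_def)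
  have "?P m0 = of_int a * (x * x - T * x + N)"
    using abc by (simp add: m0_def map_poly_pCons algebra_simps)
  hence root0: "?P m0 = 0" using assms(5) by simp
  define m where "m = primitive_part m0"
  define g where "g = content m0"
  have g0: "g \<noteq> 0" using m0 by (simp add: g_def)
  have m0_eq: "m0 = smult g m" by (simp add: g_def m_def)
  have m: "m \<noteq> 0" "degree m = 2" "content m = 1" using m0(1,2) by (simp_all add: m_def)
  have hom: "?P (u + v) = ?P u + ?P v" "?P (u * v) = ?P u * ?P v" "?P (smult k u) = of_int k * ?P u" for u v k
  proof -
    have "map_poly of_int (u + v) = (map_poly of_int u + map_poly of_int v :: complex poly)"
      by (intro poly_eqI) (simp add: coeff_map_poly)
    thus "?P (u + v) = ?P u + ?P v" by simp
    have "map_poly of_int (u * v) = (map_poly of_int u * map_poly of_int v :: complex poly)"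
      by (intro poly_eqI) (simp add: coeff_map_poly coeff_mult)
    thus "?P (u * v) = ?P u * ?P v" by simp
    have "map_poly of_int (smult k u) = (smult (of_int k) (map_poly of_int u) :: complex poly)"
      by (intro poly_eqI) (simp add: coeff_map_poly)
    thus "?P (smult k u) = of_int k * ?P u" by simp
  qed
  have "of_int g * ?P m = 0" using root0 hom(3)[of g m] unfolding m0_eq by simp
  hence root: "?P m = 0" using g0 by simp
  obtain q r where qr: "pseudo_divmod p m = (q, r)" by force
  define e where "e = lead_coeff m ^ (Suc (degree p) - degree m)"
  have e: "smult e p = m * q + r" and r: "r = 0 \<or> degree r < 2"
    using pseudo_divmod[OF m(1) qr] m(2) by (auto simp: e_def)
  have e0: "e \<noteq> 0" unfolding e_def by (metis leading_coeff_0_iff m(1) power_not_zero)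
  have "?P r = 0" using arg_cong[OF e, of ?P] hom root p by simp
  have "r = 0"
  proof (rule ccontr)
    assume "r \<noteq> 0"
    hence "degree r \<le> 1" using r by linarith
    hence "r = [:coeff r 0, coeff r 1:]"
      by (intro poly_eqI) (auto simp: coeff_pCons coeff_eq_0 split: nat.splits)
    then obtain u v where uv: "r = [:u, v:]" by blast
    have "of_int u + x * of_int v = 0" using \<open>?P r = 0\<close> unfolding uv by (simp add: map_poly_pCons)
    hence xv: "x * of_int v = - of_int u" by (simp add: add_eq_0_iff)
    show False
    proof (cases "v = 0")
      case True
      thus ?thesis using xv uv \<open>r \<noteq> 0\<close> by simp
    next
      case False
      have "x = x * of_int v / of_int v" using False by simp
      also have "\<dots> = - of_int u / of_int v" unfolding xv ..
      finally have "x = - of_int u / of_int v" .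
      thus ?thesis using assms(2) by simp
    qed
  qed
  hence "smult e p = m * q" using e by simp
  hence l1: "\<bar>lead_coeff m\<bar> = 1" by (rule primitive_dvd_monic_leading_coeff[OF m(3) _ e0 p(2)])
  define l where "l = coeff m 2"
  have l: "l * l = 1" using l1 m(2) by (auto simp: l_def abs_eq_iff')
  have ga: "a = g * l" using m0_eq unfolding l_def by (metis coeff_smult m0(2,3))
  have gb: "- b = g * coeff m 1" using m0_eq by (metis coeff_pCons_0 coeff_pCons_Suc coeff_smult m0_def One_nat_def)
  have gc: "c = g * coeff m 0" using m0_eq by (metis coeff_pCons_0 coeff_smult m0_def)
  have "T = of_int (- (coeff m 1) * l)"
  proof -
    have "T * of_int (g * l) = of_int (- (g * coeff m 1))" using abc ga gb by (metis minus_minus)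
    hence "of_int g * (T * of_int l) = of_int g * of_int (- coeff m 1)" by (simp add: mult_ac)
    hence "T * of_int l = of_int (- coeff m 1)" using g0 by (metis mult_cancel_left of_int_eq_0_iff)
    hence "T * (of_int l * of_int l) = of_int (- coeff m 1) * of_int l" by (metis mult.assoc)
    thus ?thesis using l by (simp flip: of_int_mult)
  qed
  thus "T \<in> \<int>" by (metis Ints_of_int)
  have "N = of_int (coeff m 0 * l)"
  proof -
    have "N * of_int (g * l) = of_int (g * coeff m 0)" using abc ga gc by metis
    hence "of_int g * (N * of_int l) = of_int g * of_int (coeff m 0)" by (simp add: mult_ac)
    hence "N * of_int l = of_int (coeff m 0)" using g0 by (metis mult_cancel_left of_int_eq_0_iff)
    hence "N * (of_int l * of_int l) = of_int (coeff m 0) * of_int l" by (metis mult.assoc)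
    thus ?thesis using l by (simp flip: of_int_mult)
  qed
  thus "N \<in> \<int>" by (metis Ints_of_int)
qed

context quadratic_conj
begin

text \<open>Reduces integrality to two rational numbers; all later divisibility arguments in the
  ring of integers go through this criterion. Rational x are treated apart because the polynomial
  argument needs an irrational root.\<close>

lemma ring_of_integers_iff: "x \<in> ring_of_integers K \<longleftrightarrow> x \<in> K \<and> x + cj x \<in> \<int> \<and> x * cj x \<in> \<int>"
proof safe
  assume x: "x \<in> ring_of_integers K"
  thus xK: "x \<in> K" by (simp add: ring_of_integers_def)
  have ai: "algebraic_int x" using x by (simp add: ring_of_integers_def)
  have "x + cj x \<in> \<int> \<and> x * cj x \<in> \<int>"
  proof (cases "x \<in> \<rat>")
    case True
    hence "x \<in> \<int>" using rational_algebraic_int_is_int[OF ai] by blast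
    thus ?thesis using cj_Rats[OF True] by simp
  next
    case False
    have "x * x - (x + cj x) * x + x * cj x = 0" by (simp add: algebra_simps)
    from quadratic_integer_coeffs[OF ai False tr_Rats[OF xK] nm_Rats[OF xK] this] show ?thesis by simp
  qed
  thus "x + cj x \<in> \<int>" "x * cj x \<in> \<int>" by auto
next
  assume x: "x \<in> K" "x + cj x \<in> \<int>" "x * cj x \<in> \<int>"
  have "algebraic_int x"
  proof (rule algebraic_int.intros[of "[:x * cj x, - (x + cj x), 1:]"])
    have "- (x + cj x) \<in> \<int>" using x(2) by (metis Ints_minus)
    thus "\<forall>i. coeff [:x * cj x, - (x + cj x), 1:] i \<in> \<int>"
      using x(3) by (auto simp: coeff_pCons split: nat.split)
  qed (auto simp: algebra_simps)
  thus "x \<in> ring_of_integers K" using x by (simp add: ring_of_integers_def)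
qed

lemma Ints_in_O: "of_int n \<in> ring_of_integers K"
  using Rats_sub by (auto simp: ring_of_integers_def)

lemma cj_in_O: "x \<in> ring_of_integers K \<Longrightarrow> cj x \<in> ring_of_integers K"
  unfolding ring_of_integers_iff by (auto simp: cj_in cj_cj add.commute mult.commute)

lemma cj_0 [simp]: "cj 0 = 0" and cj_1 [simp]: "cj 1 = 1"
  by (auto intro: cj_Rats)

end

subsection \<open>Finite places\<close>

lemma integer_ring_simps:
  "carrier (\<O> K) = ring_of_integers K" "x \<otimes>\<^bsub>\<O> K\<^esub> y = x * y" "x \<oplus>\<^bsub>\<O> K\<^esub> y = x + y"
  "\<one>\<^bsub>\<O> K\<^esub> = 1" "\<zero>\<^bsub>\<O> K\<^esub> = 0"
  by (simp_all add: ring_of_type_algebra_def)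

locale quadratic_place = quadratic_conj +
  fixes \<pp> :: "complex set"
  assumes prime_pp: "primeideal \<pp> (\<O> K)" and pp_nonzero: "\<pp> \<noteq> {0}"
begin

sublocale R: primeideal \<pp> "\<O> K"
  rewrites "carrier (\<O> K) = ring_of_integers K" and "monoid.mult (\<O> K) = (*)" and "ring.add (\<O> K) = (+)"
    and "monoid.one (\<O> K) = 1" and "ring.zero (\<O> K) = 0"
  by (fact prime_pp) (auto simp: ring_of_type_algebra_def fun_eq_iff)

abbreviation "OK \<equiv> ring_of_integers K"

lemma O_K: "x \<in> OK \<Longrightarrow> x \<in> K"
  by (simp add: ring_of_integers_def)

lemma O_add: "x \<in> OK \<Longrightarrow> y \<in> OK \<Longrightarrow> x + y \<in> OK"
  by (rule R.add.m_closed)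

lemma O_mult: "x \<in> OK \<Longrightarrow> y \<in> OK \<Longrightarrow> x * y \<in> OK"
  by (rule R.m_closed)

lemma O_power: "x \<in> OK \<Longrightarrow> x ^ n \<in> OK"
  using Ints_in_O[of 1] by (induction n) (auto intro: O_mult)

lemma pp_O: "x \<in> \<pp> \<Longrightarrow> x \<in> OK"
  using R.a_subset by auto

lemma pp_add: "x \<in> \<pp> \<Longrightarrow> y \<in> \<pp> \<Longrightarrow> x + y \<in> \<pp>"
  using additive_subgroup.a_closed[OF ideal.axioms(1)[OF primeideal.axioms(1)[OF prime_pp]], of x y]
  by (simp add: integer_ring_simps)

lemma pp_mult: "x \<in> \<pp> \<Longrightarrow> y \<in> OK \<Longrightarrow> x * y \<in> \<pp>"
  by (rule R.I_r_closed)

lemma pp_mult': "x \<in> OK \<Longrightarrow> y \<in> \<pp> \<Longrightarrow> x * y \<in> \<pp>"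
  by (rule R.I_l_closed)

lemma pp_minus: "x \<in> \<pp> \<Longrightarrow> - x \<in> \<pp>"
  using pp_mult[OF _ Ints_in_O[of "-1"], of x] by simp

lemma pp_prime: "x \<in> OK \<Longrightarrow> y \<in> OK \<Longrightarrow> x * y \<in> \<pp> \<Longrightarrow> x \<in> \<pp> \<or> y \<in> \<pp>"
  by (rule R.I_prime)

lemma pp_0: "0 \<in> \<pp>"
  using additive_subgroup.zero_closed[OF ideal.axioms(1)[OF primeideal.axioms(1)[OF prime_pp]]]
  by (simp add: integer_ring_simps)

lemma one_notin_pp: "1 \<notin> \<pp>"
proof
  assume "1 \<in> \<pp>"
  hence "OK \<subseteq> \<pp>" using pp_mult[of 1] by auto
  thus False using R.I_notcarr pp_O by blast
qed

lemma power_notin_pp: "s \<in> OK \<Longrightarrow> s \<notin> \<pp> \<Longrightarrow> s ^ n \<notin> \<pp>"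
  by (induction n) (use one_notin_pp pp_prime O_power in auto)

lemma trace_Ints: "x \<in> OK \<Longrightarrow> \<exists>n. x + cj x = of_int n"
  using ring_of_integers_iff by (auto elim: Ints_cases)

lemma norm_Ints: "x \<in> OK \<Longrightarrow> \<exists>n. x * cj x = of_int n"
  using ring_of_integers_iff by (auto elim: Ints_cases)

text \<open>The norm of a nonzero element of \<pp> is a nonzero integer in \<pp>, so a least
  positive integer in \<pp> exists; it is prime because \<pp> is.\<close>

lemma residue_prime: "\<exists>l::nat. prime l \<and> (\<forall>n::int. of_int n \<in> \<pp> \<longleftrightarrow> int l dvd n)"
proof -
  obtain a where a: "a \<in> \<pp>" "a \<noteq> 0" using pp_nonzero pp_0 by blast
  obtain n where n: "a * cj a = of_int n" using norm_Ints[OF pp_O[OF a(1)]] by blast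
  have "cj a \<noteq> 0" using cj_cj[OF O_K[OF pp_O[OF a(1)]]] a(2) by auto
  hence n0: "n \<noteq> 0" using n a(2) by auto
  have "of_int n \<in> \<pp>" unfolding n [symmetric] by (rule pp_mult[OF a(1) cj_in_O[OF pp_O[OF a(1)]]])
  hence "of_int \<bar>n\<bar> \<in> \<pp>" using pp_minus[of "of_int n"] by (cases "n \<ge> 0") auto
  hence ex: "\<exists>k::nat. k > 0 \<and> of_nat k \<in> \<pp>" using n0 by (intro exI[of _ "nat \<bar>n\<bar>"]) (simp add: of_nat_nat)
  define l where "l = (LEAST k::nat. k > 0 \<and> of_nat k \<in> \<pp>)"
  have l: "l > 0" "of_nat l \<in> \<pp>" using LeastI_ex[OF ex] by (auto simp: l_def)
  have least: "k \<ge> l" if "k > 0" "of_nat k \<in> \<pp>" for k using that unfolding l_def by (intro Least_le) auto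
  have dvd: "of_int m \<in> \<pp> \<longleftrightarrow> int l dvd m" for m
  proof
    assume m: "of_int m \<in> \<pp>"
    have "complex_of_int (m mod int l) = of_int m + of_nat l * of_int (- (m div int l))"
      by (simp add: minus_mult_div_eq_mod [symmetric])
    moreover have "of_int m + of_nat l * of_int (- (m div int l)) \<in> \<pp>"
      by (intro pp_add m pp_mult l Ints_in_O)
    ultimately have "of_int (m mod int l) \<in> \<pp>" by simp
    moreover define k where "k = nat (m mod int l)"
    moreover have "m mod int l \<ge> 0" "m mod int l < int l" using l by auto
    ultimately have "of_nat k \<in> \<pp>" "k < l" by (simp_all add: of_nat_nat k_def nat_less_iff)
    hence "k = 0" using least[of k] by linarith
    hence "m mod int l = 0" using \<open>m mod int l \<ge> 0\<close> by (simp add: k_def)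
    thus "int l dvd m" by presburger
  next
    assume "int l dvd m"
    then obtain k where "m = int l * k" by blast
    thus "of_int m \<in> \<pp>" using pp_mult[OF l(2) Ints_in_O[of k]] by simp
  qed
  have "prime_elem (int l)"
  proof (rule prime_elemI)
    show "int l \<noteq> 0" using l by simp
    show "\<not> is_unit (int l)" using one_notin_pp dvd[of 1] by auto
    fix a b assume "int l dvd a * b"
    hence "of_int a * of_int b \<in> \<pp>" using dvd[of "a * b"] by simp
    thus "int l dvd a \<or> int l dvd b" using pp_prime[OF Ints_in_O Ints_in_O] dvd by blast
  qed
  hence "prime (int l)" by (rule Factorial_Ring.primeI) simp
  thus ?thesis using dvd by auto
qed

definition res :: nat
  where "res = (SOME l. prime l \<and> (\<forall>n::int. of_int n \<in> \<pp> \<longleftrightarrow> int l dvd n))"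

lemma res_props: "prime res \<and> (\<forall>n::int. of_int n \<in> \<pp> \<longleftrightarrow> int res dvd n)"
  unfolding res_def by (rule someI_ex[OF residue_prime])

lemma prime_res: "prime res" and of_int_in_pp: "of_int n \<in> \<pp> \<longleftrightarrow> int res dvd n"
  using res_props by blast+

lemma res_nonzero: "of_nat res \<noteq> (0 :: complex)"
  using prime_gt_0_nat[OF prime_res] by auto

lemma res_in_pp: "of_nat res \<in> \<pp>"
  using of_int_in_pp[of "int res"] by simp

text \<open>Maximality of \<pp>. If the norm of x is prime to the residue characteristic, the
  conjugate times an integer inverts x. Otherwise the conjugate lies in \<pp>, so x is congruent to
  its trace, which is then an invertible integer.\<close>

lemma O_inverse_mod:
  assumes x: "x \<in> OK" "x \<notin> \<pp>"
  shows "\<exists>t\<in>OK. 1 - x * t \<in> \<pp>"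
proof -
  obtain n where n: "x * cj x = of_int n" using norm_Ints[OF x(1)] by blast
  have inv: "\<exists>u w. u * k + w * int res = 1" if "\<not> int res dvd k" for k
  proof -
    have "coprime k (int res)" using that prime_res by (metis coprime_commute prime_imp_coprime prime_nat_int_transfer)
    thus ?thesis using bezout_int[of k "int res"] by (simp add: coprime_iff_gcd_eq_1)
  qed
  have wl: "of_int w * of_nat res \<in> \<pp>" for w by (rule pp_mult'[OF Ints_in_O res_in_pp])
  show ?thesis
  proof (cases "int res dvd n")
    case False
    then obtain u w where uw: "u * n + w * int res = 1" using inv by blast
    have "x * (cj x * of_int u) = of_int n * of_int u" by (simp only: n mult.assoc [symmetric])
    hence "1 - x * (cj x * of_int u) = 1 - of_int (u * n)" by (simp add: mult.commute)
    also have "\<dots> = of_int w * of_nat res" using arg_cong[OF uw, of "of_int :: int \<Rightarrow> complex"] by (simp add: algebra_simps)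
    finally have "1 - x * (cj x * of_int u) \<in> \<pp>" using wl by simp
    thus ?thesis using O_mult[OF cj_in_O[OF x(1)] Ints_in_O] by blast
  next
    case True
    hence "x * cj x \<in> \<pp>" using n of_int_in_pp by simp
    hence c: "cj x \<in> \<pp>" using pp_prime[OF x(1) cj_in_O[OF x(1)]] x(2) by blast
    obtain t where t: "x + cj x = of_int t" using trace_Ints[OF x(1)] by blast
    have "\<not> int res dvd t"
    proof
      assume "int res dvd t"
      hence "x + cj x \<in> \<pp>" using t of_int_in_pp by simp
      from pp_add[OF this pp_minus[OF c]] show False using x(2) by simp
    qed
    then obtain u w where uw: "u * t + w * int res = 1" using inv by blast
    have "x * of_int u = of_int (u * t) - of_int u * cj x"
      unfolding of_int_mult t [symmetric] by (simp add: algebra_simps)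
    moreover have "of_int (u * t) = 1 - of_int w * (of_nat res :: complex)"
      using arg_cong[OF uw, of "of_int :: int \<Rightarrow> complex"] by (simp add: algebra_simps)
    ultimately have "1 - x * of_int u = of_int w * of_nat res + of_int u * cj x" by simp
    also have "\<dots> \<in> \<pp>" by (intro pp_add wl pp_mult' c Ints_in_O)
    finally show ?thesis using Ints_in_O by blast
  qed
qed

text \<open>Both trace and norm of \<open>cj b * e\<close> are divisible enough, the trace by polarisation of the norm.\<close>

lemma conj_mult_pp:
  assumes "b \<in> \<pp>" "e \<in> \<pp>"
  shows "cj b * e / of_nat res \<in> OK"
proof -
  define y where "y = cj b * e / of_nat res"
  have bO: "b \<in> OK" "e \<in> OK" using assms pp_O by auto
  have K: "b \<in> K" "e \<in> K" "cj b \<in> K" "cj e \<in> K" using bO O_K cj_in by auto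
  have lK: "1 / of_nat res \<in> K" using Rats_sub by auto
  have y_eq: "y = (cj b * e) * (1 / of_nat res)" by (simp add: y_def)
  have yK: "y \<in> K" unfolding y_eq by (intro K_mult K lK)
  have cjl: "cj (1 / of_nat res) = 1 / of_nat res" by (rule cj_Rats) auto
  have cy: "cj y = (b * cj e) * (1 / of_nat res)"
    unfolding y_eq using K lK by (simp only: cj_mult K_mult cj_cj cjl)
  have nl: "\<exists>m. x * cj x = of_nat res * of_int m" if x: "x \<in> \<pp>" for x
  proof -
    obtain n where n: "x * cj x = of_int n" using norm_Ints[OF pp_O[OF x]] by blast
    have "of_int n \<in> \<pp>" unfolding n [symmetric] by (rule pp_mult[OF x cj_in_O[OF pp_O[OF x]]])
    then obtain m where "n = int res * m" using of_int_in_pp by blast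
    thus ?thesis using n by auto
  qed
  obtain m1 m2 m3 where m: "b * cj b = of_nat res * of_int m1" "e * cj e = of_nat res * of_int m2"
     "(b + e) * cj (b + e) = of_nat res * of_int m3"
    using nl[OF assms(1)] nl[OF assms(2)] nl[OF pp_add[OF assms]] by blast
  have "cj b * e + b * cj e = (b + e) * cj (b + e) - b * cj b - e * cj e"
    using K by (simp add: cj_add algebra_simps)
  also have "\<dots> = of_nat res * of_int (m3 - m1 - m2)" unfolding m by (simp add: algebra_simps)
  finally have tr: "cj b * e + b * cj e = of_nat res * of_int (m3 - m1 - m2)" .
  have "y + cj y = (cj b * e + b * cj e) * (1 / of_nat res)" unfolding cy unfolding y_eq by (simp only: distrib_right)
  also have "\<dots> = of_int (m3 - m1 - m2)" unfolding tr using res_nonzero by simp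
  finally have 1: "y + cj y \<in> \<int>" by (metis Ints_of_int)
  have "y * cj y = (b * cj b) * (e * cj e) * ((1 / of_nat res) * (1 / of_nat res))"
    unfolding cy unfolding y_eq by (simp only: mult_ac)
  also have "\<dots> = of_int (m1 * m2)" unfolding m using res_nonzero by simp
  finally have 2: "y * cj y \<in> \<int>" by (metis Ints_of_int)
  show ?thesis using 1 2 yK unfolding y_def [symmetric] ring_of_integers_iff by blast
qed

text \<open>States that \<pp> becomes principal after inverting s. If \<open>res\<close> divides all
  of \<pp>, it is itself a generator. Otherwise y = cj b / res, for some b not divisible by
  \<open>res\<close>, maps \<pp> into the integers but not into \<pp>; choosing p with s = y p
  outside \<pp> gives s a = p (y a).\<close>

lemma local_uniformizer: "\<exists>p\<in>\<pp>. \<exists>s\<in>OK. s \<notin> \<pp> \<and> (\<forall>a\<in>\<pp>. \<exists>c\<in>OK. s * a = p * c)"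
proof (cases "\<forall>b\<in>\<pp>. b / of_nat res \<in> OK")
  case True
  have "\<forall>a\<in>\<pp>. \<exists>c\<in>OK. 1 * a = of_nat res * c"
  proof
    fix a assume "a \<in> \<pp>"
    thus "\<exists>c\<in>OK. 1 * a = of_nat res * c"
      using True res_nonzero by (intro bexI[of _ "a / of_nat res"]) auto
  qed
  moreover have "1 \<in> OK" using Ints_in_O[of 1] by simp
  ultimately show ?thesis using res_in_pp one_notin_pp by blast
next
  case False
  then obtain b where b: "b \<in> \<pp>" "b / of_nat res \<notin> OK" by blast
  define y where "y = cj b / of_nat res"
  have bO: "b \<in> OK" and bK: "b \<in> K" using b pp_O O_K by auto
  have lK: "1 / of_nat res \<in> K" using Rats_sub by auto
  have cjl: "cj (1 / of_nat res) = 1 / of_nat res" by (rule cj_Rats) auto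
  have y_eq: "y = cj b * (1 / of_nat res)" by (simp add: y_def)
  have yK: "y \<in> K" unfolding y_eq by (intro K_mult cj_in bK lK)
  have cy: "cj y = b * (1 / of_nat res)" unfolding y_eq using bK lK by (simp only: cj_mult cj_in cj_cj cjl)
  have yO: "y \<notin> OK"
  proof
    assume "y \<in> OK"
    hence "cj y \<in> OK" by (rule cj_in_O)
    thus False using b(2) unfolding cy by simp
  qed
  have y_mult: "y * e \<in> OK" if "e \<in> \<pp>" for e using conj_mult_pp[OF b(1) that] by (simp add: y_def)
  have "\<exists>p\<in>\<pp>. y * p \<notin> \<pp>"
  proof (rule ccontr)
    assume "\<not> (\<exists>p\<in>\<pp>. y * p \<notin> \<pp>)"
    hence all: "y * p \<in> \<pp>" if "p \<in> \<pp>" for p using that by blast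
    \<comment> \<open>If y \<pp> were contained in \<pp>, then applying y to \<open>res\<close>
      makes the trace of b divisible by \<open>res\<close>, and applying it to b makes its norm
      divisible by the square of \<open>res\<close>; y would be an integer.\<close>
    have "y * of_nat res = cj b" using res_nonzero by (simp add: y_def)
    hence cb: "cj b \<in> \<pp>" using all[OF res_in_pp] by simp
    obtain t where t: "b + cj b = of_int t" using trace_Ints[OF bO] by blast
    have "of_int t \<in> \<pp>" unfolding t [symmetric] by (rule pp_add[OF b(1) cb])
    then obtain t' where t': "t = int res * t'" using of_int_in_pp by blast
    obtain n where n: "b * cj b = of_int n" using norm_Ints[OF bO] by blast
    have "of_int n \<in> \<pp>" unfolding n [symmetric] by (rule pp_mult[OF b(1) pp_O[OF cb]])
    then obtain n' where n': "n = int res * n'" using of_int_in_pp by blast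
    have "y * b = (b * cj b) * (1 / of_nat res)" unfolding y_eq by (simp only: mult_ac)
    also have "\<dots> = of_int n'" unfolding n n' using res_nonzero by simp
    finally have "of_int n' \<in> \<pp>" using all[OF b(1)] by simp
    then obtain n'' where n'': "n' = int res * n''" using of_int_in_pp by blast
    have "y + cj y = (b + cj b) * (1 / of_nat res)" unfolding cy unfolding y_eq by (simp only: distrib_right add.commute)
    also have "\<dots> = of_int t'" unfolding t t' using res_nonzero by simp
    finally have 1: "y + cj y \<in> \<int>" by (metis Ints_of_int)
    have "y * cj y = (b * cj b) * ((1 / of_nat res) * (1 / of_nat res))" unfolding cy unfolding y_eq by (simp only: mult_ac)
    also have "\<dots> = of_int n''" unfolding n n' n'' using res_nonzero by simp
    finally have 2: "y * cj y \<in> \<int>" by (metis Ints_of_int)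
    show False using yO yK 1 2 unfolding ring_of_integers_iff by blast
  qed
  then obtain p where p: "p \<in> \<pp>" "y * p \<notin> \<pp>" by blast
  have "\<forall>a\<in>\<pp>. \<exists>c\<in>OK. (y * p) * a = p * c"
  proof
    fix a assume "a \<in> \<pp>"
    thus "\<exists>c\<in>OK. (y * p) * a = p * c"
      using y_mult by (intro bexI[of _ "y * a"]) auto
  qed
  thus ?thesis using p y_mult[OF p(1)] by blast
qed

section \<open>Powers of a prime ideal and the valuation\<close>

definition pow :: "nat \<Rightarrow> complex set"
  where "pow n = \<pp> [^]\<^bsub>ideals_set (\<O> K)\<^esub> n"

lemma pow_0: "pow 0 = OK"
  by (simp add: pow_def ideals_set_def nat_pow_def integer_ring_simps)

lemma pow_Suc: "pow (Suc n) = ideal_prod (\<O> K) (pow n) \<pp>"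
  by (simp add: pow_def ideals_set_def nat_pow_def)

lemma pow_Suc_prod: "i \<in> pow n \<Longrightarrow> j \<in> \<pp> \<Longrightarrow> i * j \<in> pow (Suc n)"
  unfolding pow_Suc using ideal_prod.prod[of i "pow n" j \<pp> "\<O> K"] by (simp add: integer_ring_simps)

lemma pow_Suc_induct [consumes 1, case_names prod add]:
  assumes "a \<in> pow (Suc n)" "\<And>i j. i \<in> pow n \<Longrightarrow> j \<in> \<pp> \<Longrightarrow> P (i * j)"
    "\<And>x y. x \<in> pow (Suc n) \<Longrightarrow> y \<in> pow (Suc n) \<Longrightarrow> P x \<Longrightarrow> P y \<Longrightarrow> P (x + y)"
  shows "P a"
  using assms(1) unfolding pow_Suc
proof (induction rule: ideal_prod.induct)
  case (prod i j)
  thus ?case using assms(2) by (simp add: integer_ring_simps)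
next
  case (sum x y)
  thus ?case using assms(3) by (simp add: integer_ring_simps pow_Suc)
qed

lemma pow_add: "x \<in> pow n \<Longrightarrow> y \<in> pow n \<Longrightarrow> x + y \<in> pow n"
proof (cases n)
  case (Suc m)
  assume "x \<in> pow n" "y \<in> pow n"
  thus ?thesis unfolding Suc pow_Suc using ideal_prod.sum[of x "\<O> K" "pow m" \<pp> y] by (simp add: integer_ring_simps)
qed (auto simp: pow_0 intro: O_add)

lemma pow_mult: "x \<in> pow n \<Longrightarrow> y \<in> OK \<Longrightarrow> x * y \<in> pow n"
proof (induction n arbitrary: x y)
  case (Suc n)
  from Suc.prems(1) show ?case
  proof (induction rule: pow_Suc_induct)
    case (prod i j)
    have "i * (j * y) \<in> pow (Suc n)" by (intro pow_Suc_prod pp_mult prod Suc.prems)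
    thus ?case by (simp add: mult.assoc)
  next
    case (add u v)
    thus ?case by (simp add: distrib_right pow_add)
  qed
qed (auto simp: pow_0 intro: O_mult)

lemma pow_O: "x \<in> pow n \<Longrightarrow> x \<in> OK"
proof (induction n arbitrary: x)
  case (Suc n)
  from Suc.prems show ?case
    by (induction rule: pow_Suc_induct) (auto intro: O_mult O_add Suc.IH pp_O)
qed (simp add: pow_0)

lemma pow_Suc_subset: "pow (Suc n) \<subseteq> pow n"
proof
  fix x assume "x \<in> pow (Suc n)"
  thus "x \<in> pow n" by (induction rule: pow_Suc_induct) (auto intro: pow_mult pp_O pow_add)
qed

lemma pow_antimono: "m \<le> n \<Longrightarrow> pow n \<subseteq> pow m"
  by (induction rule: dec_induct) (use pow_Suc_subset in blast)+

text \<open>With t inverse to s modulo \<pp>, write a = a (1 - s t) + (s a) t; the first summand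
  gains one power of \<pp>.\<close>

lemma pow_primary:
  assumes "s \<in> OK" "s \<notin> \<pp>" "a \<in> OK" "s * a \<in> pow n"
  shows "a \<in> pow n"
  using assms(4)
proof (induction n)
  case (Suc n)
  obtain t where t: "t \<in> OK" "1 - s * t \<in> \<pp>" using O_inverse_mod[OF assms(1,2)] by blast
  have "a \<in> pow n" using Suc pow_Suc_subset by blast
  hence "a * (1 - s * t) \<in> pow (Suc n)" by (rule pow_Suc_prod[OF _ t(2)])
  moreover have "(s * a) * t \<in> pow (Suc n)" by (rule pow_mult[OF Suc.prems t(1)])
  ultimately have "a * (1 - s * t) + (s * a) * t \<in> pow (Suc n)" by (rule pow_add)
  thus ?case by (simp add: algebra_simps)
qed (use assms(3) in \<open>simp add: pow_0\<close>)

text \<open>Elements of a power of \<pp> are sums of products, so the case n = 1 is propagated by an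
  induction in each of the two arguments. For b = e it says that the norm is divisible by the n-th
  power of \<open>res\<close>.\<close>

lemma conj_mult_pow:
  "b \<in> pow n \<Longrightarrow> e \<in> pow n \<Longrightarrow> cj b * e / of_nat res ^ n \<in> OK"
proof (induction n arbitrary: b e)
  case 0
  thus ?case by (auto simp: pow_0 intro: O_mult cj_in_O)
next
  case (Suc n)
  have "\<forall>e\<in>pow (Suc n). cj b * e / of_nat res ^ Suc n \<in> OK"
    using Suc.prems(1)
  proof (induction rule: pow_Suc_induct)
    case (prod b1 b2)
    show ?case
    proof
      fix e assume "e \<in> pow (Suc n)"
      thus "cj (b1 * b2) * e / of_nat res ^ Suc n \<in> OK"
      proof (induction rule: pow_Suc_induct)
        case (prod e1 e2)
        have K: "b1 \<in> K" "b2 \<in> K" using \<open>b1 \<in> pow n\<close> \<open>b2 \<in> \<pp>\<close> pow_O pp_O O_K by auto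
        have "cj (b1 * b2) * (e1 * e2) / of_nat res ^ Suc n = (cj b1 * e1 / of_nat res ^ n) * (cj b2 * e2 / of_nat res)"
          using K by (simp add: cj_mult mult_ac)
        also have "\<dots> \<in> OK"
          by (intro O_mult Suc.IH conj_mult_pp) (use prod \<open>b1 \<in> pow n\<close> \<open>b2 \<in> \<pp>\<close> in auto)
        finally show ?case .
      next
        case (add u v)
        have "cj (b1 * b2) * (u + v) / of_nat res ^ Suc n =
            cj (b1 * b2) * u / of_nat res ^ Suc n + cj (b1 * b2) * v / of_nat res ^ Suc n"
          by (simp only: distrib_left add_divide_distrib)
        thus ?case using O_add[OF add(3,4)] by (simp only:)
      qed
    qed
  next
    case (add u v)
    have K: "u \<in> K" "v \<in> K" using add pow_O O_K by auto
    show ?case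
    proof
      fix e assume e: "e \<in> pow (Suc n)"
      have "cj (u + v) * e / of_nat res ^ Suc n = cj u * e / of_nat res ^ Suc n + cj v * e / of_nat res ^ Suc n"
        unfolding cj_add[OF K] by (simp only: distrib_right add_divide_distrib)
      thus "cj (u + v) * e / of_nat res ^ Suc n \<in> OK" using O_add add(3,4) e by (simp only:)
    qed
  qed
  thus ?case using Suc.prems(2) by blast
qed

text \<open>Membership in the m-th power makes res^m divide the norm n, which is impossible for m =
  |n|, since m < 2^m <= res^m.\<close>

lemma exists_notin_pow:
  assumes "a \<in> OK" "a \<noteq> 0"
  shows "\<exists>m. a \<notin> pow m"
proof (rule ccontr)
  assume "\<nexists>m. a \<notin> pow m"
  hence all: "a \<in> pow m" for m by blast
  obtain n where n: "a * cj a = of_int n" using norm_Ints[OF assms(1)] by blast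
  have "cj a \<noteq> 0" using cj_cj[OF O_K[OF assms(1)]] assms(2) by auto
  hence n0: "n \<noteq> 0" using n assms(2) by auto
  define m where "m = nat \<bar>n\<bar>"
  have "cj a * a / of_nat res ^ m \<in> OK" by (rule conj_mult_pow[OF all all])
  hence OK: "of_int n / of_nat res ^ m \<in> OK" using n by (simp add: mult.commute)
  hence "algebraic_int (of_int n / of_nat res ^ m :: complex)" by (simp add: ring_of_integers_def)
  hence "of_int n / of_nat res ^ m \<in> (\<int> :: complex set)" by (rule rational_algebraic_int_is_int) auto
  then obtain k where "of_int n / of_nat res ^ m = (of_int k :: complex)" by (auto elim: Ints_cases)
  hence "of_int n = (of_int (k * int res ^ m) :: complex)" using res_nonzero by (simp add: divide_eq_eq)
  hence nk: "n = k * int res ^ m" by (simp only: of_int_eq_iff)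
  hence "int res ^ m dvd n" by simp
  hence "\<bar>int res ^ m\<bar> \<le> \<bar>n\<bar>" by (rule dvd_imp_le_int[OF n0])
  hence "int res ^ m \<le> \<bar>n\<bar>" by simp
  moreover have "int m < int res ^ m"
  proof -
    have "m < 2 ^ m" by (rule less_exp)
    also have "2 ^ m \<le> res ^ m" using prime_ge_2_nat[OF prime_res] by (intro power_mono) auto
    finally show ?thesis by (metis of_nat_less_iff of_nat_power)
  qed
  ultimately show False by (simp add: m_def)
qed

lemma integral_valuation_props:
  assumes "a \<in> OK" "a \<noteq> 0"
  shows "a \<in> pow (integral_valuation K \<pp> a)" "a \<notin> pow (Suc (integral_valuation K \<pp> a))"
proof -
  obtain m where m: "a \<notin> pow m" using exists_notin_pow[OF assms] by blast
  have iv: "integral_valuation K \<pp> a = (GREATEST n. a \<in> pow n)" by (simp add: integral_valuation_def pow_def)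
  have bd: "n \<le> m" if "a \<in> pow n" for n
    using that m pow_antimono[of m n] by (meson nat_le_linear subsetD)
  have z: "a \<in> pow 0" using assms by (simp add: pow_0)
  show "a \<in> pow (integral_valuation K \<pp> a)" unfolding iv by (rule GreatestI_nat[where b = m and P = "\<lambda>n. a \<in> pow n", OF z]) (use bd in blast)
  show "a \<notin> pow (Suc (integral_valuation K \<pp> a))"
  proof
    assume "a \<in> pow (Suc (integral_valuation K \<pp> a))"
    hence "Suc (integral_valuation K \<pp> a) \<le> integral_valuation K \<pp> a"
      unfolding iv by (rule Greatest_le_nat[where b = m]) (use bd in blast)
    thus False by simp
  qed
qed

lemma integral_valuation_eqI:
  assumes "a \<in> OK" "a \<noteq> 0" "a \<in> pow n" "a \<notin> pow (Suc n)"
  shows "integral_valuation K \<pp> a = n"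
proof (rule antisym)
  let ?v = "integral_valuation K \<pp> a"
  show "?v \<le> n"
  proof (rule ccontr)
    assume "\<not> ?v \<le> n"
    hence "pow ?v \<subseteq> pow (Suc n)" by (intro pow_antimono) simp
    thus False using assms integral_valuation_props(1)[OF assms(1,2)] by blast
  qed
  show "n \<le> ?v"
  proof (rule ccontr)
    assume "\<not> n \<le> ?v"
    hence "pow n \<subseteq> pow (Suc ?v)" by (intro pow_antimono) simp
    thus False using assms integral_valuation_props(2)[OF assms(1,2)] by blast
  qed
qed

text \<open>With the local uniformizer p and the auxiliary s, exact order n means s^n a = p^n c with
  c outside \<pp>. Such equations multiply, and \<pp> being prime keeps the product of the cofactors
  outside \<pp>.\<close>

lemma integral_valuation_mult:
  assumes "a \<in> OK" "a \<noteq> 0" "b \<in> OK" "b \<noteq> 0"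
  shows "integral_valuation K \<pp> (a * b) = integral_valuation K \<pp> a + integral_valuation K \<pp> b"
proof -
  obtain p s where ps: "p \<in> \<pp>" "s \<in> OK" "s \<notin> \<pp>" "\<And>a. a \<in> \<pp> \<Longrightarrow> \<exists>c\<in>OK. s * a = p * c"
    using local_uniformizer by blast
  have p0: "p \<noteq> 0"
  proof
    assume "p = 0"
    hence "s * a = 0" if "a \<in> \<pp>" for a using ps(4)[OF that] by auto
    moreover have "s \<noteq> 0" using ps(3) pp_0 by auto
    ultimately have "\<pp> \<subseteq> {0}" by auto
    thus False using pp_nonzero pp_0 by auto
  qed
  have pow_p: "p ^ n * c \<in> pow n" if "c \<in> OK" for n c
  proof -
    have "p ^ n \<in> pow n"
    proof (induction n)
      case (Suc n)
      from pow_Suc_prod[OF Suc.IH ps(1)] show ?case by (simp add: mult.commute)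
    qed (use Ints_in_O[of 1] in \<open>simp add: pow_0\<close>)
    thus ?thesis by (rule pow_mult[OF _ that])
  qed
  have factor: "\<exists>c\<in>OK. s ^ n * a = p ^ n * c" if "a \<in> pow n" for n a
    using that
  proof (induction n arbitrary: a)
    case (Suc n)
    from Suc.prems show ?case
    proof (induction rule: pow_Suc_induct)
      case (prod i j)
      obtain c d where cd: "c \<in> OK" "s ^ n * i = p ^ n * c" "d \<in> OK" "s * j = p * d"
        using Suc.IH[OF prod(1)] ps(4)[OF prod(2)] by blast
      have "s ^ Suc n * (i * j) = (s ^ n * i) * (s * j)" by (simp add: mult_ac)
      also have "\<dots> = p ^ Suc n * (c * d)" unfolding cd by (simp add: mult_ac)
      finally show ?case using O_mult[OF cd(1,3)] by blast
    next
      case (add u v)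
      then obtain c d where "c \<in> OK" "d \<in> OK" "s ^ Suc n * u = p ^ Suc n * c" "s ^ Suc n * v = p ^ Suc n * d" by blast
      hence "s ^ Suc n * (u + v) = p ^ Suc n * (c + d)" "c + d \<in> OK" by (auto simp only: distrib_left intro: O_add)
      thus ?case by blast
    qed
  qed (auto simp: pow_0)
  have exact: "\<exists>c\<in>OK. c \<notin> \<pp> \<and> s ^ n * a = p ^ n * c" if ex: "a \<in> OK" "a \<in> pow n" "a \<notin> pow (Suc n)" for a n
  proof -
    obtain c where c: "c \<in> OK" "s ^ n * a = p ^ n * c" using factor[OF ex(2)] by blast
    have "c \<notin> \<pp>"
    proof
      assume "c \<in> \<pp>"
      then obtain d where d: "d \<in> OK" "s * c = p * d" using ps(4) by blast
      have "s ^ Suc n * a = s * (s ^ n * a)" by simp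
      also have "\<dots> = p ^ n * (s * c)" unfolding c by simp
      also have "\<dots> = p ^ Suc n * d" unfolding d by simp
      finally have "s ^ Suc n * a \<in> pow (Suc n)" by (simp only: pow_p[OF d(1)])
      hence "a \<in> pow (Suc n)" by (rule pow_primary[OF O_power[OF ps(2)] power_notin_pp[OF ps(2,3)] ex(1)])
      thus False using ex(3) by blast
    qed
    thus ?thesis using c by blast
  qed
  let ?m = "integral_valuation K \<pp> a" and ?n = "integral_valuation K \<pp> b"
  obtain c d where cd: "c \<in> OK" "c \<notin> \<pp>" "s ^ ?m * a = p ^ ?m * c" "d \<in> OK" "d \<notin> \<pp>" "s ^ ?n * b = p ^ ?n * d"
    using exact[OF assms(1) integral_valuation_props[OF assms(1,2)]] exact[OF assms(3) integral_valuation_props[OF assms(3,4)]]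
    by blast
  have abO: "a * b \<in> OK" by (intro O_mult assms)
  have "s ^ (?m + ?n) * (a * b) = (s ^ ?m * a) * (s ^ ?n * b)" by (simp add: power_add mult_ac)
  also have "\<dots> = p ^ (?m + ?n) * (c * d)" unfolding cd by (simp add: power_add mult_ac)
  finally have ab: "s ^ (?m + ?n) * (a * b) = p ^ (?m + ?n) * (c * d)" .
  show ?thesis
  proof (rule integral_valuation_eqI[OF abO])
    show "a * b \<noteq> 0" using assms by simp
    have "s ^ (?m + ?n) * (a * b) \<in> pow (?m + ?n)" unfolding ab by (intro pow_p O_mult cd)
    thus "a * b \<in> pow (?m + ?n)"
      by (rule pow_primary[OF O_power[OF ps(2)] power_notin_pp[OF ps(2,3)] abO])
    show "a * b \<notin> pow (Suc (?m + ?n))"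
    proof
      assume "a * b \<in> pow (Suc (?m + ?n))"
      then obtain e where e: "e \<in> OK" "s ^ Suc (?m + ?n) * (a * b) = p ^ Suc (?m + ?n) * e" using factor by blast
      have "p ^ (?m + ?n) * (s * (c * d)) = s * (s ^ (?m + ?n) * (a * b))" unfolding ab by simp
      also have "\<dots> = p ^ (?m + ?n) * (p * e)" using e(2) by (simp add: mult_ac)
      finally have "s * (c * d) = p * e" using p0 by simp
      hence "s * (c * d) \<in> \<pp>" using pp_mult[OF ps(1) e(1)] by simp
      thus False using pp_prime ps cd O_mult by metis
    qed
  qed
qed

text \<open>Additivity makes the definite description meaningful: if x = a / b then a = x b, so the
  difference of orders depends only on x.\<close>

lemma valuation_nonneg:
  assumes "x \<in> OK" "x \<noteq> 0"
  shows "valuation K \<pp> x = int (integral_valuation K \<pp> x)"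
  unfolding valuation_def
proof (rule the_equality)
  have one: "(1 :: complex) \<in> OK" using Ints_in_O[of 1] by simp
  have "integral_valuation K \<pp> (1 * 1) = integral_valuation K \<pp> 1 + integral_valuation K \<pp> 1"
    by (rule integral_valuation_mult) (use one in auto)
  hence v1: "integral_valuation K \<pp> 1 = 0" by simp
  show "\<exists>a\<in>OK - {0}. \<exists>b\<in>OK - {0}. x = a / b \<and> int (integral_valuation K \<pp> x) =
      int (integral_valuation K \<pp> a) - int (integral_valuation K \<pp> b)"
    by (rule bexI[of _ x], rule bexI[of _ 1]) (use assms one v1 in auto)
next
  fix k assume "\<exists>a\<in>OK - {0}. \<exists>b\<in>OK - {0}. x = a / b \<and> k = int (integral_valuation K \<pp> a) - int (integral_valuation K \<pp> b)"
  then obtain a b where ab: "a \<in> OK" "b \<in> OK" "b \<noteq> 0" "x = a / b"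
    "k = int (integral_valuation K \<pp> a) - int (integral_valuation K \<pp> b)" by auto
  have "a = x * b" using ab by simp
  thus "k = int (integral_valuation K \<pp> x)"
    using integral_valuation_mult[OF assms ab(2,3)] ab(5) by simp
qed

lemma finite_place_norm_le_1:
  assumes "x \<in> OK"
  shows "finite_place_norm K \<pp> x \<le> 1"
proof (cases "x = 0")
  case False
  define c where "c = card (carrier (\<O> K Quot \<pp>))"
  have "finite_place_norm K \<pp> x = inverse (real c ^ integral_valuation K \<pp> x)"
    using False valuation_nonneg[OF assms False] by (simp add: finite_place_norm_def c_def power_int_minus)
  also have "\<dots> \<le> 1"
  \<comment> \<open>The cardinality of an infinite quotient would be 0 by convention; the inverse of
    0^n is then 0 or 1, and the bound persists.\<close>
  proof (cases "c = 0")
    case False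
    hence "real c ^ integral_valuation K \<pp> x \<ge> 1" by (intro one_le_power) auto
    thus ?thesis by (rule inverse_le_1_iff[THEN iffD2, OF disjI2])
  qed (cases "integral_valuation K \<pp> x", auto)
  finally show ?thesis .
qed (simp add: finite_place_norm_def)

end

lemma weil_height_le:
  assumes "number_field K" "field_degree K \<le> 2"
  obtains cj where "quadratic_conj K cj"
    "\<And>x. x \<in> ring_of_integers K \<Longrightarrow> weil_height K x \<le> (ln (max 1 (cmod x)) + ln (max 1 (cmod (cj x)))) / 2"
proof -
  obtain cj where cj: "quadratic_conj K cj"
    "\<And>(f :: complex \<Rightarrow> real) x. (\<And>y. f y \<ge> 0) \<Longrightarrow> x \<in> K \<Longrightarrow>
       (\<Sum>\<sigma>\<in>embeddings K. f (\<sigma> x)) / real (field_degree K) \<le> (f x + f (cj x)) / 2"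
    using exists_quadratic_conj[OF assms] by blast
  have "weil_height K x \<le> (ln (max 1 (cmod x)) + ln (max 1 (cmod (cj x)))) / 2" if x: "x \<in> ring_of_integers K" for x
  proof -
    have "(\<Sum>\<^sub>\<infinity>\<pp>\<in>finite_places K. ln (max 1 (finite_place_norm K \<pp> x))) = 0"
    proof (rule infsum_0)
      fix \<pp> assume "\<pp> \<in> finite_places K"
      hence pl: "quadratic_place K cj \<pp>"
        using cj(1) by (simp add: quadratic_place_def quadratic_place_axioms_def finite_places_def)
      show "ln (max 1 (finite_place_norm K \<pp> x)) = 0"
        using quadratic_place.finite_place_norm_le_1[OF pl x] by (simp add: max_absorb1)
    qed
    moreover have "x \<in> K" using x by (simp add: ring_of_integers_def)
    ultimately show ?thesis using cj(2)[of "\<lambda>y. ln (max 1 (cmod y))" x] by (simp add: weil_height_def)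
  qed
  thus thesis using that cj(1) by blast
qed

section \<open>Integral expansions\<close>

definition int_fps :: "complex fps set"
  where "int_fps = {F. \<forall>n. fps_nth F n \<in> \<int>}"

lemma int_fps_mult: "F \<in> int_fps \<Longrightarrow> G \<in> int_fps \<Longrightarrow> F * G \<in> int_fps"
  by (auto simp: int_fps_def fps_mult_nth intro!: Ints_sum Ints_mult)

lemma int_fps_1: "1 \<in> int_fps"
  by (auto simp: int_fps_def)

lemma int_fps_power: "F \<in> int_fps \<Longrightarrow> F ^ n \<in> int_fps"
  by (induction n) (auto intro: int_fps_mult int_fps_1)

lemma int_fps_X_power: "fps_X ^ n \<in> int_fps"
  by (auto simp: int_fps_def)

lemma int_fps_compose: "F \<in> int_fps \<Longrightarrow> G \<in> int_fps \<Longrightarrow> F oo G \<in> int_fps"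
  using int_fps_power[of G] by (auto simp: int_fps_def fps_compose_nth intro!: Ints_sum Ints_mult)

lemma int_fps_inverse:
  assumes "F \<in> int_fps" "fps_nth F 0 = 1"
  shows "inverse F \<in> int_fps"
proof -
  have "fps_nth (inverse F) n \<in> \<int>" for n
  proof (induction n rule: less_induct)
    case (less n)
    show ?case
    proof (cases "n = 0")
      case False
      have "F * inverse F = 1" using assms(2) by (simp add: inverse_mult_eq_1')
      hence "0 = fps_nth (F * inverse F) n" using False by simp
      also have "\<dots> = (\<Sum>i=0..n. fps_nth F i * fps_nth (inverse F) (n - i))" by (rule fps_mult_nth)
      also have "\<dots> = fps_nth F 0 * fps_nth (inverse F) n + (\<Sum>i=Suc 0..n. fps_nth F i * fps_nth (inverse F) (n - i))"
        by (subst sum.atLeast_Suc_atMost) auto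
      finally have "fps_nth (inverse F) n = - (\<Sum>i=Suc 0..n. fps_nth F i * fps_nth (inverse F) (n - i))"
        using assms(2) by (simp add: eq_neg_iff_add_eq_0)
      also have "\<dots> \<in> \<int>"
        using assms(1) less by (auto simp: int_fps_def intro!: Ints_minus Ints_sum Ints_mult)
      finally show ?thesis .
    qed (use assms(2) in simp)
  qed
  thus ?thesis by (simp add: int_fps_def)
qed

text \<open>Comparing coefficients of X^m in X F' = -s F expresses m F_m through earlier
  coefficients of F and those of s up to m.\<close>

lemma log_derivative_determines:
  fixes F G s t :: "complex fps"
  assumes F: "fps_X * fps_deriv F = - s * F" and G: "fps_X * fps_deriv G = - t * G"
    and eq: "\<And>m. m \<le> N \<Longrightarrow> fps_nth s m = fps_nth t m" and s0: "fps_nth s 0 = 0"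
    and FG: "fps_nth F 0 = fps_nth G 0" and m: "m \<le> N"
  shows "fps_nth F m = fps_nth G m"
  using m
proof (induction m rule: less_induct)
  case (less m)
  show ?case
  proof (cases "m = 0")
    case False
    have key: "of_nat m * fps_nth H m = - (\<Sum>i=Suc 0..m. fps_nth r i * fps_nth H (m - i))"
      if H: "fps_X * fps_deriv H = - r * H" and r0: "fps_nth r 0 = 0" for H r :: "complex fps"
    proof -
      have "fps_nth (fps_X * fps_deriv H) m = of_nat m * fps_nth H m" using False by (cases m) auto
      hence "of_nat m * fps_nth H m = - fps_nth (r * H) m" using H by simp
      also have "fps_nth (r * H) m = (\<Sum>i=Suc 0..m. fps_nth r i * fps_nth H (m - i))"
        unfolding fps_mult_nth by (subst sum.atLeast_Suc_atMost) (auto simp: r0)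
      finally show ?thesis .
    qed
    have "of_nat m * fps_nth F m = of_nat m * fps_nth G m"
      unfolding key[OF F s0] key[OF G eq[OF le0, symmetric, unfolded s0]]
      using less.IH less.prems eq by (intro arg_cong[of _ _ uminus] sum.cong) auto
    thus ?thesis using False by simp
  qed (use FG in simp)
qed

text \<open>The finite Euler product up to N. Its logarithmic derivative counts only divisors up to
  N, so it agrees with the full divisor sum in degrees up to N.\<close>

lemma partial_euler_log_derivative:
  defines "Q \<equiv> \<lambda>N. \<Prod>n=1..N. (1 - fps_X ^ n :: complex fps)"
    and "s \<equiv> \<lambda>N. Abs_fps (\<lambda>m. of_nat (\<Sum>n | n \<in> {1..N} \<and> n dvd m \<and> m \<noteq> 0. n))"
  shows "fps_X * fps_deriv (Q N) = - s N * Q N"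
proof (induction N)
  case 0
  have "s 0 = 0" unfolding s_def by (rule fps_ext) simp
  thus ?case by (simp add: Q_def)
next
  case (Suc N)
  define t where "t = Abs_fps (\<lambda>m. if Suc N dvd m \<and> m \<noteq> 0 then of_nat (Suc N) else 0 :: complex)"
  have s_Suc: "s (Suc N) = s N + t"
  proof (rule fps_ext)
    fix m
    have "{n \<in> {1..Suc N}. n dvd m \<and> m \<noteq> 0} =
        {n \<in> {1..N}. n dvd m \<and> m \<noteq> 0} \<union> (if Suc N dvd m \<and> m \<noteq> 0 then {Suc N} else {})"
      by (auto simp: le_Suc_eq)
    hence "(\<Sum>n | n \<in> {1..Suc N} \<and> n dvd m \<and> m \<noteq> 0. n) =
        (\<Sum>n | n \<in> {1..N} \<and> n dvd m \<and> m \<noteq> 0. n) + (if Suc N dvd m \<and> m \<noteq> 0 then Suc N else 0)"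
      by (simp only:) (subst sum.union_disjoint, auto)
    thus "fps_nth (s (Suc N)) m = fps_nth (s N + t) m"
      unfolding s_def t_def fps_add_nth fps_nth_Abs_fps by (simp only: of_nat_add) simp
  qed
  have t_eq: "t * (1 - fps_X ^ Suc N) = of_nat (Suc N) * fps_X ^ Suc N"
  proof (rule fps_ext)
    fix m
    have "fps_nth (t * (1 - fps_X ^ Suc N)) m = fps_nth t m - (if m < Suc N then 0 else fps_nth t (m - Suc N))"
      by (simp only: right_diff_distrib mult_1_right fps_sub_nth fps_X_power_mult_right_nth)
    also have "\<dots> = (if m = Suc N then of_nat (Suc N) else 0)"
    proof (cases "m < Suc N")
      case True
      thus ?thesis by (auto simp: t_def dest: dvd_imp_le)
    next
      case False
      have "Suc N dvd m - Suc N \<longleftrightarrow> Suc N dvd m" using False by (simp add: dvd_diff_nat dvd_minus_self)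
      thus ?thesis using False by (auto simp: t_def)
    qed
    also have "\<dots> = fps_nth (of_nat (Suc N) * fps_X ^ Suc N) m"
      by (cases m) (auto simp: fps_of_nat[symmetric] simp del: of_nat_Suc)
    finally show "fps_nth (t * (1 - fps_X ^ Suc N)) m = fps_nth (of_nat (Suc N) * fps_X ^ Suc N) m" .
  qed
  have Q_Suc: "Q (Suc N) = Q N * (1 - fps_X ^ Suc N)" by (simp add: Q_def)
  have "fps_deriv (1 - fps_X ^ Suc N :: complex fps) = - (of_nat (Suc N) * fps_X ^ N)"
    by (simp add: fps_deriv_power fps_of_nat[symmetric] del: of_nat_Suc power_Suc)
  hence d: "fps_X * fps_deriv (1 - fps_X ^ Suc N :: complex fps) = - (t * (1 - fps_X ^ Suc N))"
    unfolding t_eq by (simp add: mult_ac)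
  have "fps_X * fps_deriv (Q (Suc N)) =
      (fps_X * fps_deriv (Q N)) * (1 - fps_X ^ Suc N) + Q N * (fps_X * fps_deriv (1 - fps_X ^ Suc N))"
    unfolding Q_Suc by (simp only: fps_deriv_mult distrib_left mult_ac add_ac)
  also have "\<dots> = - s (Suc N) * Q (Suc N)"
    unfolding d Suc.IH s_Suc Q_Suc by (simp add: algebra_simps)
  finally show ?case .
qed

text \<open>The definition by an exponential hides that the coefficients are integers. Up to degree
  N they coincide with those of the finite product of 1 - X^n for n <= N, because the logarithmic
  derivatives do.\<close>

lemma euler_expansion:
  obtains P where "euler has_fps_expansion P" "P \<in> int_fps" "fps_nth P 0 = 1"
proof -
  have "euler analytic_on {0}"
    using holomorphic_on_euler by (auto simp: analytic_on_open intro: analytic_on_subset[of euler "ball 0 1"])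
  then obtain P where P: "euler has_fps_expansion P"
    using analytic_at_imp_has_fps_expansion_0 by blast
  have P0: "fps_nth P 0 = 1" using has_fps_expansion_imp_0_eq_fps_nth_0[OF P] by simp
  have "(\<lambda>w. w * deriv euler w) has_fps_expansion fps_X * fps_deriv P"
    by (intro fps_expansion_intros P)
  moreover have ev: "eventually (\<lambda>w. - eval_fps (lamb 1) w * euler w = w * deriv euler w) (nhds 0)"
  proof -
    have "eventually (\<lambda>w. w \<in> ball 0 1) (nhds (0 :: complex))" by (intro eventually_nhds_in_open) auto
    thus ?thesis
    proof eventually_elim
      case (elim w)
      hence w: "norm w < 1" by simp
      have "deriv euler w = - eval_fps (fps_deriv log_euler) w * euler w"
        by (rule DERIV_imp_deriv[OF euler_has_field_derivative[OF w]])
      thus ?case using log_euler_deriv[OF w] by (simp flip: log_euler_deriv[OF w])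
    qed
  qed
  have lr: "fps_conv_radius (lamb 1) > 0"
    by (rule less_le_trans[OF _ lamb_conv_radius]) simp_all
  have "(\<lambda>w. - eval_fps (lamb 1) w * euler w) has_fps_expansion - lamb 1 * P"
    by (intro fps_expansion_intros P eval_fps_has_fps_expansion lr)
  hence "(\<lambda>w. w * deriv euler w) has_fps_expansion - lamb 1 * P"
    using has_fps_expansion_cong[OF ev refl, of "- lamb 1 * P"] by simp
  ultimately have deriv_P: "fps_X * fps_deriv P = - lamb 1 * P" by (rule fps_expansion_unique_complex)
  have "fps_nth P N \<in> \<int>" for N
  proof -
    define Q where "Q = (\<Prod>n=1..N. (1 - fps_X ^ n :: complex fps))"
    have Q0: "fps_nth Q 0 = 1" unfolding Q_def by (induction N) auto
    have "fps_nth P N = fps_nth Q N"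
    proof (rule log_derivative_determines[OF deriv_P partial_euler_log_derivative[of N, folded Q_def]])
      fix m assume "m \<le> N"
      hence "{n \<in> {1..N}. n dvd m \<and> m \<noteq> 0} = {n. n dvd m}" if "m \<noteq> 0"
        using that by (auto dest: dvd_imp_le intro: Nat.gr0I)
      thus "fps_nth (lamb 1) m = fps_nth (Abs_fps (\<lambda>m. of_nat (\<Sum>n | n \<in> {1..N} \<and> n dvd m \<and> m \<noteq> 0. n))) m"
        by (cases "m = 0") (simp_all add: lamb_def sig_def)
    qed (simp_all add: P0 Q0 lamb_def)
    moreover have "Q \<in> int_fps"
    proof -
      have "(\<Prod>n\<in>A. (1 - fps_X ^ n :: complex fps)) \<in> int_fps" for A :: "nat set"
        by (induction A rule: infinite_finite_induct)
          (auto simp: int_fps_1 intro!: int_fps_mult, auto simp: int_fps_def)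
      thus ?thesis by (simp add: Q_def)
    qed
    ultimately show ?thesis by (simp add: int_fps_def)
  qed
  thus thesis using that[OF P _ P0] by (simp add: int_fps_def)
qed

section \<open>Expansions in the local parameter of level p\<close>

lemma nome_small:
  assumes "\<epsilon> > 0" "p > 0"
  shows "\<exists>Y. \<forall>z. Im z > Y \<longrightarrow> norm (nome (z / of_nat p)) < \<epsilon>"
proof (intro exI allI impI)
  fix z assume "Im z > - ln \<epsilon> * real p / (2 * pi)"
  hence "- ln \<epsilon> * real p < Im z * (2 * pi)" by (rule pos_divide_less_eq[THEN iffD1, rotated]) simp
  hence "- ln \<epsilon> < Im z * (2 * pi) / real p" using assms(2) by (simp add: pos_less_divide_eq)
  hence "- 2 * pi * (Im z / real p) < ln \<epsilon>" by (simp add: mult_ac)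
  hence "exp (- 2 * pi * (Im z / real p)) < exp (ln \<epsilon>)" by (simp only: exp_less_cancel_iff)
  thus "norm (nome (z / of_nat p)) < \<epsilon>" using assms by (simp add: norm_nome Im_divide_of_nat)
qed

lemma has_q_expansionI:
  assumes "H has_laurent_expansion L" "p > 0" "\<And>z. Im z > Y \<Longrightarrow> f z = H (nome (z / of_nat p))"
  shows "has_q_expansion p f L"
proof -
  have cr: "fls_conv_radius L > 0" and "eventually (\<lambda>u. eval_fls L u = H u) (at 0)"
    using assms(1) by (auto simp: has_laurent_expansion_def)
  then obtain \<epsilon> where \<epsilon>: "\<epsilon> > 0" "\<And>u. u \<noteq> 0 \<Longrightarrow> norm u < \<epsilon> \<Longrightarrow> eval_fls L u = H u"
    unfolding eventually_at dist_0_norm by auto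
  obtain Y' where Y': "\<And>z. Im z > Y' \<Longrightarrow> norm (nome (z / of_nat p)) < \<epsilon>"
    using nome_small[OF \<epsilon>(1) assms(2)] by blast
  have "f z = eval_fls L (exp (2 * of_real pi * \<i> * z / of_nat p))" if "Im z > max Y Y'" for z
  proof -
    have "eval_fls L (nome (z / of_nat p)) = H (nome (z / of_nat p))"
      using that by (intro \<epsilon>(2) Y') auto
    thus ?thesis using assms(3)[of z] that by (simp add: nome_def)
  qed
  thus ?thesis using cr unfolding has_q_expansion_def by blast
qed

lemma has_q_expansionE:
  assumes "has_q_expansion p f L"
  obtains Y where "eval_fls L has_laurent_expansion L" "\<And>z. Im z > Y \<Longrightarrow> f z = eval_fls L (nome (z / of_nat p))"
  using assms eval_fls_has_laurent_expansion unfolding has_q_expansion_def by (auto simp: nome_def)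

lemma has_q_expansion_combine:
  assumes "has_q_expansion p f F" "has_q_expansion p g G" "p > 0"
    and "(\<lambda>u. c (eval_fls F u) (eval_fls G u)) has_laurent_expansion H"
  shows "has_q_expansion p (\<lambda>z. c (f z) (g z)) H"
proof -
  obtain Y where Y: "\<And>z. Im z > Y \<Longrightarrow> f z = eval_fls F (nome (z / of_nat p))"
    using has_q_expansionE[OF assms(1)] by blast
  obtain Y' where Y': "\<And>z. Im z > Y' \<Longrightarrow> g z = eval_fls G (nome (z / of_nat p))"
    using has_q_expansionE[OF assms(2)] by blast
  show ?thesis
    by (rule has_q_expansionI[OF assms(4,3), of "max Y Y'"]) (use Y Y' in simp)
qed

lemma has_q_expansion_conv_radius: "has_q_expansion p f F \<Longrightarrow> fls_conv_radius F > 0"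
  by (simp add: has_q_expansion_def)

lemma
  assumes "has_q_expansion p f F" "has_q_expansion p g G" "p > 0"
  shows has_q_expansion_add: "has_q_expansion p (\<lambda>z. f z + g z) (F + G)"
    and has_q_expansion_mult: "has_q_expansion p (\<lambda>z. f z * g z) (F * G)"
    and has_q_expansion_diff: "has_q_expansion p (\<lambda>z. f z - g z) (F - G)"
  by (intro has_q_expansion_combine[OF assms] laurent_expansion_intros
      has_q_expansion_conv_radius[OF assms(1)] has_q_expansion_conv_radius[OF assms(2)])+

lemma has_q_expansion_const: "p > 0 \<Longrightarrow> has_q_expansion p (\<lambda>z. c) (fls_const c)"
  by (rule has_q_expansionI[of "\<lambda>_. c"]) auto

text \<open>Allows any lower bounds for the supports instead of the exact subdegrees. In a Galois
  family one bound must serve all members, whose subdegrees may differ.\<close>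

lemma fls_times_nth_bounds:
  fixes f g :: "complex fls"
  assumes "\<And>n. n < m \<Longrightarrow> fls_nth f n = 0" "\<And>n. n < m' \<Longrightarrow> fls_nth g n = 0"
  shows "fls_nth (f * g) n = (\<Sum>i=m..n - m'. fls_nth f i * fls_nth g (n - i))"
proof -
  define df dg where "df = fls_subdegree f" and "dg = fls_subdegree g"
  have z: "fls_nth f i = 0" if "i < max m df" for i
    using that assms(1)[of i] fls_eq0_below_subdegree[of i f] by (cases "i < m") (auto simp: df_def)
  have z': "fls_nth g i = 0" if "i < max m' dg" for i
    using that assms(2)[of i] fls_eq0_below_subdegree[of i g] by (cases "i < m'") (auto simp: dg_def)
  have *: "(\<Sum>i=a..n - b. fls_nth f i * fls_nth g (n - i)) =
      (\<Sum>i=max m df..n - max m' dg. fls_nth f i * fls_nth g (n - i))"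
    if "a \<le> max m df" "b \<le> max m' dg" for a b
    using that by (intro sum.mono_neutral_right ballI) (auto simp: z z')
  show ?thesis unfolding fls_times_nth(2) df_def[symmetric] dg_def[symmetric]
    using *[of df dg] *[of m m'] by simp
qed

section \<open>Galois conjugation of coefficients\<close>

text \<open>Member d is the series obtained when \<zeta> is replaced by \<zeta>^d. The integer
  polynomials \<open>R n\<close> do not depend on d, so conjugation is encoded by substitution
  instead of by an automorphism; d = 0 is allowed and specialises \<zeta> to 1.\<close>

definition galois_family :: "nat \<Rightarrow> (nat \<Rightarrow> complex fls) \<Rightarrow> bool"
  where "galois_family p F \<longleftrightarrow> (\<exists>R m. (\<forall>n<m. R n = 0) \<and>
    (\<forall>d n. fls_nth (F d) n = poly (map_poly of_int (R n :: int poly)) (root_unity p ^ d)))"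

lemma galois_familyI:
  assumes "\<And>n. n < m \<Longrightarrow> R n = 0"
    "\<And>d n. fls_nth (F d) n = poly (map_poly of_int (R n :: int poly)) (root_unity p ^ d)"
  shows "galois_family p F"
  unfolding galois_family_def using assms by blast

lemma of_int_poly_simps:
  "poly (map_poly of_int (a + b)) x = poly (map_poly of_int a) x + poly (map_poly of_int b) (x :: complex)"
  "poly (map_poly of_int (a * b)) x = poly (map_poly of_int a) x * poly (map_poly of_int b) x"
  "poly (map_poly of_int (- a)) x = - poly (map_poly of_int a) x"
  "poly (map_poly of_int (monom c k)) x = of_int c * x ^ k"
proof -
  have "map_poly of_int (a + b) = (map_poly of_int a + map_poly of_int b :: complex poly)"
    and "map_poly of_int (a * b) = (map_poly of_int a * map_poly of_int b :: complex poly)"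
    and "map_poly of_int (- a) = (- map_poly of_int a :: complex poly)"
    by (intro poly_eqI; simp add: coeff_map_poly coeff_mult)+
  thus "poly (map_poly of_int (a + b)) x = poly (map_poly of_int a) x + poly (map_poly of_int b) x"
    "poly (map_poly of_int (a * b)) x = poly (map_poly of_int a) x * poly (map_poly of_int b) x"
    "poly (map_poly of_int (- a)) x = - poly (map_poly of_int a) x"
    by simp_all
qed (simp add: poly_monom map_poly_monom)

lemma of_int_poly_sum: "poly (map_poly of_int (\<Sum>i\<in>A. f i)) x = (\<Sum>i\<in>A. poly (map_poly of_int (f i)) (x :: complex))"
  by (induction A rule: infinite_finite_induct) (simp_all add: of_int_poly_simps)

lemma galois_family_add:
  assumes "galois_family p F" "galois_family p G"
  shows "galois_family p (\<lambda>d. F d + G d)"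
proof -
  from assms obtain R m R' m' where *: "\<And>n. n < m \<Longrightarrow> R n = 0" "\<And>n. n < m' \<Longrightarrow> R' n = 0"
    "\<And>d n. fls_nth (F d) n = poly (map_poly of_int (R n :: int poly)) (root_unity p ^ d)"
    "\<And>d n. fls_nth (G d) n = poly (map_poly of_int (R' n :: int poly)) (root_unity p ^ d)"
    unfolding galois_family_def by metis
  show ?thesis
    by (rule galois_familyI[of "min m m'" "\<lambda>n. R n + R' n"]) (simp_all add: * of_int_poly_simps)
qed

lemma galois_family_mult:
  assumes "galois_family p F" "galois_family p G"
  shows "galois_family p (\<lambda>d. F d * G d)"
proof -
  from assms obtain R m R' m' where *: "\<And>n. n < m \<Longrightarrow> R n = 0" "\<And>n. n < m' \<Longrightarrow> R' n = 0"
    "\<And>d n. fls_nth (F d) n = poly (map_poly of_int (R n :: int poly)) (root_unity p ^ d)"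
    "\<And>d n. fls_nth (G d) n = poly (map_poly of_int (R' n :: int poly)) (root_unity p ^ d)"
    unfolding galois_family_def by metis
  have z: "fls_nth (F d) n = 0" if "n < m" for d n using that by (simp add: *)
  have z': "fls_nth (G d) n = 0" if "n < m'" for d n using that by (simp add: *)
  show ?thesis
  proof (rule galois_familyI[of "m + m'" "\<lambda>n. \<Sum>i=m..n - m'. R i * R' (n - i)"])
    fix d n
    show "fls_nth (F d * G d) n = poly (map_poly of_int (\<Sum>i=m..n - m'. R i * R' (n - i))) (root_unity p ^ d)"
      by (subst fls_times_nth_bounds[OF z z'], assumption, assumption) (simp add: of_int_poly_sum of_int_poly_simps *)
  qed simp
qed

lemma galois_family_const:
  "galois_family p (\<lambda>d. fls_const (of_int c * root_unity p ^ (d * k)))"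
  by (rule galois_familyI[of 0 "\<lambda>n. if n = 0 then monom c k else 0"])
    (auto simp: of_int_poly_simps power_mult)

lemma galois_family_X_intpow: "galois_family p (\<lambda>d. fls_X_intpow m)"
  by (rule galois_familyI[of m "\<lambda>n. if n = m then monom 1 0 else 0"]) (auto simp: of_int_poly_simps)

lemma galois_family_compose:
  assumes "A \<in> int_fps"
  shows "galois_family p (\<lambda>d. fps_to_fls (A oo (fps_const (root_unity p ^ (d * k)) * fps_X ^ r)))"
proof -
  have "\<exists>a. fps_nth A n = of_int a" for n using assms by (auto simp: int_fps_def elim: Ints_cases)
  then obtain a where a: "\<And>n. fps_nth A n = of_int (a n)" by metis
  define R where "R = (\<lambda>n::nat. \<Sum>i=0..n. if r * i = n then monom (a i) (k * i) else (0 :: int poly))"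
  have "fps_nth (A oo (fps_const (root_unity p ^ (d * k)) * fps_X ^ r)) n =
      poly (map_poly of_int (R n)) (root_unity p ^ d)" for d n
  proof -
    have "fps_nth ((fps_const (root_unity p ^ (d * k)) * fps_X ^ r) ^ i) n =
        (if r * i = n then root_unity p ^ (d * k * i) else 0)" for i
      by (simp add: power_mult_distrib fps_const_power flip: power_mult)
    thus ?thesis unfolding fps_compose_nth R_def of_int_poly_sum
      by (intro sum.cong refl) (auto simp: a of_int_poly_simps mult_ac simp flip: power_mult)
  qed
  thus ?thesis
    by (intro galois_familyI[of 0 "\<lambda>n. if n < 0 then 0 else R (nat n)"]) auto
qed

text \<open>Only the member d = 1 is tied to the function; the others are its formal
  conjugates.\<close>

definition expands :: "nat \<Rightarrow> (complex \<Rightarrow> complex) \<Rightarrow> (nat \<Rightarrow> complex fls) \<Rightarrow> bool"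
  where "expands p f F \<longleftrightarrow> f holomorphic_on {z. Im z > 0} \<and> has_q_expansion p f (F 1) \<and> galois_family p F"

lemma
  assumes "expands p f F" "expands p g G" "p > 0"
  shows expands_add: "expands p (\<lambda>z. f z + g z) (\<lambda>d. F d + G d)"
    and expands_mult: "expands p (\<lambda>z. f z * g z) (\<lambda>d. F d * G d)"
  using assms unfolding expands_def
  by (auto intro!: has_q_expansion_add has_q_expansion_mult galois_family_add galois_family_mult holomorphic_intros)

lemma expands_of_int: "p > 0 \<Longrightarrow> expands p (\<lambda>z. of_int c) (\<lambda>d. of_int c)"
  using galois_family_const[of p c 0] has_q_expansion_const[of p "of_int c"]
  by (auto simp: expands_def fls_of_int)

lemma expands_uminus:
  assumes "expands p f F" "p > 0"
  shows "expands p (\<lambda>z. - f z) (\<lambda>d. - F d)"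
  using expands_mult[OF expands_of_int[of p "-1"] assms(1)] assms(2) by simp

lemma expands_prod_coeff:
  assumes "finite I" "\<And>i. i \<in> I \<Longrightarrow> expands p (g i) (F i)" "p > 0"
  shows "expands p (\<lambda>z. coeff (\<Prod>i\<in>I. [:- g i z, 1:]) n) (\<lambda>d. coeff (\<Prod>i\<in>I. [:- F i d, 1:]) n)"
  using assms(1,2)
proof (induction I arbitrary: n rule: finite_induct)
  case empty
  show ?case using expands_of_int[OF assms(3), of 0] expands_of_int[OF assms(3), of 1] by (cases "n = 0") (auto simp: coeff_1)
next
  case (insert i I)
  have *: "coeff ([:- a, 1:] * q) n = - a * coeff q n + (if n = 0 then 0 else 1) * coeff q (n - 1)"
    for a and q :: "'b :: comm_ring_1 poly"
    by (cases n) (auto simp: mult_pCons_left coeff_pCons)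
  have c: "expands p (\<lambda>z. if n = 0 then 0 else 1) (\<lambda>d. if n = 0 then 0 else 1)"
    using expands_of_int[OF assms(3), of 0] expands_of_int[OF assms(3), of 1] by (cases "n = 0") auto
  show ?case
    unfolding prod.insert[OF insert.hyps] *
    by (intro expands_add expands_mult expands_uminus insert c assms(3)) auto
qed

section \<open>Modular units of prime level\<close>

text \<open>The index set \<open>{..p}\<close> is the projective line over the field with \<open>p\<close> elements, with \<open>p\<close> as the point at infinity.\<close>

definition phi :: "nat \<Rightarrow> nat \<Rightarrow> complex \<Rightarrow> complex"
  where "phi p k \<tau> = (if k = p then of_nat p ^ 12 * Delta (of_nat p * \<tau>) else Delta ((\<tau> + of_nat k) / of_nat p)) / Delta \<tau>"

lemma phi_nonzero [simp]: "p > 0 \<Longrightarrow> phi p k \<tau> \<noteq> 0"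
  by (simp add: phi_def)

lemma Delta_moebius:
  fixes a b c d :: int
  assumes "a * d - b * c = 1" "Im z > 0"
  shows "Delta ((of_int a * z + of_int b) / (of_int c * z + of_int d)) = (of_int c * z + of_int d) ^ 12 * Delta z"
  by (rule modular_generators[OF Delta_plus_1 Delta_minus_inverse _ assms]) auto

lemma phi_plus_int:
  assumes "p > 0" "k < p"
  shows "phi p k (\<tau> + of_int n) = phi p (nat ((int k + n) mod int p)) \<tau>"
proof -
  define r q where "r = (int k + n) mod int p" and "q = (int k + n) div int p"
  have r: "0 \<le> r" "r < int p" using assms by (auto simp: r_def)
  have "int k + n = int p * q + r" by (simp add: r_def q_def)
  hence "of_int (int k + n) = (of_int (int p * q + r) :: complex)" by (simp only:)
  hence "of_nat k + of_int n = (of_nat p * of_int q + of_int r :: complex)" by simp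
  hence "(\<tau> + of_int n + of_nat k) / of_nat p = ((\<tau> + of_int r) + of_nat p * of_int q) / of_nat p"
    by (simp add: add.assoc add.commute[of "of_int n"])
  also have "\<dots> = (\<tau> + of_int r) / of_nat p + of_int q" using assms by (subst add_divide_distrib) simp
  finally have "(\<tau> + of_int n + of_nat k) / of_nat p = (\<tau> + of_nat (nat r)) / of_nat p + of_int q" using r by simp
  moreover have "nat r \<noteq> p" "k \<noteq> p" using r assms by auto
  ultimately show ?thesis unfolding phi_def r_def[symmetric] by (simp add: Delta_plus_1)
qed

lemma phi_plus_int_infinity: "phi p p (\<tau> + of_int n) = phi p p \<tau>"
proof -
  have "of_nat p * (\<tau> + of_int n) = of_nat p * \<tau> + of_int (int p * n)" by (simp add: distrib_left)
  thus ?thesis by (simp only: phi_def Delta_plus_1 simp_thms if_True)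
qed

lemma phi_minus_inverse_0:
  assumes "Im \<tau> > 0" "p > 0"
  shows "phi p 0 (- 1 / \<tau>) = phi p p \<tau>"
proof -
  have *: "(- 1 / \<tau> + of_nat 0) / of_nat p = - 1 / (of_nat p * \<tau>)" by simp
  have "Im (of_nat p * \<tau>) > 0" using assms by simp
  from Delta_minus_inverse[OF this] Delta_minus_inverse[OF assms(1)] have
    "phi p 0 (- 1 / \<tau>) = (of_nat p * \<tau>) ^ 12 * Delta (of_nat p * \<tau>) / (\<tau> ^ 12 * Delta \<tau>)"
    unfolding phi_def * using assms(2) by simp
  also have "\<dots> = phi p p \<tau>" using assms(1) by (auto simp: phi_def power_mult_distrib)
  finally show ?thesis .
qed

lemma phi_minus_inverse_infinity:
  assumes "Im \<tau> > 0" "p > 0"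
  shows "phi p p (- 1 / \<tau>) = phi p 0 \<tau>"
proof -
  have "\<tau> \<noteq> 0" using assms by auto
  hence "- 1 / (- 1 / \<tau>) = \<tau>" by simp
  thus ?thesis using phi_minus_inverse_0[OF Im_minus_inverse[OF assms(1)] assms(2)] by simp
qed

text \<open>With k l + 1 = p m, the matrix with rows (k, -m) and (p, -l) has determinant 1 and
  carries (\<tau> + l)/p to (-1/\<tau> + k)/p, with automorphy factor p w - l = \<tau>.\<close>

lemma phi_minus_inverse:
  assumes \<tau>: "Im \<tau> > 0" and kl: "0 < k" "k < p" "l < p" "p dvd k * l + 1"
  shows "phi p k (- 1 / \<tau>) = phi p l \<tau>"
proof -
  obtain m where "k * l + 1 = p * m" using kl(4) by (auto elim: dvdE)
  hence m: "int k * int l + 1 = int p * int m" by (metis of_nat_1 of_nat_add of_nat_mult)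
  hence m': "of_nat k * of_nat l + 1 = (of_nat p * of_nat m :: complex)"
    by (metis of_int_1 of_int_add of_int_mult of_int_of_nat_eq)
  have p0: "(of_nat p :: complex) \<noteq> 0" "\<tau> \<noteq> 0" using \<tau> kl by auto
  define w where "w = (\<tau> + of_nat l) / of_nat p"
  have pw: "of_nat p * w = \<tau> + of_nat l" using p0 by (simp add: w_def)
  have Im_w: "Im w > 0" using \<tau> kl by (simp add: w_def Im_divide_of_nat)
  have den: "of_int (int p) * w + of_int (- int l) = \<tau>" by (simp add: pw)
  have "of_nat p * (of_nat k * w - of_nat m) = of_nat k * (of_nat p * w) - of_nat p * of_nat m" by (simp add: algebra_simps)
  also have "\<dots> = of_nat k * \<tau> - 1" unfolding pw m'[symmetric] by (simp add: algebra_simps)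
  finally have num: "of_int (int k) * w + of_int (- int m) = (of_nat k * \<tau> - 1) / of_nat p"
    using p0 by (simp add: eq_divide_eq mult.commute)
  have arg: "(- 1 / \<tau> + of_nat k) / of_nat p = (of_nat k * \<tau> - 1) / of_nat p / \<tau>"
    using p0 by (simp add: divide_simps)
  have "Delta ((- 1 / \<tau> + of_nat k) / of_nat p) = \<tau> ^ 12 * Delta w"
    using Delta_moebius[of "int k" "- int l" "- int m" "int p" w] m Im_w unfolding num den arg by (simp add: mult.commute)
  thus ?thesis using kl p0 unfolding phi_def Delta_minus_inverse[OF \<tau>] by (simp add: w_def)
qed

text \<open>The permutations of the projective line induced by translation of \<tau> and, below, by
  \<zeta> -> \<zeta>^d; both fix the point at infinity.\<close>

definition shift_index :: "nat \<Rightarrow> int \<Rightarrow> nat \<Rightarrow> nat"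
  where "shift_index p n k = (if k = p then p else nat ((int k + n) mod int p))"

definition scale_index :: "nat \<Rightarrow> nat \<Rightarrow> nat \<Rightarrow> nat"
  where "scale_index p d k = (if k = p then p else (d * k) mod p)"

lemma bij_shift_index:
  assumes "p > 0"
  shows "bij_betw (shift_index p n) {..p} {..p}"
proof -
  have "inj_on (shift_index p n) {..p}"
  proof (rule inj_onI)
    fix k l assume kl: "k \<in> {..p}" "l \<in> {..p}" "shift_index p n k = shift_index p n l"
    have ne: "nat ((int i + n) mod int p) \<noteq> p" for i
    proof
      assume "nat ((int i + n) mod int p) = p"
      hence "(int i + n) mod int p = int p" using assms by (simp add: nat_eq_iff)
      moreover have "(int i + n) mod int p < int p" using assms by simp
      ultimately show False by linarith
    qed
    show "k = l"
    proof (cases "k = p \<or> l = p")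
      case True
      thus ?thesis using kl ne[of k] ne[of l] by (auto simp: shift_index_def split: if_splits)
    next
      case False
      hence "(int k + n) mod int p = (int l + n) mod int p"
        using kl assms by (simp add: shift_index_def eq_nat_nat_iff)
      hence "[int k = int l] (mod int p)" by (simp add: cong_def cong_add_rcancel[unfolded cong_def])
      thus ?thesis using kl False by (simp add: cong_def)
    qed
  qed
  moreover have "shift_index p n ` {..p} \<subseteq> {..p}"
  proof -
    have "nat ((int k + n) mod int p) \<le> p" for k
      using assms by (simp add: nat_le_iff less_imp_le[OF pos_mod_bound])
    thus ?thesis by (auto simp: shift_index_def)
  qed
  ultimately show ?thesis by (simp add: bij_betw_def endo_inj_surj)
qed

lemma bij_scale_index:
  assumes "p > 0" "coprime d p"
  shows "bij_betw (scale_index p d) {..p} {..p}"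
proof -
  have "inj_on (scale_index p d) {..p}"
  proof (rule inj_onI)
    fix k l assume kl: "k \<in> {..p}" "l \<in> {..p}" "scale_index p d k = scale_index p d l"
    have ne: "(d * i) mod p \<noteq> p" for i using assms by (metis mod_less_divisor less_irrefl)
    show "k = l"
    proof (cases "k = p \<or> l = p")
      case True
      thus ?thesis using kl ne[of k] ne[of l] by (auto simp: scale_index_def split: if_splits)
    next
      case False
      hence "[d * k = d * l] (mod p)" using kl by (simp add: scale_index_def cong_def)
      hence "[k = l] (mod p)" using assms(2) by (simp add: cong_mult_lcancel_nat)
      thus ?thesis using kl False by (simp add: cong_def)
    qed
  qed
  moreover have "scale_index p d ` {..p} \<subseteq> {..p}"
  proof -
    have "(d * k) mod p \<le> p" for k using assms(1) by (simp add: less_imp_le)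
    thus ?thesis by (auto simp: scale_index_def)
  qed
  ultimately show ?thesis by (simp add: bij_betw_def endo_inj_surj)
qed

lemma phi_shift_index: "p > 0 \<Longrightarrow> k \<le> p \<Longrightarrow> phi p k (\<tau> + of_int n) = phi p (shift_index p n k) \<tau>"
  using phi_plus_int[of p k] by (auto simp: shift_index_def phi_plus_int_infinity)

text \<open>The inversion acts on the projective line as k -> -1/k, which is an involution and so a
  bijection; it exchanges 0 with infinity.\<close>

lemma inversion_index:
  assumes "prime p"
  obtains \<pi> where "bij_betw \<pi> {..p} {..p}" "\<And>k \<tau>. k \<le> p \<Longrightarrow> Im \<tau> > 0 \<Longrightarrow> phi p k (- 1 / \<tau>) = phi p (\<pi> k) \<tau>"
proof -
  have p0: "p > 0" and p1: "p > 1" using prime_gt_0_nat[OF assms] prime_gt_1_nat[OF assms] .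
  have "\<exists>l. 0 < l \<and> l < p \<and> p dvd k * l + 1" if "0 < k" "k < p" for k
  proof -
    have "coprime k p" using that assms by (metis coprime_commute nat_dvd_not_less prime_imp_coprime)
    then obtain x where "[k * x = Suc 0] (mod p)" using cong_solve_coprime_nat by blast
    hence "[k * x * (p - 1) + 1 = Suc 0 * (p - 1) + 1] (mod p)" by (intro cong_add cong_mult) auto
    hence "p dvd k * (x * (p - 1)) + 1" using p1 by (simp add: cong_def mod_eq_0_iff_dvd[symmetric] mult.assoc)
    moreover have "(k * y + 1) mod p = (k * (y mod p) + 1) mod p" for y
      by (metis mod_add_left_eq mod_mult_right_eq)
    ultimately have "p dvd k * ((x * (p - 1)) mod p) + 1" unfolding dvd_eq_mod_eq_0 by metis
    moreover from this have "(x * (p - 1)) mod p \<noteq> 0" using p1 by (intro notI) auto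
    ultimately show ?thesis using p0 by (intro exI[of _ "(x * (p - 1)) mod p"]) auto
  qed
  then obtain l where l: "\<And>k. 0 < k \<Longrightarrow> k < p \<Longrightarrow> 0 < l k \<and> l k < p \<and> p dvd k * l k + 1" by metis
  have uniq: "a = b" if ab: "0 < k" "k < p" "a < p" "b < p" "p dvd k * a + 1" "p dvd k * b + 1" for a b k
  proof -
    have "coprime k p" using ab assms by (metis coprime_commute nat_dvd_not_less prime_imp_coprime)
    moreover have "[k * a + 1 = k * b + 1] (mod p)" using ab by (simp add: cong_def dvd_eq_mod_eq_0)
    hence "[k * a = k * b] (mod p)" by (simp only: cong_add_rcancel_nat)
    ultimately have "[a = b] (mod p)" by (simp add: cong_mult_lcancel_nat)
    thus ?thesis using ab by (simp add: cong_def)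
  qed
  define \<pi> where "\<pi> k = (if k = 0 then p else if k = p then 0 else l k)" for k
  have \<pi>_\<pi>: "\<pi> (\<pi> k) = k \<and> \<pi> k \<le> p" if k: "k \<le> p" for k
  proof (cases "k = 0 \<or> k = p")
    case False
    hence k': "0 < k" "k < p" using k by auto
    note lk = l[OF k']
    hence llk: "0 < l (l k) \<and> l (l k) < p \<and> p dvd l k * l (l k) + 1" by (intro l) auto
    have "p dvd l k * k + 1" using lk by (simp add: mult.commute)
    hence "l (l k) = k" using lk llk k' by (intro uniq[of "l k"]) auto
    thus ?thesis using k' lk by (auto simp: \<pi>_def)
  qed (use p0 in \<open>auto simp: \<pi>_def\<close>)
  have "bij_betw \<pi> {..p} {..p}"
    by (rule bij_betw_byWitness[of _ \<pi>]) (use \<pi>_\<pi> in auto)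
  moreover have "phi p k (- 1 / \<tau>) = phi p (\<pi> k) \<tau>" if "k \<le> p" "Im \<tau> > 0" for k \<tau>
  proof -
    consider "k = 0" | "k = p" | "0 < k" "k < p" using \<open>k \<le> p\<close> by linarith
    thus ?thesis
    proof cases
      case 3
      thus ?thesis using phi_minus_inverse[OF that(2) 3, of "l k"] l[OF 3] by (auto simp: \<pi>_def)
    qed (use p0 phi_minus_inverse_0[OF that(2) p0] phi_minus_inverse_infinity[OF that(2) p0] in \<open>auto simp: \<pi>_def\<close>)
  qed
  ultimately show thesis by (rule that)
qed

lemma holomorphic_Delta_compose:
  assumes "f holomorphic_on {z. Im z > 0}" "\<And>z. Im z > 0 \<Longrightarrow> Im (f z) > 0"
  shows "(\<lambda>z. Delta (f z)) holomorphic_on {z. Im z > 0}"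
  using holomorphic_on_compose_gen[OF assms(1) holomorphic_Delta] assms(2) by (auto simp: o_def)

lemma holomorphic_phi:
  assumes "p > 0"
  shows "phi p k holomorphic_on {z. Im z > 0}"
proof -
  have "(\<lambda>\<tau>. of_nat p ^ 12 * Delta (of_nat p * \<tau>) / Delta \<tau>) holomorphic_on {z. Im z > 0}"
    "(\<lambda>\<tau>. Delta ((\<tau> + of_nat k) / of_nat p) / Delta \<tau>) holomorphic_on {z. Im z > 0}"
    using assms by (intro holomorphic_intros holomorphic_Delta_compose holomorphic_Delta; simp add: Im_divide_of_nat)+
  thus ?thesis unfolding phi_def [abs_def] by (cases "k = p") simp_all
qed

section \<open>Expansions of the modular units\<close>

text \<open>The common shape of all expansions of \<open>phi\<close> and its inverses in u =
  q^(1/p): a monomial times integral power series in a root of unity times a power of u, and in a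
  power of u. Conjugation multiplies the exponents of the root of unity by d.\<close>

lemma expands_basic:
  assumes f: "f holomorphic_on {z. Im z > 0}" and p: "p > 0" and r: "r > 0" and s: "s > 0"
    and A: "A has_fps_expansion SA" "SA \<in> int_fps" and B: "B has_fps_expansion SB" "SB \<in> int_fps"
    and eq: "\<And>\<tau>. Im \<tau> > 0 \<Longrightarrow> f \<tau> = of_int c * root_unity p ^ l * (nome (\<tau> / of_nat p) powi m *
        (A (root_unity p ^ k * nome (\<tau> / of_nat p) ^ r) * B (nome (\<tau> / of_nat p) ^ s)))"
  shows "expands p f (\<lambda>d. fls_const (of_int c * root_unity p ^ (d * l)) * (fls_X_intpow m *
      (fps_to_fls (SA oo (fps_const (root_unity p ^ (d * k)) * fps_X ^ r)) * fps_to_fls (SB oo fps_X ^ s))))"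
proof -
  have "(A \<circ> (\<lambda>u. root_unity p ^ k * u ^ r)) has_fps_expansion (SA oo (fps_const (root_unity p ^ k) * fps_X ^ r))"
    by (rule has_fps_expansion_compose[OF A(1)]) (use r in \<open>auto intro!: fps_expansion_intros\<close>)
  moreover have "(B \<circ> (\<lambda>u. u ^ s)) has_fps_expansion (SB oo fps_X ^ s)"
    by (rule has_fps_expansion_compose[OF B(1)]) (use s in \<open>auto intro!: fps_expansion_intros\<close>)
  ultimately have L: "(\<lambda>u. of_int c * root_unity p ^ l * (u powi m * ((A \<circ> (\<lambda>u. root_unity p ^ k * u ^ r)) u * (B \<circ> (\<lambda>u. u ^ s)) u)))
      has_laurent_expansion fls_const (of_int c * root_unity p ^ l) * (fls_X_intpow m *
      (fps_to_fls (SA oo (fps_const (root_unity p ^ k) * fps_X ^ r)) * fps_to_fls (SB oo fps_X ^ s)))"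
    by (intro laurent_expansion_intros has_laurent_expansion_fps)
  have "galois_family p (\<lambda>d. fps_to_fls (SB oo fps_X ^ s))"
    using galois_family_compose[OF B(2), of p 0 s] by simp
  moreover have "has_q_expansion p f (fls_const (of_int c * root_unity p ^ l) * (fls_X_intpow m *
      (fps_to_fls (SA oo (fps_const (root_unity p ^ k) * fps_X ^ r)) * fps_to_fls (SB oo fps_X ^ s))))"
    by (rule has_q_expansionI[OF L p, of 0]) (simp add: eq)
  ultimately show ?thesis unfolding expands_def
    by (auto intro!: f galois_family_mult galois_family_const galois_family_X_intpow galois_family_compose A)
qed

lemma root_unity_power_mod: "p > 0 \<Longrightarrow> root_unity p ^ (k mod p) = root_unity p ^ k"
proof -
  assume p: "p > 0"
  have "root_unity p ^ p = 1" using p by (simp add: root_unity_def exp_of_nat_mult [symmetric])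
  thus ?thesis by (metis mult_1_left mult_1_right power_add power_mult power_one mult_div_mod_eq)
qed

text \<open>The exponents of the root of unity depend on k only modulo p, so conjugating member k
  gives the member with index d k. The member at infinity involves no root of unity and is
  fixed.\<close>

lemma expands_family:
  assumes g: "\<And>k. k \<le> p \<Longrightarrow> g k holomorphic_on {z. Im z > 0}" and p: "p > 0"
    and A: "A has_fps_expansion SA" "SA \<in> int_fps" and B: "B has_fps_expansion SB" "SB \<in> int_fps"
    and eq: "\<And>k \<tau>. k < p \<Longrightarrow> Im \<tau> > 0 \<Longrightarrow> g k \<tau> = of_int c * root_unity p ^ (k * e) * (nome (\<tau> / of_nat p) powi m *
        (A (root_unity p ^ k * nome (\<tau> / of_nat p)) * B (nome (\<tau> / of_nat p) ^ p)))"
    and eq': "\<And>\<tau>. Im \<tau> > 0 \<Longrightarrow> g p \<tau> = of_int c' * (nome (\<tau> / of_nat p) powi m' *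
        (A (nome (\<tau> / of_nat p) ^ (p * p)) * B (nome (\<tau> / of_nat p) ^ p)))"
  obtains F where "\<And>k. k \<le> p \<Longrightarrow> expands p (g k) (F k)" "\<And>d k. k \<le> p \<Longrightarrow> F k d = F (scale_index p d k) 1"
proof
  define F1 where "F1 k d = fls_const (of_int c * root_unity p ^ (d * (k * e))) * (fls_X_intpow m *
      (fps_to_fls (SA oo (fps_const (root_unity p ^ (d * k)) * fps_X ^ 1)) * fps_to_fls (SB oo fps_X ^ p)))" for k d
  define F2 :: "nat \<Rightarrow> complex fls" where "F2 d = fls_const (of_int c' * root_unity p ^ (d * 0)) * (fls_X_intpow m' *
      (fps_to_fls (SA oo (fps_const (root_unity p ^ (d * 0)) * fps_X ^ (p * p))) * fps_to_fls (SB oo fps_X ^ p)))" for d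
  define F where "F k = (if k = p then F2 else F1 k)" for k
  show "expands p (g k) (F k)" if "k \<le> p" for k
  proof (cases "k = p")
    case True
    have "expands p (g p) F2" unfolding F2_def
      by (rule expands_basic[OF g p _ p A B]) (use p eq' in auto)
    thus ?thesis using True by (simp add: F_def)
  next
    case False
    have "expands p (g k) (F1 k)" unfolding F1_def
      by (rule expands_basic[OF g[OF that] p _ p A B]) (use p eq[of k] False that in auto)
    thus ?thesis using False by (simp add: F_def)
  qed
  show "F k d = F (scale_index p d k) 1" if "k \<le> p" for k d
  proof (cases "k = p")
    case False
    have "root_unity p ^ (d * (k * e)) = root_unity p ^ (1 * ((d * k) mod p * e))"
      by (simp add: power_mult root_unity_power_mod[OF p] flip: mult.assoc)
    moreover have "root_unity p ^ (d * k) = root_unity p ^ (1 * ((d * k) mod p))"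
      by (simp add: root_unity_power_mod[OF p])
    ultimately have "F1 k d = F1 ((d * k) mod p) 1" unfolding F1_def by (simp only:)
    moreover have "(d * k) mod p \<noteq> p" using p by (metis mod_less_divisor less_irrefl)
    ultimately show ?thesis using False by (simp add: F_def scale_index_def)
  qed (simp add: F_def scale_index_def F2_def)
qed

lemma Delta_in_local_parameter:
  assumes "p > 0"
  defines "u \<equiv> \<lambda>\<tau>. nome (\<tau> / of_nat p)"
  shows "Delta \<tau> = u \<tau> ^ p * euler (u \<tau> ^ p) ^ 24"
    and "Delta ((\<tau> + of_nat k) / of_nat p) = root_unity p ^ k * u \<tau> * euler (root_unity p ^ k * u \<tau>) ^ 24"
    and "Delta (of_nat p * \<tau>) = u \<tau> ^ (p * p) * euler (u \<tau> ^ (p * p)) ^ 24"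
proof -
  have 1: "nome \<tau> = u \<tau> ^ p" using assms by (simp flip: nome_of_nat_mult)
  thus "Delta \<tau> = u \<tau> ^ p * euler (u \<tau> ^ p) ^ 24" by (simp add: Delta_def Dq_def)
  have "nome (of_nat p * \<tau>) = u \<tau> ^ (p * p)" by (simp add: nome_of_nat_mult 1 power_mult)
  thus "Delta (of_nat p * \<tau>) = u \<tau> ^ (p * p) * euler (u \<tau> ^ (p * p)) ^ 24" by (simp add: Delta_def Dq_def)
  have "nome (of_nat k / of_nat p) = root_unity p ^ k"
    by (simp add: nome_def root_unity_def exp_of_nat_mult [symmetric] mult_ac)
  hence "nome ((\<tau> + of_nat k) / of_nat p) = root_unity p ^ k * u \<tau>"
    by (simp add: u_def add_divide_distrib nome_add mult.commute)
  thus "Delta ((\<tau> + of_nat k) / of_nat p) = root_unity p ^ k * u \<tau> * euler (root_unity p ^ k * u \<tau>) ^ 24"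
    by (simp add: Delta_def Dq_def)
qed

lemma euler24_expansion:
  obtains S where "(\<lambda>w. euler w ^ 24) has_fps_expansion S" "S \<in> int_fps"
    "(\<lambda>w. inverse (euler w ^ 24)) has_fps_expansion inverse S" "inverse S \<in> int_fps" "fps_nth S 0 = 1"
proof -
  obtain P where P: "euler has_fps_expansion P" "P \<in> int_fps" "fps_nth P 0 = 1" by (rule euler_expansion)
  have 1: "fps_nth (P ^ 24) 0 = 1" using P(3) by (simp add: fps_nth_power_0)
  have 2: "(\<lambda>w. euler w ^ 24) has_fps_expansion P ^ 24" by (intro fps_expansion_intros P)
  show thesis
    by (rule that[OF 2 int_fps_power[OF P(2)] has_fps_expansion_inverse[OF 2] int_fps_inverse[OF int_fps_power[OF P(2)] 1] 1])
      (simp add: 1)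
qed

text \<open>The leading terms are \<zeta>^k u^(1-p) for finite k and p^12 u^(p^2-p) at
  infinity.\<close>

lemma phi_expansions:
  assumes p: "p > 0"
  obtains F where "\<And>k. k \<le> p \<Longrightarrow> expands p (phi p k) (F k)" "\<And>d k. k \<le> p \<Longrightarrow> F k d = F (scale_index p d k) 1"
proof -
  obtain S where S: "(\<lambda>w. euler w ^ 24) has_fps_expansion S" "S \<in> int_fps"
    "(\<lambda>w. inverse (euler w ^ 24)) has_fps_expansion inverse S" "inverse S \<in> int_fps"
    by (rule euler24_expansion)
  have powi: "u powi (int a - int b) = u ^ a / u ^ b" if "u \<noteq> 0" for u :: complex and a b
    using that by (simp add: power_int_diff)
  show thesis
  proof (rule expands_family[OF holomorphic_phi[OF p] p S(1,2) S(3,4), where c = 1 and e = 1 and m = "int 1 - int p"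
        and c' = "int p ^ 12" and m' = "int (p * p) - int p"])
    show "phi p k \<tau> = of_int 1 * root_unity p ^ (k * 1) * (nome (\<tau> / of_nat p) powi (int 1 - int p) *
        (euler (root_unity p ^ k * nome (\<tau> / of_nat p)) ^ 24 * inverse (euler (nome (\<tau> / of_nat p) ^ p) ^ 24)))"
      if "k < p" "Im \<tau> > 0" for k \<tau>
      using that unfolding phi_def Delta_in_local_parameter(2,3)[OF p] Delta_in_local_parameter(1)[OF p, of \<tau>] powi[OF nome_nonzero] by (simp add: field_simps)
    show "phi p p \<tau> = of_int (int p ^ 12) * (nome (\<tau> / of_nat p) powi (int (p * p) - int p) *
        (euler (nome (\<tau> / of_nat p) ^ (p * p)) ^ 24 * inverse (euler (nome (\<tau> / of_nat p) ^ p) ^ 24)))"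
      if "Im \<tau> > 0" for \<tau>
      using that unfolding phi_def Delta_in_local_parameter(2,3)[OF p] Delta_in_local_parameter(1)[OF p, of \<tau>] powi[OF nome_nonzero] by (simp add: field_simps)
  qed (use that in blast)
qed

text \<open>The inverse of \<zeta>^k is written as \<zeta>^(k(p-1)), because Galois families are
  built from polynomials in \<zeta>. The factor p^12 cancels the denominator at infinity and keeps
  all coefficients integral.\<close>

lemma chi_expansions:
  assumes p: "p > 0"
  obtains F where "\<And>k. k \<le> p \<Longrightarrow> expands p (\<lambda>\<tau>. of_nat p ^ 12 / phi p k \<tau>) (F k)"
    "\<And>d k. k \<le> p \<Longrightarrow> F k d = F (scale_index p d k) 1"
proof -
  obtain S where S: "(\<lambda>w. euler w ^ 24) has_fps_expansion S" "S \<in> int_fps"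
    "(\<lambda>w. inverse (euler w ^ 24)) has_fps_expansion inverse S" "inverse S \<in> int_fps"
    by (rule euler24_expansion)
  have powi: "u powi (int a - int b) = u ^ a / u ^ b" if "u \<noteq> 0" for u :: complex and a b
    using that by (simp add: power_int_diff)
  have root: "root_unity p ^ (k * (p - 1)) * root_unity p ^ k = 1" for k
  proof -
    have "k * (p - 1) + k = p * k" using p by (cases p) auto
    moreover have "root_unity p ^ p = 1" using p by (simp add: root_unity_def exp_of_nat_mult [symmetric])
    ultimately show ?thesis unfolding power_add[symmetric] by (simp only: power_mult power_one)
  qed
  have root': "root_unity p ^ (k * (p - 1)) = 1 / root_unity p ^ k" for k
    using root[of k] by (metis mult_eq_0_iff nonzero_eq_divide_eq zero_neq_one)
  have hol: "(\<lambda>\<tau>. of_nat p ^ 12 / phi p k \<tau>) holomorphic_on {z. Im z > 0}" for k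
    by (intro holomorphic_intros holomorphic_phi p) (use p in simp)
  show thesis
  proof (rule expands_family[OF hol p S(3,4) S(1,2), where c = "int p ^ 12" and e = "p - 1" and m = "int p - int 1"
        and c' = 1 and m' = "int p - int (p * p)"])
    show "of_nat p ^ 12 / phi p k \<tau> = of_int (int p ^ 12) * root_unity p ^ (k * (p - 1)) * (nome (\<tau> / of_nat p) powi (int p - int 1) *
        (inverse (euler (root_unity p ^ k * nome (\<tau> / of_nat p)) ^ 24) * euler (nome (\<tau> / of_nat p) ^ p) ^ 24))"
      if "k < p" "Im \<tau> > 0" for k \<tau>
      using that unfolding phi_def Delta_in_local_parameter(2,3)[OF p] Delta_in_local_parameter(1)[OF p, of \<tau>] powi[OF nome_nonzero] root'
      by (simp add: divide_inverse mult_ac)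
    show "of_nat p ^ 12 / phi p p \<tau> = of_int 1 * (nome (\<tau> / of_nat p) powi (int p - int (p * p)) *
        (inverse (euler (nome (\<tau> / of_nat p) ^ (p * p)) ^ 24) * euler (nome (\<tau> / of_nat p) ^ p) ^ 24))"
      if "Im \<tau> > 0" for \<tau>
      using that p unfolding phi_def Delta_in_local_parameter(2,3)[OF p] Delta_in_local_parameter(1)[OF p, of \<tau>] powi[OF nome_nonzero] by (simp add: field_simps)
  qed (use that in blast)
qed

section \<open>Modularity and rationality of the units\<close>

text \<open>The Euclidean algorithm of \<open>modular_generators\<close>, now for a family permuted
  by the generators instead of a single form with an automorphy factor.\<close>

lemma modular_orbit:
  fixes f :: "'i \<Rightarrow> complex \<Rightarrow> complex" and a b c d :: int
  assumes T: "\<And>i n. i \<in> I \<Longrightarrow> \<exists>j\<in>I. \<forall>z. Im z > 0 \<longrightarrow> f i (z + of_int n) = f j z"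
    and S: "\<And>i. i \<in> I \<Longrightarrow> \<exists>j\<in>I. \<forall>z. Im z > 0 \<longrightarrow> f i (- 1 / z) = f j z"
    and det: "a * d - b * c = 1" and i: "i \<in> I"
  shows "\<exists>j\<in>I. \<forall>z. Im z > 0 \<longrightarrow> f i ((of_int a * z + of_int b) / (of_int c * z + of_int d)) = f j z"
  using det
proof (induction "nat \<bar>c\<bar>" arbitrary: a b c d rule: less_induct)
  case less
  show ?case
  proof (cases "c = 0")
    case True
    hence "a * d = 1" using less.prems by simp
    hence ad: "(a = 1 \<and> d = 1) \<or> (a = -1 \<and> d = -1)" by (simp add: zmult_eq_1_iff)
    hence *: "(of_int a * z + of_int b) / (of_int c * z + of_int d) = z + of_int (b * d)" for z :: complex
      using True by auto
    show ?thesis unfolding * by (rule T[OF i])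
  next
    case False
    define q where "q = d div c"
    define d' b' where "d' = d - c * q" and "b' = b - a * q"
    have d'_eq: "d' = d mod c" by (simp add: d'_def q_def minus_mult_div_eq_mod)
    have "\<bar>d'\<bar> < \<bar>c\<bar>" unfolding d'_eq using False by (rule abs_mod_less)
    hence lt: "nat \<bar>d'\<bar> < nat \<bar>c\<bar>" using False by simp
    have det': "b' * (- c) - (- a) * d' = 1" using less.prems(1) by (simp add: b'_def d'_def algebra_simps)
    obtain j where j: "j \<in> I" "\<And>z. Im z > 0 \<Longrightarrow>
        f i ((of_int b' * z + of_int (- a)) / (of_int d' * z + of_int (- c))) = f j z"
      using less.hyps[OF lt det'] by blast
    obtain j' where j': "j' \<in> I" "\<And>z. Im z > 0 \<Longrightarrow> f j (- 1 / z) = f j' z" using S[OF j(1)] by blast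
    obtain j'' where j'': "j'' \<in> I" "\<And>z. Im z > 0 \<Longrightarrow> f j' (z + of_int q) = f j'' z" using T[OF j'(1)] by blast
    have "f i ((of_int a * z + of_int b) / (of_int c * z + of_int d)) = f j'' z" if z: "Im z > 0" for z
    proof -
      define w where "w = z + of_int q"
      have w: "Im w > 0" using z by (simp add: w_def)
      hence w0: "w \<noteq> 0" by auto
      have num: "of_int a * z + of_int b = of_int a * w + of_int b'" by (simp add: w_def b'_def algebra_simps)
      have den: "of_int c * z + of_int d = of_int c * w + of_int d'" by (simp add: w_def d'_def algebra_simps)
      have e1: "of_int b' * (- 1 / w) + of_int (- a) = - (of_int a * w + of_int b') * (1 / w)"
        using w0 by (simp add: diff_divide_distrib algebra_simps)
      have e2: "of_int d' * (- 1 / w) + of_int (- c) = - (of_int c * w + of_int d') * (1 / w)"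
        using w0 by (simp add: diff_divide_distrib algebra_simps)
      have "(- x * (1 / w)) / (- y * (1 / w)) = x / y" for x y using w0 by simp
      hence "(of_int a * z + of_int b) / (of_int c * z + of_int d) =
          (of_int b' * (- 1 / w) + of_int (- a)) / (of_int d' * (- 1 / w) + of_int (- c))"
        unfolding num den e1 e2 by (simp only:)
      thus ?thesis using j(2)[OF Im_minus_inverse[OF w]] j'(2)[OF w] j''(2)[OF z] by (simp only: w_def)
    qed
    thus ?thesis using j''(1) by blast
  qed
qed

lemma phi_moebius:
  fixes a b c d :: int
  assumes "prime p" "k \<le> p" "a * d - b * c = 1"
  shows "\<exists>j\<le>p. \<forall>z. Im z > 0 \<longrightarrow> phi p k ((of_int a * z + of_int b) / (of_int c * z + of_int d)) = phi p j z"
proof -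
  have p0: "p > 0" using assms by (simp add: prime_gt_0_nat)
  obtain \<pi> where \<pi>: "bij_betw \<pi> {..p} {..p}" "\<And>k \<tau>. k \<le> p \<Longrightarrow> Im \<tau> > 0 \<Longrightarrow> phi p k (- 1 / \<tau>) = phi p (\<pi> k) \<tau>"
    using inversion_index[OF assms(1)] by metis
  have "\<exists>j\<in>{..p}. \<forall>z. Im z > 0 \<longrightarrow> phi p k ((of_int a * z + of_int b) / (of_int c * z + of_int d)) = phi p j z"
  proof (rule modular_orbit[OF _ _ assms(3)])
    show "\<exists>j\<in>{..p}. \<forall>z. Im z > 0 \<longrightarrow> phi p i (z + of_int n) = phi p j z" if "i \<in> {..p}" for i n
      using that bij_betwE[OF bij_shift_index[OF p0, of n]] phi_shift_index[OF p0]
      by (intro bexI[of _ "shift_index p n i"]) auto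
    show "\<exists>j\<in>{..p}. \<forall>z. Im z > 0 \<longrightarrow> phi p i (- 1 / z) = phi p j z" if "i \<in> {..p}" for i
      using that bij_betwE[OF \<pi>(1)] \<pi>(2) by (intro bexI[of _ "\<pi> i"]) auto
  qed (use assms in auto)
  thus ?thesis by auto
qed

text \<open>Conjugation by diag(p, 1) or its inverse keeps the matrix integral exactly under the
  stated divisibility, and the automorphy factor at z/p or p z equals the one at z, so it cancels in
  the quotient.\<close>

lemma phi_invariant:
  fixes a b c d :: int
  assumes "p > 0" "a * d - b * c = 1" "Im z > 0" "k = 0 \<and> int p dvd b \<or> k = p \<and> int p dvd c"
  shows "phi p k ((of_int a * z + of_int b) / (of_int c * z + of_int d)) = phi p k z"
proof -
  define D where "D = of_int c * z + of_int d"
  have D: "D \<noteq> 0" unfolding D_def by (rule moebius_denominator_nonzero[OF assms(2,3)])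
  have p: "(of_nat p :: complex) \<noteq> 0" using assms by simp
  have \<Delta>: "Delta ((of_int a * z + of_int b) / D) = D ^ 12 * Delta z"
    unfolding D_def by (rule Delta_moebius[OF assms(2,3)])
  from assms(4) show ?thesis
  proof (elim disjE conjE)
    assume k: "k = 0" and "int p dvd b"
    then obtain b' where b': "b = int p * b'" by blast
    have "Im (z / of_nat p) > 0" using assms by (simp add: Im_divide_of_nat)
    from Delta_moebius[of a d b' "c * int p", OF _ this] assms(2)
    have "Delta ((of_int a * (z / of_nat p) + of_int b') / (of_int (c * int p) * (z / of_nat p) + of_int d)) =
        (of_int (c * int p) * (z / of_nat p) + of_int d) ^ 12 * Delta (z / of_nat p)"
      by (simp add: b' mult_ac)
    moreover have "of_int (c * int p) * (z / of_nat p) + of_int d = D" using p by (simp add: D_def)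
    moreover have "of_int a * (z / of_nat p) + of_int b' = (of_int a * z + of_int b) / of_nat p"
      using p by (simp add: b' add_divide_distrib)
    ultimately have "Delta ((of_int a * z + of_int b) / D / of_nat p) = D ^ 12 * Delta (z / of_nat p)"
      by (simp add: mult.commute)
    thus ?thesis using \<Delta> D assms(1) unfolding D_def[symmetric] phi_def k by simp
  next
    assume k: "k = p" and "int p dvd c"
    then obtain c' where c': "c = int p * c'" by blast
    have "Im (of_nat p * z) > 0" using assms by simp
    from Delta_moebius[of a d "int p * b" c', OF _ this] assms(2)
    have "Delta ((of_int a * (of_nat p * z) + of_int (int p * b)) / (of_int c' * (of_nat p * z) + of_int d)) =
        (of_int c' * (of_nat p * z) + of_int d) ^ 12 * Delta (of_nat p * z)"
      by (simp add: c' mult_ac)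
    moreover have "of_int c' * (of_nat p * z) + of_int d = D" by (simp add: D_def c' mult_ac)
    moreover have "of_int a * (of_nat p * z) + of_int (int p * b) = of_nat p * (of_int a * z + of_int b)"
      by (simp add: algebra_simps)
    ultimately have "Delta (of_nat p * ((of_int a * z + of_int b) / D)) = D ^ 12 * Delta (of_nat p * z)"
      by (simp add: times_divide_eq_right)
    thus ?thesis using \<Delta> D assms(1) unfolding D_def[symmetric] phi_def k by simp
  qed
qed

lemma has_q_expansion_cong:
  assumes "has_q_expansion p f F" "\<And>z. Im z > 0 \<Longrightarrow> g z = f z"
  shows "has_q_expansion p g F"
proof -
  obtain Y where Y: "fls_conv_radius F > 0" "\<And>z. Im z > Y \<Longrightarrow> f z = eval_fls F (exp (2 * of_real pi * \<i> * z / of_nat p))"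
    using assms(1) unfolding has_q_expansion_def by auto
  thus ?thesis unfolding has_q_expansion_def
    by (intro conjI exI[of _ "max Y 0"]) (use assms(2) in auto)
qed

lemma SL2Z_det: "A \<in> SL2Z \<Longrightarrow> A$1$1 * A$2$2 - A$1$2 * A$2$1 = 1"
  by (simp add: SL2Z_def det_2)

text \<open>Rationality comes from d = 0: scaling by 0 fixes both indices 0 and p, so the expansion
  equals its specialisation at \<zeta> = 1, whose coefficients are integers. The expansions at the
  other cusps exist because the modular group only permutes the units.\<close>

lemma phi_level_field:
  assumes p: "prime p" and k: "k = 0 \<or> k = p"
  shows "phi p k \<in> level_field p"
    and "\<exists>F. has_q_expansion p (phi p k) F \<and> (\<forall>n. fls_nth F n \<in> \<rat>)"
proof -
  interpret cyclotomic p using p by unfold_locales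
  have p0: "p > 0" using p by (auto intro: prime_gt_0_nat)
  obtain F where F: "\<And>k. k \<le> p \<Longrightarrow> expands p (phi p k) (F k)" "\<And>d k. k \<le> p \<Longrightarrow> F k d = F (scale_index p d k) 1"
    using phi_expansions[OF p0] by metis
  have kp: "k \<le> p" using k by auto
  have "scale_index p 0 k = k" using k p0 by (auto simp: scale_index_def)
  hence F01: "F k 0 = F k 1" using F(2)[OF kp, of 0] by (simp only:)
  have "fls_nth (F k 1) n \<in> \<rat>" for n
  proof -
    obtain R where "fls_nth (F k 0) n = poly (map_poly of_int (R :: int poly)) (root_unity p ^ 0)"
      using F(1)[OF kp] unfolding expands_def galois_family_def by blast
    also have "\<dots> \<in> \<rat>" by (induction R) (auto simp: map_poly_pCons)
    finally show ?thesis by (simp add: F01)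
  qed
  moreover have q: "has_q_expansion p (phi p j) (F j 1)" if "j \<le> p" for j using F(1)[OF that] by (simp add: expands_def)
  ultimately show ex: "\<exists>F. has_q_expansion p (phi p k) F \<and> (\<forall>n. fls_nth F n \<in> \<rat>)" using kp by blast
  have "phi p k nicely_meromorphic_on \<H>"
  proof (rule analytic_on_imp_nicely_meromorphic_on)
    have "open {z. Im z > 0}" by (rule open_halfspace_Im_gt)
    thus "phi p k analytic_on \<H>" unfolding upper_half_plane_def using holomorphic_phi[OF p0] by (simp add: analytic_on_open)
  qed
  moreover have "phi p k (moebius_act A z) = phi p k z" if A: "A \<in> SL2Z" "mat_cong p A (mat 1)" and z: "z \<in> \<H>" for A z
  proof -
    have "[A$1$2 = 0] (mod int p)" "[A$2$1 = 0] (mod int p)"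
      using A(2) by (simp_all add: mat_cong_def mat_def forall_2)
    thus ?thesis unfolding moebius_act_def
      by (intro phi_invariant[OF p0 SL2Z_det[OF A(1)]]) (use z k in \<open>auto simp: upper_half_plane_def cong_0_iff\<close>)
  qed
  moreover have "\<exists>F. has_q_expansion p (phi p k \<circ> moebius_act A) F" if A: "A \<in> SL2Z" for A
  proof -
    obtain j where "j \<le> p" "\<And>z. Im z > 0 \<Longrightarrow> (phi p k \<circ> moebius_act A) z = phi p j z"
      using phi_moebius[OF p kp SL2Z_det[OF A]] by (auto simp: moebius_act_def)
    thus ?thesis using has_q_expansion_cong[OF q] by blast
  qed
  ultimately have "phi p k \<in> modular_functions p" by (simp add: modular_functions_def)
  moreover have "\<exists>F. has_q_expansion p (phi p k) F \<and> (\<forall>n. fls_nth F n \<in> cyclotomic_field p)"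
    using ex Rats_sub_cyclotomic by blast
  ultimately show "phi p k \<in> level_field p" by (simp add: level_field_def)
qed

text \<open>Modulo p a diagonal matrix M equals diag(1, det M) times a lift A with off-diagonal
  entries divisible by p. The automorphism fixes the rational coefficients, so the intermediate
  function is \<open>phi p k\<close> itself, and A fixes it by \<open>phi_invariant\<close>.\<close>

lemma phi_curve_function_field:
  assumes p: "prime p" and k: "k = 0 \<or> k = p"
  shows "phi p k \<in> curve_function_field p (split_cartan p)"
proof -
  interpret cyclotomic p using p by unfold_locales
  have p0: "p > 0" using p by (auto intro: prime_gt_0_nat)
  note f = phi_level_field[OF p k]
  have "gl2_acts p M (phi p k) (phi p k)" if M: "M \<in> split_cartan p" for M
  proof -
    define a where "a = M$1$1"
    have cop: "coprime (det M) (int p)" and M12: "int p dvd M$1$2" and M21: "int p dvd M$2$1"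
      using M by (auto simp: split_cartan_def cong_0_iff)
    have "[det M = a * M$2$2 - 0 * M$2$1] (mod int p)" unfolding det_2 a_def
      by (intro cong_diff cong_mult) (use M12 in \<open>auto simp: cong_0_iff\<close>)
    hence det: "[det M = a * M$2$2] (mod int p)" by simp
    hence "coprime (a * M$2$2) (int p)" using cop by (metis cong_imp_coprime)
    \<comment> \<open>The lift A needs both off-diagonal entries divisible by p and determinant 1,
      so a is inverted modulo p^2.\<close>
    hence "coprime a (int p * int p)" by simp
    then obtain a' where "[a * a' = 1] (mod int p * int p)" using cong_solve_coprime_int by blast
    then obtain l where "a * a' - 1 = int p * int p * l" by (auto simp: cong_iff_dvd_diff elim: dvdE)
    hence l: "a * a' - int p * (int p * l) = 1" by simp
    define A :: "int^2^2" where "A = vector [vector [a, int p], vector [int p * l, a']]"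
    have A: "A$1$1 = a" "A$1$2 = int p" "A$2$1 = int p * l" "A$2$2 = a'" by (simp_all add: A_def)
    have SL: "A \<in> SL2Z" unfolding SL2Z_def using l by (simp add: det_2 A)
    obtain \<sigma> where \<sigma>: "cyclotomic_aut p (det M) \<sigma>" "\<And>x. x \<in> \<rat> \<Longrightarrow> \<sigma> x = x"
      by (rule exists_cyclotomic_aut[OF cop]) blast
    obtain F where F: "has_q_expansion p (phi p k) F" "\<And>n. fls_nth F n \<in> \<rat>" using f(2) by blast
    have inv: "phi p k z = phi p k (moebius_act A z)" if "z \<in> \<H>" for z
      unfolding moebius_act_def using that k
      by (intro phi_invariant[OF p0 SL2Z_det[OF SL], symmetric]) (auto simp: upper_half_plane_def A)
    have "[a * a' = 1] (mod int p)" using l by (metis cong_iff_dvd_diff dvd_triv_left diff_eq_eq add.commute diff_add_cancel add_diff_cancel_right')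
    hence "[M$2$2 * (a * a') = M$2$2 * 1] (mod int p)" by (intro cong_mult) auto
    moreover have "[det M * a' = (a * M$2$2) * a'] (mod int p)" using det by (intro cong_mult) auto
    moreover have "M$2$2 * (a * a') = (a * M$2$2) * a'" by (simp only: mult_ac)
    ultimately have "[(a * M$2$2) * a' = M$2$2] (mod int p)" "[det M * a' = (a * M$2$2) * a'] (mod int p)" by simp_all
    hence c22: "[M$2$2 = det M * a'] (mod int p)" by (rule cong_sym[OF cong_trans[rotated]])
    have "mat_cong p M (diag2 1 (det M) ** A)"
    proof -
      have D: "(diag2 1 (det M) ** A)$1$1 = a" "(diag2 1 (det M) ** A)$1$2 = int p"
        "(diag2 1 (det M) ** A)$2$1 = det M * (int p * l)" "(diag2 1 (det M) ** A)$2$2 = det M * a'"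
        by (simp_all add: matrix_matrix_mult_def sum_2 diag2_def A)
      have "[M$1$2 = int p] (mod int p)" "[M$2$1 = det M * (int p * l)] (mod int p)"
        using M12 M21 by (auto simp: cong_def dvd_eq_mod_eq_0)
      thus ?thesis unfolding mat_cong_def forall_2 D using c22 by (simp add: a_def)
    qed
    thus ?thesis unfolding gl2_acts_def using f(1) SL \<sigma> F inv
      by (intro conjI bexI[of _ A] bexI[of _ "phi p k"] exI[of _ \<sigma>] exI[of _ F]) auto
  qed
  thus ?thesis using f(1) by (simp add: curve_function_field_def)
qed

section \<open>Integral polynomials in the modular invariant\<close>

lemma sum_root_unity_powers:
  assumes "prime p"
  shows "(\<Sum>d<p. root_unity p ^ (d * k)) = (if p dvd k then of_nat p else 0)"
proof -
  interpret cyclotomic p using assms by unfold_locales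
  define x where "x = root_unity p ^ k"
  have *: "(\<Sum>d<p. root_unity p ^ (d * k)) = (\<Sum>d<p. x ^ d)" by (simp add: x_def mult.commute flip: power_mult)
  show ?thesis
  proof (cases "p dvd k")
    case True
    hence "x = 1" using zeta_power_eq_1_iff by (simp add: x_def)
    thus ?thesis using True * by simp
  next
    case False
    hence "x \<noteq> 1" using zeta_power_eq_1_iff by (simp add: x_def)
    moreover have "x ^ p = 1" unfolding x_def by (metis power_mult mult.commute power_one zeta_power_p)
    ultimately show ?thesis using False * by (simp add: geometric_sum)
  qed
qed

text \<open>The weights 1 - \<zeta>^(-d) vanish at d = 0 and add up to p, so p v is a weighted sum
  over all d. By orthogonality of roots of unity this sum is p times an integer. Plain averaging
  over nonzero d would leave a denominator p - 1.\<close>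

lemma galois_invariant_integer:
  fixes R :: "int poly"
  assumes p: "prime p" and v: "\<And>d. 0 < d \<Longrightarrow> d < p \<Longrightarrow> poly (map_poly of_int R) (root_unity p ^ d) = v"
  shows "v \<in> \<int>"
proof -
  have p1: "p > 1" by (rule prime_gt_1_nat[OF p])
  let ?\<zeta> = "root_unity p"
  define w where "w d = 1 - ?\<zeta> ^ (d * (p - 1))" for d
  have "\<not> p dvd p - 1" using p1 by (auto dest: dvd_imp_le)
  hence "(\<Sum>d<p. w d) = of_nat p" using sum_root_unity_powers[OF p, of "p - 1"] by (simp add: w_def sum_subtractf)
  hence "of_nat p * v = (\<Sum>d<p. w d) * v" by simp
  also have "\<dots> = (\<Sum>d<p. w d * v)" by (rule sum_distrib_right)
  also have "(\<Sum>d<p. w d * v) = (\<Sum>d<p. w d * poly (map_poly of_int R) (?\<zeta> ^ d))"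
  proof (intro sum.cong refl)
    fix d assume "d \<in> {..<p}"
    thus "w d * v = w d * poly (map_poly of_int R) (?\<zeta> ^ d)" using v[of d] by (cases "d = 0") (auto simp: w_def)
  qed
  also have "\<dots> = (\<Sum>d<p. \<Sum>i\<le>degree R. of_int (coeff R i) * (?\<zeta> ^ (d * i) - ?\<zeta> ^ (d * (i + (p - 1)))))"
  proof (intro sum.cong refl)
    fix d
    have "w d * (?\<zeta> ^ d) ^ i = ?\<zeta> ^ (d * i) - ?\<zeta> ^ (d * (i + (p - 1)))" for i
      unfolding w_def distrib_left power_add by (simp add: power_mult[of _ d i] algebra_simps)
    hence *: "w d * (of_int c * (?\<zeta> ^ d) ^ i) = of_int c * (?\<zeta> ^ (d * i) - ?\<zeta> ^ (d * (i + (p - 1))))" for i c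
      by (metis mult.left_commute)
    have "poly (map_poly of_int R) (?\<zeta> ^ d) = (\<Sum>i\<le>degree R. of_int (coeff R i) * (?\<zeta> ^ d) ^ i)"
      by (simp add: poly_altdef degree_map_poly coeff_map_poly)
    thus "w d * poly (map_poly of_int R) (?\<zeta> ^ d) =
        (\<Sum>i\<le>degree R. of_int (coeff R i) * (?\<zeta> ^ (d * i) - ?\<zeta> ^ (d * (i + (p - 1)))))"
      by (simp only: sum_distrib_left *)
  qed
  also have "\<dots> = (\<Sum>i\<le>degree R. of_int (coeff R i) *
      ((\<Sum>d<p. ?\<zeta> ^ (d * i)) - (\<Sum>d<p. ?\<zeta> ^ (d * (i + (p - 1))))))"
    by (subst sum.swap) (simp only: sum_distrib_left[symmetric] sum_subtractf)
  also have "\<dots> = of_nat p * (\<Sum>i\<le>degree R. of_int (coeff R i) *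
      ((if p dvd i then 1 else 0) - (if p dvd i + (p - 1) then 1 else 0)))"
    unfolding sum_root_unity_powers[OF p] sum_distrib_left by (intro sum.cong refl) auto
  finally have "v = (\<Sum>i\<le>degree R. of_int (coeff R i) *
      ((if p dvd i then 1 else 0) - (if p dvd i + (p - 1) then 1 else 0)))" using p1 by simp
  also have "\<dots> \<in> \<int>" by (intro Ints_sum Ints_mult) auto
  finally show ?thesis .
qed

lemma q_expansion_leading_term:
  assumes f: "has_q_expansion p f L" and p: "p > 0" and L: "\<And>n. n < m \<Longrightarrow> fls_nth L n = 0" and e: "e > 0"
  shows "\<exists>Y. \<forall>z. Im z > Y \<longrightarrow> norm (f z * nome (z / of_nat p) powi (- m) - fls_nth L m) < e"
proof -
  obtain Y where Y: "eval_fls L has_laurent_expansion L" "\<And>z. Im z > Y \<Longrightarrow> f z = eval_fls L (nome (z / of_nat p))"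
    by (rule has_q_expansionE[OF f]) blast
  define G where "G = L * fls_X_intpow (- m)"
  have G: "(\<lambda>u. eval_fls L u * u powi (- m)) has_laurent_expansion G"
    unfolding G_def by (intro laurent_expansion_intros Y(1))
  have Gn: "fls_nth G n = fls_nth L (n + m)" for n unfolding G_def fls_X_intpow_times_conv_shift(2) by simp
  have "fls_subdegree G \<ge> 0"
  proof (cases "G = 0")
    case False
    thus ?thesis using L by (intro fls_subdegree_geI) (auto simp: Gn)
  qed simp
  hence "((\<lambda>u. eval_fls L u * u powi (- m)) \<longlongrightarrow> fls_nth G 0) (at 0)"
    by (rule has_laurent_expansion_imp_tendsto_0[OF G])
  from tendsto_at_cusp[OF this e] obtain Y' where Y':
    "\<And>z. Im z > Y' \<Longrightarrow> norm (eval_fls L (nome z) * nome z powi (- m) - fls_nth L m) < e" by (auto simp: Gn)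
  have "norm (f z * nome (z / of_nat p) powi (- m) - fls_nth L m) < e" if z: "Im z > max Y (Y' * real p)" for z
  proof -
    have "Im (z / of_nat p) > Y'" using z p by (simp add: Im_divide_of_nat pos_less_divide_eq)
    thus ?thesis using Y' Y(2)[of z] z by simp
  qed
  thus ?thesis by blast
qed

lemma klein_j_expansion:
  assumes p: "p > 0"
  obtains J where "has_q_expansion p klein_j J" "\<And>n. fls_nth J n \<in> \<int>" "\<And>n. n < - int p \<Longrightarrow> fls_nth J n = 0" "fls_nth J (- int p) = 1"
proof -
  obtain S where S: "(\<lambda>w. inverse (euler w ^ 24)) has_fps_expansion inverse S" "inverse S \<in> int_fps" "fps_nth S 0 = 1"
    by (rule euler24_expansion) blast
  define E where "E = 1 + fps_const 240 * lamb 3"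
  have lr: "fps_conv_radius (lamb 3) > 0" by (rule less_le_trans[OF _ lamb_conv_radius]) simp_all
  have E: "E4q has_fps_expansion E" unfolding E4q_def[abs_def] E_def
    by (intro fps_expansion_intros eval_fps_has_fps_expansion lr)
  have "E \<in> int_fps" by (auto simp: E_def int_fps_def lamb_def)
  define G where "G = (E ^ 3 * inverse S) oo fps_X ^ p"
  have G_int: "G \<in> int_fps" unfolding G_def
    by (intro int_fps_compose int_fps_mult int_fps_power S int_fps_X_power \<open>E \<in> int_fps\<close>)
  have G0: "fps_nth G 0 = 1" using S(3) by (simp add: G_def E_def lamb_def fps_nth_power_0)
  have "((\<lambda>w. E4q w ^ 3 * inverse (euler w ^ 24)) \<circ> (\<lambda>u. u ^ p)) has_fps_expansion G" unfolding G_def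
    by (rule has_fps_expansion_compose) (use p in \<open>auto intro!: fps_expansion_intros E S\<close>)
  hence L: "(\<lambda>u. u powi (- int p) * ((\<lambda>w. E4q w ^ 3 * inverse (euler w ^ 24)) \<circ> (\<lambda>u. u ^ p)) u)
      has_laurent_expansion fls_X_intpow (- int p) * fps_to_fls G"
    by (intro laurent_expansion_intros has_laurent_expansion_fps)
  have "has_q_expansion p klein_j (fls_X_intpow (- int p) * fps_to_fls G)"
  proof (rule has_q_expansionI[OF L p, of 0])
    fix z assume z: "Im z > 0"
    have "nome z = nome (z / of_nat p) ^ p" using p by (simp flip: nome_of_nat_mult)
    thus "klein_j z = nome (z / of_nat p) powi (- int p) *
        ((\<lambda>w. E4q w ^ 3 * inverse (euler w ^ 24)) \<circ> (\<lambda>u. u ^ p)) (nome (z / of_nat p))"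
      unfolding klein_j_eq[OF z] Delta_def Dq_def by (simp add: power_int_minus divide_inverse)
  qed
  moreover have "fls_nth (fls_X_intpow (- int p) * fps_to_fls G) n =
      (if n < - int p then 0 else fps_nth G (nat (n + int p)))" for n
    unfolding fls_X_intpow_times_conv_shift(1) by simp
  ultimately show thesis using G_int G0 by (intro that) (auto simp: int_fps_def)
qed

lemma klein_j_power_expansion:
  assumes p: "p > 0"
  obtains J where "has_q_expansion p (\<lambda>z. klein_j z ^ k) J" "\<And>n. fls_nth J n \<in> \<int>"
    "\<And>n. n < - int (p * k) \<Longrightarrow> fls_nth J n = 0" "fls_nth J (- int (p * k)) = 1"
proof (induction k arbitrary: thesis)
  case 0
  show ?case by (rule 0[of 1]) (use has_q_expansion_const[OF p, of 1] in auto)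
next
  case (Suc k)
  obtain J where J: "has_q_expansion p (\<lambda>z. klein_j z ^ k) J" "\<And>n. fls_nth J n \<in> \<int>"
    "\<And>n. n < - int (p * k) \<Longrightarrow> fls_nth J n = 0" "fls_nth J (- int (p * k)) = 1"
    using Suc.IH by blast
  obtain J1 where J1: "has_q_expansion p klein_j J1" "\<And>n. fls_nth J1 n \<in> \<int>"
    "\<And>n. n < - int p \<Longrightarrow> fls_nth J1 n = 0" "fls_nth J1 (- int p) = 1"
    by (rule klein_j_expansion[OF p]) blast
  have nth: "fls_nth (J1 * J) n = (\<Sum>i=- int p..n - (- int (p * k)). fls_nth J1 i * fls_nth J (n - i))" for n
    by (rule fls_times_nth_bounds) (use J1(3) J(3) in auto)
  have k: "- int (p * Suc k) = - int p + - int (p * k)" by simp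
  show ?case
  proof (rule Suc.prems)
    show "has_q_expansion p (\<lambda>z. klein_j z ^ Suc k) (J1 * J)"
      using has_q_expansion_mult[OF J1(1) J(1) p] by simp
    show "fls_nth (J1 * J) n \<in> \<int>" for n unfolding nth by (intro Ints_sum Ints_mult J1 J)
    show "fls_nth (J1 * J) n = 0" if "n < - int (p * Suc k)" for n
      unfolding nth using that k by simp
    show "fls_nth (J1 * J) (- int (p * Suc k)) = 1" unfolding nth k using J(4) by (simp add: J1(4))
  qed
qed

text \<open>Induction on the pole order in u = q^(1/p). If p does not divide it, invariance under z
  -> z + 1 kills the leading coefficient; if it is p k, subtracting an integer multiple of j^k
  removes that term. Without a pole the maximum principle makes f constant.\<close>

lemma q_expansion_principle:
  assumes p: "prime p"
  shows "f holomorphic_on {z. Im z > 0} \<Longrightarrow> (\<And>z n. Im z > 0 \<Longrightarrow> f (z + of_int n) = f z) \<Longrightarrow>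
    (\<And>z. Im z > 0 \<Longrightarrow> f (- 1 / z) = f z) \<Longrightarrow> has_q_expansion p f L \<Longrightarrow> (\<And>n. fls_nth L n \<in> \<int>) \<Longrightarrow>
    (\<And>n. n < - int N \<Longrightarrow> fls_nth L n = 0) \<Longrightarrow>
    \<exists>R :: int poly. \<forall>z. Im z > 0 \<longrightarrow> f z = poly (map_poly of_int R) (klein_j z)"
proof (induction N arbitrary: f L)
  case 0
  have p0: "p > 0" by (rule prime_gt_0_nat[OF p])
  obtain a where a: "fls_nth L 0 = of_int a" using 0(5)[of 0] by (auto elim: Ints_cases)
  have "f z = fls_nth L 0" if "Im z > 0" for z
  proof (rule modular_maximum_principle[OF 0(1) 0(2) 0(3) _ that])
    fix e :: real assume "e > 0"
    thus "\<exists>Y. \<forall>z. Im z > Y \<longrightarrow> norm (f z - fls_nth L 0) < e"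
      using q_expansion_leading_term[OF 0(4) p0, of 0] 0(6) by simp
  qed
  thus ?case by (intro exI[of _ "[:a:]"]) (simp add: a map_poly_pCons)
next
  case (Suc N)
  interpret cyclotomic p using p by unfold_locales
  define m where "m = - int (Suc N)"
  obtain a where a: "fls_nth L m = of_int a" using Suc.prems(5)[of m] by (auto elim: Ints_cases)
  show ?case
  proof (cases "p dvd Suc N")
    case False
    \<comment> \<open>Far up, f u^(N+1) is close to the leading coefficient a. Replacing z by z + 1
      keeps f and multiplies u by \<zeta>, so a and \<zeta>^(N+1) a are arbitrarily close.\<close>
    have "norm (root_unity p ^ Suc N * of_int a - of_int a :: complex) \<le> e" if e: "e > 0" for e
    proof -
      have "e / 2 > 0" using e by simp
      from q_expansion_leading_term[OF Suc.prems(4) p_pos _ this, of m] Suc.prems(6)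
      obtain Y where Y: "\<And>z. Im z > Y \<Longrightarrow> norm (f z * nome (z / of_nat p) powi (- m) - of_int a) < e / 2"
        unfolding a[symmetric] by (auto simp: m_def)
      define z where "z = \<i> * of_real (max Y 0 + 1)"
      have z: "Im z > Y" "Im z > 0" by (auto simp: z_def)
      define b where "b = f z * nome (z / of_nat p) ^ Suc N"
      have "norm (b - of_int a) < e / 2" using Y[OF z(1)] by (simp only: b_def m_def minus_minus power_int_of_nat)
      moreover have "f (z + 1) = f z" using Suc.prems(2)[OF z(2), of 1] by simp
      moreover have "nome ((z + 1) / of_nat p) = root_unity p * nome (z / of_nat p)"
        unfolding add_divide_distrib nome_add by (simp add: nome_def root_unity_def)
      hence "nome ((z + 1) / of_nat p) ^ Suc N = root_unity p ^ Suc N * nome (z / of_nat p) ^ Suc N"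
        by (simp only: power_mult_distrib)
      ultimately have 1: "norm (b - of_int a) < e / 2" and 2: "norm (root_unity p ^ Suc N * b - of_int a) < e / 2"
        using Y[of "z + 1"] z(1) by (simp_all only: b_def m_def minus_minus power_int_of_nat mult_ac plus_complex.sel one_complex.sel add_0_right)
      have "root_unity p ^ Suc N * of_int a - of_int a =
          (root_unity p ^ Suc N * b - of_int a) - root_unity p ^ Suc N * (b - of_int a)" by (simp only: right_diff_distrib) simp
      also have "norm \<dots> \<le> norm (root_unity p ^ Suc N * b - of_int a) + norm (root_unity p ^ Suc N * (b - of_int a))"
        by (rule norm_triangle_ineq4)
      also have "norm (root_unity p ^ Suc N * (b - of_int a)) = norm (b - of_int a)"
        by (simp add: norm_mult norm_power root_unity_def del: power_Suc)
      finally show ?thesis using 1 2 by linarith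
    qed
    hence "norm (root_unity p ^ Suc N * of_int a - of_int a :: complex) \<le> 0" by (rule field_le_epsilon[of _ 0, simplified])
    hence "(root_unity p ^ Suc N - 1) * of_int a = 0" by (simp add: left_diff_distrib del: power_Suc)
    hence "a = 0" using False by (simp add: zeta_power_eq_1_iff del: power_Suc)
    have "fls_nth L n = 0" if "n < - int N" for n
    proof (cases "n = m")
      case False
      thus ?thesis using that by (intro Suc.prems(6)) (simp add: m_def)
    qed (simp add: a \<open>a = 0\<close>)
    thus ?thesis using Suc.IH[OF Suc.prems(1-5)] by blast
  next
    case True
    then obtain k where k: "Suc N = p * k" by blast
    obtain J where J: "has_q_expansion p (\<lambda>z. klein_j z ^ k) J" "\<And>n. fls_nth J n \<in> \<int>"
      "\<And>n. n < m \<Longrightarrow> fls_nth J n = 0" "fls_nth J m = 1"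
      unfolding m_def k by (rule klein_j_power_expansion[OF p_pos, of k]) blast
    define g where "g z = f z - of_int a * klein_j z ^ k" for z
    define M where "M = L - fls_const (of_int a) * J"
    have "\<exists>R :: int poly. \<forall>z. Im z > 0 \<longrightarrow> g z = poly (map_poly of_int R) (klein_j z)"
    proof (rule Suc.IH)
      show "g holomorphic_on {z. Im z > 0}" unfolding g_def[abs_def]
        by (intro holomorphic_intros Suc.prems(1) holomorphic_klein_j)
      show "has_q_expansion p g M" unfolding g_def[abs_def] M_def
        by (intro has_q_expansion_diff has_q_expansion_mult has_q_expansion_const Suc.prems(4) J(1) p_pos)
      show "fls_nth M n \<in> \<int>" for n unfolding M_def using Suc.prems(5) J(2) by (auto intro!: Ints_diff Ints_mult)
      show "fls_nth M n = 0" if "n < - int N" for n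
      proof (cases "n = m")
        case False
        hence "n < m" using that by (simp add: m_def)
        thus ?thesis using J(3) Suc.prems(6)[of n] by (simp add: M_def m_def)
      qed (simp add: M_def a J(4))
    qed (use Suc.prems(2,3) klein_j_minus_inverse in \<open>simp_all add: g_def klein_j_plus_int\<close>)
    then obtain R :: "int poly" where "\<And>z. Im z > 0 \<Longrightarrow> g z = poly (map_poly of_int R) (klein_j z)" by blast
    thus ?thesis by (intro exI[of _ "R + monom a k"]) (simp add: of_int_poly_simps g_def diff_eq_eq)
  qed
qed

text \<open>Only the permutation of the roots matters: invariance under conjugation makes the
  expansion coefficients of each symmetric function integers, and invariance under the generators
  lets the expansion principle apply.\<close>

lemma modular_coefficients:
  assumes p: "prime p" and I: "finite I" "\<And>i. i \<in> I \<Longrightarrow> expands p (g i) (F i)"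
    and gal: "\<And>d. 0 < d \<Longrightarrow> d < p \<Longrightarrow> (\<Prod>i\<in>I. [:- F i d, 1:]) = (\<Prod>i\<in>I. [:- F i 1, 1:])"
    and T: "\<And>z n. Im z > 0 \<Longrightarrow> (\<Prod>i\<in>I. [:- g i (z + of_int n), 1:]) = (\<Prod>i\<in>I. [:- g i z, 1:])"
    and S: "\<And>z. Im z > 0 \<Longrightarrow> (\<Prod>i\<in>I. [:- g i (- 1 / z), 1:]) = (\<Prod>i\<in>I. [:- g i z, 1:])"
  shows "\<exists>R :: nat \<Rightarrow> int poly. \<forall>n z. Im z > 0 \<longrightarrow>
    coeff (\<Prod>i\<in>I. [:- g i z, 1:]) n = poly (map_poly of_int (R n)) (klein_j z)"
proof -
  have p0: "p > 0" by (rule prime_gt_0_nat[OF p])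
  have "\<exists>R :: int poly. \<forall>z. Im z > 0 \<longrightarrow> coeff (\<Prod>i\<in>I. [:- g i z, 1:]) n = poly (map_poly of_int R) (klein_j z)" for n
  proof -
    have e: "expands p (\<lambda>z. coeff (\<Prod>i\<in>I. [:- g i z, 1:]) n) (\<lambda>d. coeff (\<Prod>i\<in>I. [:- F i d, 1:]) n)"
      by (rule expands_prod_coeff[OF I p0])
    define L where "L = coeff (\<Prod>i\<in>I. [:- F i 1, 1:]) n"
    obtain R where R: "\<And>d m. fls_nth (coeff (\<Prod>i\<in>I. [:- F i d, 1:]) n) m = poly (map_poly of_int (R m :: int poly)) (root_unity p ^ d)"
      using e unfolding expands_def galois_family_def by blast
    have "fls_nth L m \<in> \<int>" for m
    proof (rule galois_invariant_integer[OF p])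
      fix d assume d: "0 < d" "d < p"
      show "poly (map_poly of_int (R m)) (root_unity p ^ d) = fls_nth L m"
        unfolding R[symmetric] L_def gal[OF d] ..
    qed
    moreover have "fls_nth L m = 0" if "m < - int (nat (- fls_subdegree L))" for m
      using that by (intro fls_eq0_below_subdegree) linarith
    moreover have "(\<lambda>z. coeff (\<Prod>i\<in>I. [:- g i z, 1:]) n) holomorphic_on {z. Im z > 0}"
      "has_q_expansion p (\<lambda>z. coeff (\<Prod>i\<in>I. [:- g i z, 1:]) n) L"
      using e by (simp_all add: expands_def L_def)
    moreover have "coeff (\<Prod>i\<in>I. [:- g i (z + of_int m), 1:]) n = coeff (\<Prod>i\<in>I. [:- g i z, 1:]) n"
      "coeff (\<Prod>i\<in>I. [:- g i (- 1 / z), 1:]) n = coeff (\<Prod>i\<in>I. [:- g i z, 1:]) n" if "Im z > 0" for z m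
      by (simp_all only: T[OF that] S[OF that])
    ultimately show ?thesis by (intro q_expansion_principle[OF p, where L = L and N = "nat (- fls_subdegree L)"])
  qed
  thus ?thesis by metis
qed

lemma prod_reindex_permutation:
  assumes "bij_betw \<pi> I I" "\<And>i. i \<in> I \<Longrightarrow> h i = h' (\<pi> i)"
  shows "(\<Prod>i\<in>I. [:- h i, 1:]) = (\<Prod>i\<in>I. [:- h' i, 1:])"
proof -
  have "(\<Prod>i\<in>I. [:- h i, 1:]) = (\<Prod>i\<in>I. [:- h' (\<pi> i), 1:])" by (intro prod.cong refl) (simp add: assms(2))
  also have "\<dots> = (\<Prod>i\<in>I. [:- h' i, 1:])" by (rule prod.reindex_bij_betw[OF assms(1)])
  finally show ?thesis .
qed

section \<open>Resolvent polynomials over Z[j]\<close>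

text \<open>Ordered pairs of distinct points of the projective line. A permutation acting on both
  entries preserves distinctness, so these pairs already form an invariant root set.\<close>

definition index_pairs :: "nat \<Rightarrow> (nat \<times> nat) set"
  where "index_pairs p = {(\<alpha>, \<beta>). \<alpha> \<le> p \<and> \<beta> \<le> p \<and> \<alpha> \<noteq> \<beta>}"

lemma finite_index_pairs: "finite (index_pairs p)"
  by (rule finite_subset[of _ "{..p} \<times> {..p}"]) (auto simp: index_pairs_def)

lemma bij_index_pairs:
  assumes "bij_betw \<pi> {..p} {..p}"
  shows "bij_betw (map_prod \<pi> \<pi>) (index_pairs p) (index_pairs p)"
proof -
  have inj: "\<pi> a = \<pi> b \<longleftrightarrow> a = b" if "a \<le> p" "b \<le> p" for a b
    using assms that by (auto simp: bij_betw_def inj_on_def)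
  have le: "\<pi> a \<le> p" if "a \<le> p" for a using bij_betwE[OF assms] that by auto
  have "inj_on (map_prod \<pi> \<pi>) (index_pairs p)"
    by (auto simp: inj_on_def index_pairs_def inj)
  moreover have "map_prod \<pi> \<pi> ` index_pairs p \<subseteq> index_pairs p"
    by (auto simp: index_pairs_def inj le)
  ultimately show ?thesis by (simp add: bij_betw_def endo_inj_surj finite_index_pairs)
qed

lemma coprime_less_prime: "prime (p::nat) \<Longrightarrow> 0 < d \<Longrightarrow> d < p \<Longrightarrow> coprime d p"
  by (metis coprime_commute nat_dvd_not_less prime_imp_coprime)

lemma phi_pair_polynomial:
  assumes p: "prime p"
  shows "\<exists>R :: nat \<Rightarrow> int poly. \<forall>n z. Im z > 0 \<longrightarrow>
    coeff (\<Prod>i\<in>index_pairs p. [:- (phi p (fst i) z + of_nat t * phi p (snd i) z), 1:]) n = poly (map_poly of_int (R n)) (klein_j z)"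
proof -
  have p0: "p > 0" by (rule prime_gt_0_nat[OF p])
  obtain F where F: "\<And>k. k \<le> p \<Longrightarrow> expands p (phi p k) (F k)" "\<And>d k. k \<le> p \<Longrightarrow> F k d = F (scale_index p d k) 1"
    using phi_expansions[OF p0] by metis
  obtain \<pi> where \<pi>: "bij_betw \<pi> {..p} {..p}" "\<And>k \<tau>. k \<le> p \<Longrightarrow> Im \<tau> > 0 \<Longrightarrow> phi p k (- 1 / \<tau>) = phi p (\<pi> k) \<tau>"
    using inversion_index[OF p] by metis
  have le: "fst i \<le> p" "snd i \<le> p" if "i \<in> index_pairs p" for i using that by (auto simp: index_pairs_def)
  show ?thesis
  proof (rule modular_coefficients[OF p finite_index_pairs, where F = "\<lambda>i d. F (fst i) d + of_int (int t) * F (snd i) d"])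
    show "expands p (\<lambda>z. phi p (fst i) z + of_nat t * phi p (snd i) z) (\<lambda>d. F (fst i) d + of_int (int t) * F (snd i) d)"
      if "i \<in> index_pairs p" for i
      using expands_of_int[OF p0, of "int t"] le[OF that] by (intro expands_add expands_mult F(1) p0) auto
    show "(\<Prod>i\<in>index_pairs p. [:- (F (fst i) d + of_int (int t) * F (snd i) d), 1:]) =
        (\<Prod>i\<in>index_pairs p. [:- (F (fst i) 1 + of_int (int t) * F (snd i) 1), 1:])" if "0 < d" "d < p" for d
      by (rule prod_reindex_permutation[OF bij_index_pairs[OF bij_scale_index[OF p0 coprime_less_prime[OF p that]]]])
        (simp only: fst_map_prod snd_map_prod F(2)[OF le(1), of _ d] F(2)[OF le(2), of _ d])
    show "(\<Prod>i\<in>index_pairs p. [:- (phi p (fst i) (z + of_int n) + of_nat t * phi p (snd i) (z + of_int n)), 1:]) =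
        (\<Prod>i\<in>index_pairs p. [:- (phi p (fst i) z + of_nat t * phi p (snd i) z), 1:])" for z n
      by (rule prod_reindex_permutation[OF bij_index_pairs[OF bij_shift_index[OF p0, of n]]])
        (use le in \<open>simp add: phi_shift_index[OF p0]\<close>)
    show "(\<Prod>i\<in>index_pairs p. [:- (phi p (fst i) (- 1 / z) + of_nat t * phi p (snd i) (- 1 / z)), 1:]) =
        (\<Prod>i\<in>index_pairs p. [:- (phi p (fst i) z + of_nat t * phi p (snd i) z), 1:])" if "Im z > 0" for z
      by (rule prod_reindex_permutation[OF bij_index_pairs[OF \<pi>(1)]]) (use le \<pi>(2) that in simp)
  qed
qed

lemma
  assumes p: "prime p"
  shows phi_polynomial: "\<exists>R :: nat \<Rightarrow> int poly. \<forall>n z. Im z > 0 \<longrightarrow>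
      coeff (\<Prod>i\<le>p. [:- phi p i z, 1:]) n = poly (map_poly of_int (R n)) (klein_j z)"
    and chi_polynomial: "\<exists>R :: nat \<Rightarrow> int poly. \<forall>n z. Im z > 0 \<longrightarrow>
      coeff (\<Prod>i\<le>p. [:- (of_nat p ^ 12 / phi p i z), 1:]) n = poly (map_poly of_int (R n)) (klein_j z)"
proof -
  have p0: "p > 0" by (rule prime_gt_0_nat[OF p])
  obtain \<pi> where \<pi>: "bij_betw \<pi> {..p} {..p}" "\<And>k \<tau>. k \<le> p \<Longrightarrow> Im \<tau> > 0 \<Longrightarrow> phi p k (- 1 / \<tau>) = phi p (\<pi> k) \<tau>"
    using inversion_index[OF p] by metis
  have *: "\<exists>R :: nat \<Rightarrow> int poly. \<forall>n z. Im z > 0 \<longrightarrow>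
      coeff (\<Prod>i\<le>p. [:- h (phi p i z), 1:]) n = poly (map_poly of_int (R n)) (klein_j z)"
    if F: "\<And>k. k \<le> p \<Longrightarrow> expands p (\<lambda>z. h (phi p k z)) (F k)" "\<And>d k. k \<le> p \<Longrightarrow> F k d = F (scale_index p d k) 1" for F h
  proof (rule modular_coefficients[OF p finite_atMost, where F = F])
    show "(\<Prod>i\<le>p. [:- F i d, 1:]) = (\<Prod>i\<le>p. [:- F i 1, 1:])" if "0 < d" "d < p" for d
      by (rule prod_reindex_permutation[OF bij_scale_index[OF p0 coprime_less_prime[OF p that]]]) (simp only: F(2)[of _ d] atMost_iff)
    show "(\<Prod>i\<le>p. [:- h (phi p i (z + of_int n)), 1:]) = (\<Prod>i\<le>p. [:- h (phi p i z), 1:])" for z n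
      by (rule prod_reindex_permutation[OF bij_shift_index[OF p0, of n]]) (simp add: phi_shift_index[OF p0])
    show "(\<Prod>i\<le>p. [:- h (phi p i (- 1 / z)), 1:]) = (\<Prod>i\<le>p. [:- h (phi p i z), 1:])" if "Im z > 0" for z
      by (rule prod_reindex_permutation[OF \<pi>(1)]) (use \<pi>(2) that in simp)
  qed (use F(1) in auto)
  show "\<exists>R :: nat \<Rightarrow> int poly. \<forall>n z. Im z > 0 \<longrightarrow>
      coeff (\<Prod>i\<le>p. [:- phi p i z, 1:]) n = poly (map_poly of_int (R n)) (klein_j z)"
    by (rule phi_expansions[OF p0], rule *[where h = "\<lambda>x. x"]) blast+
  show "\<exists>R :: nat \<Rightarrow> int poly. \<forall>n z. Im z > 0 \<longrightarrow>
      coeff (\<Prod>i\<le>p. [:- (of_nat p ^ 12 / phi p i z), 1:]) n = poly (map_poly of_int (R n)) (klein_j z)"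
    by (rule chi_expansions[OF p0], rule *[where h = "\<lambda>x. of_nat p ^ 12 / x"]) blast+
qed

lemma prod_linear_poly:
  fixes h :: "'i \<Rightarrow> complex"
  assumes "finite I"
  shows "degree (\<Prod>i\<in>I. [:- h i, 1:]) = card I" "lead_coeff (\<Prod>i\<in>I. [:- h i, 1:]) = 1"
    and "poly (\<Prod>i\<in>I. [:- h i, 1:]) x = 0 \<longleftrightarrow> x \<in> h ` I"
    and "poly (\<Prod>i\<in>I. [:- h i, 1:]) x = (\<Sum>n\<le>card I. coeff (\<Prod>i\<in>I. [:- h i, 1:]) n * x ^ n)"
proof -
  show d: "degree (\<Prod>i\<in>I. [:- h i, 1:]) = card I" by (subst degree_prod_eq_sum_degree) auto
  show "lead_coeff (\<Prod>i\<in>I. [:- h i, 1:]) = 1" by (subst lead_coeff_prod) auto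
  show "poly (\<Prod>i\<in>I. [:- h i, 1:]) x = 0 \<longleftrightarrow> x \<in> h ` I" using assms by (auto simp: poly_prod)
  show "poly (\<Prod>i\<in>I. [:- h i, 1:]) x = (\<Sum>n\<le>card I. coeff (\<Prod>i\<in>I. [:- h i, 1:]) n * x ^ n)"
    unfolding d[symmetric] by (rule poly_altdef)
qed

section \<open>Integrality and conjugation of values\<close>

text \<open>Reducing coefficients by x^2 = T x - N writes the equation as A(y) + x B(y) = 0 with A
  monic of degree D and B of smaller degree. The norm A^2 + T A B + N B^2 is then a monic integer
  polynomial vanishing at y.\<close>

lemma monic_over_quadratic_algebraic_int:
  fixes R :: "nat \<Rightarrow> int poly"
  assumes j: "x + x' = of_int T" "x * x' = of_int N"
    and root: "(\<Sum>n\<le>D. poly (map_poly of_int (R n)) x * y ^ n) = 0" and D: "D > 0"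
    and monic: "poly (map_poly of_int (R D)) x = 1"
  shows "algebraic_int (y :: complex)"
proof -
  have x2: "x * x = of_int T * x - of_int N" using j by (simp flip: j add: algebra_simps)
  have "\<exists>a b. poly (map_poly of_int r) x = of_int a + x * of_int b" for r :: "int poly"
  proof (induction r)
    case (pCons c r)
    then obtain a b where "poly (map_poly of_int r) x = of_int a + x * of_int b" by blast
    hence "poly (map_poly of_int (pCons c r)) x = of_int c + x * of_int a + (x * x) * of_int b"
      by (simp add: map_poly_pCons algebra_simps)
    also have "\<dots> = of_int (c - N * b) + x * of_int (a + T * b)" unfolding x2 by (simp add: algebra_simps)
    finally show ?case by blast
  qed (auto intro!: exI[of _ 0])
  hence "\<forall>n. \<exists>a b. poly (map_poly of_int (R n)) x = of_int a + x * of_int b" by blast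
  then obtain a b where ab: "\<And>n. poly (map_poly of_int (R n)) x = of_int (a n) + x * of_int (b n)" by metis
  define A0 B where "A0 = (\<Sum>n<D. monom (a n) n)" and "B = (\<Sum>n<D. monom (b n) n)"
  define A where "A = monom 1 D + A0"
  have "degree A0 < D" "degree B < D"
    using D by (auto intro!: degree_lessI simp: A0_def B_def coeff_sum)
  hence dA: "degree A = D" "lead_coeff A = 1"
  proof -
    assume "degree A0 < D"
    hence "degree A0 < degree (monom (1::int) D)" by (simp add: degree_monom_eq)
    thus "degree A = D" "lead_coeff A = 1"
      unfolding A_def using degree_add_eq_left[of A0 "monom 1 D"] lead_coeff_add_le[of A0 "monom 1 D"]
      by (simp_all add: degree_monom_eq add.commute)
  qed
  have ev: "poly (map_poly of_int (\<Sum>n<D. monom (c n) n)) y = (\<Sum>n<D. of_int (c n) * y ^ n)" for c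
    by (simp add: of_int_poly_sum of_int_poly_simps)
  have "0 = (\<Sum>n<D. poly (map_poly of_int (R n)) x * y ^ n) + y ^ D"
    using root by (simp add: monic lessThan_Suc_atMost[symmetric])
  also have "\<dots> = poly (map_poly of_int A) y + x * poly (map_poly of_int B) y"
    unfolding A_def A0_def B_def of_int_poly_simps ev ab
    by (simp add: distrib_right sum.distrib sum_distrib_left mult.assoc)
  finally have PB: "poly (map_poly of_int A) y = - x * poly (map_poly of_int B) y" by (simp add: eq_neg_iff_add_eq_0)
  define M where "M = smult T (A * B) + smult N (B * B)"
  have "degree M < 2 * D"
  proof -
    have "degree (smult T (A * B)) \<le> D + degree B" using degree_smult_le[of T "A * B"] degree_mult_le[of A B] dA by linarith
    moreover have "degree (smult N (B * B)) \<le> degree B + degree B" using degree_smult_le[of N "B * B"] degree_mult_le[of B B] by linarith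
    ultimately show ?thesis unfolding M_def using \<open>degree B < D\<close> by (intro degree_add_less) auto
  qed
  moreover have "degree (A * A) = 2 * D" "lead_coeff (A * A) = 1"
  proof -
    have "A \<noteq> 0" using dA by auto
    thus "degree (A * A) = 2 * D" by (simp add: degree_mult_eq dA)
    show "lead_coeff (A * A) = 1" by (simp only: lead_coeff_mult dA(2) mult_1)
  qed
  ultimately have "lead_coeff (M + A * A) = 1" by (simp only: lead_coeff_add_le)
  moreover have "poly (map_poly of_int (M + A * A)) y = 0"
  proof -
    have sm: "poly (map_poly of_int (smult c q)) y = of_int c * poly (map_poly of_int q) y" for c q
      using of_int_poly_simps(2)[of "[:c:]" q y] by (simp add: map_poly_pCons)
    define v where "v = poly (map_poly of_int B) y"
    have "poly (map_poly of_int (M + A * A)) y = (x * x - of_int T * x + of_int N) * (v * v)"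
      unfolding M_def of_int_poly_simps sm PB v_def[symmetric] by (simp add: algebra_simps)
    thus ?thesis unfolding x2 by simp
  qed
  ultimately show ?thesis unfolding algebraic_int_altdef_ipoly by blast
qed

lemma modular_value_algebraic_int:
  fixes h :: "nat \<Rightarrow> complex"
  assumes j: "x + x' \<in> \<int>" "x * x' \<in> \<int>"
    and R: "\<And>n. coeff (\<Prod>i\<le>p. [:- h i, 1:]) n = poly (map_poly of_int (R n :: int poly)) x" and k: "k \<le> p"
  shows "algebraic_int (h k)"
proof -
  obtain T N where TN: "x + x' = of_int T" "x * x' = of_int N" using j by (auto elim!: Ints_cases)
  show ?thesis
  proof (rule monic_over_quadratic_algebraic_int[OF TN])
    have "poly (\<Prod>i\<le>p. [:- h i, 1:]) (h k) = 0" using k by (simp add: prod_linear_poly(3))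
    thus "(\<Sum>n\<le>Suc p. poly (map_poly of_int (R n)) x * h k ^ n) = 0"
      by (simp add: prod_linear_poly(4) R)
    show "poly (map_poly of_int (R (Suc p))) x = 1"
      using prod_linear_poly(1,2)[of "{..p}" h] by (simp add: R)
  qed simp
qed

text \<open>For every natural t the image of phi_0 + t phi_p under \<sigma> is a root of the
  resolvent at \<tau>'. Infinitely many t share finitely many index pairs, and two t with the same
  pair determine both values separately.\<close>

lemma modular_transfer:
  fixes K :: "complex set" and \<sigma> :: "complex \<Rightarrow> complex"
  assumes p: "prime p" and K: "\<int> \<subseteq> K" "\<And>x y. x \<in> K \<Longrightarrow> y \<in> K \<Longrightarrow> x + y \<in> K" "\<And>x y. x \<in> K \<Longrightarrow> y \<in> K \<Longrightarrow> x * y \<in> K"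
    and \<sigma>: "\<And>x y. x \<in> K \<Longrightarrow> y \<in> K \<Longrightarrow> \<sigma> (x + y) = \<sigma> x + \<sigma> y"
      "\<And>x y. x \<in> K \<Longrightarrow> y \<in> K \<Longrightarrow> \<sigma> (x * y) = \<sigma> x * \<sigma> y" "\<And>x. x \<in> \<int> \<Longrightarrow> \<sigma> x = x"
    and \<tau>: "Im \<tau> > 0" "klein_j \<tau> \<in> K" "phi p 0 \<tau> \<in> K" "phi p p \<tau> \<in> K"
    and \<tau>': "Im \<tau>' > 0" "klein_j \<tau>' = \<sigma> (klein_j \<tau>)"
  obtains \<alpha> \<beta> where "\<alpha> \<le> p" "\<beta> \<le> p" "\<alpha> \<noteq> \<beta>" "\<sigma> (phi p 0 \<tau>) = phi p \<alpha> \<tau>'" "\<sigma> (phi p p \<tau>) = phi p \<beta> \<tau>'"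
proof -
  have p0: "p > 0" by (rule prime_gt_0_nat[OF p])
  have Kp: "x ^ n \<in> K \<and> \<sigma> (x ^ n) = \<sigma> x ^ n" if "x \<in> K" for x n
    using that K(1) \<sigma>(3)[of 1] by (induction n) (auto intro: K(3) simp: \<sigma>(2))
  have Kr: "poly (map_poly of_int r) x \<in> K \<and> \<sigma> (poly (map_poly of_int r) x) = poly (map_poly of_int r) (\<sigma> x)"
    if "x \<in> K" for x and r :: "int poly"
  proof (induction r)
    case 0
    show ?case using K(1) \<sigma>(3)[of 0] by auto
  next
    case (pCons c r)
    have "of_int c \<in> K" using K(1) by auto
    thus ?case using pCons.IH that by (simp add: map_poly_pCons K \<sigma>)
  qed
  have Ks: "(\<Sum>n\<le>D. c n) \<in> K \<and> \<sigma> (\<Sum>n\<le>D. c n) = (\<Sum>n\<le>D. \<sigma> (c n))" if c: "\<And>n. c n \<in> K" for c and D :: nat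
    by (induction D) (auto simp: c \<sigma>(1) K(2))
  have "\<exists>i\<in>index_pairs p. \<sigma> (phi p 0 \<tau>) + of_nat t * \<sigma> (phi p p \<tau>) = phi p (fst i) \<tau>' + of_nat t * phi p (snd i) \<tau>'" for t
  proof -
    define h where "h z i = phi p (fst i) z + of_nat t * phi p (snd i) z" for z i
    obtain R :: "nat \<Rightarrow> int poly" where R: "\<And>n z. Im z > 0 \<Longrightarrow>
        coeff (\<Prod>i\<in>index_pairs p. [:- h z i, 1:]) n = poly (map_poly of_int (R n)) (klein_j z)"
      using phi_pair_polynomial[OF p, of t] unfolding h_def by blast
    define y where "y = phi p 0 \<tau> + of_nat t * phi p p \<tau>"
    have tK: "of_nat t \<in> K" using K(1) by auto
    have yK: "y \<in> K" unfolding y_def by (intro K \<tau> tK)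
    have \<sigma>y: "\<sigma> y = \<sigma> (phi p 0 \<tau>) + of_nat t * \<sigma> (phi p p \<tau>)"
      unfolding y_def using \<tau> tK K(3) \<sigma>(3)[of "of_nat t"] by (simp add: \<sigma>)
    have "y = h \<tau> (0, p)" by (simp add: y_def h_def)
    moreover have "(0, p) \<in> index_pairs p" using p0 by (simp add: index_pairs_def)
    ultimately have "poly (\<Prod>i\<in>index_pairs p. [:- h \<tau> i, 1:]) y = 0"
      by (simp add: prod_linear_poly(3)[OF finite_index_pairs])
    hence "(\<Sum>n\<le>card (index_pairs p). poly (map_poly of_int (R n)) (klein_j \<tau>) * y ^ n) = 0"
      by (simp add: prod_linear_poly(4)[OF finite_index_pairs] R[OF \<tau>(1)])
    moreover have "poly (map_poly of_int (R n)) (klein_j \<tau>) * y ^ n \<in> K" for n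
      using Kr[OF \<tau>(2)] Kp[OF yK] by (intro K) auto
    note Ks[of "\<lambda>n. poly (map_poly of_int (R n)) (klein_j \<tau>) * y ^ n" "card (index_pairs p)", OF this, THEN conjunct2]
    moreover have "\<sigma> (poly (map_poly of_int (R n)) (klein_j \<tau>) * y ^ n) = poly (map_poly of_int (R n)) (klein_j \<tau>') * \<sigma> y ^ n" for n
      using Kr[OF \<tau>(2)] Kp[OF yK] by (simp add: \<sigma>(2) \<tau>'(2))
    ultimately have "(\<Sum>n\<le>card (index_pairs p). poly (map_poly of_int (R n)) (klein_j \<tau>') * \<sigma> y ^ n) = 0"
      using \<sigma>(3)[of 0] by simp
    hence "poly (\<Prod>i\<in>index_pairs p. [:- h \<tau>' i, 1:]) (\<sigma> y) = 0"
      by (simp add: prod_linear_poly(4)[OF finite_index_pairs] R[OF \<tau>'(1)])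
    thus ?thesis unfolding prod_linear_poly(3)[OF finite_index_pairs] \<sigma>y h_def by auto
  qed
  then obtain i where i: "\<And>t. i t \<in> index_pairs p"
    "\<And>t. \<sigma> (phi p 0 \<tau>) + of_nat t * \<sigma> (phi p p \<tau>) = phi p (fst (i t)) \<tau>' + of_nat t * phi p (snd (i t)) \<tau>'" by metis
  \<comment> \<open>Pigeonhole: t ranges over all naturals, while there are only finitely many index
    pairs.\<close>
  have "\<not> inj i"
  proof
    assume "inj i"
    moreover have "finite (range i)" by (rule finite_subset[OF _ finite_index_pairs[of p]]) (use i(1) in auto)
    ultimately show False using finite_imageD infinite_UNIV_nat by blast
  qed
  then obtain s t where st: "s \<noteq> t" "i s = i t" by (auto simp: inj_def)
  define \<alpha> \<beta> where "\<alpha> = fst (i t)" and "\<beta> = snd (i t)"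
  have eq: "\<sigma> (phi p 0 \<tau>) + of_nat s * \<sigma> (phi p p \<tau>) = phi p \<alpha> \<tau>' + of_nat s * phi p \<beta> \<tau>'"
    "\<sigma> (phi p 0 \<tau>) + of_nat t * \<sigma> (phi p p \<tau>) = phi p \<alpha> \<tau>' + of_nat t * phi p \<beta> \<tau>'"
    using i(2)[of s] i(2)[of t] st(2) by (simp_all add: \<alpha>_def \<beta>_def)
  have "(of_nat s - of_nat t) * (\<sigma> (phi p p \<tau>) - phi p \<beta> \<tau>') =
      (\<sigma> (phi p 0 \<tau>) + of_nat s * \<sigma> (phi p p \<tau>)) - (\<sigma> (phi p 0 \<tau>) + of_nat t * \<sigma> (phi p p \<tau>)) -
      ((phi p \<alpha> \<tau>' + of_nat s * phi p \<beta> \<tau>') - (phi p \<alpha> \<tau>' + of_nat t * phi p \<beta> \<tau>'))" by (simp add: algebra_simps)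
  hence "\<sigma> (phi p p \<tau>) = phi p \<beta> \<tau>'" unfolding eq using st(1) by simp
  moreover from this have "\<sigma> (phi p 0 \<tau>) = phi p \<alpha> \<tau>'" using eq(1) by simp
  ultimately show thesis using i(1)[of t] by (intro that[of \<alpha> \<beta>]) (auto simp: index_pairs_def \<alpha>_def \<beta>_def split: prod.splits)
qed

section \<open>Height estimates\<close>

lemma norm_eval_fps_le:
  assumes "norm (w :: complex) < 1" "fps_conv_radius F \<ge> 1" "\<And>M. (\<Sum>n<M. norm (fps_nth F n) * norm w ^ n) \<le> B"
  shows "norm (eval_fps F w) \<le> B"
proof -
  have "(\<lambda>n. fps_nth F n * w ^ n) sums eval_fps F w"
    by (rule sums_eval_fps[OF norm_less_conv_radius[OF assms(1,2)]])
  hence "(\<lambda>M. norm (\<Sum>n<M. fps_nth F n * w ^ n)) \<longlonglongrightarrow> norm (eval_fps F w)"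
    unfolding sums_def by (rule tendsto_norm)
  moreover have "norm (\<Sum>n<M. fps_nth F n * w ^ n) \<le> B" for M
    using norm_sum[of "\<lambda>n. fps_nth F n * w ^ n" "{..<M}"] assms(3)[of M] by (simp add: norm_mult norm_power)
  ultimately show ?thesis by (intro LIMSEQ_le_const2) auto
qed

lemma sum_inverse_squares_le: "(\<Sum>e=1..M. 1 / real e ^ 2) \<le> 2"
proof -
  have "(\<Sum>e=1..Suc M. 1 / real e ^ 2) \<le> 2 - 1 / real (Suc M)" for M
  proof (induction M)
    case (Suc M)
    have "1 / (x + 1) ^ 2 \<le> 1 / x - 1 / (x + 1)" if "x > 0" for x :: real
    proof -
      have "1 / x - 1 / (x + 1) = 1 / (x * (x + 1))" using that by (simp add: field_simps)
      moreover have "1 / ((x + 1) * (x + 1)) \<le> 1 / (x * (x + 1))"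
        using that by (intro divide_left_mono mult_right_mono) auto
      ultimately show ?thesis by (simp add: power2_eq_square)
    qed
    from this[of "real (Suc M)"] have "1 / real (Suc (Suc M)) ^ 2 \<le> 1 / real (Suc M) - 1 / real (Suc (Suc M))"
      by (simp add: add.commute)
    thus ?case using Suc by (subst sum.nat_ivl_Suc') auto
  qed simp
  hence "(\<Sum>e=1..Suc M. 1 / real e ^ 2) \<le> 2" for M by (rule order_trans) simp
  thus ?thesis by (cases M) (simp, simp only:)
qed

text \<open>The full series is 1/(exp l - 1), and exp l >= 1 + l.\<close>

lemma geometric_exp_sum_le:
  assumes "l > (0::real)"
  shows "(\<Sum>d=1..M. exp (- l) ^ d) \<le> 1 / l"
proof -
  define x where "x = exp (- l)"
  have x: "0 < x" "x < 1" using assms by (auto simp: x_def)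
  have "(1 - x) * (\<Sum>d=1..M. x ^ d) = x - x ^ Suc M"
  proof (induction M)
    case (Suc M)
    have "(1 - x) * (\<Sum>d=1..Suc M. x ^ d) = (1 - x) * (\<Sum>d=1..M. x ^ d) + (1 - x) * x ^ Suc M"
      by (simp add: distrib_left)
    also have "\<dots> = x - x ^ Suc (Suc M)" unfolding Suc by (simp add: algebra_simps)
    finally show ?case .
  qed simp
  also have "\<dots> \<le> x" using x by simp
  finally have 1: "(1 - x) * (\<Sum>d=1..M. x ^ d) \<le> x" .
  have "x * (1 + l) \<le> x * exp l" using x exp_ge_add_one_self[of l] by (intro mult_left_mono) auto
  also have "\<dots> = 1" by (simp add: x_def flip: exp_add)
  finally have "x \<le> (1 - x) * (1 / l)" using assms by (simp add: field_simps)
  with 1 have "(1 - x) * (\<Sum>d=1..M. x ^ d) \<le> (1 - x) * (1 / l)" by linarith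
  thus ?thesis using x unfolding x_def[symmetric] by (subst (asm) mult_le_cancel_left_pos) auto
qed

text \<open>With n = e d the coefficient weight d/n is 1/e. The geometric sum over d is at most 1/(e
  l), and the remaining sum of 1/e^2 is at most 2.\<close>

lemma norm_log_euler_le:
  assumes "norm w = exp (- l)" "l > 0"
  shows "norm (eval_fps log_euler w) \<le> 2 / l"
proof (rule norm_eval_fps_le[OF _ log_euler_conv_radius])
  show "norm w < 1" using assms by simp
  fix M :: nat
  define r where "r = exp (- l)"
  have r: "0 < r" by (simp add: r_def)
  have "(\<Sum>n<M. norm (fps_nth log_euler n) * norm w ^ n) \<le> (\<Sum>n\<le>M. norm (fps_nth log_euler n) * norm w ^ n)"
    by (intro sum_mono2) auto
  also have "\<dots> = (\<Sum>n=1..M. norm (fps_nth log_euler n) * norm w ^ n)"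
    by (intro sum.mono_neutral_right) (auto simp: log_euler_def)
  also have "\<dots> = (\<Sum>n=1..M. \<Sum>d | d dvd n. real d / real n * r ^ n)"
  proof (intro sum.cong refl)
    fix n
    have "norm (fps_nth log_euler n) = real (sig 1 n) / real n" by (simp add: log_euler_def norm_divide)
    thus "norm (fps_nth log_euler n) * norm w ^ n = (\<Sum>d | d dvd n. real d / real n * r ^ n)"
      by (simp add: sig_def assms(1) r_def sum_divide_distrib sum_distrib_right)
  qed
  also have "\<dots> = (\<Sum>(n, d)\<in>Sigma {1..M} (\<lambda>n. {d. d dvd n}). real d / real n * r ^ n)"
    by (rule sum.Sigma) auto
  also have "\<dots> \<le> (\<Sum>(e, d)\<in>{1..M} \<times> {1..M}. 1 / real e * r ^ (e * d))"
  proof (rule sum_le_included[where i = "\<lambda>(e, d). (e * d, d)"])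
    show "finite (Sigma {1..M} (\<lambda>n. {d. d dvd n}))" by (intro finite_SigmaI) auto
    show "\<forall>x\<in>Sigma {1..M} (\<lambda>n. {d. d dvd n}). \<exists>y\<in>{1..M} \<times> {1..M}. (case y of (e, d) \<Rightarrow> (e * d, d)) = x \<and>
        (case x of (n, d) \<Rightarrow> real d / real n * r ^ n) \<le> (case y of (e, d) \<Rightarrow> 1 / real e * r ^ (e * d))"
    proof
      fix x assume x_in: "x \<in> Sigma {1..M} (\<lambda>n. {d. d dvd n})"
      obtain n d where x: "x = (n, d)" by (cases x)
      have nd: "1 \<le> n" "n \<le> M" "d dvd n" using x_in by (auto simp: x)
      then obtain e where e: "n = e * d" by (metis dvd_def mult.commute)
      have "e \<noteq> 0" "d \<noteq> 0" using nd e by auto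
      moreover from this have "e \<le> n" "d \<le> n" by (simp_all add: e)
      hence "e \<le> M" "d \<le> M" using nd(2) by simp_all
      ultimately show "\<exists>y\<in>{1..M} \<times> {1..M}. (case y of (e, d) \<Rightarrow> (e * d, d)) = x \<and>
          (case x of (n, d) \<Rightarrow> real d / real n * r ^ n) \<le> (case y of (e, d) \<Rightarrow> 1 / real e * r ^ (e * d))"
        using nd by (intro bexI[of _ "(e, d)"]) (auto simp: x e)
    qed
  qed (use r in auto)
  also have "\<dots> = (\<Sum>e=1..M. 1 / real e * (\<Sum>d=1..M. exp (- (real e * l)) ^ d))"
    unfolding sum.cartesian_product[symmetric] sum_distrib_left
    by (intro sum.cong refl) (simp add: r_def mult_ac flip: exp_of_nat_mult)
  also have "\<dots> \<le> (\<Sum>e=1..M. 1 / real e * (1 / (real e * l)))"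
    using assms by (intro sum_mono mult_left_mono geometric_exp_sum_le) auto
  also have "\<dots> = (\<Sum>e=1..M. 1 / real e ^ 2) * (1 / l)"
    unfolding sum_distrib_right by (intro sum.cong refl) (simp add: power2_eq_square)
  also have "\<dots> \<le> 2 * (1 / l)" using assms by (intro mult_right_mono sum_inverse_squares_le) auto
  finally show "(\<Sum>n<M. norm (fps_nth log_euler n) * norm w ^ n) \<le> 2 / l" by simp
qed

text \<open>The main term is log|q|; the error is 24 times the bound 2/l for
  log|\<open>euler\<close>| at l = 2 pi Im \<tau>, hence 48.\<close>

lemma ln_Delta_bound:
  assumes "Im \<tau> > 0"
  shows "\<bar>ln (cmod (Delta \<tau>)) + 2 * pi * Im \<tau>\<bar> \<le> 48 / (2 * pi * Im \<tau>)"
proof -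
  define w where "w = nome \<tau>"
  have nw: "norm w = exp (- (2 * pi * Im \<tau>))" by (simp add: w_def norm_nome)
  have "ln (cmod (euler w)) = - Re (eval_fps log_euler w)" by (simp add: euler_def)
  hence e: "\<bar>ln (cmod (euler w))\<bar> \<le> 2 / (2 * pi * Im \<tau>)"
    using abs_Re_le_cmod[of "eval_fps log_euler w"] norm_log_euler_le[OF nw] assms by simp
  have "ln (cmod (Delta \<tau>)) = ln (cmod w) + 24 * ln (cmod (euler w))"
    by (simp add: Delta_def Dq_def w_def norm_mult norm_power ln_mult ln_realpow)
  also have "ln (cmod w) = - (2 * pi * Im \<tau>)" by (simp add: nw)
  finally show ?thesis using e by simp
qed

lemma three_less_two_pi_Im: "Im \<tau> > 1 / 2 \<Longrightarrow> 2 * pi * Im \<tau> > 3"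
  using pi_gt3 mult_strict_mono[of "1/2" "Im \<tau>" 3 pi] by (simp add: mult_ac)

text \<open>Since t > 3, the error 48/t of the denominator is at most 16; at (\<tau> + k)/p the
  height is divided by p, so the numerator contributes at most 16 p.\<close>

lemma ln_phi_bound:
  assumes \<tau>: "Im \<tau> > 1 / 2" and p: "p \<ge> 3" and k: "k < p"
  defines "t \<equiv> 2 * pi * Im \<tau>"
  shows "\<bar>ln (cmod (phi p k \<tau>)) - (t - t / real p)\<bar> \<le> 16 * (real p + 1)"
proof -
  have t: "t > 3" unfolding t_def by (rule three_less_two_pi_Im[OF \<tau>])
  have Im: "2 * pi * Im ((\<tau> + of_nat k) / of_nat p) = t / real p" by (simp add: t_def Im_divide_of_nat)
  have "Im ((\<tau> + of_nat k) / of_nat p) > 0" "Im \<tau> > 0" using \<tau> p by (simp_all add: Im_divide_of_nat)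
  from ln_Delta_bound[OF this(1)] ln_Delta_bound[OF this(2)]
  have 1: "\<bar>ln (cmod (Delta ((\<tau> + of_nat k) / of_nat p))) + t / real p\<bar> \<le> 48 / (t / real p)"
    and 2: "\<bar>ln (cmod (Delta \<tau>)) + t\<bar> \<le> 48 / t" unfolding Im by (simp_all add: t_def)
  have "48 / t \<le> 48 / 3" using t by (intro divide_left_mono) auto
  moreover have "48 / (t / real p) \<le> 16 * real p"
  proof -
    have "48 / (t / real p) = (48 / t) * real p" by simp
    also have "\<dots> \<le> (48 / 3) * real p" using \<open>48 / t \<le> 48 / 3\<close> by (intro mult_right_mono) auto
    finally show ?thesis by simp
  qed
  moreover have "ln (cmod (phi p k \<tau>)) = ln (cmod (Delta ((\<tau> + of_nat k) / of_nat p))) - ln (cmod (Delta \<tau>))"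
    using k by (simp add: phi_def norm_divide ln_div)
  ultimately show ?thesis using 1 2 by argo
qed

lemma ln_phi_infinity_bound:
  assumes \<tau>: "Im \<tau> > 1 / 2" and p: "p \<ge> 3"
  defines "t \<equiv> 2 * pi * Im \<tau>"
  shows "\<bar>ln (cmod (phi p p \<tau>)) - (12 * ln (real p) - (real p - 1) * t)\<bar> \<le> 16 * (real p + 1)"
proof -
  have t: "t > 3" unfolding t_def by (rule three_less_two_pi_Im[OF \<tau>])
  have Im: "2 * pi * Im (of_nat p * \<tau>) = real p * t" by (simp add: t_def)
  have "Im (of_nat p * \<tau>) > 0" "Im \<tau> > 0" using \<tau> p by simp_all
  from ln_Delta_bound[OF this(1)] ln_Delta_bound[OF this(2)]
  have 1: "\<bar>ln (cmod (Delta (of_nat p * \<tau>))) + real p * t\<bar> \<le> 48 / (real p * t)"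
    and 2: "\<bar>ln (cmod (Delta \<tau>)) + t\<bar> \<le> 48 / t" unfolding Im by (simp_all add: t_def)
  have "48 / t \<le> 48 / 3" using t by (intro divide_left_mono) auto
  moreover have "48 / (real p * t) \<le> 48 / t"
  proof (rule divide_left_mono)
    show "t \<le> real p * t" using t p mult_right_mono[of 1 "real p" t] by simp
  qed (use t p in auto)
  moreover have "ln (cmod (phi p p \<tau>)) = 12 * ln (real p) + ln (cmod (Delta (of_nat p * \<tau>))) - ln (cmod (Delta \<tau>))"
    using p by (simp add: phi_def norm_divide norm_mult norm_power ln_div ln_mult ln_realpow)
  moreover have "(real p - 1) * t = real p * t - t" by (simp add: algebra_simps)
  moreover have "real p \<ge> 3" using p by simp
  ultimately show ?thesis using 1 2 by argo
qed

text \<open>The crude bound n^4 <= 16^n for the divisor sum makes the series geometric with ratio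
  4/5 and sum 5; 1201 = 1 + 240 * 5.\<close>

lemma norm_E4q_le:
  assumes "norm w \<le> 1 / 20"
  shows "norm (E4q w) \<le> 1201"
proof -
  have "norm (eval_fps (lamb 3) w) \<le> 5"
  proof (rule norm_eval_fps_le)
    fix M :: nat
    have "(\<Sum>n<M. norm (fps_nth (lamb 3) n) * norm w ^ n) \<le> (\<Sum>n<M. (4 / 5) ^ n)"
    proof (rule sum_mono)
      fix n
      have "sig 3 n \<le> n ^ 4"
      proof (cases "n = 0")
        case False
        have "sig 3 n \<le> (\<Sum>d\<in>{1..n}. n ^ 3)" unfolding sig_def
        proof (rule order_trans[OF sum_mono2 sum_mono])
          show "{d. d dvd n} \<subseteq> {1..n}" using False by (auto intro: Suc_leI Nat.gr0I dest: dvd_imp_le)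
        qed (auto intro: power_mono)
        thus ?thesis by (simp add: power_numeral_reduce)
      qed simp
      also have "n ^ 4 \<le> (2 ^ n) ^ 4" by (intro power_mono) (simp_all add: less_imp_le)
      also have "\<dots> = (2 ^ 4) ^ n" by (simp only: power_mult[symmetric] mult.commute)
      also have "\<dots> = 16 ^ n" by simp
      finally have "real (sig 3 n) \<le> 16 ^ n" by (metis of_nat_le_iff of_nat_numeral of_nat_power)
      hence "real (sig 3 n) * norm w ^ n \<le> 16 ^ n * (1 / 20) ^ n"
        using assms by (intro mult_mono power_mono) auto
      also have "\<dots> = (4 / 5) ^ n" by (simp flip: power_mult_distrib)
      finally show "norm (fps_nth (lamb 3) n) * norm w ^ n \<le> (4 / 5) ^ n" by (simp add: lamb_def)
    qed
    also have "\<dots> = 5 * (1 - (4 / 5) ^ M)" by (simp add: sum_gp_strict)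
    also have "\<dots> \<le> 5" by simp
    finally show "(\<Sum>n<M. norm (fps_nth (lamb 3) n) * norm w ^ n) \<le> 5" .
  qed (use assms lamb_conv_radius[of 3] in auto)
  moreover have "norm (E4q w) \<le> norm (1 :: complex) + norm (240 * eval_fps (lamb 3) w)"
    unfolding E4q_def by (rule norm_triangle_ineq)
  ultimately show ?thesis by (simp add: norm_mult)
qed

text \<open>40 = 24 + 16: the numerator of j is at most exp(8)^3, because 1201 <= exp(8), and the
  lower bound for \<open>Delta\<close> loses 48/t <= 16.\<close>

lemma ln_klein_j_le:
  assumes \<tau>: "Im \<tau> > 1 / 2"
  shows "ln (max 1 (cmod (klein_j \<tau>))) \<le> 2 * pi * Im \<tau> + 40"
proof -
  define t where "t = 2 * pi * Im \<tau>"
  have t: "t > 3" unfolding t_def by (rule three_less_two_pi_Im[OF \<tau>])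
  have \<tau>0: "Im \<tau> > 0" using \<tau> by simp
  have half: "5 / 2 \<le> exp (1 :: real)" using exp_lower_Taylor_quadratic[of 1] by simp
  have "(5 / 2) ^ 4 \<le> exp (1 :: real) ^ 4" by (intro power_mono half) simp
  have "(20 :: real) \<le> exp 3"
  proof -
    \<comment> \<open>The number exp(3) exceeds 20 only slightly, so the quadratic Taylor bound is
      used at 1/16 and raised to the power 48.\<close>
    have "(1 + 1 / 16 + (1 / 16)\<^sup>2 / 2) ^ 48 \<le> exp (1 / 16 :: real) ^ 48"
      by (intro power_mono exp_lower_Taylor_quadratic) auto
    also have "\<dots> = exp 3" by (simp flip: exp_of_nat_mult)
    finally show ?thesis by (rule order_trans[rotated]) (simp add: power2_eq_square power_numeral_reduce)
  qed
  hence "exp (- 3) \<le> (1 / 20 :: real)" by (simp add: exp_minus field_simps)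
  moreover have "norm (nome \<tau>) \<le> exp (- 3)" using t by (simp add: norm_nome t_def)
  ultimately have E: "norm (E4q (nome \<tau>)) \<le> 1201" by (intro norm_E4q_le) linarith
  have "(1201 :: real) \<le> (5 / 2) ^ 8" by (simp add: power_numeral_reduce)
  also have "\<dots> \<le> exp 1 ^ 8" by (intro power_mono half) simp
  also have "\<dots> = exp 8" by (simp flip: exp_of_nat_mult)
  finally have E: "norm (E4q (nome \<tau>)) \<le> exp 8" using E by linarith
  have "48 / t \<le> 48 / 3" using t by (intro divide_left_mono) auto
  hence "- t - 16 \<le> ln (cmod (Delta \<tau>))" using ln_Delta_bound[OF \<tau>0, folded t_def] by linarith
  hence "exp (- t - 16) \<le> cmod (Delta \<tau>)" by (simp add: ln_ge_iff)
  hence "cmod (klein_j \<tau>) \<le> exp 8 ^ 3 / exp (- t - 16)"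
    unfolding klein_j_eq[OF \<tau>0] norm_divide norm_power by (intro frac_le power_mono E) auto
  also have "\<dots> = exp (t + 40)" by (simp add: exp_diff[symmetric] flip: exp_of_nat_mult)
  finally have "max 1 (cmod (klein_j \<tau>)) \<le> exp (t + 40)" using t by simp
  hence "ln (max 1 (cmod (klein_j \<tau>))) \<le> ln (exp (t + 40))" by (subst ln_le_cancel_iff) auto
  thus ?thesis by (simp add: t_def)
qed

context quadratic_conj
begin

lemma norm_ge_1:
  assumes "y \<in> ring_of_integers K" "y \<noteq> 0"
  shows "ln (cmod y) + ln (cmod (cj y)) \<ge> 0" and "cj y \<noteq> 0"
proof -
  have y: "y \<in> K" "y * cj y \<in> \<int>" using assms(1) by (simp_all add: ring_of_integers_iff)
  show cy: "cj y \<noteq> 0" using cj_cj[OF y(1)] assms(2) by auto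
  obtain n where n: "y * cj y = of_int n" using y(2) by (auto elim: Ints_cases)
  hence "n \<noteq> 0" using cy assms(2) by auto
  have "cmod y * cmod (cj y) = real_of_int \<bar>n\<bar>" unfolding norm_mult[symmetric] n by simp
  hence "cmod y * cmod (cj y) \<ge> 1" using \<open>n \<noteq> 0\<close> by linarith
  hence "ln (cmod y * cmod (cj y)) \<ge> 0" by simp
  thus "ln (cmod y) + ln (cmod (cj y)) \<ge> 0" using cy assms(2) by (simp add: ln_mult)
qed

lemma K_divide:
  assumes "x \<in> K" "y \<in> K" "y \<noteq> 0"
  shows "x / y \<in> K" and "cj (x / y) = cj x / cj y"
proof -
  have cy: "cj y \<noteq> 0" using cj_cj[OF assms(2)] assms(3) by auto
  have "inverse (y * cj y) \<in> K" using nm_Rats[OF assms(2)] Rats_sub by (auto intro: Rats_inverse)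
  hence "x * cj y * inverse (y * cj y) \<in> K" using assms by (intro K_mult cj_in)
  moreover have "x * cj y * inverse (y * cj y) = x / y" using cy assms(3) by (simp add: field_simps)
  ultimately show xy: "x / y \<in> K" by simp
  have "cj (x / y) * cj y = cj x" using cj_mult[OF xy assms(2)] assms(3) by simp
  thus "cj (x / y) = cj x / cj y" using cy by (simp add: field_simps)
qed

end

lemma klein_j_surj_high: "\<exists>\<tau>. Im \<tau> > 1 / 2 \<and> klein_j \<tau> = x"
proof -
  obtain z where z: "Im z > 0" "klein_j z = x" using klein_j_surj by blast
  obtain a b c d :: int and w where w: "a * d - b * c = 1"
    "w = (of_int a * z + of_int b) / (of_int c * z + of_int d)" "Im w > 1 / 2"
    using fundamental_domain[OF z(1)] by metis
  show ?thesis using klein_j_moebius[OF w(1) z(1)] w z by auto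
qed

text \<open>Rationality is stated through values of regular functions at representatives of the
  orbit; the identity matrix puts \<tau> itself in the orbit, and the units are holomorphic
  there.\<close>

lemma integral_point_values:
  assumes p: "prime p" and P: "P \<in> integral_points p (split_cartan p) K"
  obtains \<tau> where "Im \<tau> > 0" "point_j P = klein_j \<tau>" "klein_j \<tau> \<in> ring_of_integers K" "phi p 0 \<tau> \<in> K" "phi p p \<tau> \<in> K"
proof -
  have p0: "p > 0" by (rule prime_gt_0_nat[OF p])
  have P': "P \<in> open_curve (split_cartan p)" "point_j P \<in> ring_of_integers K"
    "\<And>f \<tau>. f \<in> curve_function_field p (split_cartan p) \<Longrightarrow> \<tau> \<in> P \<Longrightarrow> \<not> is_pole f \<tau> \<Longrightarrow> f \<tau> \<in> K"
    using P by (auto simp: integral_points_def rational_points_def)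
  obtain \<tau> where \<tau>: "Im \<tau> > 0" "P = (\<lambda>A. moebius_act A \<tau>) ` (SL2Z \<inter> split_cartan p)"
    using P'(1) by (auto simp: open_curve_def upper_half_plane_def)
  have "mat 1 \<in> SL2Z \<inter> split_cartan p" by (simp add: SL2Z_def split_cartan_def det_I) (simp add: mat_def)
  moreover have "moebius_act (mat 1) \<tau> = \<tau>" by (simp add: moebius_act_def mat_def)
  ultimately have \<tau>P: "\<tau> \<in> P" unfolding \<tau>(2) by (metis image_eqI)
  have "klein_j z = klein_j \<tau>" if "z \<in> P" for z
    using that klein_j_moebius[OF SL2Z_det \<tau>(1)] unfolding \<tau>(2) by (auto simp: moebius_act_def)
  hence "klein_j ` P = (\<lambda>_. klein_j \<tau>) ` P" by (intro image_cong refl)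
  also have "\<dots> = {klein_j \<tau>}" by (rule image_constant[OF \<tau>P])
  finally have "klein_j ` P = {klein_j \<tau>}" .
  hence j: "point_j P = klein_j \<tau>" by (simp add: point_j_def)
  have "phi p k \<tau> \<in> K" if "k = 0 \<or> k = p" for k
  proof (rule P'(3)[OF phi_curve_function_field[OF p that] \<tau>P])
    have "open {z. Im z > 0}" by (rule open_halfspace_Im_gt)
    hence "phi p k analytic_on {\<tau>}" using \<tau>(1) holomorphic_phi[OF p0, of k]
      by (auto simp: analytic_on_open intro: analytic_on_subset[of _ "{z. Im z > 0}"])
    thus "\<not> is_pole (phi p k) \<tau>" by (rule analytic_at_imp_no_pole)
  qed
  thus thesis using that[OF \<tau>(1) j] P'(2) j by simp
qed

text \<open>Here \<open>f1\<close>, \<open>f2\<close> and \<open>g1\<close>, \<open>g2\<close> are the logarithms of the conjugates of \<open>phi p 0\<close> and \<open>phi p p\<close>; an uppercase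
  letter says that the corresponding conjugate has index \<open>p\<close>.\<close>

lemma conjugate_heights:
  fixes f1 f2 g1 g2 :: real
  assumes p: "p \<ge> (3::real)" and l: "l \<ge> 0" and t: "t1 > 0" "t2 > 0"
    and low: "A1 \<or> f1 \<ge> t1 - t1 / p - e" "A2 \<or> f2 \<ge> t2 - t2 / p - e" "B1 \<or> g1 \<ge> t1 - t1 / p - e" "B2 \<or> g2 \<ge> t2 - t2 / p - e"
    and up: "A1 \<or> f1 \<le> t1 - t1 / p + e" "A2 \<or> f2 \<le> t2 - t2 / p + e" "B1 \<or> g1 \<le> t1 - t1 / p + e" "B2 \<or> g2 \<le> t2 - t2 / p + e"
    and inf: "\<not> A1 \<or> f1 \<le> 12 * l - (p - 1) * t1 + e" "\<not> A2 \<or> f2 \<le> 12 * l - (p - 1) * t2 + e"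
      "\<not> B1 \<or> g1 \<le> 12 * l - (p - 1) * t1 + e" "\<not> B2 \<or> g2 \<le> 12 * l - (p - 1) * t2 + e"
    and ne: "\<not> (A1 \<and> B1)" "\<not> (A2 \<and> B2)"
    and norm: "f1 + f2 \<ge> 0" "g1 + g2 \<ge> 0" "24 * l - f1 - f2 \<ge> 0" "24 * l - g1 - g2 \<ge> 0"
  shows "t1 + t2 \<le> 36 * l + 3 * e"
proof -
  have div: "t / p \<le> t / 3" if "t > 0" for t using that p by (intro divide_left_mono) auto
  have mul: "t - t / p - (p - 1) * t \<le> - (4 / 3 * t)" if "t > 0" for t
  proof -
    \<comment> \<open>The factors come from p^2 - (10/3) p + 1; the constant 4/3 is the value of (p
      - 1) - (1 - 1/p) at p = 3, where equality holds.\<close>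
    have "0 \<le> (p - 3) * (p - 1 / 3) * (t / p)" using p that by (intro mult_nonneg_nonneg) auto
    also have "(p - 3) * (p - 1 / 3) * (t / p) = (p - 2) * t + t / p - 4 / 3 * t"
    proof -
      define s where "s = t / p"
      have ts: "t = p * s" using p by (simp add: s_def)
      have "(p - 3) * (p - 1 / 3) * s = (p - 2) * (p * s) + s - 4 / 3 * (p * s)" by (simp add: field_simps)
      thus ?thesis by (simp only: s_def[symmetric] ts[symmetric])
    qed
    finally have "0 \<le> (p - 2) * t + t / p - 4 / 3 * t" .
    moreover have "(p - 2) * t = (p - 1) * t - t" by (simp add: algebra_simps)
    ultimately show ?thesis by linarith
  qed
  note d = div[OF t(1)] div[OF t(2)] and m = mul[OF t(1)] mul[OF t(2)]
  \<comment> \<open>In the first two cases one function has a finite index at both conjugates: p^12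
    over that function has nonnegative log norm, which with 1 - 1/p >= 2/3 gives 36 l + 3 e. In the
    mixed cases the product of both functions decays at rate at least 4/3, which gives 18 l + 3
    e.\<close>
  consider "\<not> A1" "\<not> A2" | "\<not> B1" "\<not> B2" | "A1" "B2" "\<not> B1" "\<not> A2" | "A2" "B1" "\<not> B2" "\<not> A1" using ne by blast
  thus ?thesis
  proof cases
    case 1
    hence "f1 \<ge> t1 - t1 / p - e" "f2 \<ge> t2 - t2 / p - e" using low by auto
    thus ?thesis using d norm(3) by linarith
  next
    case 2
    hence "g1 \<ge> t1 - t1 / p - e" "g2 \<ge> t2 - t2 / p - e" using low by auto
    thus ?thesis using d norm(4) by linarith
  next
    case 3
    hence "f1 \<le> 12 * l - (p - 1) * t1 + e" "g2 \<le> 12 * l - (p - 1) * t2 + e"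
      "g1 \<le> t1 - t1 / p + e" "f2 \<le> t2 - t2 / p + e" using up inf by auto
    thus ?thesis using m norm(1,2) l by linarith
  next
    case 4
    hence "f2 \<le> 12 * l - (p - 1) * t2 + e" "g1 \<le> 12 * l - (p - 1) * t1 + e"
      "g2 \<le> t2 - t2 / p + e" "f1 \<le> t1 - t1 / p + e" using up inf by auto
    thus ?thesis using m norm(1,2) l by linarith
  qed
qed

text \<open>The margin at p = 3 is small: replacing log 3 by 1 would fail there, so the lower bound
  1.09 is established first.\<close>

lemma numerical_bound:
  assumes "p \<ge> (3::real)"
  shows "18 * ln p + 24 * (p + 1) + 40 \<le> 24 * p * ln (3 * p)"
proof -
  have "exp (109 / 100 :: real) = exp 1 * exp (9 / 100)" by (simp flip: exp_add)
  also have "\<dots> \<le> (272 / 100) * (1 + 9 / 100 + (9 / 100)\<^sup>2)"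
    using e_less_272 by (intro mult_mono exp_bound) auto
  also have "\<dots> \<le> 3" by (simp add: power2_eq_square)
  finally have l3: "109 / 100 \<le> ln (3 :: real)" by (subst ln_ge_iff) auto
  have lp: "109 / 100 \<le> ln p" using l3 ln_mono[of 3 p] assms by linarith
  have "(24 * p - 18) * (109 / 100) \<le> (24 * p - 18) * ln p" using lp assms by (intro mult_left_mono) auto
  moreover have "24 * p * (109 / 100) \<le> 24 * p * ln 3" using l3 assms by (intro mult_left_mono) auto
  moreover have "24 * p * ln (3 * p) = 24 * p * ln 3 + (24 * p - 18) * ln p + 18 * ln p"
    using assms by (simp add: ln_mult algebra_simps)
  moreover have "18 * l + 24 * (p + 1) + 40 \<le> z"
    if "(24 * p - 18) * (109 / 100) \<le> u" "24 * p * (109 / 100) \<le> v" "z = v + u + 18 * l" for l u v z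
    using that assms by (simp add: field_simps)
  ultimately show ?thesis by blast
qed

theorem theorem6p1:
  fixes p :: nat and K :: "complex set" and P :: "complex set"
  assumes "prime p" and "p \<ge> 3"
    and "number_field K" and "field_degree K \<le> 2"
    and "P \<in> integral_points p (split_cartan p) K"
  shows "weil_height K (point_j P) \<le> 24 * real p * ln (3 * real p)"
proof -
  have p0: "p > 0" by (rule prime_gt_0_nat[OF assms(1)])
  obtain cj where cj: "quadratic_conj K cj"
    "\<And>x. x \<in> ring_of_integers K \<Longrightarrow> weil_height K x \<le> (ln (max 1 (cmod x)) + ln (max 1 (cmod (cj x)))) / 2"
    by (rule weil_height_le[OF assms(3,4)]) blast
  interpret quadratic_conj K cj by (rule cj(1))
  obtain \<tau> where \<tau>: "Im \<tau> > 0" "point_j P = klein_j \<tau>" "klein_j \<tau> \<in> ring_of_integers K" "phi p 0 \<tau> \<in> K" "phi p p \<tau> \<in> K"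
    by (rule integral_point_values[OF assms(1,5)])
  have j: "klein_j \<tau> \<in> K" "klein_j \<tau> + cj (klein_j \<tau>) \<in> \<int>" "klein_j \<tau> * cj (klein_j \<tau>) \<in> \<int>"
    using \<tau>(3) by (simp_all add: ring_of_integers_iff)
  \<comment> \<open>The given \<tau> may lie close to the real axis, where the estimates fail. It is
    replaced by a point with the same j and height above 1/2, so even the identity conjugate passes
    through \<open>modular_transfer\<close>, which may change the indices.\<close>
  obtain \<tau>1 where \<tau>1: "Im \<tau>1 > 1 / 2" "klein_j \<tau>1 = klein_j \<tau>" using klein_j_surj_high by blast
  obtain \<tau>2 where \<tau>2: "Im \<tau>2 > 1 / 2" "klein_j \<tau>2 = cj (klein_j \<tau>)" using klein_j_surj_high by blast
  have K_Ints: "\<int> \<subseteq> K" using Rats_sub Ints_subset_Rats by blast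
  obtain \<alpha>1 \<beta>1 where 1: "\<alpha>1 \<le> p" "\<beta>1 \<le> p" "\<alpha>1 \<noteq> \<beta>1" "phi p 0 \<tau> = phi p \<alpha>1 \<tau>1" "phi p p \<tau> = phi p \<beta>1 \<tau>1"
    by (rule modular_transfer[where \<sigma> = "\<lambda>x. x" and K = K and \<tau>' = \<tau>1, OF assms(1) K_Ints K_add K_mult _ _ _ \<tau>(1) j(1) \<tau>(4,5)])
      (use \<tau>1 in auto)
  obtain \<alpha>2 \<beta>2 where 2: "\<alpha>2 \<le> p" "\<beta>2 \<le> p" "\<alpha>2 \<noteq> \<beta>2" "cj (phi p 0 \<tau>) = phi p \<alpha>2 \<tau>2" "cj (phi p p \<tau>) = phi p \<beta>2 \<tau>2"
    by (rule modular_transfer[where \<sigma> = cj and K = K and \<tau>' = \<tau>2, OF assms(1) K_Ints K_add K_mult cj_add cj_mult _ \<tau>(1) j(1) \<tau>(4,5)])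
      (use \<tau>2 cj_Rats Ints_subset_Rats in auto)
  have O: "phi p k \<tau> \<in> ring_of_integers K" "of_nat p ^ 12 / phi p k \<tau> \<in> ring_of_integers K"
    "cj (of_nat p ^ 12 / phi p k \<tau>) = of_nat p ^ 12 / cj (phi p k \<tau>)" if k: "k = 0 \<or> k = p" for k
  proof -
    have kp: "k \<le> p" and fK: "phi p k \<tau> \<in> K" using k \<tau> by auto
    have pR: "(of_nat p ^ 12 :: complex) \<in> \<rat>" by simp
    hence pK: "of_nat p ^ 12 \<in> K" using Rats_sub by blast
    obtain R :: "nat \<Rightarrow> int poly" where "\<And>n z. Im z > 0 \<Longrightarrow>
        coeff (\<Prod>i\<le>p. [:- phi p i z, 1:]) n = poly (map_poly of_int (R n)) (klein_j z)"
      using phi_polynomial[OF assms(1)] by blast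
    hence "algebraic_int (phi p k \<tau>)" by (rule modular_value_algebraic_int[OF j(2,3) _ kp]) (rule \<tau>(1))
    thus "phi p k \<tau> \<in> ring_of_integers K" using fK by (simp add: ring_of_integers_def)
    obtain R :: "nat \<Rightarrow> int poly" where "\<And>n z. Im z > 0 \<Longrightarrow>
        coeff (\<Prod>i\<le>p. [:- (of_nat p ^ 12 / phi p i z), 1:]) n = poly (map_poly of_int (R n)) (klein_j z)"
      using chi_polynomial[OF assms(1)] by blast
    hence "algebraic_int (of_nat p ^ 12 / phi p k \<tau>)" by (rule modular_value_algebraic_int[OF j(2,3) _ kp]) (rule \<tau>(1))
    thus "of_nat p ^ 12 / phi p k \<tau> \<in> ring_of_integers K"
      using K_divide(1)[OF pK fK] p0 by (simp add: ring_of_integers_def)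
    show "cj (of_nat p ^ 12 / phi p k \<tau>) = of_nat p ^ 12 / cj (phi p k \<tau>)"
      using K_divide(2)[OF pK fK] cj_Rats[OF pR] p0 by simp
  qed
  define l where "l = ln (real p)"
  have l: "l \<ge> 0" using p0 by (simp add: l_def)
  have ln_inv: "ln (cmod (of_nat p ^ 12 / x)) = 12 * l - ln (cmod x)" if "x \<noteq> 0" for x
    using that p0 by (simp add: norm_divide norm_power ln_div ln_realpow l_def)
  have n: "ln (cmod (phi p k \<tau>)) + ln (cmod (cj (phi p k \<tau>))) \<ge> 0"
    "24 * l - ln (cmod (phi p k \<tau>)) - ln (cmod (cj (phi p k \<tau>))) \<ge> 0" if k: "k = 0 \<or> k = p" for k
  proof -
    have ne: "phi p k \<tau> \<noteq> 0" "cj (phi p k \<tau>) \<noteq> 0" using norm_ge_1(2)[OF O(1)[OF k]] p0 by auto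
    show "ln (cmod (phi p k \<tau>)) + ln (cmod (cj (phi p k \<tau>))) \<ge> 0" by (rule norm_ge_1(1)[OF O(1)[OF k] ne(1)])
    have "of_nat p ^ 12 / phi p k \<tau> \<noteq> 0" using ne p0 by simp
    from norm_ge_1(1)[OF O(2)[OF k] this]
    show "24 * l - ln (cmod (phi p k \<tau>)) - ln (cmod (cj (phi p k \<tau>))) \<ge> 0"
      unfolding O(3)[OF k] ln_inv[OF ne(1)] ln_inv[OF ne(2)] by linarith
  qed
  define t1 t2 e where "t1 = 2 * pi * Im \<tau>1" and "t2 = 2 * pi * Im \<tau>2" and "e = 16 * (real p + 1)"
  have t: "t1 > 0" "t2 > 0" using three_less_two_pi_Im[OF \<tau>1(1)] three_less_two_pi_Im[OF \<tau>2(1)] by (simp_all add: t1_def t2_def)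
  \<comment> \<open>The alternatives with \<open>k = p\<close> match the disjunctive hypotheses of
    \<open>conjugate_heights\<close>, so that one statement serves all four conjugate
    values.\<close>
  have b: "k = p \<or> ln (cmod (phi p k z)) \<ge> 2 * pi * Im z - 2 * pi * Im z / real p - e"
    "k = p \<or> ln (cmod (phi p k z)) \<le> 2 * pi * Im z - 2 * pi * Im z / real p + e"
    "\<not> k = p \<or> ln (cmod (phi p k z)) \<le> 12 * l - (real p - 1) * (2 * pi * Im z) + e"
    if "k \<le> p" "Im z > 1 / 2" for k z
  proof -
    have "k < p" if "k \<noteq> p" using that \<open>k \<le> p\<close> by simp
    note * = ln_phi_bound[OF \<open>Im z > 1 / 2\<close> assms(2) this] ln_phi_infinity_bound[OF \<open>Im z > 1 / 2\<close> assms(2)]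
    show "k = p \<or> ln (cmod (phi p k z)) \<ge> 2 * pi * Im z - 2 * pi * Im z / real p - e"
      "k = p \<or> ln (cmod (phi p k z)) \<le> 2 * pi * Im z - 2 * pi * Im z / real p + e"
      using *(1) unfolding e_def abs_le_iff by linarith+
    show "\<not> k = p \<or> ln (cmod (phi p k z)) \<le> 12 * l - (real p - 1) * (2 * pi * Im z) + e"
      using *(2) unfolding e_def l_def abs_le_iff by (cases "k = p") (simp, linarith)
  qed
  have "t1 + t2 \<le> 36 * l + 3 * e"
  proof (rule conjugate_heights[where p = "real p" and ?A1.0 = "\<alpha>1 = p" and ?A2.0 = "\<alpha>2 = p" and ?B1.0 = "\<beta>1 = p" and ?B2.0 = "\<beta>2 = p"])
    show "\<alpha>1 = p \<or> ln (cmod (phi p \<alpha>1 \<tau>1)) \<ge> t1 - t1 / real p - e" "\<alpha>1 = p \<or> ln (cmod (phi p \<alpha>1 \<tau>1)) \<le> t1 - t1 / real p + e"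
      "\<not> \<alpha>1 = p \<or> ln (cmod (phi p \<alpha>1 \<tau>1)) \<le> 12 * l - (real p - 1) * t1 + e"
      unfolding t1_def by (rule b[OF 1(1) \<tau>1(1)])+
    show "\<beta>1 = p \<or> ln (cmod (phi p \<beta>1 \<tau>1)) \<ge> t1 - t1 / real p - e" "\<beta>1 = p \<or> ln (cmod (phi p \<beta>1 \<tau>1)) \<le> t1 - t1 / real p + e"
      "\<not> \<beta>1 = p \<or> ln (cmod (phi p \<beta>1 \<tau>1)) \<le> 12 * l - (real p - 1) * t1 + e"
      unfolding t1_def by (rule b[OF 1(2) \<tau>1(1)])+
    show "\<alpha>2 = p \<or> ln (cmod (phi p \<alpha>2 \<tau>2)) \<ge> t2 - t2 / real p - e" "\<alpha>2 = p \<or> ln (cmod (phi p \<alpha>2 \<tau>2)) \<le> t2 - t2 / real p + e"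
      "\<not> \<alpha>2 = p \<or> ln (cmod (phi p \<alpha>2 \<tau>2)) \<le> 12 * l - (real p - 1) * t2 + e"
      unfolding t2_def by (rule b[OF 2(1) \<tau>2(1)])+
    show "\<beta>2 = p \<or> ln (cmod (phi p \<beta>2 \<tau>2)) \<ge> t2 - t2 / real p - e" "\<beta>2 = p \<or> ln (cmod (phi p \<beta>2 \<tau>2)) \<le> t2 - t2 / real p + e"
      "\<not> \<beta>2 = p \<or> ln (cmod (phi p \<beta>2 \<tau>2)) \<le> 12 * l - (real p - 1) * t2 + e"
      unfolding t2_def by (rule b[OF 2(2) \<tau>2(1)])+
    show "\<not> (\<alpha>1 = p \<and> \<beta>1 = p)" "\<not> (\<alpha>2 = p \<and> \<beta>2 = p)" using 1(3) 2(3) by auto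
    show "ln (cmod (phi p \<alpha>1 \<tau>1)) + ln (cmod (phi p \<alpha>2 \<tau>2)) \<ge> 0"
      "24 * l - ln (cmod (phi p \<alpha>1 \<tau>1)) - ln (cmod (phi p \<alpha>2 \<tau>2)) \<ge> 0"
      using n[of 0] by (simp_all add: 1(4) 2(4)[unfolded 1(4)])
    show "ln (cmod (phi p \<beta>1 \<tau>1)) + ln (cmod (phi p \<beta>2 \<tau>2)) \<ge> 0"
      "24 * l - ln (cmod (phi p \<beta>1 \<tau>1)) - ln (cmod (phi p \<beta>2 \<tau>2)) \<ge> 0"
      using n[of p] by (simp_all add: 1(5) 2(5)[unfolded 1(5)])
  qed (use assms(2) l t in auto)
  moreover have "ln (max 1 (cmod (klein_j \<tau>))) \<le> t1 + 40" "ln (max 1 (cmod (cj (klein_j \<tau>)))) \<le> t2 + 40"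
    using ln_klein_j_le[OF \<tau>1(1)] ln_klein_j_le[OF \<tau>2(1)] by (simp_all add: \<tau>1(2) \<tau>2(2) t1_def t2_def)
  \<comment> \<open>Averaging the two bounds for log|j| halves 36 l + 48 (q + 1) and keeps the
    40.\<close>
  moreover have "h \<le> 18 * l + 24 * (q + 1) + 40"
    if "t1 + t2 \<le> 36 * l + 3 * (16 * (q + 1))" "a \<le> t1 + 40" "b \<le> t2 + 40" "h \<le> (a + b) / 2" for h a b q
    using that by (simp add: field_simps)
  ultimately have "weil_height K (point_j P) \<le> 18 * l + 24 * (real p + 1) + 40"
    using cj(2)[OF \<tau>(3)] unfolding \<tau>(2) e_def by blast
  also have "\<dots> \<le> 24 * real p * ln (3 * real p)" unfolding l_def using assms(2) by (intro numerical_bound) simp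
  finally show ?thesis .
qed
end
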